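(* There exist universal constants $C_1,C_2>0$ and, for each $d$, a constant $c_d$ depending polynomially on $d$, such that the following holds. Let $\mathcal X\subset\mathbb R^d$ be compact and let $\mu^0=\sum_{k=1}^{s_0}a_k^0\delta_{x_k^0}$ be a sparse measure with $s_0$ distinct spikes $x_k^0\in\mathcal X$, weights $a_k^0>0$, $\sum_ka_k^0=1$. Fix a bandwidth $\tau>0$ with $$\tau\le\tau_{\max}(\mu^0):=\frac{\min_{1\le k\ne\ell\le s_0}\|x_k^0-x_\ell^0\|_2}{147.77\,s_0^{1/4}d^{7/4}}.$$ Let $\phi$ be a probability density on $\mathbb R^d$ (template) with finite kernel switch constant $$C_{\mathrm{switch}}=C_{\mathrm{switch}}(\tau,\phi):=\sup_{\omega\in[-1/\tau,1/\tau]^d}\sqrt{\frac{\mathfrak F[\Psi_\tau]}{\mathfrak F[\lambda_\tau]\,|\mathfrak F[\phi]|^2}(\omega)}<+\infty .$$ Let $F:\mathcal M(\mathcal X)\to\mathcal F_\tau$, $F\mu=\lambda_\tau\star\phi\star\mu$. Let $z_1,\dots,z_n$ be an i.i.d. sample from the density $\phi\star\mu^0$, $\hat f_n=\frac1n\sum_{j=1}^n\delta_{z_j}$, $y=\lambda_\tau\star\hat f_n$, and $$J_\kappa(\mu)=\tfrac12\|y-F\mu\|_{\mathcal F_\tau}^2+\kappa\|\mu\|_{\mathrm{TV}},\qquad\mu\in\mathcal M(\mathcal X).$$ Let $(\delta_n)$ be any sequence of positive reals diverging to $+\infty$ and set $r_n=\delta_nn^{-1/4}$. Let $\alpha\in(0,1)$,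 $C_\alpha=2\sqrt{1+C_1\log(C_2/\alpha)}$, and $$\kappa=\frac1{\sqrt2\,C_{\mathrm{switch}}}\,\frac{C_\alpha\tau^{-d/2}}{\sqrt n}\,\frac1{\sqrt{s_0}} .$$ Then, for any $\mu\in\mathcal M(\mathcal X)$ such that $J_\kappa(\mu)\le J_\kappa(\mu^0)$ and $n\ge c_d\delta_n^4$, with probability at least $1-\alpha$ over the draw of the sample: 1. $\displaystyle |\mu|(\mathcal F^{\mathrm{reg}}(r_n))\le\frac{256\sqrt2\,C_\alpha C_{\mathrm{switch}}\tau^{-d/2}}{23\,\delta_n^2}\sqrt{s_0}$; 2. for all $k\in\{1,\dots,s_0\}$, $\displaystyle \big|\mu(\mathcal N_k^{\mathrm{reg}}(r_n))-a_k^0\big|\le\frac{1536\sqrt2\,C_\alpha C_{\mathrm{switch}}\tau^{-d/2}}{23\,\delta_n^2}\sqrt{s_0}$; 3. for all Borel $A\subset\mathcal X$ such that $\displaystyle |\mu|(A)>\frac{256\sqrt2\,C_\alpha C_{\mathrm{switch}}\tau^{-d/2}}{23\,\delta_n^2}\sqrt{s_0}$, there exist $k$ and $t\in A$ such that $\frac1{2\sqrt3\,\tau}\|t-x_k^0\|_2\le r_n$.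
   Context: $\mathcal M(\mathcal X)$: finite signed Radon measures on $\mathcal X$, with total variation norm $\|\cdot\|_{\mathrm{TV}}$; $|\mu|$: total variation measure. Fourier transform: $\mathfrak F[g](\omega)=\int_{\mathbb R^d}g(z)e^{-\imath\omega^\top z}dz$. For $u\in\mathbb R^d$, $\operatorname{sinc}(u)=\prod_{i=1}^d\frac{\sin u_i}{u_i}$. Smoothing kernel: $\lambda_\tau(x)=\tau^{-d}\operatorname{sinc}(x/\tau)$, with $\mathfrak F[\lambda_\tau]=\pi^d\mathbf 1_{[-1/\tau,1/\tau]^d}$. $\mathcal F_\tau$ is the RKHS of the kernel $(s,t)\mapsto\lambda_\tau(t-s)$ on $\mathbb R^d$, i.e. the functions $g\in L^2(\mathbb R^d)$ with $\|g\|_{\mathcal F_\tau}^2=\frac1{(2\pi)^d}\int\frac{|\mathfrak F[g](\omega)|^2}{\mathfrak F[\lambda_\tau](\omega)}d\omega<\infty$ (convention $0/0=0$). Sinc-4 kernel: $\Psi_\tau(u)=\operatorname{sinc}^4(u/(4\tau))$. The convention $0/0=0$ is used in $C_{\mathrm{switch}}$. Near and far regions: with $\mathfrak d(s,t)=\frac1{2\sqrt3\,\tau}\|s-t\|_2$, $\mathcal N_k^{\mathrm{reg}}(r)=\{x\in\mathcal X:\mathfrak d(x,x_k^0)\le r\}$ and $\mathcal F^{\mathrm{reg}}(r)=\mathcal X\setminus\bigcup_{k=1}^{s_0}\mathcal N_k^{\mathrm{reg}}(r)$. *)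

theory Defs
  imports "HOL-Probability.Probability" "HOL-Computational_Algebra.Polynomial"
begin

text \<open>
  The dimension \<open>d\<close> has to be quantified inside the statement (some constants do not depend on it),
  so \<open>\<real>\<^sup>d\<close> is not a type: a vector is an extensional function \<open>nat \<Rightarrow> real\<close> on \<open>{..<d}\<close>, and \<open>\<real>\<^sup>d\<close>
  is the carrier of the product space below, with its Borel sets and Lebesgue measure.
\<close>

type_synonym vec = "nat \<Rightarrow> real"

definition Rd :: "nat \<Rightarrow> vec measure" where
  "Rd d = (\<Pi>\<^sub>M i\<in>{..<d}. lborel)"

definition Rd_topology :: "nat \<Rightarrow> vec topology" where
  "Rd_topology d = product_topology (\<lambda>_. euclideanreal) {..<d}"

definition vdiff :: "nat \<Rightarrow> vec \<Rightarrow> vec \<Rightarrow> vec" where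
  "vdiff d x y = (\<lambda>i\<in>{..<d}. x i - y i)"

definition vdist :: "nat \<Rightarrow> vec \<Rightarrow> vec \<Rightarrow> real" where
  "vdist d x y = L2_set (\<lambda>i. x i - y i) {..<d}"

definition cube :: "nat \<Rightarrow> real \<Rightarrow> vec set" where
  "cube d R = {w \<in> space (Rd d). \<forall>i<d. \<bar>w i\<bar> \<le> R}"


section \<open>Finite signed Radon measures\<close>

text \<open>
  A finite signed measure on the \<open>\<sigma>\<close>-algebra of \<open>M\<close> is a real-valued set function; only the
  measurable sets of \<open>M\<close> matter here, not the measure that \<open>M\<close> carries.
\<close>

definition signed_measure :: "'a measure \<Rightarrow> ('a set \<Rightarrow> real) \<Rightarrow> bool" where
  "signed_measure M \<mu> \<longleftrightarrow> \<mu> {} = 0 \<and>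
     (\<forall>A. range A \<subseteq> sets M \<longrightarrow> disjoint_family A \<longrightarrow> (\<lambda>i::nat. \<mu> (A i)) sums \<mu> (\<Union>i. A i))"

text \<open>The total variation measure \<open>|\<mu>|\<close>; it is finite if \<open>\<mu>\<close> is a signed measure.\<close>

definition variation :: "'a measure \<Rightarrow> ('a set \<Rightarrow> real) \<Rightarrow> 'a set \<Rightarrow> ennreal" where
  "variation M \<mu> A =
     (SUP P \<in> {P :: nat \<Rightarrow> 'a set. range P \<subseteq> sets M \<and> disjoint_family P \<and> (\<Union>i. P i) = A}.
        \<Sum>i. ennreal \<bar>\<mu> (P i)\<bar>)"

text \<open>The Jordan decomposition \<open>\<mu>\<^sup>+ = (|\<mu>| + \<mu>) / 2\<close>, \<open>\<mu>\<^sup>- = (|\<mu>| - \<mu>) / 2\<close>.\<close>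

definition jordan_pos :: "'a measure \<Rightarrow> ('a set \<Rightarrow> real) \<Rightarrow> 'a measure" where
  "jordan_pos M \<mu> = measure_of (space M) (sets M)
     (\<lambda>A. ennreal ((enn2real (variation M \<mu> A) + \<mu> A) / 2))"

definition jordan_neg :: "'a measure \<Rightarrow> ('a set \<Rightarrow> real) \<Rightarrow> 'a measure" where
  "jordan_neg M \<mu> = measure_of (space M) (sets M)
     (\<lambda>A. ennreal ((enn2real (variation M \<mu> A) - \<mu> A) / 2))"

definition signed_integral :: "'a measure \<Rightarrow> ('a set \<Rightarrow> real) \<Rightarrow> ('a \<Rightarrow> real) \<Rightarrow> real" where
  "signed_integral M \<mu> f = integral\<^sup>L (jordan_pos M \<mu>) f - integral\<^sup>L (jordan_neg M \<mu>) f"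

definition borel_on :: "nat \<Rightarrow> vec set \<Rightarrow> vec measure" where
  "borel_on d X = restrict_space (Rd d) X"

definition radon_measures :: "nat \<Rightarrow> vec set \<Rightarrow> (vec set \<Rightarrow> real) set" where
  "radon_measures d X = {\<mu>. signed_measure (borel_on d X) \<mu> \<and>
     (\<forall>A \<in> sets (borel_on d X). variation (borel_on d X) \<mu> A =
        (SUP K \<in> {K. compactin (Rd_topology d) K \<and> K \<subseteq> A}. variation (borel_on d X) \<mu> K))}"

text \<open>The discrete measure \<open>\<Sum>k\<in>I. w k \<delta>\<^bsub>x k\<^esub>\<close>.\<close>

definition discrete_measure :: "'i set \<Rightarrow> ('i \<Rightarrow> real) \<Rightarrow> ('i \<Rightarrow> 'a) \<Rightarrow> 'a set \<Rightarrow> real" where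
  "discrete_measure I w x A = (\<Sum>k\<in>I. w k * indicator A (x k))"


section \<open>Convolutions and Fourier transforms\<close>

definition conv :: "nat \<Rightarrow> (vec \<Rightarrow> real) \<Rightarrow> (vec \<Rightarrow> real) \<Rightarrow> vec \<Rightarrow> real" where
  "conv d g h x = (LINT t|Rd d. g (vdiff d x t) * h t)"

definition conv_measure ::
    "nat \<Rightarrow> vec measure \<Rightarrow> (vec \<Rightarrow> real) \<Rightarrow> (vec set \<Rightarrow> real) \<Rightarrow> vec \<Rightarrow> real" where
  "conv_measure d M g \<mu> x = signed_integral M \<mu> (\<lambda>t. g (vdiff d x t))"

definition fourier :: "nat \<Rightarrow> (vec \<Rightarrow> real) \<Rightarrow> vec \<Rightarrow> complex" where
  "fourier d g w = (LINT z|Rd d. complex_of_real (g z) * exp (- \<i> * complex_of_real (\<Sum>i<d. w i * z i)))"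

text \<open>
  The functions in the RKHS are square integrable but in general not integrable, so their Fourier
  transform is the Plancherel one: \<open>h\<close> is a Fourier transform of \<open>g \<in> L\<^sup>2\<close> if it is the
  \<open>L\<^sup>2\<close>-limit of the transforms of the truncations of \<open>g\<close> to growing cubes. Such an \<open>h\<close> exists and
  is unique up to null sets.
\<close>

definition is_fourier_L2 :: "nat \<Rightarrow> (vec \<Rightarrow> real) \<Rightarrow> (vec \<Rightarrow> complex) \<Rightarrow> bool" where
  "is_fourier_L2 d g h \<longleftrightarrow>
     g \<in> borel_measurable (Rd d) \<and> (\<integral>\<^sup>+z. ennreal ((g z)\<^sup>2) \<partial>Rd d) < \<infinity> \<and>
     h \<in> borel_measurable (Rd d) \<and>
     ((\<lambda>R. \<integral>\<^sup>+w. ennreal ((cmod (h w - fourier d (\<lambda>z. indicator (cube d R) z * g z) w))\<^sup>2) \<partial>Rd d)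
        \<longlongrightarrow> 0) at_top"


section \<open>The smoothing kernel, its RKHS, and the kernel switch constant\<close>

text \<open>\<^const>\<open>sinc\<close> is the one-dimensional function with value 1 at 0.\<close>

definition sinc_vec :: "nat \<Rightarrow> vec \<Rightarrow> real" where
  "sinc_vec d u = (\<Prod>i<d. sinc (u i))"

definition lam :: "nat \<Rightarrow> real \<Rightarrow> vec \<Rightarrow> real" where
  "lam d \<tau> x = sinc_vec d (\<lambda>i. x i / \<tau>) / \<tau> ^ d"

text \<open>
  \<^const>\<open>lam\<close> is not integrable, so its transform is not an instance of \<^const>\<open>fourier\<close>; this is the
  pointwise version of its Plancherel transform that is used in divisions below.
\<close>

definition fourier_lam :: "nat \<Rightarrow> real \<Rightarrow> vec \<Rightarrow> real" where
  "fourier_lam d \<tau> w = pi ^ d * indicator (cube d (1 / \<tau>)) w"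

definition sinc4 :: "nat \<Rightarrow> real \<Rightarrow> vec \<Rightarrow> real" where
  "sinc4 d \<tau> u = (sinc_vec d (\<lambda>i. u i / (4 * \<tau>))) ^ 4"

text \<open>
  The squared RKHS norm, with value \<open>\<infinity>\<close> outside of the RKHS. All \<open>h\<close> in the infimum give the same
  value, and there is none if \<open>g\<close> is not in \<open>L\<^sup>2\<close>. Division in \<^typ>\<open>ennreal\<close> satisfies
  \<open>0 / 0 = 0\<close> and \<open>a / 0 = \<infinity>\<close> for \<open>a > 0\<close>, here and in the kernel switch constant.
\<close>

definition rkhs_norm_sq :: "nat \<Rightarrow> real \<Rightarrow> (vec \<Rightarrow> real) \<Rightarrow> ennreal" where
  "rkhs_norm_sq d \<tau> g = (INF h \<in> {h. is_fourier_L2 d g h}.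
     ennreal (1 / (2 * pi) ^ d) *
       (\<integral>\<^sup>+w. ennreal ((cmod (h w))\<^sup>2) / ennreal (fourier_lam d \<tau> w) \<partial>Rd d))"

definition ennsqrt :: "ennreal \<Rightarrow> ennreal" where
  "ennsqrt x = (if x = \<infinity> then \<infinity> else ennreal (sqrt (enn2real x)))"

text \<open>The Fourier transform of \<^const>\<open>sinc4\<close> is real and nonnegative, hence equal to its real part.\<close>

definition C_switch :: "nat \<Rightarrow> real \<Rightarrow> (vec \<Rightarrow> real) \<Rightarrow> ennreal" where
  "C_switch d \<tau> \<phi> = (SUP w \<in> cube d (1 / \<tau>).
     ennsqrt (ennreal (Re (fourier d (sinc4 d \<tau>) w)) /
       (ennreal (fourier_lam d \<tau> w) * ennreal ((cmod (fourier d \<phi> w))\<^sup>2))))"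


section \<open>The estimation problem\<close>

definition probability_density :: "nat \<Rightarrow> (vec \<Rightarrow> real) \<Rightarrow> bool" where
  "probability_density d \<phi> \<longleftrightarrow> \<phi> \<in> borel_measurable (Rd d) \<and> (\<forall>x \<in> space (Rd d). 0 \<le> \<phi> x) \<and>
     (\<integral>\<^sup>+x. ennreal (\<phi> x) \<partial>Rd d) = 1"

text \<open>For \<open>s = 1\<close> the minimum is over the empty set and \<open>tau_max\<close> is \<open>\<infinity>\<close>: no constraint.\<close>

definition tau_max :: "nat \<Rightarrow> nat \<Rightarrow> (nat \<Rightarrow> vec) \<Rightarrow> ereal" where
  "tau_max d s x =
     (INF (k, l) \<in> {(k, l). k \<in> {1..s} \<and> l \<in> {1..s} \<and> k \<noteq> l}. ereal (vdist d (x k) (x l))) /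
     ereal (147.77 * real s powr (1/4) * real d powr (7/4))"

definition forward :: "nat \<Rightarrow> vec set \<Rightarrow> real \<Rightarrow> (vec \<Rightarrow> real) \<Rightarrow> (vec set \<Rightarrow> real) \<Rightarrow> vec \<Rightarrow> real" where
  "forward d X \<tau> \<phi> \<mu> = conv_measure d (borel_on d X) (conv d (lam d \<tau>) \<phi>) \<mu>"

text \<open>The law of an i.i.d. sample of size \<open>n\<close> from the density \<open>\<phi> \<star> \<mu>\<close>.\<close>

definition sample_law ::
    "nat \<Rightarrow> vec set \<Rightarrow> (vec \<Rightarrow> real) \<Rightarrow> (vec set \<Rightarrow> real) \<Rightarrow> nat \<Rightarrow> (nat \<Rightarrow> vec) measure" where
  "sample_law d X \<phi> \<mu> n =
     (\<Pi>\<^sub>M j\<in>{1..n}. density (Rd d) (\<lambda>z. ennreal (conv_measure d (borel_on d X) \<phi> \<mu> z)))"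

definition empirical_measure :: "nat \<Rightarrow> (nat \<Rightarrow> vec) \<Rightarrow> vec set \<Rightarrow> real" where
  "empirical_measure n z = discrete_measure {1..n} (\<lambda>_. 1 / real n) z"

definition observation :: "nat \<Rightarrow> real \<Rightarrow> nat \<Rightarrow> (nat \<Rightarrow> vec) \<Rightarrow> vec \<Rightarrow> real" where
  "observation d \<tau> n z = conv_measure d (Rd d) (lam d \<tau>) (empirical_measure n z)"

text \<open>The objective function, for the data \<open>y\<close> and a regularisation parameter \<open>\<kappa> > 0\<close>.\<close>

definition objective ::
    "nat \<Rightarrow> vec set \<Rightarrow> real \<Rightarrow> (vec \<Rightarrow> real) \<Rightarrow> (vec \<Rightarrow> real) \<Rightarrow> real \<Rightarrow> (vec set \<Rightarrow> real) \<Rightarrow> ennreal" where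
  "objective d X \<tau> \<phi> y \<kappa> \<mu> =
     rkhs_norm_sq d \<tau> (\<lambda>x. y x - forward d X \<tau> \<phi> \<mu> x) / 2 +
     ennreal \<kappa> * variation (borel_on d X) \<mu> X"

definition scaled_dist :: "nat \<Rightarrow> real \<Rightarrow> vec \<Rightarrow> vec \<Rightarrow> real" where
  "scaled_dist d \<tau> s t = 1 / (2 * sqrt 3 * \<tau>) * vdist d s t"

definition near_region :: "nat \<Rightarrow> vec set \<Rightarrow> real \<Rightarrow> vec \<Rightarrow> real \<Rightarrow> vec set" where
  "near_region d X \<tau> c r = {x \<in> X. scaled_dist d \<tau> x c \<le> r}"

definition far_region :: "nat \<Rightarrow> vec set \<Rightarrow> real \<Rightarrow> nat \<Rightarrow> (nat \<Rightarrow> vec) \<Rightarrow> real \<Rightarrow> vec set" where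
  "far_region d X \<tau> s x r = X - (\<Union>k\<in>{1..s}. near_region d X \<tau> (x k) r)"

end

theory Submission
  imports Defs
begin

text \<open>
  Write \<open>N(H) = 2\<^sup>-\<^sup>d \<integral> |H|\<^sup>2\<close> over the cube \<open>[-1/\<tau>, 1/\<tau>]\<^sup>d\<close>. The function
  \<open>x \<mapsto> 2\<^sup>-\<^sup>d \<integral> H(\<omega>) e\<^sup>i\<^sup>\<omega>\<^sup>x d\<omega>\<close> (integral over the cube) has squared RKHS norm \<open>N(H)\<close>, by Plancherel. The kernel
  \<open>\<lambda>\<^sub>\<tau>\<close> is of this form with \<open>H = 1\<close>, hence so are the observation, with the transform of the empirical
  measure as \<open>H\<close>, and \<open>F \<mu>\<close>, with \<open>H = \<phi>^ \<mu>^\<close>. All norms in the objective thereby become integrals of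
  transforms over the cube.

  Noise. For \<open>\<mu> = \<mu>\<^sup>0\<close> the residual is the average of \<open>n\<close> independent centred characters, so \<open>N\<close> has
  expectation at most \<open>\<tau>\<^sup>-\<^sup>d / n\<close>, and replacing one sample point changes \<open>N\<^sup>1\<^sup>/\<^sup>2\<close> by at most
  \<open>2 \<tau>\<^sup>-\<^sup>d\<^sup>/\<^sup>2 / n\<close>. McDiarmid's inequality gives \<open>N \<le> \<rho>\<^sup>2 = 4 (1 + log(1/\<alpha>)) \<tau>\<^sup>-\<^sup>d / n\<close> with probability at
  least \<open>1 - \<alpha>\<close> (\<open>noise_bound\<close>). This is where \<open>C\<^sub>1 = C\<^sub>2 = 1\<close> come from.

  Certificates. In the coordinates \<open>u = (x - x\<^sub>k) / (4 \<tau>)\<close> the sinc-4 kernel is a product of factors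
  \<open>sinc\<^sup>4(u\<^sub>i)\<close>. It and its derivatives up to order 3 decay like \<open>d\<^sup>2 / |u|\<^sup>4\<close>, while the bound on \<open>\<tau>\<close> says
  that \<open>|u|\<^sup>4 \<ge> 1862000 s d\<^sup>7\<close> at the other spikes. Hence the linear system for a combination of
  translates of the kernel and of its first partial derivatives that has prescribed values \<open>b\<^sub>k\<close> in
  \<open>[-1,1]\<close> and vanishing gradient at the spikes is a small perturbation of a diagonal one. Its solution
  \<open>\<eta>\<close> is close to \<open>b\<^sub>k\<close> near \<open>x\<^sub>k\<close> up to \<open>|u|\<^sup>2\<close>; if all \<open>b\<^sub>k\<close> are 1, then \<open>1 - |\<eta>|\<close> is at least
  \<open>23/96 min(|u|\<^sup>2, 1)\<close> for the nearest spike (\<open>certificate_exists\<close>).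

  Kernel switch. The transform of the sinc-4 kernel is a spline that is supported in the cube.
  Thus \<open>\<eta>(y) = \<integral> p A e\<^sup>i\<^sup>\<omega>\<^sup>y\<close> with the spline \<open>p\<close> and a trigonometric amplitude \<open>A\<close>; the interpolation
  conditions give \<open>\<integral> p |A|\<^sup>2 \<le> 2 s\<close>, and finiteness of the switch constant means
  \<open>p \<le> C\<^sub>s\<^sub>w\<^sub>i\<^sub>t\<^sub>c\<^sub>h\<^sup>2 2\<^sup>-\<^sup>d |\<phi>^|\<^sup>2\<close>. By Cauchy-Schwarz, in the form of a weighted arithmetic-geometric mean,
  \<open>\<integral> \<eta> d(\<mu> - \<mu>\<^sup>0)\<close> is controlled by \<open>N(\<phi>^ (\<mu>^ - \<mu>\<^sup>0^))\<close>, i.e. by the residuals of \<open>\<mu>\<close> and \<open>\<mu>\<^sup>0\<close>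
  (\<open>pairing_bound\<close>, \<open>cert_difference\<close>).

  Conclusion. If all \<open>b\<^sub>k\<close> are 1 then \<open>\<integral> (1 - |\<eta>|) d|\<mu>| \<le> |\<mu>|(X) - \<integral> \<eta> d\<mu>\<close>. Comparing objectives bounds this
  by \<open>2 \<rho>\<^sup>2 / \<kappa>\<close> and the residual of \<open>\<mu>\<close> by \<open>11 \<rho>\<^sup>2\<close> (\<open>bregman\<close>). As \<open>1 - |\<eta>| \<ge> 23/128 r\<^sup>2\<close> on the far region
  for \<open>r \<le> 1\<close>, the first claim follows, and the third by monotonicity. For the second, take \<open>\<eta>\<^sub>k\<close>
  with value 1 at \<open>x\<^sub>k\<close> and 0 at the other spikes, and bound \<open>|1\<^sub>N - \<eta>\<^sub>k|\<close>, for the near region \<open>N\<close> of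
  \<open>x\<^sub>k\<close>, by a multiple of \<open>1 - |\<eta>|\<close> plus twice the indicator of the far region (\<open>localisation\<close>). The
  condition \<open>n \<ge> c\<^sub>d \<delta>\<^sub>n\<^sup>4\<close> with \<open>c\<^sub>d = 1\<close> says precisely that \<open>r\<^sub>n \<le> 1\<close>.
\<close>

section \<open>The total variation of a signed measure\<close>

abbreviation partitions :: "'a measure \<Rightarrow> 'a set \<Rightarrow> (nat \<Rightarrow> 'a set) set" where
  "partitions M A \<equiv> {P. range P \<subseteq> sets M \<and> disjoint_family P \<and> (\<Union>i. P i) = A}"

lemma variation_empty:
  assumes "signed_measure M \<mu>"
  shows "variation M \<mu> {} = 0"
proof -
  have "(\<Sum>i. ennreal \<bar>\<mu> (P i)\<bar>) = 0" if "(\<Union>i. P i) = {}" for P :: "nat \<Rightarrow> 'a set"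
  proof -
    have "P i = {}" for i using that by auto
    then show ?thesis using assms by (simp add: signed_measure_def)
  qed
  moreover have "(\<lambda>_. {}) \<in> partitions M {}" by (auto simp: disjoint_family_on_def)
  ultimately show ?thesis unfolding variation_def
    by (intro antisym SUP_least) auto
qed

lemma abs_le_variation:
  assumes "signed_measure M \<mu>" "A \<in> sets M"
  shows "ennreal \<bar>\<mu> A\<bar> \<le> variation M \<mu> A"
proof -
  let ?P = "\<lambda>i::nat. if i = 0 then A else {}"
  have "(\<Sum>i. ennreal \<bar>\<mu> (?P i)\<bar>) = (\<Sum>i\<in>{0}. ennreal \<bar>\<mu> (?P i)\<bar>)"
    using assms(1) by (intro suminf_finite) (auto simp: signed_measure_def)
  moreover have "?P \<in> partitions M A"
    using assms(2) by (auto simp: disjoint_family_on_def)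
  ultimately show ?thesis
    unfolding variation_def by (intro SUP_upper2[of ?P]) auto
qed

text \<open>
  Interleaving a partition of \<open>A\<close> with one of \<open>B\<close> gives a partition of \<open>A \<union> B\<close>.
\<close>

lemma variation_Un_ge:
  assumes s: "signed_measure M \<mu>" and A: "A \<in> sets M" "B \<in> sets M" "A \<inter> B = {}"
  shows "variation M \<mu> A + variation M \<mu> B \<le> variation M \<mu> (A \<union> B)"
proof -
  have key: "(\<Sum>i. ennreal \<bar>\<mu> (P i)\<bar>) + (\<Sum>i. ennreal \<bar>\<mu> (Q i)\<bar>) \<le> variation M \<mu> (A \<union> B)"
    if P: "P \<in> partitions M A" and Q: "Q \<in> partitions M B" for P Q
  proof -
    \<comment> \<open>the partition that alternates between \<open>P\<close> and \<open>Q\<close>\<close>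
    define R where "R n = (if even n then P (n div 2) else Q (n div 2))" for n :: nat
    have sR: "R n \<in> sets M" for n using P Q by (auto simp: R_def)
    have PA: "(\<Union>i. P i) = A" and QB: "(\<Union>i. Q i) = B" using P Q by blast+
    have UR: "(\<Union>i. R i) = A \<union> B"
    proof (rule antisym)
      show "(\<Union>i. R i) \<subseteq> A \<union> B"
      proof (rule UN_least)
        fix n
        have "P (n div 2) \<subseteq> A" "Q (n div 2) \<subseteq> B" unfolding PA[symmetric] QB[symmetric] by blast+
        then show "R n \<subseteq> A \<union> B" unfolding R_def by (cases "even n") auto
      qed
      have "P n \<subseteq> (\<Union>i. R i)" for n using UN_upper[of "2 * n" UNIV R] by (simp add: R_def)
      moreover have "Q n \<subseteq> (\<Union>i. R i)" for n using UN_upper[of "2 * n + 1" UNIV R] by (simp add: R_def)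
      ultimately show "A \<union> B \<subseteq> (\<Union>i. R i)" unfolding PA[symmetric] QB[symmetric] by (meson UN_least Un_least)
    qed
    have dR: "disjoint_family R"
    proof (unfold disjoint_family_on_def, intro ballI impI)
      fix m n :: nat assume "m \<noteq> n"
      have PQ: "P i \<inter> Q j = {}" for i j using A(3) unfolding PA[symmetric] QB[symmetric] by blast
      have PP: "P i \<inter> P j = {}" "Q i \<inter> Q j = {}" if "i \<noteq> j" for i j
        using P Q that by (auto simp: disjoint_family_on_def)
      have "m div 2 \<noteq> n div 2" if "even m = even n"
        using that \<open>m \<noteq> n\<close> by (metis even_two_times_div_two odd_two_times_div_two_succ)
      then show "R m \<inter> R n = {}"
        unfolding R_def using PP(1)[of "m div 2" "n div 2"] PP(2)[of "m div 2" "n div 2"]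
          PQ[of "m div 2" "n div 2"] PQ[of "n div 2" "m div 2"]
        by (cases "even m"; cases "even n") (simp_all add: Int_commute)
    qed
    have "(\<Sum>i. ennreal \<bar>\<mu> (P i)\<bar>) + (\<Sum>i. ennreal \<bar>\<mu> (Q i)\<bar>) = (\<Sum>i. ennreal \<bar>\<mu> (P i)\<bar> + ennreal \<bar>\<mu> (Q i)\<bar>)"
      by (rule suminf_add) auto
    also have "\<dots> = (\<Sum>i. \<Sum>j\<in>{i * 2..<i * 2 + 2}. ennreal \<bar>\<mu> (R j)\<bar>)"
    proof (intro arg_cong[where f = suminf] ext)
      fix i :: nat
      have "{i * 2..<i * 2 + 2} = {2 * i, 2 * i + 1}" by auto
      then show "ennreal \<bar>\<mu> (P i)\<bar> + ennreal \<bar>\<mu> (Q i)\<bar> = (\<Sum>j\<in>{i * 2..<i * 2 + 2}. ennreal \<bar>\<mu> (R j)\<bar>)"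
        by (simp add: R_def)
    qed
    also have "\<dots> = (\<Sum>i. ennreal \<bar>\<mu> (R i)\<bar>)"
      by (rule sums_unique[symmetric], rule sums_group) (auto simp: summable_sums)
    also have "\<dots> \<le> variation M \<mu> (A \<union> B)"
      unfolding variation_def using sR UR dR by (intro SUP_upper) auto
    finally show ?thesis .
  qed
  have ne: "partitions M C \<noteq> {}" if "C \<in> sets M" for C
  proof -
    have "(\<lambda>i::nat. if i = 0 then C else {}) \<in> partitions M C"
      using that by (auto simp: disjoint_family_on_def)
    then show ?thesis by blast
  qed
  have "variation M \<mu> A + variation M \<mu> B
      = (SUP P\<in>partitions M A. (\<Sum>i. ennreal \<bar>\<mu> (P i)\<bar>) + variation M \<mu> B)"
    unfolding variation_def by (rule ennreal_SUP_add_left[symmetric, OF ne[OF A(1)]])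
  also have "\<dots> \<le> variation M \<mu> (A \<union> B)"
  proof (rule SUP_least)
    fix P assume P: "P \<in> partitions M A"
    define c where "c = (\<Sum>i. ennreal \<bar>\<mu> (P i)\<bar>)"
    have "c + variation M \<mu> B = (SUP Q\<in>partitions M B. c + (\<Sum>i. ennreal \<bar>\<mu> (Q i)\<bar>))"
      unfolding variation_def by (rule ennreal_SUP_add_right[OF ne[OF A(2)]])
    also have "\<dots> \<le> variation M \<mu> (A \<union> B)"
      unfolding c_def by (rule SUP_least) (rule key[OF P])
    finally have "c + variation M \<mu> B \<le> variation M \<mu> (A \<union> B)" .
    then show "(\<Sum>i. ennreal \<bar>\<mu> (P i)\<bar>) + variation M \<mu> B \<le> variation M \<mu> (A \<union> B)"
      unfolding c_def .
  qed
  finally show ?thesis .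
qed

lemma variation_mono:
  assumes s: "signed_measure M \<mu>" and A: "A \<in> sets M" "B \<in> sets M" "A \<subseteq> B"
  shows "variation M \<mu> A \<le> variation M \<mu> B"
proof -
  have "variation M \<mu> A + 0 \<le> variation M \<mu> A + variation M \<mu> (B - A)" by (intro add_left_mono) simp
  also have "\<dots> \<le> variation M \<mu> (A \<union> (B - A))" using A by (intro variation_Un_ge[OF s]) auto
  also have "A \<union> (B - A) = B" using A by auto
  finally show ?thesis by simp
qed

text \<open>
  The bound from below comes from finite superadditivity and monotonicity. For the bound from above, a
  partition \<open>P\<close> of the union is refined to the pieces \<open>P j \<inter> A i\<close>, and the two summations are exchanged.
\<close>

lemma variation_countably_additive:
  assumes s: "signed_measure M \<mu>"
  shows "countably_additive (sets M) (variation M \<mu>)"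
proof (rule countably_additiveI)
  fix A :: "nat \<Rightarrow> 'a set"
  assume A: "range A \<subseteq> sets M" "disjoint_family A" and U: "(\<Union>i. A i) \<in> sets M"
  have "(\<Sum>i<n. variation M \<mu> (A i)) \<le> variation M \<mu> (\<Union>i<n. A i)" for n
  proof (induction n)
    case 0
    show ?case using s by (simp add: variation_empty)
  next
    case (Suc n)
    have "(\<Sum>i<Suc n. variation M \<mu> (A i)) \<le> variation M \<mu> (\<Union>i<n. A i) + variation M \<mu> (A n)"
      using Suc.IH by (simp add: add_right_mono)
    also have "\<dots> \<le> variation M \<mu> ((\<Union>i<n. A i) \<union> A n)"
    proof (rule variation_Un_ge[OF s])
      show "(\<Union>i<n. A i) \<inter> A n = {}"
      proof -
        have "A i \<inter> A n = {}" if "i < n" for i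
          using A(2) that unfolding disjoint_family_on_def by auto
        then show ?thesis by blast
      qed
    qed (use A(1) in auto)
    also have "(\<Union>i<n. A i) \<union> A n = (\<Union>i<Suc n. A i)" by (auto simp: less_Suc_eq)
    finally show ?case .
  qed
  moreover have "variation M \<mu> (\<Union>i<n. A i) \<le> variation M \<mu> (\<Union>i. A i)" for n
    using A U by (intro variation_mono[OF s]) auto
  ultimately have "(\<Sum>i<n. variation M \<mu> (A i)) \<le> variation M \<mu> (\<Union>i. A i)" for n
    using order_trans by blast
  then have 1: "(\<Sum>i. variation M \<mu> (A i)) \<le> variation M \<mu> (\<Union>i. A i)"
    by (intro suminf_le_const) auto
  have "variation M \<mu> (\<Union>i. A i) \<le> (\<Sum>i. variation M \<mu> (A i))"
    unfolding variation_def[of M \<mu> "\<Union>i. A i"]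
  proof (rule SUP_least)
    fix P assume P: "P \<in> partitions M (\<Union>i. A i)"
    have "ennreal \<bar>\<mu> (P j)\<bar> \<le> (\<Sum>i. ennreal \<bar>\<mu> (P j \<inter> A i)\<bar>)" for j
    proof -
      have sub: "P j \<subseteq> (\<Union>i. A i)" using P by auto
      have "(\<lambda>i. \<mu> (P j \<inter> A i)) sums \<mu> (\<Union>i. P j \<inter> A i)"
        using s A P unfolding signed_measure_def
        by (elim conjE allE[of _ "\<lambda>i. P j \<inter> A i"]) (auto simp: disjoint_family_on_def)
      moreover have "(\<Union>i. P j \<inter> A i) = P j" using sub by auto
      ultimately have lim: "(\<lambda>n. \<Sum>i<n. \<mu> (P j \<inter> A i)) \<longlonglongrightarrow> \<mu> (P j)" by (simp add: sums_def)
      have "(\<lambda>n. ennreal \<bar>\<Sum>i<n. \<mu> (P j \<inter> A i)\<bar>) \<longlonglongrightarrow> ennreal \<bar>\<mu> (P j)\<bar>"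
        by (intro tendsto_ennrealI tendsto_rabs lim)
      moreover have "ennreal \<bar>\<Sum>i<n. \<mu> (P j \<inter> A i)\<bar> \<le> (\<Sum>i. ennreal \<bar>\<mu> (P j \<inter> A i)\<bar>)" for n
      proof -
        have "ennreal \<bar>\<Sum>i<n. \<mu> (P j \<inter> A i)\<bar> \<le> ennreal (\<Sum>i<n. \<bar>\<mu> (P j \<inter> A i)\<bar>)"
          by (intro ennreal_leI sum_abs)
        also have "\<dots> = (\<Sum>i<n. ennreal \<bar>\<mu> (P j \<inter> A i)\<bar>)" by (rule sum_ennreal[symmetric]) auto
        also have "\<dots> \<le> (\<Sum>i. ennreal \<bar>\<mu> (P j \<inter> A i)\<bar>)" by (intro sum_le_suminf) auto
        finally show ?thesis .
      qed
      ultimately show ?thesis by (rule LIMSEQ_le_const2[OF _ exI, rule_format])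
    qed
    then have "(\<Sum>j. ennreal \<bar>\<mu> (P j)\<bar>) \<le> (\<Sum>j. \<Sum>i. ennreal \<bar>\<mu> (P j \<inter> A i)\<bar>)"
      by (intro suminf_le) auto
    also have "\<dots> = (\<Sum>i. \<Sum>j. ennreal \<bar>\<mu> (P j \<inter> A i)\<bar>)"
    proof -
      have "(\<Sum>j. \<Sum>i. ennreal \<bar>\<mu> (P j \<inter> A i)\<bar>)
          = (\<integral>\<^sup>+j. (\<Sum>i. ennreal \<bar>\<mu> (P j \<inter> A i)\<bar>) \<partial>count_space UNIV)"
        by (rule nn_integral_count_space_nat[symmetric])
      also have "\<dots> = (\<Sum>i. \<integral>\<^sup>+j. ennreal \<bar>\<mu> (P j \<inter> A i)\<bar> \<partial>count_space UNIV)"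
        by (rule nn_integral_suminf[where f = "\<lambda>i j. ennreal \<bar>\<mu> (P j \<inter> A i)\<bar>"]) (rule borel_measurable_count_space)
      also have "\<dots> = (\<Sum>i. \<Sum>j. ennreal \<bar>\<mu> (P j \<inter> A i)\<bar>)"
        by (intro arg_cong[where f = suminf] ext nn_integral_count_space_nat)
      finally show ?thesis .
    qed
    also have "\<dots> \<le> (\<Sum>i. variation M \<mu> (A i))"
    proof (intro suminf_le)
      fix i
      have dP: "disjoint_family P" and rP: "\<And>j. P j \<in> sets M" and UP: "(\<Union>j. P j) = (\<Union>j. A j)"
        using P by blast+
      have "disjoint_family (\<lambda>j. P j \<inter> A i)" using dP unfolding disjoint_family_on_def by blast
      moreover have "(\<Union>j. P j \<inter> A i) = A i" using UP by blast
      moreover have "range (\<lambda>j. P j \<inter> A i) \<subseteq> sets M" using rP A(1) by auto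
      ultimately have "(\<lambda>j. P j \<inter> A i) \<in> partitions M (A i)" by blast
      then show "(\<Sum>j. ennreal \<bar>\<mu> (P j \<inter> A i)\<bar>) \<le> variation M \<mu> (A i)"
        unfolding variation_def by (intro SUP_upper2[of "\<lambda>j. P j \<inter> A i"]) auto
    qed auto
    finally show "(\<Sum>j. ennreal \<bar>\<mu> (P j)\<bar>) \<le> (\<Sum>i. variation M \<mu> (A i))" .
  qed
  with 1 show "(\<Sum>i. variation M \<mu> (A i)) = variation M \<mu> (\<Union>i. A i)" by (rule antisym)
qed

lemma
  assumes s: "signed_measure M \<mu>" and fin: "variation M \<mu> (space M) < \<infinity>"
  shows emeasure_jordan_pos: "\<And>A. A \<in> sets M \<Longrightarrow>
      emeasure (jordan_pos M \<mu>) A = ennreal ((enn2real (variation M \<mu> A) + \<mu> A) / 2)" (is "\<And>A. _ \<Longrightarrow> ?P A")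
    and emeasure_jordan_neg: "\<And>A. A \<in> sets M \<Longrightarrow>
      emeasure (jordan_neg M \<mu>) A = ennreal ((enn2real (variation M \<mu> A) - \<mu> A) / 2)" (is "\<And>A. _ \<Longrightarrow> ?N A")
    and abs_le_variation_real: "\<And>A. A \<in> sets M \<Longrightarrow> \<bar>\<mu> A\<bar> \<le> enn2real (variation M \<mu> A)" (is "\<And>A. _ \<Longrightarrow> ?B A")
proof -
  have f: "variation M \<mu> A < \<infinity>" if "A \<in> sets M" for A
    using variation_mono[OF s that sets.top sets.sets_into_space[OF that]] fin by (rule le_less_trans)
  show b: "?B A" if "A \<in> sets M" for A
    using enn2real_mono[OF abs_le_variation[OF s that]] f[OF that] by simp
  \<comment> \<open>\<open>c = 1\<close> and \<open>c = -1\<close> give the two Jordan parts\<close>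
  have ca: "countably_additive (sets M) (\<lambda>A. ennreal ((enn2real (variation M \<mu> A) + c * \<mu> A) / 2))"
    if c: "\<bar>c\<bar> = 1" for c
  proof (rule countably_additiveI)
    fix A :: "nat \<Rightarrow> 'a set"
    assume A: "range A \<subseteq> sets M" "disjoint_family A" and U: "(\<Union>i. A i) \<in> sets M"
    have nn: "0 \<le> (enn2real (variation M \<mu> B) + c * \<mu> B) / 2" if "B \<in> sets M" for B
      using b[OF that] c by (auto simp: abs_if split: if_splits)
    have e: "ennreal (enn2real (variation M \<mu> B)) = variation M \<mu> B" if "B \<in> sets M" for B
      using f[OF that] by simp
    have Am: "A i \<in> sets M" for i using A(1) by auto
    have sm: "(\<Sum>i. ennreal (enn2real (variation M \<mu> (A i)))) = ennreal (enn2real (variation M \<mu> (\<Union>i. A i)))"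
      using variation_countably_additive[OF s] A U
      by (simp add: e[OF Am] e[OF U] countably_additive_def)
    have su: "summable (\<lambda>i. enn2real (variation M \<mu> (A i)))"
      by (rule summable_suminf_not_top) (simp_all only: sm, simp_all)
    have "ennreal (\<Sum>i. enn2real (variation M \<mu> (A i))) = ennreal (enn2real (variation M \<mu> (\<Union>i. A i)))"
      unfolding sm[symmetric] by (rule suminf_ennreal2[OF enn2real_nonneg su, symmetric])
    then have "(\<Sum>i. enn2real (variation M \<mu> (A i))) = enn2real (variation M \<mu> (\<Union>i. A i))"
      by (rule ennreal_inj[THEN iffD1, rotated 2]) (intro suminf_nonneg[OF su] enn2real_nonneg)+
    then have "(\<lambda>i. enn2real (variation M \<mu> (A i))) sums enn2real (variation M \<mu> (\<Union>i. A i))"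
      using summable_sums[OF su] by simp
    moreover have "(\<lambda>i. \<mu> (A i)) sums \<mu> (\<Union>i. A i)"
      using s A unfolding signed_measure_def by blast
    ultimately have "(\<lambda>i. (enn2real (variation M \<mu> (A i)) + c * \<mu> (A i)) / 2) sums
       ((enn2real (variation M \<mu> (\<Union>i. A i)) + c * \<mu> (\<Union>i. A i)) / 2)"
      by (intro sums_divide sums_add sums_mult)
    then show "(\<Sum>i. ennreal ((enn2real (variation M \<mu> (A i)) + c * \<mu> (A i)) / 2)) =
        ennreal ((enn2real (variation M \<mu> (\<Union>i. A i)) + c * \<mu> (\<Union>i. A i)) / 2)"
      by (intro suminf_ennreal_eq nn Am)
  qed
  have em: "emeasure (measure_of (space M) (sets M) (\<lambda>A. ennreal ((enn2real (variation M \<mu> A) + c * \<mu> A) / 2))) A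
      = ennreal ((enn2real (variation M \<mu> A) + c * \<mu> A) / 2)" if "A \<in> sets M" "\<bar>c\<bar> = 1" for c A
  proof (rule emeasure_measure_of_sigma)
    show "sigma_algebra (space M) (sets M)" by (rule sets.sigma_algebra_axioms)
    show "positive (sets M) (\<lambda>A. ennreal ((enn2real (variation M \<mu> A) + c * \<mu> A) / 2))"
      using s by (simp add: positive_def variation_empty signed_measure_def)
  qed (use that ca in auto)
  show "?P A" if "A \<in> sets M" for A using em[OF that, of 1] by (simp add: jordan_pos_def)
  show "?N A" if "A \<in> sets M" for A using em[OF that, of "-1"] by (simp add: jordan_neg_def)
qed

lemma space_jordan [simp]: "space (jordan_pos M \<mu>) = space M" "space (jordan_neg M \<mu>) = space M"
  by (simp_all add: jordan_pos_def jordan_neg_def space_measure_of sets.space_closed)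

lemma sets_jordan [simp, measurable_cong]: "sets (jordan_pos M \<mu>) = sets M" "sets (jordan_neg M \<mu>) = sets M"
  by (simp_all add: jordan_pos_def jordan_neg_def)

lemma finite_measure_jordan:
  assumes s: "signed_measure M \<mu>" and fin: "variation M \<mu> (space M) < \<infinity>"
  shows "finite_measure (jordan_pos M \<mu>)" "finite_measure (jordan_neg M \<mu>)"
  by (auto intro!: finite_measureI simp: emeasure_jordan_pos[OF assms] emeasure_jordan_neg[OF assms])

lemma measure_jordan:
  assumes s: "signed_measure M \<mu>" and fin: "variation M \<mu> (space M) < \<infinity>" and A: "A \<in> sets M"
  shows "\<mu> A = measure (jordan_pos M \<mu>) A - measure (jordan_neg M \<mu>) A"
    and "variation M \<mu> A = ennreal (measure (jordan_pos M \<mu>) A + measure (jordan_neg M \<mu>) A)"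
proof -
  have b: "\<bar>\<mu> A\<bar> \<le> enn2real (variation M \<mu> A)" by (rule abs_le_variation_real[OF assms])
  have p: "measure (jordan_pos M \<mu>) A = (enn2real (variation M \<mu> A) + \<mu> A) / 2"
    using b by (simp add: measure_def emeasure_jordan_pos[OF s fin A])
  have n: "measure (jordan_neg M \<mu>) A = (enn2real (variation M \<mu> A) - \<mu> A) / 2"
    using b by (simp add: measure_def emeasure_jordan_neg[OF s fin A])
  show "\<mu> A = measure (jordan_pos M \<mu>) A - measure (jordan_neg M \<mu>) A"
    unfolding p n by (simp add: field_simps)
  have "variation M \<mu> A < \<infinity>"
    using variation_mono[OF s A sets.top sets.sets_into_space[OF A]] fin by (rule le_less_trans)
  then show "variation M \<mu> A = ennreal (measure (jordan_pos M \<mu>) A + measure (jordan_neg M \<mu>) A)"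
    unfolding p n by (simp add: field_simps)
qed

lemma signed_measure_discrete:
  fixes M :: "'a measure"
  assumes "finite I"
  shows "signed_measure M (discrete_measure I w x)"
  unfolding signed_measure_def discrete_measure_def
proof (intro conjI allI impI)
  fix A :: "nat \<Rightarrow> 'a set" assume A: "disjoint_family A"
  have "(\<lambda>i. indicator (A i) y :: real) sums indicator (\<Union>i. A i) y" for y
  proof (cases "\<exists>j. y \<in> A j")
    case True
    then obtain j where j: "y \<in> A j" by blast
    have ij: "i = j" if "y \<in> A i" for i using A that j unfolding disjoint_family_on_def by blast
    have "indicator (A i) y = (if i = j then 1 else 0 :: real)" for i
      using j ij[of i] by (cases "i = j") (auto simp: indicator_eq_0_iff)
    then have e: "(\<lambda>i. indicator (A i) y :: real) = (\<lambda>i. if i = j then 1 else 0)" by (rule ext)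
    have "(\<lambda>i. indicator (A i) y :: real) sums 1"
      unfolding e by (rule sums_single)
    then show ?thesis using j by (auto simp: indicator_def)
  next
    case False
    then show ?thesis by (auto simp: indicator_def)
  qed
  then show "(\<lambda>i. \<Sum>k\<in>I. w k * indicator (A i) (x k)) sums (\<Sum>k\<in>I. w k * indicator (\<Union>i. A i) (x k))"
    by (intro sums_sum sums_mult)
qed simp

text \<open>
  For a nonnegative set function every partition sum equals the total mass by countable additivity.
\<close>

lemma variation_nonneg:
  assumes s: "signed_measure M \<mu>" and nn: "\<And>A. 0 \<le> \<mu> A" and A: "A \<in> sets M"
  shows "variation M \<mu> A = ennreal (\<mu> A)"
proof (rule antisym)
  show "variation M \<mu> A \<le> ennreal (\<mu> A)" unfolding variation_def
  proof (rule SUP_least)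
    fix P assume P: "P \<in> partitions M A"
    then have "(\<lambda>i. \<mu> (P i)) sums \<mu> A" using s unfolding signed_measure_def by blast
    then have "(\<Sum>i. ennreal (\<mu> (P i))) = ennreal (\<mu> A)" using nn by (intro suminf_ennreal_eq) auto
    then show "(\<Sum>i. ennreal \<bar>\<mu> (P i)\<bar>) \<le> ennreal (\<mu> A)" using nn by simp
  qed
  show "ennreal (\<mu> A) \<le> variation M \<mu> A"
    using abs_le_variation[OF s A] nn[of A] by simp
qed

lemma discrete_measure_nonneg:
  assumes "\<And>k. k \<in> I \<Longrightarrow> 0 \<le> w k"
  shows "0 \<le> discrete_measure I w x A"
  unfolding discrete_measure_def using assms by (intro sum_nonneg mult_nonneg_nonneg) auto

lemma variation_discrete:
  assumes "finite I" "\<And>k. k \<in> I \<Longrightarrow> 0 \<le> w k" "A \<in> sets M"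
  shows "variation M (discrete_measure I w x) A = ennreal (discrete_measure I w x A)"
  by (intro variation_nonneg signed_measure_discrete assms discrete_measure_nonneg)

text \<open>
  Since the weights are nonnegative, the variation is the measure itself; so the positive part is the
  image of a weighted counting measure, whose integrals are finite sums, and the negative part vanishes.
\<close>

lemma jordan_discrete:
  assumes I: "finite I" and w: "\<And>k. k \<in> I \<Longrightarrow> 0 \<le> w k" and x: "\<And>k. k \<in> I \<Longrightarrow> x k \<in> space M"
  shows "jordan_pos M (discrete_measure I w x) = distr (point_measure I (\<lambda>k. ennreal (w k))) M x"
    and "jordan_neg M (discrete_measure I w x) = null_measure M"
proof -
  let ?\<mu> = "discrete_measure I w x"
  note s = signed_measure_discrete[OF I, of M w x]
  have v: "variation M ?\<mu> A = ennreal (?\<mu> A)" if "A \<in> sets M" for A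
    using I w that by (rule variation_discrete)
  have nn: "0 \<le> ?\<mu> A" for A using w by (rule discrete_measure_nonneg)
  have fin: "variation M ?\<mu> (space M) < \<infinity>" by (simp add: v)
  have xm [measurable]: "x \<in> measurable (point_measure I (\<lambda>k. ennreal (w k))) M"
    using x by (auto simp: measurable_def point_measure_def sets.sets_into_space)
  show "jordan_pos M ?\<mu> = distr (point_measure I (\<lambda>k. ennreal (w k))) M x"
  proof (rule measure_eqI)
    fix A assume "A \<in> sets (jordan_pos M ?\<mu>)"
    then have A: "A \<in> sets M" by simp
    have "emeasure (distr (point_measure I (\<lambda>k. ennreal (w k))) M x) A = (\<Sum>k\<in>{k\<in>I. x k \<in> A}. ennreal (w k))"
    proof -
      have "x -` A \<inter> space (point_measure I (\<lambda>k. ennreal (w k))) = {k\<in>I. x k \<in> A}"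
        by (auto simp: space_point_measure)
      then show ?thesis
        unfolding emeasure_distr[OF xm A] using I by (subst emeasure_point_measure_finite) auto
    qed
    also have "\<dots> = ennreal (\<Sum>k\<in>{k\<in>I. x k \<in> A}. w k)" using w by (intro sum_ennreal) auto
    also have "(\<Sum>k\<in>{k\<in>I. x k \<in> A}. w k) = ?\<mu> A"
      unfolding discrete_measure_def sum.inter_filter[OF I] by (intro sum.cong) (auto simp: indicator_def)
    finally show "emeasure (jordan_pos M ?\<mu>) A = emeasure (distr (point_measure I (\<lambda>k. ennreal (w k))) M x) A"
      using nn[of A] by (simp add: emeasure_jordan_pos[OF s fin A] v[OF A])
  qed simp
  show "jordan_neg M ?\<mu> = null_measure M"
  proof (rule measure_eqI)
    fix A assume "A \<in> sets (jordan_neg M ?\<mu>)"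
    then have A: "A \<in> sets M" by simp
    show "emeasure (jordan_neg M ?\<mu>) A = emeasure (null_measure M) A"
      using nn[of A] by (simp add: emeasure_jordan_neg[OF s fin A] v[OF A])
  qed simp
qed

lemma
  fixes f :: "'a \<Rightarrow> 'b :: {banach, second_countable_topology}"
  assumes I: "finite I" and w: "\<And>k. k \<in> I \<Longrightarrow> 0 \<le> w k" and x: "\<And>k. k \<in> I \<Longrightarrow> x k \<in> space M"
    and f [measurable]: "f \<in> borel_measurable M"
  shows integral_jordan_pos_discrete: "integral\<^sup>L (jordan_pos M (discrete_measure I w x)) f = (\<Sum>k\<in>I. w k *\<^sub>R f (x k))"
    and integral_jordan_neg_discrete: "integral\<^sup>L (jordan_neg M (discrete_measure I w x)) f = 0"
proof -
  have xm [measurable]: "x \<in> measurable (point_measure I (\<lambda>k. ennreal (w k))) M"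
    using x by (auto simp: measurable_def point_measure_def sets.sets_into_space)
  show "integral\<^sup>L (jordan_pos M (discrete_measure I w x)) f = (\<Sum>k\<in>I. w k *\<^sub>R f (x k))"
  proof -
    have "integral\<^sup>L (jordan_pos M (discrete_measure I w x)) f = integral\<^sup>L (distr (point_measure I (\<lambda>k. ennreal (w k))) M x) f"
      by (subst jordan_discrete(1)[OF I w x]) simp_all
    also have "\<dots> = (\<integral>k. f (x k) \<partial>point_measure I (\<lambda>k. ennreal (w k)))"
      by (rule integral_distr[OF xm f])
    also have "\<dots> = (\<Sum>k\<in>I. w k *\<^sub>R f (x k))"
      by (rule lebesgue_integral_point_measure_finite[OF I w])
    finally show ?thesis .
  qed
  show "integral\<^sup>L (jordan_neg M (discrete_measure I w x)) f = 0"
    by (subst jordan_discrete(2)[OF I w x]) simp_all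
qed

section \<open>Concentration for functions of independent samples\<close>

text \<open>
  Hoeffding's lemma needs an interval of length \<open>c\<close> that contains the values; a function of oscillation at
  most \<open>c\<close> takes its values in the interval of that length that starts at its infimum.
\<close>

lemma hoeffding_oscillation:
  assumes "prob_space M" and h [measurable]: "h \<in> borel_measurable M"
    and osc: "\<And>x y. x \<in> space M \<Longrightarrow> y \<in> space M \<Longrightarrow> \<bar>h x - h y\<bar> \<le> (c::real)"
    and \<theta>: "0 < (\<theta>::real)"
  shows "(\<integral>\<^sup>+x. ennreal (exp (\<theta> * (h x - integral\<^sup>L M h))) \<partial>M) \<le> ennreal (exp (\<theta>\<^sup>2 * c\<^sup>2 / 8))"
proof -
  interpret prob_space M by fact
  obtain x0 where x0: "x0 \<in> space M" using not_empty by blast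
  define a where "a = (INF x\<in>space M. h x)"
  have bdd: "bdd_below (h ` space M)"
    using osc[OF x0] by (intro bdd_belowI2[of _ "h x0 - c"]) (smt (verit))
  have lo: "a \<le> h x" if "x \<in> space M" for x
    unfolding a_def using bdd that by (rule cINF_lower)
  have hi: "h x \<le> a + c" if x: "x \<in> space M" for x
  proof -
    have "h x - c \<le> a" unfolding a_def
      using x0 osc[OF x] by (intro cINF_greatest) (auto, smt (verit))
    then show ?thesis by simp
  qed
  interpret interval_bounded_random_variable M h a "a + c"
    by unfold_locales (auto intro!: AE_I2 lo hi)
  show ?thesis using Hoeffdings_lemma_nn_integral[OF \<theta>] by simp
qed

text \<open>
  Induction on the number of coordinates: integrating out one coordinate costs a factor
  \<open>exp (\<theta>\<^sup>2 c\<^sup>2 / 8)\<close> by Hoeffding's lemma, and the partial average inherits the bounded differences.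
\<close>

text \<open>
  McDiarmid's inequality: Markov's inequality for \<open>exp (\<theta> (f - E f))\<close> at the optimal \<open>\<theta>\<close>.
\<close>

lemma mcdiarmid_exp:
  fixes f :: "('i \<Rightarrow> 'a) \<Rightarrow> real"
  assumes M: "prob_space M" and I: "finite I"
    and f: "f \<in> borel_measurable (PiM I (\<lambda>_. M))"
    and bdd: "\<And>z. z \<in> space (PiM I (\<lambda>_. M)) \<Longrightarrow> \<bar>f z\<bar> \<le> B"
    and diff: "\<And>i z x y. i \<in> I \<Longrightarrow> z \<in> space (PiM I (\<lambda>_. M)) \<Longrightarrow> x \<in> space M \<Longrightarrow> y \<in> space M \<Longrightarrow>
        \<bar>f (z(i := x)) - f (z(i := y))\<bar> \<le> c"
    and \<theta>: "0 < \<theta>"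
  shows "(\<integral>\<^sup>+z. ennreal (exp (\<theta> * (f z - integral\<^sup>L (PiM I (\<lambda>_. M)) f))) \<partial>PiM I (\<lambda>_. M))
           \<le> ennreal (exp (\<theta>\<^sup>2 * c\<^sup>2 * real (card I) / 8))"
  using I f bdd diff
proof (induction I arbitrary: f rule: finite_induct)
  case empty
  interpret P: prob_space "PiM {} (\<lambda>_::'i. M)" by (intro prob_space_PiM M)
  have sp: "space (PiM {} (\<lambda>_::'i. M)) = {\<lambda>_. undefined}" by (simp add: space_PiM)
  have "integral\<^sup>L (PiM {} (\<lambda>_. M)) f = f (\<lambda>_. undefined)"
  proof -
    have "integral\<^sup>L (PiM {} (\<lambda>_. M)) f = (\<integral>z. f (\<lambda>_. undefined) \<partial>PiM {} (\<lambda>_::'i. M))"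
      by (intro Bochner_Integration.integral_cong) (auto simp: sp)
    then show ?thesis by (simp add: P.prob_space)
  qed
  then have "(\<integral>\<^sup>+z. ennreal (exp (\<theta> * (f z - integral\<^sup>L (PiM {} (\<lambda>_. M)) f))) \<partial>PiM {} (\<lambda>_. M))
      = (\<integral>\<^sup>+z. 1 \<partial>PiM {} (\<lambda>_::'i. M))"
    by (intro nn_integral_cong) (auto simp: sp)
  also have "\<dots> = 1" using P.emeasure_space_1 by simp
  finally show ?case by simp
next
  case (insert i I)
  interpret M: prob_space M by fact
  interpret PS: product_sigma_finite "\<lambda>_::'i. M" ..
  interpret P: prob_space "PiM I (\<lambda>_::'i. M)" by (intro prob_space_PiM M)
  interpret P': prob_space "PiM (insert i I) (\<lambda>_::'i. M)" by (intro prob_space_PiM M)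
  note [measurable] = insert.prems(1)
  have upd [measurable]: "(\<lambda>(z, y). z(i := y)) \<in> PiM I (\<lambda>_. M) \<Otimes>\<^sub>M M \<rightarrow>\<^sub>M PiM (insert i I) (\<lambda>_. M)"
    by (rule measurable_add_dim)
  have upd_space: "z(i := y) \<in> space (PiM (insert i I) (\<lambda>_. M))"
    if "z \<in> space (PiM I (\<lambda>_. M))" "y \<in> space M" for z y
    using measurable_space[OF upd, of "(z, y)"] that by (simp add: space_pair_measure)
  define g where "g z = (\<integral>y. f (z(i := y)) \<partial>M)" for z
  have fm2 [measurable]: "(\<lambda>(z, y). f (z(i := y))) \<in> borel_measurable (PiM I (\<lambda>_. M) \<Otimes>\<^sub>M M)"
    using measurable_compose[OF upd insert.prems(1)] by (simp add: case_prod_beta')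
  have gm [measurable]: "g \<in> borel_measurable (PiM I (\<lambda>_. M))"
    unfolding g_def by measurable
  have fm1: "(\<lambda>y. f (z(i := y))) \<in> borel_measurable M" if z: "z \<in> space (PiM I (\<lambda>_. M))" for z
    using measurable_compose[OF measurable_Pair1'[OF z] fm2] by simp
  have fint: "integrable M (\<lambda>y. f (z(i := y)))" if z: "z \<in> space (PiM I (\<lambda>_. M))" for z
    using fm1[OF z] insert.prems(2)[OF upd_space[OF z]]
    by (intro M.integrable_const_bound[where B = B] AE_I2) (simp_all del: fun_upd_apply)
  have gb: "\<bar>g z\<bar> \<le> B" if z: "z \<in> space (PiM I (\<lambda>_. M))" for z
  proof -
    have "\<bar>g z\<bar> \<le> (\<integral>y. \<bar>f (z(i := y))\<bar> \<partial>M)" unfolding g_def by (rule integral_abs_bound)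
    also have "\<dots> \<le> (\<integral>y. B \<partial>M)"
      using fint[OF z] insert.prems(2)[OF upd_space[OF z]] by (intro integral_mono) (simp_all del: fun_upd_apply)
    finally show ?thesis by (simp add: M.prob_space)
  qed
  have gd: "\<bar>g (z(j := x)) - g (z(j := y))\<bar> \<le> c"
    if j: "j \<in> I" and z: "z \<in> space (PiM I (\<lambda>_. M))" and x: "x \<in> space M" and y: "y \<in> space M" for j z x y
  proof -
    have zz: "z(j := w) \<in> space (PiM I (\<lambda>_. M))" if "w \<in> space M" for w
      using z j that by (auto simp: space_PiM PiE_iff extensional_def)
    have ij: "i \<noteq> j" using insert.hyps j by auto
    have "g (z(j := x)) - g (z(j := y)) = (\<integral>w. f (z(j := x, i := w)) - f (z(j := y, i := w)) \<partial>M)"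
      unfolding g_def using fint[OF zz[OF x]] fint[OF zz[OF y]]
      by (rule Bochner_Integration.integral_diff[symmetric])
    also have "\<bar>\<dots>\<bar> \<le> (\<integral>w. \<bar>f (z(j := x, i := w)) - f (z(j := y, i := w))\<bar> \<partial>M)"
      by (rule integral_abs_bound)
    also have "\<dots> \<le> (\<integral>w. c \<partial>M)"
    proof (intro integral_mono)
      fix w assume w: "w \<in> space M"
      show "\<bar>f (z(j := x, i := w)) - f (z(j := y, i := w))\<bar> \<le> c"
        using insert.prems(3)[of j "z(i := w)" x y] j upd_space[OF z w] x y
        by (simp add: fun_upd_twist[OF ij] del: fun_upd_apply)
    qed (use fint[OF zz[OF x]] fint[OF zz[OF y]] in auto)
    finally show ?thesis by (simp add: M.prob_space)
  qed
  have Ef: "integral\<^sup>L (PiM (insert i I) (\<lambda>_. M)) f = integral\<^sup>L (PiM I (\<lambda>_. M)) g"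
    unfolding g_def
  proof (rule PS.product_integral_insert[OF insert.hyps])
    show "integrable (Pi\<^sub>M (insert i I) (\<lambda>_. M)) f"
      using insert.prems(2) by (intro P'.integrable_const_bound[where B = B] AE_I2) auto
  qed
  let ?E = "integral\<^sup>L (PiM I (\<lambda>_. M)) g"
  have "(\<integral>\<^sup>+z. ennreal (exp (\<theta> * (f z - ?E))) \<partial>PiM (insert i I) (\<lambda>_. M))
     = (\<integral>\<^sup>+z. \<integral>\<^sup>+y. ennreal (exp (\<theta> * (f (z(i := y)) - ?E))) \<partial>M \<partial>PiM I (\<lambda>_. M))"
    by (rule PS.product_nn_integral_insert[OF insert.hyps]) measurable
  also have "\<dots> = (\<integral>\<^sup>+z. ennreal (exp (\<theta> * (g z - ?E))) *
       (\<integral>\<^sup>+y. ennreal (exp (\<theta> * (f (z(i := y)) - g z))) \<partial>M) \<partial>PiM I (\<lambda>_. M))"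
  proof (intro nn_integral_cong)
    fix z assume z: "z \<in> space (PiM I (\<lambda>_. M))"
    note [measurable] = fm1[OF z]
    have "exp (\<theta> * (f (z(i := y)) - ?E)) = exp (\<theta> * (g z - ?E)) * exp (\<theta> * (f (z(i := y)) - g z))" for y
      by (simp add: exp_add[symmetric] algebra_simps)
    then show "(\<integral>\<^sup>+y. ennreal (exp (\<theta> * (f (z(i := y)) - ?E))) \<partial>M) = ennreal (exp (\<theta> * (g z - ?E))) *
       (\<integral>\<^sup>+y. ennreal (exp (\<theta> * (f (z(i := y)) - g z))) \<partial>M)"
      by (simp add: ennreal_mult nn_integral_cmult)
  qed
  also have "\<dots> \<le> (\<integral>\<^sup>+z. ennreal (exp (\<theta> * (g z - ?E))) * ennreal (exp (\<theta>\<^sup>2 * c\<^sup>2 / 8)) \<partial>PiM I (\<lambda>_. M))"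
  proof (intro nn_integral_mono mult_left_mono)
    fix z assume z: "z \<in> space (PiM I (\<lambda>_. M))"
    show "(\<integral>\<^sup>+y. ennreal (exp (\<theta> * (f (z(i := y)) - g z))) \<partial>M) \<le> ennreal (exp (\<theta>\<^sup>2 * c\<^sup>2 / 8))"
      unfolding g_def
    proof (rule hoeffding_oscillation[OF M fm1[OF z] _ \<theta>])
      fix x y assume xy: "x \<in> space M" "y \<in> space M"
      show "\<bar>f (z(i := x)) - f (z(i := y))\<bar> \<le> c"
        using insert.prems(3)[of i "z(i := x)" x y] xy upd_space[OF z xy(1)] by (simp del: fun_upd_apply)
    qed
  qed simp
  also have "\<dots> = (\<integral>\<^sup>+z. ennreal (exp (\<theta> * (g z - ?E))) \<partial>PiM I (\<lambda>_. M)) * ennreal (exp (\<theta>\<^sup>2 * c\<^sup>2 / 8))"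
    by (rule nn_integral_multc) measurable
  also have "\<dots> \<le> ennreal (exp (\<theta>\<^sup>2 * c\<^sup>2 * real (card I) / 8)) * ennreal (exp (\<theta>\<^sup>2 * c\<^sup>2 / 8))"
    by (intro mult_right_mono insert.IH gm gb gd) auto
  also have "\<dots> = ennreal (exp (\<theta>\<^sup>2 * c\<^sup>2 * real (card (insert i I)) / 8))"
    using insert.hyps by (simp add: ennreal_mult[symmetric] exp_add[symmetric] field_simps)
  finally show ?case unfolding Ef .
qed

lemma mcdiarmid:
  fixes f :: "('i \<Rightarrow> 'a) \<Rightarrow> real"
  assumes M: "prob_space M" and I: "finite I" "I \<noteq> {}"
    and f [measurable]: "f \<in> borel_measurable (PiM I (\<lambda>_. M))"
    and bdd: "\<And>z. z \<in> space (PiM I (\<lambda>_. M)) \<Longrightarrow> \<bar>f z\<bar> \<le> B"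
    and diff: "\<And>i z x y. i \<in> I \<Longrightarrow> z \<in> space (PiM I (\<lambda>_. M)) \<Longrightarrow> x \<in> space M \<Longrightarrow> y \<in> space M \<Longrightarrow>
        \<bar>f (z(i := x)) - f (z(i := y))\<bar> \<le> c"
    and c: "0 < c" and t: "0 < t"
  shows "measure (PiM I (\<lambda>_. M)) {z \<in> space (PiM I (\<lambda>_. M)). integral\<^sup>L (PiM I (\<lambda>_. M)) f + t \<le> f z}
           \<le> exp (- 2 * t\<^sup>2 / (c\<^sup>2 * real (card I)))"
proof -
  let ?P = "PiM I (\<lambda>_. M)"
  interpret P: prob_space ?P by (intro prob_space_PiM M)
  have N: "0 < real (card I)" using I by (simp add: card_gt_0_iff)
  \<comment> \<open>minimises the exponent \<open>\<theta>\<^sup>2 c\<^sup>2 |I| / 8 - \<theta> t\<close>\<close>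
  define \<theta> where "\<theta> = 4 * t / (c\<^sup>2 * real (card I))"
  have \<theta>: "0 < \<theta>" using N c t by (simp add: \<theta>_def)
  let ?S = "{z \<in> space ?P. integral\<^sup>L ?P f + t \<le> f z}"
  have "emeasure ?P ?S * ennreal (exp (\<theta> * t)) = (\<integral>\<^sup>+z. ennreal (exp (\<theta> * t)) * indicator ?S z \<partial>?P)"
    by (subst nn_integral_cmult_indicator) (auto simp: mult.commute)
  also have "\<dots> \<le> (\<integral>\<^sup>+z. ennreal (exp (\<theta> * (f z - integral\<^sup>L ?P f))) \<partial>?P)"
    using \<theta> by (intro nn_integral_mono) (auto simp: indicator_def)
  also have "\<dots> \<le> ennreal (exp (\<theta>\<^sup>2 * c\<^sup>2 * real (card I) / 8))"
    by (rule mcdiarmid_exp[OF M I(1) f bdd diff \<theta>])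
  finally have "measure ?P ?S * exp (\<theta> * t) \<le> exp (\<theta>\<^sup>2 * c\<^sup>2 * real (card I) / 8)"
    by (simp add: P.emeasure_eq_measure ennreal_mult[symmetric])
  then have "measure ?P ?S \<le> exp (\<theta>\<^sup>2 * c\<^sup>2 * real (card I) / 8) / exp (\<theta> * t)"
    by (simp add: field_simps)
  also have "\<dots> = exp (\<theta>\<^sup>2 * c\<^sup>2 * real (card I) / 8 - \<theta> * t)" by (simp add: exp_diff)
  also have "\<theta>\<^sup>2 * c\<^sup>2 * real (card I) / 8 - \<theta> * t = - 2 * t\<^sup>2 / (c\<^sup>2 * real (card I))"
    using N c unfolding \<theta>_def by (simp add: field_simps power2_eq_square)
  finally show ?thesis .
qed

lemma cmod_sq_add: "(cmod (a + b))\<^sup>2 = (cmod a)\<^sup>2 + 2 * Re (a * cnj b) + (cmod b)\<^sup>2"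
  unfolding cmod_power2 by (simp add: power2_eq_square algebra_simps)

text \<open>
  Orthogonality of independent centred variables: the cross terms vanish when one coordinate is
  integrated out.
\<close>

lemma expectation_cmod_sum_sq:
  fixes \<zeta> :: "'a \<Rightarrow> complex"
  assumes M: "prob_space M" and I: "finite I"
    and \<zeta> [measurable]: "\<zeta> \<in> borel_measurable M" and B: "\<And>x. cmod (\<zeta> x) \<le> B"
    and mean: "integral\<^sup>L M \<zeta> = 0"
  shows "(\<integral>z. (cmod (\<Sum>i\<in>I. \<zeta> (z i)))\<^sup>2 \<partial>PiM I (\<lambda>_. M)) = real (card I) * (\<integral>x. (cmod (\<zeta> x))\<^sup>2 \<partial>M)"
  using I
proof (induction I rule: finite_induct)
  case empty
  then show ?case by simp
next
  case (insert i I)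
  interpret M: prob_space M by fact
  interpret PS: product_sigma_finite "\<lambda>_::'b. M" ..
  interpret P: prob_space "PiM I (\<lambda>_::'b. M)" by (intro prob_space_PiM M)
  interpret P': prob_space "PiM (insert i I) (\<lambda>_::'b. M)" by (intro prob_space_PiM M)
  have sb: "cmod (\<Sum>j\<in>J. \<zeta> (z j)) \<le> real (card J) * B" for J and z :: "'b \<Rightarrow> 'a"
    using B by (intro order_trans[OF norm_sum] sum_bounded_above) 
  have B0: "0 \<le> B" using B norm_ge_zero order_trans by blast
  have i1: "integrable M \<zeta>" by (rule M.integrable_const_bound[where B = B]) (auto intro: B)
  have i2: "integrable M (\<lambda>x. (cmod (\<zeta> x))\<^sup>2)"
    by (rule M.integrable_const_bound[where B = "B\<^sup>2"]) (auto intro!: power_mono B)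
  have "(\<integral>z. (cmod (\<Sum>j\<in>insert i I. \<zeta> (z j)))\<^sup>2 \<partial>PiM (insert i I) (\<lambda>_. M))
      = (\<integral>z. \<integral>y. (cmod (\<Sum>j\<in>insert i I. \<zeta> ((z(i := y)) j)))\<^sup>2 \<partial>M \<partial>PiM I (\<lambda>_. M))"
  proof (rule PS.product_integral_insert[OF insert.hyps])
    have "(\<lambda>z. (cmod (\<Sum>j\<in>insert i I. \<zeta> (z j)))\<^sup>2) \<in> borel_measurable (Pi\<^sub>M (insert i I) (\<lambda>_. M))"
      by measurable
    then show "integrable (Pi\<^sub>M (insert i I) (\<lambda>_. M)) (\<lambda>z. (cmod (\<Sum>j\<in>insert i I. \<zeta> (z j)))\<^sup>2)"
      by (intro P'.integrable_const_bound[where B = "(real (card (insert i I)) * B)\<^sup>2"] AE_I2) 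
         (auto intro!: power_mono sb simp del: sum.insert card.insert)
  qed
  also have "\<dots> = (\<integral>z. (cmod (\<Sum>j\<in>I. \<zeta> (z j)))\<^sup>2 + (\<integral>x. (cmod (\<zeta> x))\<^sup>2 \<partial>M) \<partial>PiM I (\<lambda>_. M))"
  proof (rule Bochner_Integration.integral_cong[OF refl])
    fix z assume "z \<in> space (PiM I (\<lambda>_. M))"
    let ?s = "\<Sum>j\<in>I. \<zeta> (z j)"
    have s: "(\<Sum>j\<in>insert i I. \<zeta> ((z(i := y)) j)) = ?s + \<zeta> y" for y
      using insert.hyps by (auto simp: add.commute intro!: sum.cong)
    have "(\<integral>y. (cmod (?s + \<zeta> y))\<^sup>2 \<partial>M) = (\<integral>y. (cmod ?s)\<^sup>2 + 2 * Re (?s * cnj (\<zeta> y)) + (cmod (\<zeta> y))\<^sup>2 \<partial>M)"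
      by (simp add: cmod_sq_add)
    also have "\<dots> = (\<integral>y. (cmod ?s)\<^sup>2 + 2 * Re (?s * cnj (\<zeta> y)) \<partial>M) + (\<integral>y. (cmod (\<zeta> y))\<^sup>2 \<partial>M)"
      using i1 i2 by (intro Bochner_Integration.integral_add) auto
    also have "(\<integral>y. (cmod ?s)\<^sup>2 + 2 * Re (?s * cnj (\<zeta> y)) \<partial>M) = (cmod ?s)\<^sup>2 + (\<integral>y. 2 * Re (?s * cnj (\<zeta> y)) \<partial>M)"
      using i1 by (subst Bochner_Integration.integral_add) (auto simp: M.prob_space)
    also have "(\<integral>y. 2 * Re (?s * cnj (\<zeta> y)) \<partial>M) = 2 * Re (?s * cnj (integral\<^sup>L M \<zeta>))"
    proof -
      have "(\<integral>y. ?s * cnj (\<zeta> y) \<partial>M) = ?s * cnj (integral\<^sup>L M \<zeta>)"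
        using i1 by simp
      moreover have "(\<integral>y. Re (?s * cnj (\<zeta> y)) \<partial>M) = Re (\<integral>y. ?s * cnj (\<zeta> y) \<partial>M)"
        using i1 by (intro integral_Re) auto
      moreover have "(\<integral>y. 2 * Re (?s * cnj (\<zeta> y)) \<partial>M) = 2 * (\<integral>y. Re (?s * cnj (\<zeta> y)) \<partial>M)"
        by (rule integral_mult_right_zero)
      ultimately show ?thesis by (simp only:)
    qed
    finally show "(\<integral>y. (cmod (\<Sum>j\<in>insert i I. \<zeta> ((z(i := y)) j)))\<^sup>2 \<partial>M) = (cmod ?s)\<^sup>2 + (\<integral>x. (cmod (\<zeta> x))\<^sup>2 \<partial>M)"
      by (simp only: s mean) simp
  qed
  also have "\<dots> = (\<integral>z. (cmod (\<Sum>j\<in>I. \<zeta> (z j)))\<^sup>2 \<partial>PiM I (\<lambda>_. M)) + (\<integral>x. (cmod (\<zeta> x))\<^sup>2 \<partial>M)"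
  proof (subst Bochner_Integration.integral_add)
    show "integrable (Pi\<^sub>M I (\<lambda>_. M)) (\<lambda>z. (cmod (\<Sum>j\<in>I. \<zeta> (z j)))\<^sup>2)"
      by (intro P.integrable_const_bound[where B = "(real (card I) * B)\<^sup>2"] AE_I2) 
         (auto intro!: power_mono sb)
  qed (auto simp: P.prob_space)
  finally show ?case using insert by (simp add: algebra_simps)
qed

section \<open>Derivatives of the fourth power of sinc\<close>

text \<open>
  The \<open>j\<close>-th derivative of sinc, obtained by differentiating \<open>sinc v = (1/2) \<integral> cos (t v)\<close> over \<open>[-1,1]\<close>
  under the integral sign. The integral form makes sense at 0 as well and gives uniform bounds directly.
\<close>

definition sincd :: "nat \<Rightarrow> real \<Rightarrow> real" where
  "sincd j v = integral {-1..1} (\<lambda>t. t ^ j * cos (t * v + real j * pi / 2)) / 2"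

lemma sincd_deriv: "(sincd j has_real_derivative sincd (Suc j) v) (at v)"
proof -
  have "((\<lambda>v. integral (cbox (-1) 1) (\<lambda>t. t ^ j * cos (t * v + real j * pi / 2))) has_field_derivative
      integral (cbox (-1) 1) (\<lambda>t. t ^ Suc j * cos (t * v + real (Suc j) * pi / 2))) (at v within UNIV)"
  proof (rule leibniz_rule_field_derivative)
    fix v t :: real
    have "cos (t * v + real (Suc j) * pi / 2) = - sin (t * v + real j * pi / 2)"
    proof -
      have e: "t * v + real (Suc j) * pi / 2 = (t * v + real j * pi / 2) + pi / 2" by (simp add: field_simps)
      show ?thesis unfolding e by (subst cos_add) simp
    qed
    then show "((\<lambda>v. t ^ j * cos (t * v + real j * pi / 2)) has_field_derivative
        t ^ Suc j * cos (t * v + real (Suc j) * pi / 2)) (at v within UNIV)"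
      by (auto intro!: derivative_eq_intros)
    show "(\<lambda>t. t ^ j * cos (t * v + real j * pi / 2)) integrable_on cbox (-1) 1"
      by (intro integrable_continuous continuous_intros) 
    show "continuous_on (UNIV \<times> cbox (-1) 1) (\<lambda>(x, t). t ^ Suc j * cos (t * x + real (Suc j) * pi / 2))"
      by (auto simp: split_beta intro!: continuous_intros)
  qed auto
  then show ?thesis unfolding sincd_def[abs_def] by (auto intro!: derivative_eq_intros simp: cbox_interval)
qed

lemma sincd_bound: "\<bar>sincd j v\<bar> \<le> 1"
proof -
  have "norm (integral {-1..1} (\<lambda>t::real. t ^ j * cos (t * v + real j * pi / 2))) \<le> 1 * (1 - (-1))"
  proof (rule integral_bound)
    show "continuous_on {-1..1} (\<lambda>t. t ^ j * cos (t * v + real j * pi / 2))"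
      by (intro continuous_intros)
    fix t :: real assume "t \<in> {-1..1}"
    then have "\<bar>t ^ j\<bar> \<le> 1" by (auto simp: power_abs intro!: power_le_one)
    then show "norm (t ^ j * cos (t * v + real j * pi / 2)) \<le> 1"
      using abs_cos_le_one[of "t * v + real j * pi / 2"] by (simp add: abs_mult mult_le_one)
  qed auto
  then show ?thesis by (simp add: sincd_def)
qed

lemma sincd_0: "sincd 0 v = sinc v"
proof (cases "v = 0")
  case True
  then show ?thesis by (simp add: sincd_def)
next
  case False
  have "((\<lambda>t. cos (t * v)) has_integral (sin (1 * v) / v - sin ((-1) * v) / v)) {-1..1}"
    using False by (intro fundamental_theorem_of_calculus)
      (auto intro!: derivative_eq_intros simp flip: has_real_derivative_iff_has_vector_derivative)
  then have "integral {-1..1} (\<lambda>t. cos (t * v)) = 2 * sin v / v"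
    by (simp add: integral_unique)
  then show ?thesis using False by (simp add: sincd_def)
qed

lemma sincd_2_0: "sincd 2 0 = - 1 / 3"
proof -
  have "((\<lambda>t::real. t ^ 2) has_integral (1 ^ 3 / 3 - (-1) ^ 3 / 3)) {-1..1}"
    by (intro fundamental_theorem_of_calculus)
      (auto intro!: derivative_eq_intros simp: power2_eq_square simp flip: has_real_derivative_iff_has_vector_derivative)
  then have "integral {-1..1} (\<lambda>t::real. t ^ 2) = 2 / 3"
    by (simp add: integral_unique)
  then show ?thesis by (simp add: sincd_def)
qed

lemma sincd_1_0: "sincd 1 0 = 0"
proof -
  have "((\<lambda>t::real. t * 0) has_integral 0) {-1..1}" by simp
  then show ?thesis by (simp add: sincd_def integral_unique)
qed

text \<open>
  Successive derivatives of the identity \<open>v sinc v = sin v\<close>. They express \<open>v\<close> times a derivative through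
  bounded quantities, which is the decay at infinity in \<open>sincd_decay\<close>.
\<close>

lemma sincd_rec:
  shows "v * sincd 0 v = sin v"
    and "v * sincd 1 v + sincd 0 v = cos v"
    and "v * sincd 2 v + 2 * sincd 1 v = - sin v"
    and "v * sincd 3 v + 3 * sincd 2 v = - cos v"
proof -
  have suc: "Suc 0 = 1" "Suc 1 = 2" "Suc 2 = 3" by simp_all
  have d': "(sincd 0 has_real_derivative sincd 1 v) (at v)" "(sincd 1 has_real_derivative sincd 2 v) (at v)"
     "(sincd 2 has_real_derivative sincd 3 v) (at v)" for v
    using sincd_deriv[of 0 v, unfolded suc] sincd_deriv[of 1 v, unfolded suc] sincd_deriv[of 2 v, unfolded suc] by this
  show 0: "v * sincd 0 v = sin v" for v by (simp add: sincd_0)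
  have "((\<lambda>v. v * sincd 0 v) has_real_derivative v * sincd 1 v + sincd 0 v) (at v)" for v
    by (auto intro!: derivative_eq_intros d'[unfolded One_nat_def])
  moreover have "((\<lambda>v. v * sincd 0 v) has_real_derivative cos v) (at v)" for v
    unfolding 0 by (rule DERIV_sin)
  ultimately show 1: "v * sincd 1 v + sincd 0 v = cos v" for v by (rule DERIV_unique)
  have "((\<lambda>v. v * sincd 1 v + sincd 0 v) has_real_derivative v * sincd 2 v + 2 * sincd 1 v) (at v)" for v
    by (auto intro!: derivative_eq_intros d'[unfolded One_nat_def])
  moreover have "((\<lambda>v. v * sincd 1 v + sincd 0 v) has_real_derivative - sin v) (at v)" for v
    unfolding 1 by (rule DERIV_cos)
  ultimately show 2: "v * sincd 2 v + 2 * sincd 1 v = - sin v" for v by (rule DERIV_unique)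
  have "((\<lambda>v. v * sincd 2 v + 2 * sincd 1 v) has_real_derivative v * sincd 3 v + 3 * sincd 2 v) (at v)" for v
    by (auto intro!: derivative_eq_intros d'[unfolded One_nat_def])
  moreover have "((\<lambda>v. v * sincd 2 v + 2 * sincd 1 v) has_real_derivative - cos v) (at v)" for v
    unfolding 2 by (intro DERIV_minus DERIV_sin)
  ultimately show "v * sincd 3 v + 3 * sincd 2 v = - cos v" for v by (rule DERIV_unique)
qed

lemma sincd_decay:
  shows "\<bar>v * sincd 0 v\<bar> \<le> 1" "\<bar>v * sincd 1 v\<bar> \<le> 3" "\<bar>v * sincd 2 v\<bar> \<le> 3" "\<bar>v * sincd 3 v\<bar> \<le> 4"
proof -
  note r = sincd_rec[of v]
  note b = sincd_bound[of 0 v] sincd_bound[of 1 v] sincd_bound[of 2 v] sincd_bound[of 3 v]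
  note t = abs_sin_le_one[of v] abs_cos_le_one[of v]
  show "\<bar>v * sincd 0 v\<bar> \<le> 1" "\<bar>v * sincd 1 v\<bar> \<le> 3" "\<bar>v * sincd 2 v\<bar> \<le> 3" "\<bar>v * sincd 3 v\<bar> \<le> 4"
    using r b t by linarith+
qed

text \<open>
  The \<open>j\<close>-th derivative of \<open>sinc\<^sup>4\<close> for \<open>j \<le> 3\<close>, written out by the Leibniz rule.
\<close>

definition sg :: "nat \<Rightarrow> real \<Rightarrow> real" where
  "sg j v = (if j = 0 then sincd 0 v ^ 4
     else if j = 1 then 4 * sincd 0 v ^ 3 * sincd 1 v
     else if j = 2 then 12 * sincd 0 v ^ 2 * sincd 1 v ^ 2 + 4 * sincd 0 v ^ 3 * sincd 2 v
     else 24 * sincd 0 v * sincd 1 v ^ 3 + 36 * sincd 0 v ^ 2 * sincd 1 v * sincd 2 v + 4 * sincd 0 v ^ 3 * sincd 3 v)"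

lemma sg_0: "sg 0 v = sincd 0 v ^ 4" by (simp add: sg_def)

lemma sg_at_0: "sg 0 0 = 1" "sg 1 0 = 0" "sg 2 0 = - 4 / 3"
  using sincd_1_0 by (simp_all add: sg_def sincd_0 sincd_2_0)

lemma sg_deriv:
  assumes "j \<le> 2"
  shows "(sg j has_real_derivative sg (Suc j) v) (at v)"
proof -
  have suc: "Suc 0 = 1" "Suc 1 = 2" "Suc 2 = 3" by simp_all
  have d: "(sincd 0 has_real_derivative sincd 1 v) (at v)" "(sincd 1 has_real_derivative sincd 2 v) (at v)"
     "(sincd 2 has_real_derivative sincd 3 v) (at v)"
    using sincd_deriv[of 0 v, unfolded suc] sincd_deriv[of 1 v, unfolded suc] sincd_deriv[of 2 v, unfolded suc] by this
  consider "j = 0" | "j = 1" | "j = 2" using assms by linarith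
  then show ?thesis
  proof cases
    case 1
    show ?thesis unfolding 1 sg_def[abs_def]
      by (auto intro!: derivative_eq_intros d[unfolded One_nat_def] simp: power2_eq_square power3_eq_cube)
  next
    case 2
    show ?thesis unfolding 2 sg_def[abs_def]
      by (auto intro!: derivative_eq_intros d[unfolded One_nat_def] simp: power2_eq_square power3_eq_cube)
  next
    case 3
    show ?thesis unfolding 3 sg_def[abs_def]
      by (auto intro!: derivative_eq_intros d[unfolded One_nat_def] simp: power2_eq_square power3_eq_cube algebra_simps)
  qed
qed

lemma abs_prod4_le:
  fixes a b c d :: real
  assumes "\<bar>a\<bar> \<le> A" "\<bar>b\<bar> \<le> B" "\<bar>c\<bar> \<le> C" "\<bar>d\<bar> \<le> D"
  shows "\<bar>a * b * c * d\<bar> \<le> A * B * C * D"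
  unfolding abs_mult using assms by (intro mult_mono mult_nonneg_nonneg) auto

text \<open>
  Every term in \<open>sg j\<close> has four factors from the derivatives of sinc, so it is homogeneous of degree 4 under
  a scaling \<open>s\<close>; this covers the uniform bound (\<open>s = 1\<close>) and the decay (\<open>s = v\<close>) at once.
\<close>

lemma sg_bounds_aux:
  assumes s: "\<bar>s * sincd 0 v\<bar> \<le> A0" "\<bar>s * sincd 1 v\<bar> \<le> A1" "\<bar>s * sincd 2 v\<bar> \<le> A2" "\<bar>s * sincd 3 v\<bar> \<le> A3"
  shows "\<bar>s ^ 4 * sg 0 v\<bar> \<le> A0 * A0 * A0 * A0"
    "\<bar>s ^ 4 * sg 1 v\<bar> \<le> 4 * (A0 * A0 * A0 * A1)"
    "\<bar>s ^ 4 * sg 2 v\<bar> \<le> 12 * (A0 * A0 * A1 * A1) + 4 * (A0 * A0 * A0 * A2)"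
    "\<bar>s ^ 4 * sg 3 v\<bar> \<le> 24 * (A0 * A1 * A1 * A1) + 36 * (A0 * A0 * A1 * A2) + 4 * (A0 * A0 * A0 * A3)"
proof -
  let ?a = "s * sincd 0 v" and ?b = "s * sincd 1 v" and ?c = "s * sincd 2 v" and ?d = "s * sincd 3 v"
  have "s ^ 4 * sg 0 v = ?a * ?a * ?a * ?a"
    by (simp add: sg_def power_numeral_reduce algebra_simps)
  then show "\<bar>s ^ 4 * sg 0 v\<bar> \<le> A0 * A0 * A0 * A0" by (simp only:) (rule abs_prod4_le s)+
  have "s ^ 4 * sg 1 v = 4 * (?a * ?a * ?a * ?b)"
    by (simp add: sg_def power_numeral_reduce algebra_simps)
  then show "\<bar>s ^ 4 * sg 1 v\<bar> \<le> 4 * (A0 * A0 * A0 * A1)"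
    using abs_prod4_le[OF s(1) s(1) s(1) s(2)] by simp
  have "s ^ 4 * sg 2 v = 12 * (?a * ?a * ?b * ?b) + 4 * (?a * ?a * ?a * ?c)"
    by (simp add: sg_def power_numeral_reduce algebra_simps)
  then show "\<bar>s ^ 4 * sg 2 v\<bar> \<le> 12 * (A0 * A0 * A1 * A1) + 4 * (A0 * A0 * A0 * A2)"
    using abs_prod4_le[OF s(1) s(1) s(2) s(2)] abs_prod4_le[OF s(1) s(1) s(1) s(3)] by linarith
  have "s ^ 4 * sg 3 v = 24 * (?a * ?b * ?b * ?b) + 36 * (?a * ?a * ?b * ?c) + 4 * (?a * ?a * ?a * ?d)"
    by (simp add: sg_def power_numeral_reduce algebra_simps)
  then show "\<bar>s ^ 4 * sg 3 v\<bar> \<le> 24 * (A0 * A1 * A1 * A1) + 36 * (A0 * A0 * A1 * A2) + 4 * (A0 * A0 * A0 * A3)"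
    using abs_prod4_le[OF s(1) s(2) s(2) s(2)] abs_prod4_le[OF s(1) s(1) s(2) s(3)]
      abs_prod4_le[OF s(1) s(1) s(1) s(4)] by linarith
qed

lemma sg_bound:
  assumes "j \<le> 3"
  shows "\<bar>sg j v\<bar> \<le> 4 ^ j"
proof -
  have "\<bar>1 * sincd i v\<bar> \<le> 1" for i using sincd_bound[of i v] by simp
  note b = sg_bounds_aux[of 1 v 1 1 1 1, OF this this this this]
  consider "j = 0" | "j = 1" | "j = 2" | "j = 3" using assms by linarith
  then show ?thesis by cases (use b in simp_all)
qed

lemma sg_decay:
  assumes "j \<le> 3"
  shows "v ^ 4 * \<bar>sg j v\<bar> \<le> 16 * 4 ^ j"
proof -
  note b = sg_bounds_aux[of v v 1 3 3 4, OF sincd_decay]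
  have "v ^ 4 * \<bar>sg j v\<bar> = \<bar>v ^ 4 * sg j v\<bar>" by (simp add: abs_mult)
  moreover consider "j = 0" | "j = 1" | "j = 2" | "j = 3" using assms by linarith
  then have "\<bar>v ^ 4 * sg j v\<bar> \<le> 16 * 4 ^ j" by cases (use b in simp_all)
  ultimately show ?thesis by simp
qed

text \<open>
  The Taylor bound for sin, divided by \<open>t\<close>.
\<close>

lemma sincd_taylor: "\<bar>sincd 0 t - (1 - t\<^sup>2 / 6)\<bar> \<le> t ^ 4 / 120"
proof (cases "t = 0")
  case False
  have e: "(\<Sum>m<5. sin_coeff m * t ^ m) = t - t ^ 3 / 6"
  proof -
    have "{..<5::nat} = {0, 1, 2, 3, 4}" by auto
    then show ?thesis by (simp add: sin_coeff_def fact_numeral)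
  qed
  have "\<bar>sin t - (t - t ^ 3 / 6)\<bar> \<le> \<bar>t\<bar> ^ 5 / 120"
  proof -
    have f: "inverse (fact 5 :: real) = 1 / 120" by (simp add: fact_numeral)
    show ?thesis using Maclaurin_sin_bound[of t 5] unfolding e f by simp
  qed
  then have "\<bar>sin t - (t - t ^ 3 / 6)\<bar> / \<bar>t\<bar> \<le> \<bar>t\<bar> ^ 5 / 120 / \<bar>t\<bar>" by (rule divide_right_mono) simp
  moreover have "\<bar>sin t - (t - t ^ 3 / 6)\<bar> / \<bar>t\<bar> = \<bar>sincd 0 t - (1 - t\<^sup>2 / 6)\<bar>"
    using False by (simp add: sincd_0 abs_divide[symmetric] diff_divide_distrib power2_eq_square power3_eq_cube)
  moreover have "\<bar>t\<bar> ^ 5 / 120 / \<bar>t\<bar> = t ^ 4 / 120"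
    using False by (simp add: eval_nat_numeral)
  ultimately show ?thesis by simp
qed (simp add: sincd_0)

lemma one_minus_le_exp_neg: "1 - x \<le> exp (- x)" for x :: real
  using exp_ge_add_one_self[of "- x"] by simp

text \<open>
  A bound of Gaussian type up to distance 1 that saturates afterwards. It is multiplicative, so it passes
  to the product kernel in any dimension without loss. Up to 5/4 it follows from the Taylor expansion,
  beyond that from \<open>|sinc t| \<le> 1 / |t|\<close>.
\<close>

lemma sg_0_upper: "sg 0 t \<le> exp (- (3 / 5) * min (t\<^sup>2) 1)"
proof (cases "\<bar>t\<bar> \<le> 5 / 4")
  case True
  have t2: "t\<^sup>2 \<le> 25 / 16" using power_mono[OF True, of 2] by (simp add: power2_eq_square)
  have t4: "t ^ 4 = t\<^sup>2 * t\<^sup>2" by (simp add: power_numeral_reduce)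
  have "t ^ 4 \<le> t\<^sup>2 * (25 / 16)" unfolding t4 by (intro mult_left_mono t2) simp
  moreover have "sincd 0 t - (1 - t\<^sup>2 / 6) \<le> t ^ 4 / 120" "- (sincd 0 t - (1 - t\<^sup>2 / 6)) \<le> t ^ 4 / 120"
    using sincd_taylor[of t] unfolding abs_le_iff by blast+
  moreover have "0 \<le> t\<^sup>2" by simp
  ultimately have s: "sincd 0 t \<le> 1 - 3 / 20 * t\<^sup>2" "0 \<le> sincd 0 t"
    using t2 by linarith+
  have "sincd 0 t \<le> exp (- (3 / 20 * t\<^sup>2))" using s(1) one_minus_le_exp_neg[of "3 / 20 * t\<^sup>2"] by linarith
  then have "sincd 0 t ^ 4 \<le> exp (- (3 / 20 * t\<^sup>2)) ^ 4" using s(2) by (intro power_mono) auto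
  also have "\<dots> = exp (- (3 / 5) * t\<^sup>2)" by (simp flip: exp_of_nat_mult)
  also have "\<dots> \<le> exp (- (3 / 5) * min (t\<^sup>2) 1)" by simp
  finally show ?thesis by (simp add: sg_0)
next
  case False
  have t0: "\<bar>t\<bar> > 5 / 4" using False by simp
  have "\<bar>t * sincd 0 t\<bar> \<le> 1" by (rule sincd_decay(1))
  then have "\<bar>sincd 0 t\<bar> \<le> 4 / 5"
  proof -
    assume a: "\<bar>t * sincd 0 t\<bar> \<le> 1"
    have "5 / 4 * \<bar>sincd 0 t\<bar> \<le> \<bar>t\<bar> * \<bar>sincd 0 t\<bar>" using t0 by (intro mult_right_mono) auto
    with a show ?thesis by (simp add: abs_mult)
  qed
  then have "\<bar>sincd 0 t\<bar> ^ 4 \<le> (4 / 5) ^ 4" by (intro power_mono) auto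
  then have "sg 0 t \<le> 1 - 11 / 20" by (simp add: sg_0 power_numeral_reduce)
  also have "\<dots> \<le> exp (- (3 / 5))"
  proof -
    have "1 - 3 / 20 \<le> exp (- (3 / 20 :: real))" using one_minus_le_exp_neg[of "3 / 20"] by simp
    then have "(1 - 3 / 20) ^ 4 \<le> exp (- (3 / 20 :: real)) ^ 4" by (intro power_mono) auto
    also have "\<dots> = exp (- (3 / 5))" by (simp flip: exp_of_nat_mult)
    finally show ?thesis by (simp add: power_numeral_reduce)
  qed
  also have "\<dots> = exp (- (3 / 5) * min (t\<^sup>2) 1)"
  proof -
    have "1 \<le> t\<^sup>2" using power_mono[of 1 "\<bar>t\<bar>" 2] t0 by simp
    then show ?thesis by simp
  qed
  finally show ?thesis .
qed

lemma sg_0_lower: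
  assumes "\<bar>t\<bar> \<le> 1"
  shows "1 - 7 / 10 * t\<^sup>2 \<le> sg 0 t"
proof -
  have t2: "t\<^sup>2 \<le> 1" using power_mono[OF assms, of 2] by simp
  have t4: "t ^ 4 = t\<^sup>2 * t\<^sup>2" by (simp add: power_numeral_reduce)
  have "t ^ 4 \<le> t\<^sup>2 * 1" unfolding t4 by (intro mult_left_mono t2) simp
  moreover have "- (sincd 0 t - (1 - t\<^sup>2 / 6)) \<le> t ^ 4 / 120"
    using sincd_taylor[of t] unfolding abs_le_iff by blast
  ultimately have "1 - 7 / 40 * t\<^sup>2 \<le> sincd 0 t" by linarith
  moreover have "0 \<le> 1 - 7 / 40 * t\<^sup>2" using t2 by simp
  ultimately have "(1 - 7 / 40 * t\<^sup>2) ^ 4 \<le> sincd 0 t ^ 4" by (intro power_mono)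
  moreover have "1 + real 4 * (- (7 / 40 * t\<^sup>2)) \<le> (1 + - (7 / 40 * t\<^sup>2)) ^ 4"
    using t2 by (intro Bernoulli_inequality) simp
  ultimately show ?thesis by (simp add: sg_0)
qed

lemma sg_0_range: "0 \<le> sg 0 t" "sg 0 t \<le> 1"
  using sg_bound[of 0 t] by (simp_all add: sg_0)

section \<open>The transform of the fourth power of sinc\<close>

lemma cis_measurable [measurable]: "cis \<in> borel_measurable borel"
  by (intro borel_measurable_continuous_onI continuous_intros)

text \<open>
  Convolution with the uniform density on \<open>[-1,1]\<close>; it multiplies the transform by sinc.
\<close>

definition box_average :: "(real \<Rightarrow> real) \<Rightarrow> real \<Rightarrow> real" where
  "box_average b t = (\<integral>s. b s * (indicator {-1..1} (t - s) / 2) \<partial>lborel)"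

definition bump :: "real \<Rightarrow> (real \<Rightarrow> real) \<Rightarrow> bool" where
  "bump R b \<longleftrightarrow> b \<in> borel_measurable borel \<and> (\<forall>s. 0 \<le> b s \<and> b s \<le> 1) \<and> (\<forall>s. R < \<bar>s\<bar> \<longrightarrow> b s = 0)"

lemma bump_integrable:
  assumes "bump R b"
  shows "integrable lborel b"
proof (rule Bochner_Integration.integrable_bound[where f = "indicator {-R..R} :: real \<Rightarrow> real"])
  show "integrable lborel (indicator {-R..R} :: real \<Rightarrow> real)"
    by (rule integrable_real_indicator) (auto simp: emeasure_lborel_Icc_eq)
  show "b \<in> borel_measurable lborel" using assms by (simp add: bump_def)
  have "norm (b s) \<le> norm (indicator {-R..R} s :: real)" for s
    using assms by (cases "R < \<bar>s\<bar>") (auto simp: bump_def indicator_def)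
  then show "AE s in lborel. norm (b s) \<le> norm (indicator {-R..R} s :: real)" by simp
qed

lemma bump_mult_integrable:
  fixes g :: "real \<Rightarrow> complex"
  assumes "bump R b" and [measurable]: "g \<in> borel_measurable borel" and "\<And>s. \<bar>s\<bar> \<le> R \<Longrightarrow> cmod (g s) \<le> C"
  shows "integrable lborel (\<lambda>s. b s *\<^sub>R g s)"
proof (rule Bochner_Integration.integrable_bound[where f = "\<lambda>s. C * b s"])
  show "integrable lborel (\<lambda>s. C * b s)" using bump_integrable[OF assms(1)] by simp
  have [measurable]: "b \<in> borel_measurable borel" using assms by (simp add: bump_def)
  show "(\<lambda>s. b s *\<^sub>R g s) \<in> borel_measurable lborel" by simp
  have "norm (b s *\<^sub>R g s) \<le> norm (C * b s)" for s
  proof (cases "R < \<bar>s\<bar>")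
    case True
    then have "b s = 0" using assms by (auto simp: bump_def)
    then show ?thesis by simp
  next
    case False
    then have "cmod (g s) \<le> \<bar>C\<bar>" using assms(3)[of s] by linarith
    then show ?thesis by (simp add: abs_mult mult.commute[of "\<bar>C\<bar>"] mult_left_mono)
  qed
  then show "AE s in lborel. norm (b s *\<^sub>R g s) \<le> norm (C * b s)" by simp
qed

lemma integral_box: "(\<integral>t. indicator {-1..1} (t - s) / 2 \<partial>lborel) = (1 :: real)" for s :: real
proof -
  have "indicator {-1..1} (t - s) = (indicator {s-1..s+1} t :: real)" for t
    by (auto simp: indicator_def)
  then show ?thesis by simp
qed

lemma box_average_bump:
  assumes b: "bump R b"
  shows "bump (R + 1) (box_average b)"
  unfolding bump_def
proof (intro conjI allI impI)
  have bm [measurable]: "b \<in> borel_measurable borel" and b01: "\<And>s. 0 \<le> b s" "\<And>s. b s \<le> 1"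
    and bR: "\<And>s. R < \<bar>s\<bar> \<Longrightarrow> b s = 0"
    using b by (auto simp: bump_def)
  show "box_average b \<in> borel_measurable borel" unfolding box_average_def by measurable
  fix t
  show "0 \<le> box_average b t" unfolding box_average_def using b01 by (intro integral_nonneg_AE AE_I2) auto
  have "box_average b t \<le> (\<integral>s. indicator {t-1..t+1} s / 2 \<partial>lborel)"
    unfolding box_average_def
  proof (intro integral_mono)
    show "integrable lborel (\<lambda>s. b s * (indicator {-1..1} (t - s) / 2))" using b01
      by (intro Bochner_Integration.integrable_bound[OF bump_integrable[OF b]] AE_I2) (auto simp: indicator_def)
    show "integrable lborel (\<lambda>s. indicator {t-1..t+1} s / 2 :: real)"
      by (intro integrable_divide_zero integrable_real_indicator) (auto simp: emeasure_lborel_Icc_eq)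
    show "b s * (indicator {-1..1} (t - s) / 2) \<le> indicator {t-1..t+1} s / 2" for s
      using b01(2)[of s] by (auto simp: indicator_def)
  qed
  then show "box_average b t \<le> 1" by simp
  assume t: "R + 1 < \<bar>t\<bar>"
  have "b s * (indicator {-1..1} (t - s) / 2) = 0" for s
    using bR[of s] t by (cases "R < \<bar>s\<bar>") (auto simp: indicator_def)
  then show "box_average b t = 0" unfolding box_average_def by (simp only: Bochner_Integration.integral_zero)
qed

lemma box_average_continuous:
  assumes b: "bump R b"
  shows "isCont (box_average b) t"
proof (rule continuous_at_sequentiallyI)
  fix u assume u: "u \<longlonglongrightarrow> t"
  have bm [measurable]: "b \<in> borel_measurable borel" and b01: "\<And>s. 0 \<le> b s" 
    using b by (auto simp: bump_def)
  show "(\<lambda>n. box_average b (u n)) \<longlonglongrightarrow> box_average b t"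
    unfolding box_average_def
  proof (rule integral_dominated_convergence[where w = b])
    show "integrable lborel b" by (rule bump_integrable[OF b])
    have "AE s in lborel. s \<notin> {t - 1, t + 1}" 
      using AE_lborel_singleton[of "t - 1"] AE_lborel_singleton[of "t + 1"] by eventually_elim auto
    then show "AE s in lborel. (\<lambda>n. b s * (indicator {-1..1} (u n - s) / 2)) \<longlonglongrightarrow> b s * (indicator {-1..1} (t - s) / 2)"
    proof eventually_elim
      case (elim s)
      have lim: "(\<lambda>n. u n - s) \<longlonglongrightarrow> t - s" by (intro tendsto_intros u)
      have "\<forall>\<^sub>F n in sequentially. indicator {-1..1} (u n - s) = (indicator {-1..1} (t - s) :: real)"
      proof (cases "\<bar>t - s\<bar> < 1")
        case True
        have "\<forall>\<^sub>F n in sequentially. - 1 < u n - s \<and> u n - s < 1"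
          using True by (intro eventually_conj order_tendstoD[OF lim]) auto
        then show ?thesis by (rule eventually_mono) (use True in \<open>auto simp: indicator_def\<close>)
      next
        case False
        then consider "1 < t - s" | "t - s < -1" using elim by (auto simp: abs_if split: if_splits)
        then show ?thesis
        proof cases
          case 1
          then have "\<forall>\<^sub>F n in sequentially. 1 < u n - s" by (rule order_tendstoD[OF lim])
          then show ?thesis by (rule eventually_mono) (use 1 in \<open>auto simp: indicator_def\<close>)
        next
          case 2
          then have "\<forall>\<^sub>F n in sequentially. u n - s < - 1" by (rule order_tendstoD[OF lim])
          then show ?thesis by (rule eventually_mono) (use 2 in \<open>auto simp: indicator_def\<close>)
        qed
      qed
      then have "(\<lambda>n. indicator {-1..1} (u n - s) :: real) \<longlonglongrightarrow> indicator {-1..1} (t - s)"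
        by (rule tendsto_eventually)
      then show ?case by (intro tendsto_intros) auto
    qed
    show "AE s in lborel. norm (b s * (indicator {-1..1} (u n - s) / 2)) \<le> b s" for n
      using b01 by (intro AE_I2) (auto simp: indicator_def)
  qed measurable
qed

lemma integral_box_cis: "(\<integral>s. (indicator {-1..1} s / 2) *\<^sub>R cis (s * v) \<partial>lborel) = complex_of_real (sincd 0 v)"
proof -
  have i: "set_integrable lborel {-1..1::real} (\<lambda>s. cos (s * v))" "set_integrable lborel {-1..1::real} (\<lambda>s. sin (s * v))"
    by (rule borel_integrable_atLeastAtMost', intro continuous_intros)+
  have ci: "set_integrable lborel {-1..1::real} (\<lambda>s. cis (s * v))"
    by (rule borel_integrable_atLeastAtMost') (intro continuous_intros)
  have "(\<integral>s. (indicator {-1..1} s / 2) *\<^sub>R cis (s * v) \<partial>lborel) = (1 / 2) *\<^sub>R (LINT s:{-1..1}|lborel. cis (s * v))"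
    unfolding set_lebesgue_integral_def by (subst integral_scaleR_right[symmetric]) (auto intro!: Bochner_Integration.integral_cong)
  also have "(LINT s:{-1..1}|lborel. cis (s * v)) = complex_of_real (integral {-1..1} (\<lambda>s. cos (s * v)))"
  proof (rule complex_eqI)
    have re: "Re (LINT s:{-1..1}|lborel. cis (s * v)) = (LINT s:{-1..1}|lborel. cos (s * v))"
      using ci unfolding set_lebesgue_integral_def set_integrable_def by (subst integral_Re[symmetric]) auto
    have im: "Im (LINT s:{-1..1}|lborel. cis (s * v)) = (LINT s:{-1..1}|lborel. sin (s * v))"
      using ci unfolding set_lebesgue_integral_def set_integrable_def by (subst integral_Im[symmetric]) auto
    show "Re (LINT s:{-1..1}|lborel. cis (s * v)) = Re (complex_of_real (integral {-1..1} (\<lambda>s. cos (s * v))))"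
      unfolding re by (simp add: set_borel_integral_eq_integral(2)[OF i(1)])
    have "(LINT s:{-1..1}|lborel. sin (s * v)) = - (LINT s:{-1..1}|lborel. sin (s * v))"
      unfolding set_lebesgue_integral_def
      by (subst lborel_integral_real_affine[where c = "-1" and t = 0])
         (auto simp flip: Bochner_Integration.integral_minus intro!: Bochner_Integration.integral_cong simp: indicator_def)
    then show "Im (LINT s:{-1..1}|lborel. cis (s * v)) = Im (complex_of_real (integral {-1..1} (\<lambda>s. cos (s * v))))"
      unfolding im by simp
  qed
  finally show ?thesis by (simp add: sincd_def scaleR_conv_of_real)
qed

text \<open>
  The convolution theorem, here a single application of Fubini and a translation.
\<close>

lemma box_average_fourier:
  assumes b: "bump R b"
  shows "(\<integral>t. box_average b t *\<^sub>R cis (t * v) \<partial>lborel) = complex_of_real (sincd 0 v) * (\<integral>t. b t *\<^sub>R cis (t * v) \<partial>lborel)"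
proof -
  have bm [measurable]: "b \<in> borel_measurable borel" using b by (auto simp: bump_def)
  let ?f = "\<lambda>(s, t). (b s * (indicator {-1..1} (t - s) / 2)) *\<^sub>R cis (t * v)"
  have int: "integrable (lborel \<Otimes>\<^sub>M lborel) ?f"
  proof (rule lborel_pair.Fubini_integrable)
    have "(\<lambda>s. LINT t|lborel. norm (?f (s, t))) = (\<lambda>s. b s)"
    proof
      fix s
      have "(LINT t|lborel. norm (?f (s, t))) = (LINT t|lborel. b s * (indicator {-1..1} (t - s) / 2))"
        using b by (intro Bochner_Integration.integral_cong) (auto simp: bump_def)
      then show "(LINT t|lborel. norm (?f (s, t))) = b s" using integral_box[of s] by simp
    qed
    then show "integrable lborel (\<lambda>s. LINT t|lborel. norm (?f (s, t)))"
      using bump_integrable[OF b] by simp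
    have "integrable lborel (\<lambda>t. ?f (s, t))" for s
    proof (rule Bochner_Integration.integrable_bound[where f = "\<lambda>t. b s * (indicator {s-1..s+1} t / 2)"])
      show "integrable lborel (\<lambda>t. b s * (indicator {s-1..s+1} t / 2))" 
        by (intro integrable_mult_right integrable_divide_zero integrable_real_indicator) (auto simp: emeasure_lborel_Icc_eq)
    qed (auto simp: indicator_def)
    then show "AE s in lborel. integrable lborel (\<lambda>t. ?f (s, t))" by simp
  qed measurable
  have "(\<integral>t. box_average b t *\<^sub>R cis (t * v) \<partial>lborel) = (\<integral>t. \<integral>s. ?f (s, t) \<partial>lborel \<partial>lborel)"
    unfolding box_average_def
  proof (intro Bochner_Integration.integral_cong refl)
    fix t
    show "(\<integral>s. b s * (indicator {-1..1} (t - s) / 2) \<partial>lborel) *\<^sub>R cis (t * v) = (\<integral>s. ?f (s, t) \<partial>lborel)"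
      by (subst integral_scaleR_left[symmetric]) (auto intro!: Bochner_Integration.integrable_bound[OF bump_integrable[OF b]] simp: indicator_def)
  qed
  also have "\<dots> = (\<integral>s. \<integral>t. ?f (s, t) \<partial>lborel \<partial>lborel)"
    using int by (subst lborel_pair.Fubini_integral[symmetric]) (auto simp: split_beta')
  also have "\<dots> = (\<integral>s. complex_of_real (sincd 0 v) * (b s *\<^sub>R cis (s * v)) \<partial>lborel)"
  proof (intro Bochner_Integration.integral_cong refl)
    fix s
    have "(\<integral>t. ?f (s, t) \<partial>lborel) = (\<integral>t. ?f (s, s + t) \<partial>lborel)"
      by (subst lborel_integral_real_affine[where c = 1 and t = s]) auto
    also have "\<dots> = (\<integral>t. (b s *\<^sub>R cis (s * v)) * ((indicator {-1..1} t / 2) *\<^sub>R cis (t * v)) \<partial>lborel)"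
      by (intro Bochner_Integration.integral_cong refl) (simp add: cis_mult distrib_right)
    also have "\<dots> = (b s *\<^sub>R cis (s * v)) * complex_of_real (sincd 0 v)"
      by (subst integral_mult_right_zero) (simp add: integral_box_cis)
    finally show "(\<integral>t. ?f (s, t) \<partial>lborel) = complex_of_real (sincd 0 v) * (b s *\<^sub>R cis (s * v))" by simp
  qed
  also have "\<dots> = complex_of_real (sincd 0 v) * (\<integral>s. b s *\<^sub>R cis (s * v) \<partial>lborel)"
    by (rule integral_mult_right_zero)
  finally show ?thesis .
qed

text \<open>
  The cubic B-spline: the density of a sum of four independent uniform variables on \<open>[-1,1]\<close>. Hence its
  support is \<open>[-4,4]\<close> and its transform is \<open>sinc\<^sup>4\<close>.
\<close>

definition spline :: "real \<Rightarrow> real" where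
  "spline = box_average (box_average (box_average (\<lambda>s. indicator {-1..1} s / 2)))"

lemma box_bump: "bump 1 (\<lambda>s. indicator {-1..1} s / 2)"
  by (auto simp: bump_def indicator_def)

lemma spline_bump: "bump 4 spline"
  using box_average_bump[OF box_average_bump[OF box_average_bump[OF box_bump]]] by (simp add: spline_def)

lemma spline_isCont: "isCont spline t"
  unfolding spline_def by (rule box_average_continuous[OF box_average_bump[OF box_average_bump[OF box_bump]]])

lemma spline_measurable [measurable]: "spline \<in> borel_measurable borel"
  using spline_bump by (simp add: bump_def)

lemma spline_fourier: "(\<integral>t. spline t *\<^sub>R cis (t * v) \<partial>lborel) = complex_of_real (sg 0 v)"
  unfolding spline_def
    box_average_fourier[OF box_average_bump[OF box_average_bump[OF box_bump]]]
    box_average_fourier[OF box_average_bump[OF box_bump]] box_average_fourier[OF box_bump] integral_box_cis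
  by (simp add: sg_0 power_numeral_reduce)

text \<open>
  Multiplying the density by \<open>(i t)\<^sup>j\<close> corresponds to differentiating the transform \<open>j\<close> times, which stays
  within the range where \<open>sg\<close> is the derivative.
\<close>

lemma spline_moment_integrable: "integrable lborel (\<lambda>t. spline t *\<^sub>R ((\<i> * complex_of_real t) ^ j * cis (t * v)))"
proof (rule bump_mult_integrable[OF spline_bump, where C = "4 ^ j"])
  fix s :: real assume "\<bar>s\<bar> \<le> 4"
  then show "cmod ((\<i> * complex_of_real s) ^ j * cis (s * v)) \<le> 4 ^ j"
    by (simp add: norm_mult norm_power power_mono)
qed measurable

lemma spline_moment_deriv:
  "((\<lambda>v. \<integral>t. spline t *\<^sub>R ((\<i> * complex_of_real t) ^ j * cis (t * v)) \<partial>lborel) has_vector_derivative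
     (\<integral>t. spline t *\<^sub>R ((\<i> * complex_of_real t) ^ Suc j * cis (t * v)) \<partial>lborel)) (at v)"
proof -
  have eq: "(\<integral>t. spline t *\<^sub>R ((\<i> * complex_of_real t) ^ i * cis (t * v)) \<partial>lborel)
      = integral (cbox (-4) 4) (\<lambda>t. spline t *\<^sub>R ((\<i> * complex_of_real t) ^ i * cis (t * v)))" for i v
  proof -
    have z: "spline t = indicator {-4..4} t *\<^sub>R spline t" for t
    proof (cases "4 < \<bar>t\<bar>")
      case True
      then show ?thesis using spline_bump by (simp add: bump_def)
    qed (auto simp: indicator_def)
    have e: "(\<lambda>t. spline t *\<^sub>R ((\<i> * complex_of_real t) ^ i * cis (t * v)))
       = (\<lambda>t. indicator {-4..4} t *\<^sub>R (spline t *\<^sub>R ((\<i> * complex_of_real t) ^ i * cis (t * v))))"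
      by (subst z) simp
    have s: "set_integrable lborel {-4..4} (\<lambda>t. spline t *\<^sub>R ((\<i> * complex_of_real t) ^ i * cis (t * v)))"
      unfolding set_integrable_def e[symmetric] by (rule spline_moment_integrable)
    have "(\<integral>t. spline t *\<^sub>R ((\<i> * complex_of_real t) ^ i * cis (t * v)) \<partial>lborel)
       = (LINT t:{-4..4}|lborel. spline t *\<^sub>R ((\<i> * complex_of_real t) ^ i * cis (t * v)))"
      unfolding set_lebesgue_integral_def e[symmetric] ..
    then show ?thesis using set_borel_integral_eq_integral(2)[OF s] by (simp add: cbox_interval)
  qed
  have cs: "continuous_on S spline" for S
    using spline_isCont by (simp add: continuous_at_imp_continuous_on)
  have "((\<lambda>v. integral (cbox (-4) 4) (\<lambda>t. spline t *\<^sub>R ((\<i> * complex_of_real t) ^ j * cis (t * v)))) has_vector_derivative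
     integral (cbox (-4) 4) (\<lambda>t. spline t *\<^sub>R ((\<i> * complex_of_real t) ^ Suc j * cis (t * v)))) (at v within UNIV)"
  proof (rule leibniz_rule_vector_derivative)
    fix v t :: real
    have "((\<lambda>v. cis (t * v)) has_vector_derivative \<i> * complex_of_real t * cis (t * v)) (at v within UNIV)"
    proof -
      have "((\<lambda>z. exp (\<i> * complex_of_real t * z)) has_field_derivative
          \<i> * complex_of_real t * exp (\<i> * complex_of_real t * complex_of_real v)) (at (complex_of_real v))"
        by (auto intro!: derivative_eq_intros)
      then have "((\<lambda>v. exp (\<i> * complex_of_real t * complex_of_real v)) has_vector_derivative
          \<i> * complex_of_real t * exp (\<i> * complex_of_real t * complex_of_real v)) (at v within UNIV)"
        by (rule has_vector_derivative_real_field)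
      then show ?thesis by (simp add: cis_conv_exp mult.assoc)
    qed
    then show "((\<lambda>v. spline t *\<^sub>R ((\<i> * complex_of_real t) ^ j * cis (t * v))) has_vector_derivative
        spline t *\<^sub>R ((\<i> * complex_of_real t) ^ Suc j * cis (t * v))) (at v within UNIV)"
      by (auto intro!: derivative_eq_intros simp: ac_simps)
    show "(\<lambda>t. spline t *\<^sub>R ((\<i> * complex_of_real t) ^ j * cis (t * v))) integrable_on cbox (-4) 4"
      by (intro integrable_continuous continuous_intros cs)
    show "continuous_on (UNIV \<times> cbox (-4) 4) (\<lambda>(v, t). spline t *\<^sub>R ((\<i> * complex_of_real t) ^ Suc j * cis (t * v)))"
      unfolding split_beta by (intro continuous_intros continuous_on_compose2[OF cs[of UNIV]]) auto
  qed auto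
  then show ?thesis by (simp only: eq)
qed

lemma spline_moment:
  assumes "j \<le> 3"
  shows "(\<integral>t. spline t *\<^sub>R ((\<i> * complex_of_real t) ^ j * cis (t * v)) \<partial>lborel) = complex_of_real (sg j v)"
  using assms
proof (induction j arbitrary: v)
  case 0
  then show ?case using spline_fourier[of v] by simp
next
  case (Suc j)
  have "((\<lambda>v. complex_of_real (sg j v)) has_vector_derivative
     (\<integral>t. spline t *\<^sub>R ((\<i> * complex_of_real t) ^ Suc j * cis (t * v)) \<partial>lborel)) (at v)"
    using spline_moment_deriv[of j v] Suc by simp
  moreover have "((\<lambda>v. complex_of_real (sg j v)) has_vector_derivative complex_of_real (sg (Suc j) v)) (at v)"
    using sg_deriv[of j v] Suc.prems
    by (intro has_vector_derivative_of_real) (auto simp: has_real_derivative_iff_has_vector_derivative)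
  ultimately show ?case by (rule vector_derivative_unique_at)
qed

lemma gaussian_integrable:
  assumes "0 < (\<epsilon>::real)"
  shows "integrable lborel (\<lambda>v. exp (- (\<epsilon> * v)\<^sup>2 / 2))"
proof -
  have "integrable lborel (\<lambda>v. sqrt (2 * pi) * std_normal_density (0 + \<epsilon> * v))"
    using assms by (intro integrable_mult_right lborel_integrable_real_affine) auto
  then show ?thesis by (simp add: std_normal_density_def)
qed

text \<open>
  The characteristic function of the normal distribution after a rescaling.
\<close>

lemma gaussian_fourier:
  assumes \<epsilon>: "0 < (\<epsilon>::real)"
  shows "(\<integral>v. cis (u * v) * complex_of_real (exp (- (\<epsilon> * v)\<^sup>2 / 2)) \<partial>lborel) = complex_of_real (2 * pi * normal_density 0 \<epsilon> u)"
proof -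
  have "char std_normal_distribution (u / \<epsilon>) = (\<integral>x. std_normal_density x *\<^sub>R cis (u / \<epsilon> * x) \<partial>lborel)"
    unfolding char_def by (subst integral_density) (auto simp: cis_conv_exp ac_simps)
  also have "\<dots> = \<epsilon> *\<^sub>R (\<integral>v. std_normal_density (0 + \<epsilon> * v) *\<^sub>R cis (u / \<epsilon> * (0 + \<epsilon> * v)) \<partial>lborel)"
    using \<epsilon> by (subst lborel_integral_real_affine[where c = \<epsilon> and t = 0]) auto
  also have "(\<integral>v. std_normal_density (0 + \<epsilon> * v) *\<^sub>R cis (u / \<epsilon> * (0 + \<epsilon> * v)) \<partial>lborel)
      = (\<integral>v. complex_of_real (1 / sqrt (2 * pi)) * (cis (u * v) * complex_of_real (exp (- (\<epsilon> * v)\<^sup>2 / 2))) \<partial>lborel)"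
    using \<epsilon> by (intro Bochner_Integration.integral_cong) (auto simp: std_normal_density_def scaleR_conv_of_real)
  also have "\<dots> = complex_of_real (1 / sqrt (2 * pi)) * (\<integral>v. cis (u * v) * complex_of_real (exp (- (\<epsilon> * v)\<^sup>2 / 2)) \<partial>lborel)"
    by (rule integral_mult_right_zero)
  finally have "complex_of_real (exp (- (u / \<epsilon>)\<^sup>2 / 2)) = complex_of_real (\<epsilon> / sqrt (2 * pi)) * (\<integral>v. cis (u * v) * complex_of_real (exp (- (\<epsilon> * v)\<^sup>2 / 2)) \<partial>lborel)"
    by (simp add: char_std_normal_distribution scaleR_conv_of_real)
  then have "(\<integral>v. cis (u * v) * complex_of_real (exp (- (\<epsilon> * v)\<^sup>2 / 2)) \<partial>lborel)
     = complex_of_real (sqrt (2 * pi) / \<epsilon> * exp (- (u / \<epsilon>)\<^sup>2 / 2))"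
    using \<epsilon> by (simp add: field_simps)
  also have "sqrt (2 * pi) / \<epsilon> * exp (- (u / \<epsilon>)\<^sup>2 / 2) = 2 * pi * normal_density 0 \<epsilon> u"
  proof -
    have s: "sqrt (2 * pi * \<epsilon>\<^sup>2) = sqrt (2 * pi) * \<epsilon>" using \<epsilon> by (simp add: real_sqrt_mult)
    have a: "a * a * (1 / (a * \<epsilon>) * E) = a / \<epsilon> * E" if "a \<noteq> 0" for a E :: real using that by simp
    have p: "2 * pi = sqrt (2 * pi) * sqrt (2 * pi)" by simp
    have "2 * pi * normal_density 0 \<epsilon> u = (sqrt (2 * pi) * sqrt (2 * pi)) * (1 / (sqrt (2 * pi) * \<epsilon>) * exp (- (u / \<epsilon>)\<^sup>2 / 2))"
      unfolding normal_density_def s by (simp add: power_divide)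
    also have "\<dots> = sqrt (2 * pi) / \<epsilon> * exp (- (u / \<epsilon>)\<^sup>2 / 2)" by (rule a) simp
    finally show ?thesis by (rule sym)
  qed
  finally show ?thesis .
qed

lemma sg_0_integrable: "integrable lborel (sg 0)"
proof (rule Bochner_Integration.integrable_bound[where f = "\<lambda>v. 32 * inverse (1 + v\<^sup>2)"])
  show "integrable lborel (\<lambda>v::real. 32 * inverse (1 + v\<^sup>2))"
    using integrable_inverse_1_plus_square by (simp add: set_integrable_def)
  have "isCont (sg 0) v" for v using sg_deriv[of 0 v] by (auto intro: DERIV_isCont)
  then show "sg 0 \<in> borel_measurable lborel"
    by (simp add: borel_measurable_continuous_onI continuous_at_imp_continuous_on)
  have "norm (sg 0 v) \<le> norm (32 * inverse (1 + v\<^sup>2))" for v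
  proof -
    \<comment> \<open>\<open>1 + v\<^sup>2 \<le> 2 + v\<^sup>4\<close>, so boundedness and quartic decay give an integrable majorant\<close>
    have "2 * v\<^sup>2 \<le> 1 + v ^ 4" using sum_squares_bound[of 1 "v\<^sup>2"] by (simp add: power2_eq_square power4_eq_xxxx)
    then have "(1 + v\<^sup>2) * sg 0 v \<le> (1 + (1 + v ^ 4)) * sg 0 v"
      using sg_0_range(1)[of v] zero_le_power2[of v] by (intro mult_right_mono) linarith+
    also have "\<dots> \<le> 32" using sg_decay[of 0 v] sg_0_range[of v] by (simp add: algebra_simps)
    finally show ?thesis using sg_0_range(1)[of v] zero_le_power2[of v]
      by (simp add: field_simps abs_of_nonneg add_pos_nonneg)
  qed
  then show "AE v in lborel. norm (sg 0 v) \<le> norm (32 * inverse (1 + v\<^sup>2))" by simp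
qed

text \<open>
  Fourier inversion by Gaussian regularisation: the weight \<open>exp (- (\<epsilon> v)\<^sup>2 / 2)\<close> makes Fubini applicable and
  turns the left-hand side into a Gaussian average of the spline at scale \<open>\<epsilon>\<close> around \<open>t\<close>. For \<open>\<epsilon> \<rightarrow> 0\<close> both
  sides converge by dominated convergence, as \<open>sinc\<^sup>4\<close> is integrable and the spline is continuous.
\<close>

lemma spline_inversion:
  "(\<integral>v. complex_of_real (sg 0 v) * cis (- (t * v)) \<partial>lborel) = complex_of_real (2 * pi * spline t)"
proof -
  have [measurable]: "sg 0 \<in> borel_measurable borel"
    using borel_measurable_integrable[OF sg_0_integrable] by simp
  define \<epsilon> where "\<epsilon> n = 1 / real (Suc n)" for n
  have \<epsilon>: "0 < \<epsilon> n" for n by (simp add: \<epsilon>_def)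
  have \<epsilon>0: "\<epsilon> \<longlonglongrightarrow> 0" unfolding \<epsilon>_def[abs_def] using LIMSEQ_inverse_real_of_nat by (simp only: inverse_eq_divide)
  let ?I = "\<lambda>n. (\<integral>v. complex_of_real (sg 0 v) * cis (- (t * v)) * complex_of_real (exp (- (\<epsilon> n * v)\<^sup>2 / 2)) \<partial>lborel)"
  have lim1: "?I \<longlonglongrightarrow> (\<integral>v. complex_of_real (sg 0 v) * cis (- (t * v)) * complex_of_real (exp (- (0 * v)\<^sup>2 / 2)) \<partial>lborel)"
  proof (rule integral_dominated_convergence[where w = "sg 0"])
    show "AE v in lborel. (\<lambda>n. complex_of_real (sg 0 v) * cis (- (t * v)) * complex_of_real (exp (- (\<epsilon> n * v)\<^sup>2 / 2))) \<longlonglongrightarrow>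
        complex_of_real (sg 0 v) * cis (- (t * v)) * complex_of_real (exp (- (0 * v)\<^sup>2 / 2))"
      by (intro AE_I2 tendsto_intros \<epsilon>0) auto
    show "AE v in lborel. norm (complex_of_real (sg 0 v) * cis (- (t * v)) * complex_of_real (exp (- (\<epsilon> n * v)\<^sup>2 / 2))) \<le> sg 0 v" for n
      using sg_0_range by (intro AE_I2) (auto simp: norm_mult mult_left_le)
  qed (use sg_0_integrable in measurable)
  have "?I n = (\<integral>x. complex_of_real (2 * pi * (spline (t + \<epsilon> n * x) * std_normal_density x)) \<partial>lborel)" for n
  proof -
    let ?g = "\<lambda>v. complex_of_real (exp (- (\<epsilon> n * v)\<^sup>2 / 2))"
    let ?f = "\<lambda>(s, v). spline s *\<^sub>R (cis ((s - t) * v) * ?g v)"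
    have abs_le: "\<bar>spline s\<bar> \<le> 1" for s using spline_bump by (auto simp: bump_def)
    have int: "integrable (lborel \<Otimes>\<^sub>M lborel) ?f"
    proof (rule lborel_pair.Fubini_integrable)
      have "(\<lambda>s. LINT v|lborel. norm (?f (s, v))) = (\<lambda>s. spline s * (\<integral>v. exp (- (\<epsilon> n * v)\<^sup>2 / 2) \<partial>lborel))"
        using spline_bump by (intro ext) (simp add: norm_mult bump_def)
      then show "integrable lborel (\<lambda>s. LINT v|lborel. norm (?f (s, v)))"
        using bump_integrable[OF spline_bump] by simp
      have "integrable lborel (\<lambda>v. ?f (s, v))" for s
        by (simp, intro impI Bochner_Integration.integrable_bound[OF gaussian_integrable[OF \<epsilon>[of n]]])
           (auto simp: norm_mult abs_le)
      then show "AE s in lborel. integrable lborel (\<lambda>v. ?f (s, v))" by simp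
    qed measurable
    have "?I n = (\<integral>v. \<integral>s. ?f (s, v) \<partial>lborel \<partial>lborel)"
    proof (intro Bochner_Integration.integral_cong refl)
      fix v
      have e: "cis ((s - t) * v) = cis (- (t * v)) * cis (s * v)" for s
        by (simp add: cis_mult algebra_simps)
      have "(\<integral>s. ?f (s, v) \<partial>lborel) = (\<integral>s. (cis (- (t * v)) * ?g v) * (spline s *\<^sub>R cis (s * v)) \<partial>lborel)"
        by (intro Bochner_Integration.integral_cong refl) (simp only: e split_conv, simp add: mult_ac)
      also have "\<dots> = (cis (- (t * v)) * ?g v) * (\<integral>s. spline s *\<^sub>R cis (s * v) \<partial>lborel)"
        by (rule integral_mult_right_zero)
      finally show "complex_of_real (sg 0 v) * cis (- (t * v)) * ?g v = (\<integral>s. ?f (s, v) \<partial>lborel)"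
        by (simp add: spline_fourier)
    qed
    also have "\<dots> = (\<integral>s. \<integral>v. ?f (s, v) \<partial>lborel \<partial>lborel)"
      using int by (subst lborel_pair.Fubini_integral[symmetric]) (auto simp: split_beta')
    also have "\<dots> = (\<integral>s. complex_of_real (2 * pi * (spline s * normal_density 0 (\<epsilon> n) (s - t))) \<partial>lborel)"
      by (intro Bochner_Integration.integral_cong refl) (simp only: split_conv integral_scaleR_right gaussian_fourier[OF \<epsilon>], simp add: scaleR_conv_of_real)
    also have "\<dots> = \<epsilon> n *\<^sub>R (\<integral>x. complex_of_real (2 * pi * (spline (t + \<epsilon> n * x) * normal_density 0 (\<epsilon> n) (t + \<epsilon> n * x - t))) \<partial>lborel)"
      using \<epsilon>[of n] by (subst lborel_integral_real_affine[where c = "\<epsilon> n" and t = t]) auto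
    also have "\<dots> = (\<integral>x. complex_of_real (2 * pi * (spline (t + \<epsilon> n * x) * std_normal_density x)) \<partial>lborel)"
    proof (subst integral_scaleR_right[symmetric], intro Bochner_Integration.integral_cong refl)
      fix x
      have h: "std_normal_density x = \<epsilon> n * normal_density 0 (\<epsilon> n) (\<epsilon> n * x)"
        using \<epsilon>[of n] by (simp add: normal_density_def real_sqrt_mult power_mult_distrib field_simps)
      show "\<epsilon> n *\<^sub>R complex_of_real (2 * pi * (spline (t + \<epsilon> n * x) * normal_density 0 (\<epsilon> n) (t + \<epsilon> n * x - t)))
          = complex_of_real (2 * pi * (spline (t + \<epsilon> n * x) * std_normal_density x))"
        unfolding h by (simp add: scaleR_conv_of_real)
    qed
    finally show ?thesis .
  qed
  moreover have "(\<lambda>n. (\<integral>x. complex_of_real (2 * pi * (spline (t + \<epsilon> n * x) * std_normal_density x)) \<partial>lborel))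
      \<longlonglongrightarrow> (\<integral>x. complex_of_real (2 * pi * (spline t * std_normal_density x)) \<partial>lborel)"
  proof (rule integral_dominated_convergence[where w = "\<lambda>x. 2 * pi * std_normal_density x"])
    show "AE x in lborel. (\<lambda>n. complex_of_real (2 * pi * (spline (t + \<epsilon> n * x) * std_normal_density x))) \<longlonglongrightarrow>
        complex_of_real (2 * pi * (spline t * std_normal_density x))"
    proof (intro AE_I2 tendsto_of_real tendsto_mult tendsto_const)
      fix x
      have "(\<lambda>n. t + \<epsilon> n * x) \<longlonglongrightarrow> t + 0 * x" by (intro tendsto_intros \<epsilon>0)
      then show "(\<lambda>n. spline (t + \<epsilon> n * x)) \<longlonglongrightarrow> spline t"
        by (intro isCont_tendsto_compose[OF spline_isCont]) simp
    qed
    show "AE x in lborel. norm (complex_of_real (2 * pi * (spline (t + \<epsilon> n * x) * std_normal_density x))) \<le> 2 * pi * std_normal_density x" for n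
      using spline_bump by (intro AE_I2) (auto simp: bump_def norm_mult intro!: mult_left_le_one_le)
  qed auto
  ultimately have "?I \<longlonglongrightarrow> (\<integral>x. complex_of_real (2 * pi * (spline t * std_normal_density x)) \<partial>lborel)" by simp
  also have "(\<integral>x. complex_of_real (2 * pi * (spline t * std_normal_density x)) \<partial>lborel) = complex_of_real (2 * pi * spline t)"
    by (subst integral_complex_of_real) simp
  finally have "?I \<longlonglongrightarrow> complex_of_real (2 * pi * spline t)" .
  from LIMSEQ_unique[OF this lim1] show ?thesis by simp
qed

section \<open>Integration on the coordinate space\<close>

definition dotv :: "nat \<Rightarrow> vec \<Rightarrow> vec \<Rightarrow> real" where
  "dotv d w z = (\<Sum>i<d. w i * z i)"

definition vaffine :: "nat \<Rightarrow> vec \<Rightarrow> real \<Rightarrow> vec \<Rightarrow> vec" where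
  "vaffine d x e v = (\<lambda>i\<in>{..<d}. x i + e * v i)"

interpretation Rd_factors: product_sigma_finite "\<lambda>_::nat. lborel :: real measure" ..

lemma cnj_measurable [measurable]: "cnj \<in> borel_measurable borel"
  by (intro borel_measurable_continuous_onI continuous_intros)

lemma space_Rd: "space (Rd d) = extensional {..<d}"
  by (auto simp: Rd_def space_PiM PiE_def)

lemma vdiff_space [simp]: "vdiff d x y \<in> space (Rd d)"
  by (simp add: vdiff_def space_Rd)

lemma vaffine_space [simp]: "vaffine d x e v \<in> space (Rd d)"
  by (simp add: vaffine_def space_Rd)

lemma sigma_finite_Rd: "sigma_finite_measure (Rd d)"
  unfolding Rd_def by (rule Rd_factors.sigma_finite) simp

lemma component_measurable: "i < d \<Longrightarrow> (\<lambda>z. z i) \<in> borel_measurable (Rd d)"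
  unfolding Rd_def using measurable_component_singleton[of i "{..<d}" "\<lambda>_. lborel :: real measure"] by simp

lemma component_measurable':
  "f \<in> N \<rightarrow>\<^sub>M Rd d \<Longrightarrow> i < d \<Longrightarrow> (\<lambda>x. f x i) \<in> borel_measurable N"
  by (rule measurable_compose[OF _ component_measurable])

lemma Rd_measurableI:
  assumes "\<And>i. i < d \<Longrightarrow> (\<lambda>x. f x i) \<in> borel_measurable N"
  shows "(\<lambda>x. \<lambda>i\<in>{..<d}. f x i) \<in> N \<rightarrow>\<^sub>M Rd d"
  unfolding Rd_def using assms by (intro measurable_restrict) simp

lemma dotv_measurable [measurable (raw)]:
  assumes [measurable]: "f \<in> N \<rightarrow>\<^sub>M Rd d" "g \<in> N \<rightarrow>\<^sub>M Rd d"
  shows "(\<lambda>x. dotv d (f x) (g x)) \<in> borel_measurable N"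
  unfolding dotv_def by (intro borel_measurable_sum borel_measurable_times component_measurable'[OF assms(1)] component_measurable'[OF assms(2)]) auto

lemma vdiff_measurable [measurable (raw)]:
  assumes [measurable]: "f \<in> N \<rightarrow>\<^sub>M Rd d" "g \<in> N \<rightarrow>\<^sub>M Rd d"
  shows "(\<lambda>x. vdiff d (f x) (g x)) \<in> N \<rightarrow>\<^sub>M Rd d"
  unfolding vdiff_def by (intro Rd_measurableI borel_measurable_diff component_measurable'[OF assms(1)] component_measurable'[OF assms(2)])

lemma vaffine_measurable [measurable (raw)]:
  assumes [measurable]: "f \<in> N \<rightarrow>\<^sub>M Rd d" "g \<in> N \<rightarrow>\<^sub>M Rd d" "h \<in> borel_measurable N"
  shows "(\<lambda>x. vaffine d (f x) (h x) (g x)) \<in> N \<rightarrow>\<^sub>M Rd d"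
  unfolding vaffine_def by (intro Rd_measurableI borel_measurable_add borel_measurable_times component_measurable'[OF assms(1)] component_measurable'[OF assms(2)] assms(3))

lemma cube_eq_PiE: "cube d R = Pi\<^sub>E {..<d} (\<lambda>_. {-R..R})"
proof -
  have e: "\<bar>t\<bar> \<le> R \<longleftrightarrow> t \<in> {-R..R}" for t :: real by auto
  show ?thesis unfolding cube_def space_Rd PiE_def Pi_def e by auto
qed

lemma cube_measurable [measurable]: "cube d R \<in> sets (Rd d)"
  unfolding cube_eq_PiE Rd_def by (intro sets_PiM_I_finite) auto

lemma dotv_commute: "dotv d w z = dotv d z w"
  by (simp add: dotv_def mult.commute)

lemma dotv_vdiff: "dotv d w (vdiff d x t) = dotv d w x - dotv d w t"
  by (simp add: dotv_def vdiff_def sum_subtractf[symmetric] algebra_simps)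

lemma cis_sum: "finite A \<Longrightarrow> cis (\<Sum>i\<in>A. f i) = (\<Prod>i\<in>A. cis (f i))"
  by (induction A rule: finite_induct) (simp_all flip: cis_mult)

lemma cis_dotv: "cis (dotv d w z) = (\<Prod>i<d. cis (w i * z i))"
  by (simp add: dotv_def cis_sum)

lemma emeasure_cube: "emeasure (Rd d) (cube d R) = ennreal ((2 * max R 0) ^ d)"
proof -
  have "emeasure (Rd d) (cube d R) = (\<Prod>i<d. emeasure lborel {-R..R})"
    by (simp add: cube_eq_PiE Rd_def Rd_factors.emeasure_PiM)
  also have "emeasure lborel {-R..R} = ennreal (2 * max R 0)"
    by (simp add: emeasure_lborel_Icc_eq max_def)
  finally show ?thesis by (simp add: ennreal_power)
qed

lemma integrable_cube_bounded:
  fixes f :: "vec \<Rightarrow> 'b :: {banach, second_countable_topology}"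
  assumes [measurable]: "f \<in> borel_measurable (Rd d)" and "\<And>w. w \<in> space (Rd d) \<Longrightarrow> norm (f w) \<le> B"
  shows "integrable (Rd d) (\<lambda>w. indicator (cube d R) w *\<^sub>R f w)"
proof (rule Bochner_Integration.integrable_bound[where f = "\<lambda>w. B * indicator (cube d R) w"])
  show "integrable (Rd d) (\<lambda>w. B * indicator (cube d R) w)"
    by (intro integrable_mult_right integrable_real_indicator) (auto simp: emeasure_cube)
  show "AE w in Rd d. norm (indicator (cube d R) w *\<^sub>R f w) \<le> norm (B * indicator (cube d R) w)"
    using assms(2) by (intro AE_I2) (auto simp: indicator_def intro: order_trans[OF _ abs_ge_self])
qed measurable

text \<open>
  Fubini for a bounded kernel between two integrable functions: this is how a transform is moved
  from one factor of a product to the other.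
\<close>

lemma fubini_kernel:
  fixes a :: "'a \<Rightarrow> complex" and b :: "'b \<Rightarrow> complex"
  assumes MN: "sigma_finite_measure M" "sigma_finite_measure N"
    and a: "integrable M a" and b: "integrable N b"
    and k [measurable]: "(\<lambda>(x, y). k x y) \<in> borel_measurable (M \<Otimes>\<^sub>M N)"
    and k1: "\<And>x y. x \<in> space M \<Longrightarrow> y \<in> space N \<Longrightarrow> cmod (k x y) \<le> C"
  shows "(\<integral>x. a x * (\<integral>y. b y * k x y \<partial>N) \<partial>M) = (\<integral>y. b y * (\<integral>x. a x * k x y \<partial>M) \<partial>N)"
proof -
  interpret pair_sigma_finite M N using MN by (simp add: pair_sigma_finite_def)
  have am [measurable]: "a \<in> borel_measurable M" and bm [measurable]: "b \<in> borel_measurable N"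
    using a b by auto
  let ?f = "\<lambda>(x, y). a x * b y * k x y"
  have kx: "(\<lambda>y. k x y) \<in> borel_measurable N" if "x \<in> space M" for x
    using measurable_compose[OF measurable_Pair1'[OF that] k] by simp
  have ix: "integrable N (\<lambda>y. a x * b y * k x y)" if x: "x \<in> space M" for x
  proof (rule Bochner_Integration.integrable_bound[where f = "\<lambda>y. (cmod (a x) * C) * cmod (b y)"])
    show "integrable N (\<lambda>y. (cmod (a x) * C) * cmod (b y))" using b by simp
    show "(\<lambda>y. a x * b y * k x y) \<in> borel_measurable N" using kx[OF x] by measurable
    show "AE y in N. norm (a x * b y * k x y) \<le> norm (cmod (a x) * C * cmod (b y))"
    proof (rule AE_I2)
      fix y assume y: "y \<in> space N"
      have "cmod (a x) * cmod (b y) * cmod (k x y) \<le> cmod (a x) * cmod (b y) * \<bar>C\<bar>"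
        using k1[OF x y] by (intro mult_left_mono) auto
      then show "norm (a x * b y * k x y) \<le> norm (cmod (a x) * C * cmod (b y))"
        by (simp add: norm_mult abs_mult mult_ac)
    qed
  qed
  have int: "integrable (M \<Otimes>\<^sub>M N) ?f"
  proof (rule Fubini_integrable)
    show "?f \<in> borel_measurable (M \<Otimes>\<^sub>M N)" by measurable
    show "integrable M (\<lambda>x. LINT y|N. norm (?f (x, y)))"
    proof (rule Bochner_Integration.integrable_bound[where f = "\<lambda>x. cmod (a x) * (\<bar>C\<bar> * (\<integral>y. cmod (b y) \<partial>N))"])
      show "integrable M (\<lambda>x. cmod (a x) * (\<bar>C\<bar> * (\<integral>y. cmod (b y) \<partial>N)))" using a by simp
      show "(\<lambda>x. LINT y|N. norm (?f (x, y))) \<in> borel_measurable M" by measurable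
      show "AE x in M. norm (LINT y|N. norm (?f (x, y))) \<le> norm (cmod (a x) * (\<bar>C\<bar> * (\<integral>y. cmod (b y) \<partial>N)))"
      proof (rule AE_I2)
        fix x assume x: "x \<in> space M"
        have "(LINT y|N. norm (?f (x, y))) \<le> (LINT y|N. (cmod (a x) * \<bar>C\<bar>) * cmod (b y))"
        proof (rule integral_mono)
          show "integrable N (\<lambda>y. norm (?f (x, y)))" using ix[OF x] by simp
          show "integrable N (\<lambda>y. (cmod (a x) * \<bar>C\<bar>) * cmod (b y))" using b by simp
          fix y assume y: "y \<in> space N"
          have "cmod (a x) * cmod (b y) * cmod (k x y) \<le> cmod (a x) * cmod (b y) * \<bar>C\<bar>"
            using k1[OF x y] by (intro mult_left_mono) auto
          then show "norm (?f (x, y)) \<le> (cmod (a x) * \<bar>C\<bar>) * cmod (b y)"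
            by (simp add: norm_mult mult_ac)
        qed
        moreover have "0 \<le> (LINT y|N. norm (?f (x, y)))" by simp
        ultimately show "norm (LINT y|N. norm (?f (x, y))) \<le> norm (cmod (a x) * (\<bar>C\<bar> * (\<integral>y. cmod (b y) \<partial>N)))"
          by (simp add: abs_mult mult_ac)
      qed
    qed
    show "AE x in M. integrable N (\<lambda>y. ?f (x, y))" using ix by (intro AE_I2) simp
  qed
  have "(\<integral>x. a x * (\<integral>y. b y * k x y \<partial>N) \<partial>M) = (\<integral>x. \<integral>y. ?f (x, y) \<partial>N \<partial>M)"
    by (simp add: mult.assoc)
  also have "\<dots> = (\<integral>y. \<integral>x. ?f (x, y) \<partial>M \<partial>N)"
    using int by (subst Fubini_integral[symmetric]) (auto simp: split_beta')
  also have "\<dots> = (\<integral>y. b y * (\<integral>x. a x * k x y \<partial>M) \<partial>N)"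
    by (simp add: mult_ac flip: integral_mult_right_zero)
  finally show ?thesis .
qed

text \<open>
  The product measure that is rescaled by \<open>|e|\<^sup>d\<close> after the affine map agrees with Lebesgue measure on
  boxes, by the one-dimensional change of variables in each coordinate.
\<close>

lemma Rd_affine:
  fixes f :: "vec \<Rightarrow> 'b :: {banach, second_countable_topology}"
  assumes e: "e \<noteq> 0" and f [measurable]: "f \<in> borel_measurable (Rd d)"
  shows "(\<integral>z. f z \<partial>Rd d) = \<bar>e\<bar> ^ d *\<^sub>R (\<integral>v. f (vaffine d x e v) \<partial>Rd d)"
proof -
  have T [measurable]: "vaffine d x e \<in> Rd d \<rightarrow>\<^sub>M Rd d"
    unfolding vaffine_def by (rule Rd_measurableI) (use component_measurable in measurable)
  have "density (distr (Rd d) (Rd d) (vaffine d x e)) (\<lambda>_. ennreal (\<bar>e\<bar> ^ d)) = PiM {..<d} (\<lambda>_. lborel)"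
  proof (rule Rd_factors.PiM_eqI)
    show "sets (density (distr (Rd d) (Rd d) (vaffine d x e)) (\<lambda>_. ennreal (\<bar>e\<bar> ^ d))) = sets (PiM {..<d} (\<lambda>_. lborel))"
      by (simp add: Rd_def)
    fix A :: "nat \<Rightarrow> real set" assume A: "\<And>i. i \<in> {..<d} \<Longrightarrow> A i \<in> sets lborel"
    have A': "Pi\<^sub>E {..<d} A \<in> sets (Rd d)" unfolding Rd_def using A by (intro sets_PiM_I_finite) auto
    have pre: "vaffine d x e -` Pi\<^sub>E {..<d} A \<inter> space (Rd d) = Pi\<^sub>E {..<d} (\<lambda>i. (\<lambda>s. x i + e * s) -` A i)"
      unfolding PiE_def Pi_def vaffine_def space_Rd by auto
    have B: "(\<lambda>s. x i + e * s) -` A i \<in> sets lborel" if "i < d" for i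
    proof -
      have "(\<lambda>s. x i + e * s) -` A i \<inter> space borel \<in> sets borel"
        using A[of i] that by (intro measurable_sets[of _ borel borel]) auto
      then show ?thesis by simp
    qed
    have one: "ennreal \<bar>e\<bar> * emeasure lborel ((\<lambda>s. x i + e * s) -` A i) = emeasure lborel (A i)" if "i < d" for i
    proof -
      have "emeasure lborel (A i) = emeasure (density (distr lborel borel (\<lambda>s. x i + e * s)) (\<lambda>_. ennreal \<bar>e\<bar>)) (A i)"
        by (subst lborel_real_affine[OF e, of "x i"]) simp
      also have "\<dots> = ennreal \<bar>e\<bar> * emeasure lborel ((\<lambda>s. x i + e * s) -` A i)"
        using A[of i] that by (simp add: emeasure_density_const emeasure_distr)
      finally show ?thesis by simp
    qed
    have "emeasure (density (distr (Rd d) (Rd d) (vaffine d x e)) (\<lambda>_. ennreal (\<bar>e\<bar> ^ d))) (Pi\<^sub>E {..<d} A)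
        = ennreal (\<bar>e\<bar> ^ d) * emeasure (Rd d) (Pi\<^sub>E {..<d} (\<lambda>i. (\<lambda>s. x i + e * s) -` A i))"
      using A' by (simp add: emeasure_density_const emeasure_distr pre)
    also have "\<dots> = (\<Prod>i<d. ennreal \<bar>e\<bar>) * (\<Prod>i<d. emeasure lborel ((\<lambda>s. x i + e * s) -` A i))"
      unfolding Rd_def using B by (subst Rd_factors.emeasure_PiM) (auto simp: ennreal_power)
    also have "\<dots> = (\<Prod>i<d. emeasure lborel (A i))"
      unfolding prod.distrib[symmetric] using one by (intro prod.cong) auto
    finally show "emeasure (density (distr (Rd d) (Rd d) (vaffine d x e)) (\<lambda>_. ennreal (\<bar>e\<bar> ^ d))) (Pi\<^sub>E {..<d} A)
        = (\<Prod>i<d. emeasure lborel (A i))" .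
  qed simp
  then have "(\<integral>z. f z \<partial>Rd d) = (\<integral>z. f z \<partial>density (distr (Rd d) (Rd d) (vaffine d x e)) (\<lambda>_. ennreal (\<bar>e\<bar> ^ d)))"
    by (simp add: Rd_def)
  also have "\<dots> = (\<integral>z. \<bar>e\<bar> ^ d *\<^sub>R f z \<partial>distr (Rd d) (Rd d) (vaffine d x e))"
    by (subst integral_density) auto
  also have "\<dots> = (\<integral>v. \<bar>e\<bar> ^ d *\<^sub>R f (vaffine d x e v) \<partial>Rd d)"
    by (subst integral_distr) auto
  also have "\<dots> = \<bar>e\<bar> ^ d *\<^sub>R (\<integral>v. f (vaffine d x e v) \<partial>Rd d)"
    by (rule integral_scaleR_right)
  finally show ?thesis .
qed

lemma AE_Rd_component_neq:
  assumes "i < d"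
  shows "AE x in Rd d. x i \<noteq> c"
proof (rule AE_I')
  let ?N = "Pi\<^sub>E {..<d} (\<lambda>j. if j = i then {c} else UNIV)"
  have "emeasure (Rd d) ?N = (\<Prod>j<d. emeasure lborel (if j = i then {c} else UNIV))"
    unfolding Rd_def by (rule Rd_factors.emeasure_PiM) auto
  also have "\<dots> = 0" using assms by (intro prod_zero) auto
  finally show "?N \<in> null_sets (Rd d)"
    unfolding Rd_def by (auto intro!: null_setsI sets_PiM_I_finite)
  show "{x \<in> space (Rd d). \<not> x i \<noteq> c} \<subseteq> ?N"
    by (auto simp: space_Rd PiE_iff extensional_def)
qed

section \<open>Plancherel's identity\<close>

lemma cnj_mult_self: "cnj z * z = complex_of_real ((cmod z)\<^sup>2)"
  by (metis complex_norm_square mult.commute)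

definition mesh :: "nat \<Rightarrow> real" where "mesh n = 1 / real (Suc n)"

lemma mesh_pos: "0 < mesh n" by (simp add: mesh_def)

lemma mesh_lim: "mesh \<longlonglongrightarrow> 0"
  unfolding mesh_def[abs_def] using LIMSEQ_inverse_real_of_nat by (simp only: inverse_eq_divide)

text \<open>
  Continuity along the sequences \<open>x + v / (n + 1)\<close>. This is the only continuity that dominated convergence
  needs for averages over shrinking Gaussians, and it holds almost everywhere for a function that is cut
  off to a cube.
\<close>

definition ray_continuous :: "nat \<Rightarrow> (vec \<Rightarrow> 'b::topological_space) \<Rightarrow> vec \<Rightarrow> bool" where
  "ray_continuous d f x \<longleftrightarrow> (\<forall>v\<in>space (Rd d). (\<lambda>n. f (vaffine d x (mesh n) v)) \<longlonglongrightarrow> f x)"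

text \<open>
  The transform of a complex function; \<^const>\<open>fourier\<close> is the case of real functions.
\<close>

definition ft :: "nat \<Rightarrow> (vec \<Rightarrow> complex) \<Rightarrow> vec \<Rightarrow> complex" where
  "ft d f w = (\<integral>z. f z * cis (- dotv d w z) \<partial>Rd d)"

lemma fourier_eq_ft: "fourier d g = ft d (\<lambda>z. complex_of_real (g z))"
  unfolding fourier_def ft_def dotv_def by (simp add: cis_conv_exp fun_eq_iff)

lemma ft_measurable [measurable]:
  assumes [measurable]: "f \<in> borel_measurable (Rd d)"
  shows "ft d f \<in> borel_measurable (Rd d)"
proof -
  interpret sigma_finite_measure "Rd d" by (rule sigma_finite_Rd)
  show ?thesis unfolding ft_def[abs_def] by measurable
qed

lemma ft_bound:
  "cmod (ft d f w) \<le> (\<integral>z. cmod (f z) \<partial>Rd d)"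
proof -
  have "cmod (ft d f w) \<le> (\<integral>z. norm (f z * cis (- dotv d w z)) \<partial>Rd d)"
    unfolding ft_def by (rule integral_norm_bound)
  then show ?thesis by (simp add: norm_mult)
qed

definition gauss_weight :: "nat \<Rightarrow> real \<Rightarrow> vec \<Rightarrow> real" where
  "gauss_weight d e w = (\<Prod>i<d. exp (- (e * w i)\<^sup>2 / 2))"

text \<open>
  The Gaussian density of variance \<open>e\<^sup>2\<close>, which is up to a constant the transform of \<open>gauss_weight\<close>.
\<close>

definition heat :: "nat \<Rightarrow> real \<Rightarrow> vec \<Rightarrow> real" where
  "heat d e u = (\<Prod>i<d. normal_density 0 e (u i))"

lemma heat_measurable [measurable (raw)]:
  assumes [measurable]: "f \<in> N \<rightarrow>\<^sub>M Rd d"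
  shows "(\<lambda>x. heat d e (f x)) \<in> borel_measurable N"
  unfolding heat_def
  by (intro borel_measurable_prod measurable_compose[OF component_measurable'[OF assms] borel_measurable_normal_density]) auto

lemma gauss_weight_measurable [measurable (raw)]:
  assumes [measurable]: "f \<in> N \<rightarrow>\<^sub>M Rd d"
  shows "(\<lambda>x. gauss_weight d e (f x)) \<in> borel_measurable N"
proof -
  have "(\<lambda>x. exp (- (e * f x i)\<^sup>2 / 2)) \<in> borel_measurable N" if "i < d" for i
    using component_measurable'[OF assms that] by measurable
  then show ?thesis unfolding gauss_weight_def by (intro borel_measurable_prod) auto
qed

lemma gauss_weight_range: "0 \<le> gauss_weight d e w" "gauss_weight d e w \<le> 1"
  by (auto simp: gauss_weight_def intro!: prod_nonneg prod_le_1)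

lemma gauss_weight_integrable: "0 < e \<Longrightarrow> integrable (Rd d) (gauss_weight d e)"
  unfolding gauss_weight_def[abs_def] Rd_def
  by (rule Rd_factors.product_integrable_prod, rule finite_lessThan, rule gaussian_integrable)

lemma gauss_weight_fourier:
  assumes e: "0 < e"
  shows "(\<integral>w. complex_of_real (gauss_weight d e w) * cis (dotv d w u) \<partial>Rd d) = complex_of_real ((2 * pi) ^ d * heat d e u)"
proof -
  have int: "integrable lborel (\<lambda>v. cis (s * v) * complex_of_real (exp (- (e * v)\<^sup>2 / 2)))" for s
    by (rule Bochner_Integration.integrable_bound[OF gaussian_integrable[OF e]]) (auto simp: norm_mult)
  have "(\<integral>w. complex_of_real (gauss_weight d e w) * cis (dotv d w u) \<partial>Rd d)
     = (\<integral>w. (\<Prod>i<d. cis (u i * w i) * complex_of_real (exp (- (e * w i)\<^sup>2 / 2))) \<partial>Rd d)"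
    by (intro Bochner_Integration.integral_cong refl)
       (simp only: cis_dotv gauss_weight_def of_real_prod prod.distrib[symmetric] mult.commute)
  also have "\<dots> = (\<Prod>i<d. (\<integral>v. cis (u i * v) * complex_of_real (exp (- (e * v)\<^sup>2 / 2)) \<partial>lborel))"
    unfolding Rd_def by (rule Rd_factors.product_integral_prod, rule finite_lessThan, rule int)
  also have "\<dots> = (\<Prod>i<d. complex_of_real (2 * pi * normal_density 0 e (u i)))"
    by (simp only: gaussian_fourier[OF e])
  finally show ?thesis by (simp add: heat_def prod.distrib power_mult_distrib flip: of_real_prod)
qed

lemma heat_1_integrable: "integrable (Rd d) (heat d 1)" and heat_1_integral: "(\<integral>v. heat d 1 v \<partial>Rd d) = 1"
  unfolding heat_def[abs_def] Rd_def
  by (rule Rd_factors.product_integrable_prod, simp, simp)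
     (subst Rd_factors.product_integral_prod, auto)

lemma heat_nonneg: "0 \<le> heat d e u"
  by (auto simp: heat_def intro!: prod_nonneg)

lemma heat_scale: "0 < e \<Longrightarrow> e ^ d * heat d e (vdiff d (vaffine d x e v) x) = heat d 1 v"
proof -
  assume e: "0 < e"
  have h: "e * normal_density 0 e (e * s) = normal_density 0 1 s" for s
    using e by (simp add: normal_density_def real_sqrt_mult power_mult_distrib field_simps)
  have "e ^ d * heat d e (vdiff d (vaffine d x e v) x) = (\<Prod>i<d. e * normal_density 0 e (e * v i))"
    by (simp add: heat_def prod.distrib vdiff_def vaffine_def)
  then show ?thesis by (simp only: h) (simp add: heat_def)
qed

text \<open>
  Convolution with \<open>heat d e\<close>, written with the variable rescaled so that the weight does not depend on \<open>e\<close>.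
\<close>

definition smooth :: "nat \<Rightarrow> real \<Rightarrow> (vec \<Rightarrow> complex) \<Rightarrow> vec \<Rightarrow> complex" where
  "smooth d e f x = (\<integral>v. f (vaffine d x e v) * complex_of_real (heat d 1 v) \<partial>Rd d)"

text \<open>
  Plancherel's identity before the Gaussian regularisation is removed: expand both transforms, exchange the
  integrals, and the weight becomes the Gaussian kernel in \<open>y - x\<close>.
\<close>

lemma weighted_energy:
  assumes e: "0 < e" and f: "integrable (Rd d) f"
  shows "(\<integral>w. complex_of_real (gauss_weight d e w) * cnj (ft d f w) * ft d f w \<partial>Rd d)
     = complex_of_real ((2 * pi) ^ d) * (\<integral>x. f x * smooth d e (\<lambda>y. cnj (f y)) x \<partial>Rd d)"
proof -
  have fm [measurable]: "f \<in> borel_measurable (Rd d)" using f by simp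
  note sf = sigma_finite_Rd[of d]
  have g: "integrable (Rd d) (\<lambda>w. complex_of_real (gauss_weight d e w))"
    using gauss_weight_integrable[OF e] by simp
  have A: "integrable (Rd d) (\<lambda>w. complex_of_real (gauss_weight d e w) * cnj (ft d f w))"
  proof (rule Bochner_Integration.integrable_bound[where f = "\<lambda>w. (\<integral>z. cmod (f z) \<partial>Rd d) * gauss_weight d e w"])
    show "integrable (Rd d) (\<lambda>w. (\<integral>z. cmod (f z) \<partial>Rd d) * gauss_weight d e w)"
      using gauss_weight_integrable[OF e] by simp
    show "AE w in Rd d. norm (complex_of_real (gauss_weight d e w) * cnj (ft d f w)) \<le> norm ((\<integral>z. cmod (f z) \<partial>Rd d) * gauss_weight d e w)"
      using ft_bound[of d f] gauss_weight_range[of d e]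
      by (intro AE_I2) (auto simp: norm_mult abs_mult mult.commute intro!: mult_left_mono mult_right_mono)
  qed measurable
  have inner: "(\<integral>w. complex_of_real (gauss_weight d e w) * cnj (ft d f w) * cis (- dotv d w x) \<partial>Rd d)
      = complex_of_real ((2 * pi) ^ d) * smooth d e (\<lambda>y. cnj (f y)) x" if x: "x \<in> space (Rd d)" for x
  proof -
    have c: "cnj (ft d f w) = (\<integral>y. cnj (f y) * cis (dotv d w y) \<partial>Rd d)" for w
    proof -
      have "cnj (ft d f w) = (\<integral>y. cnj (f y * cis (- dotv d w y)) \<partial>Rd d)"
        unfolding ft_def by (rule Bochner_Integration.integral_cnj[symmetric])
      then show ?thesis by (simp add: cis_cnj)
    qed
    have "(\<integral>w. complex_of_real (gauss_weight d e w) * cnj (ft d f w) * cis (- dotv d w x) \<partial>Rd d)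
       = (\<integral>w. complex_of_real (gauss_weight d e w) * (\<integral>y. cnj (f y) * cis (dotv d w (vdiff d y x)) \<partial>Rd d) \<partial>Rd d)"
      unfolding c
    proof (intro Bochner_Integration.integral_cong refl)
      fix w
      have "(\<integral>y. cnj (f y) * cis (dotv d w y) \<partial>Rd d) * cis (- dotv d w x) = (\<integral>y. cnj (f y) * cis (dotv d w y) * cis (- dotv d w x) \<partial>Rd d)"
        by (rule integral_mult_left_zero[symmetric])
      also have "\<dots> = (\<integral>y. cnj (f y) * cis (dotv d w (vdiff d y x)) \<partial>Rd d)"
        by (simp add: mult.assoc cis_mult dotv_vdiff)
      finally show "complex_of_real (gauss_weight d e w) * (\<integral>y. cnj (f y) * cis (dotv d w y) \<partial>Rd d) * cis (- dotv d w x)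
         = complex_of_real (gauss_weight d e w) * (\<integral>y. cnj (f y) * cis (dotv d w (vdiff d y x)) \<partial>Rd d)"
        by (simp add: mult.assoc)
    qed
    also have "\<dots> = (\<integral>y. cnj (f y) * (\<integral>w. complex_of_real (gauss_weight d e w) * cis (dotv d w (vdiff d y x)) \<partial>Rd d) \<partial>Rd d)"
    proof (rule fubini_kernel[OF sf sf g, where C = 1])
      show "integrable (Rd d) (\<lambda>y. cnj (f y))" using f by simp
      show "(\<lambda>(w, y). cis (dotv d w (vdiff d y x))) \<in> borel_measurable (Rd d \<Otimes>\<^sub>M Rd d)"
        unfolding case_prod_beta' using x
        by (intro measurable_compose[OF _ cis_measurable] dotv_measurable vdiff_measurable) simp_all
    qed simp
    also have "\<dots> = (\<integral>y. complex_of_real ((2 * pi) ^ d) * (cnj (f y) * complex_of_real (heat d e (vdiff d y x))) \<partial>Rd d)"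
      by (simp only: gauss_weight_fourier[OF e]) (simp add: mult_ac)
    also have "\<dots> = complex_of_real ((2 * pi) ^ d) * (\<integral>y. cnj (f y) * complex_of_real (heat d e (vdiff d y x)) \<partial>Rd d)"
      by (rule integral_mult_right_zero)
    also have "(\<integral>y. cnj (f y) * complex_of_real (heat d e (vdiff d y x)) \<partial>Rd d) = smooth d e (\<lambda>y. cnj (f y)) x"
    proof -
      have "(\<integral>y. cnj (f y) * complex_of_real (heat d e (vdiff d y x)) \<partial>Rd d) = \<bar>e\<bar> ^ d *\<^sub>R (\<integral>v. cnj (f (vaffine d x e v)) * complex_of_real (heat d e (vdiff d (vaffine d x e v) x)) \<partial>Rd d)"
        using e x by (intro Rd_affine) auto
      also have "\<dots> = (\<integral>v. \<bar>e\<bar> ^ d *\<^sub>R (cnj (f (vaffine d x e v)) * complex_of_real (heat d e (vdiff d (vaffine d x e v) x))) \<partial>Rd d)"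
        by (rule integral_scaleR_right[symmetric])
      also have "\<dots> = smooth d e (\<lambda>y. cnj (f y)) x"
        unfolding smooth_def
      proof (intro Bochner_Integration.integral_cong refl)
        fix v
        show "\<bar>e\<bar> ^ d *\<^sub>R (cnj (f (vaffine d x e v)) * complex_of_real (heat d e (vdiff d (vaffine d x e v) x))) = cnj (f (vaffine d x e v)) * complex_of_real (heat d 1 v)"
          unfolding heat_scale[OF e, of d x v, symmetric] using e by (simp add: scaleR_conv_of_real)
      qed
      finally show ?thesis .
    qed
    finally show ?thesis .
  qed
  have "(\<integral>w. complex_of_real (gauss_weight d e w) * cnj (ft d f w) * ft d f w \<partial>Rd d)
     = (\<integral>w. complex_of_real (gauss_weight d e w) * cnj (ft d f w) * (\<integral>z. f z * cis (- dotv d w z) \<partial>Rd d) \<partial>Rd d)"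
    by (simp only: ft_def)
  also have "\<dots> = (\<integral>x. f x * (\<integral>w. complex_of_real (gauss_weight d e w) * cnj (ft d f w) * cis (- dotv d w x) \<partial>Rd d) \<partial>Rd d)"
  proof (rule fubini_kernel[OF sf sf A f, where C = 1])
    show "(\<lambda>(w, z). cis (- dotv d w z)) \<in> borel_measurable (Rd d \<Otimes>\<^sub>M Rd d)"
      unfolding case_prod_beta' by measurable
  qed simp
  also have "\<dots> = (\<integral>x. complex_of_real ((2 * pi) ^ d) * (f x * smooth d e (\<lambda>y. cnj (f y)) x) \<partial>Rd d)"
    by (intro Bochner_Integration.integral_cong refl) (simp only: inner mult.left_commute)
  also have "\<dots> = complex_of_real ((2 * pi) ^ d) * (\<integral>x. f x * smooth d e (\<lambda>y. cnj (f y)) x \<partial>Rd d)"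
    by (rule integral_mult_right_zero)
  finally show ?thesis .
qed

text \<open>
  Let the regularisation scale tend to 0 in \<open>weighted_energy\<close>: the left-hand side converges by monotone
  convergence, which yields integrability at the same time; the right-hand side converges by dominated
  convergence, as \<open>f\<close> is bounded, integrable and continuous along rays almost everywhere.
\<close>

theorem plancherel:
  assumes f: "integrable (Rd d) f" and B: "\<And>x. x \<in> space (Rd d) \<Longrightarrow> cmod (f x) \<le> B"
    and rc: "AE x in Rd d. ray_continuous d f x"
  shows "integrable (Rd d) (\<lambda>w. (cmod (ft d f w))\<^sup>2)" (is ?A)
    and "(\<integral>w. (cmod (ft d f w))\<^sup>2 \<partial>Rd d) = (2 * pi) ^ d * (\<integral>x. (cmod (f x))\<^sup>2 \<partial>Rd d)" (is ?B)
proof -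
  have fm [measurable]: "f \<in> borel_measurable (Rd d)" using f by simp
  have vm [measurable]: "vaffine d x e \<in> Rd d \<rightarrow>\<^sub>M Rd d" for x e
    unfolding vaffine_def by (rule Rd_measurableI) (use component_measurable in measurable)
  have fv [measurable]: "(\<lambda>v. f (vaffine d x e v)) \<in> borel_measurable (Rd d)" for x e
    by (rule measurable_compose[OF vm fm])
  have hm [measurable]: "heat d 1 \<in> borel_measurable (Rd d)"
    using heat_1_integrable by (rule borel_measurable_integrable)
  define C where "C = (2 * pi) ^ d * (\<integral>x. (cmod (f x))\<^sup>2 \<partial>Rd d)"
  let ?F = "\<lambda>n w. gauss_weight d (mesh n) w * (cmod (ft d f w))\<^sup>2"
  have smb: "cmod (smooth d e (\<lambda>y. cnj (f y)) x) \<le> B" for x e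
  proof -
    have "cmod (smooth d e (\<lambda>y. cnj (f y)) x) \<le> (\<integral>v. norm (cnj (f (vaffine d x e v)) * complex_of_real (heat d 1 v)) \<partial>Rd d)"
      unfolding smooth_def by (rule integral_norm_bound)
    also have "\<dots> \<le> (\<integral>v. B * heat d 1 v \<partial>Rd d)"
    proof (rule integral_mono)
      show "integrable (Rd d) (\<lambda>v. B * heat d 1 v)" using heat_1_integrable by simp
      show le: "norm (cnj (f (vaffine d x e v)) * complex_of_real (heat d 1 v)) \<le> B * heat d 1 v" for v
        using B[of "vaffine d x e v"] heat_nonneg[of d 1 v] by (simp add: norm_mult mult_right_mono)
      show "integrable (Rd d) (\<lambda>v. norm (cnj (f (vaffine d x e v)) * complex_of_real (heat d 1 v)))"
      proof (rule Bochner_Integration.integrable_bound)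
        show "integrable (Rd d) (\<lambda>v. B * heat d 1 v)" using heat_1_integrable by simp
        show "AE v in Rd d. norm (norm (cnj (f (vaffine d x e v)) * complex_of_real (heat d 1 v))) \<le> norm (B * heat d 1 v)"
          using le by (intro AE_I2) (auto intro: order_trans[OF _ abs_ge_self])
        show "(\<lambda>v. norm (cnj (f (vaffine d x e v)) * complex_of_real (heat d 1 v))) \<in> borel_measurable (Rd d)"
          by measurable
      qed
    qed
    also have "\<dots> = B" by (simp add: heat_1_integral)
    finally show ?thesis .
  qed
  have lim: "(\<lambda>n. (\<integral>x. f x * smooth d (mesh n) (\<lambda>y. cnj (f y)) x \<partial>Rd d)) \<longlonglongrightarrow> (\<integral>x. f x * cnj (f x) \<partial>Rd d)"
  proof (rule integral_dominated_convergence[where w = "\<lambda>x. cmod (f x) * B"])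
    show "integrable (Rd d) (\<lambda>x. cmod (f x) * B)" using f by simp
    show "AE x in Rd d. (\<lambda>n. f x * smooth d (mesh n) (\<lambda>y. cnj (f y)) x) \<longlonglongrightarrow> f x * cnj (f x)"
      using rc
    proof eventually_elim
      case (elim x)
      have "(\<lambda>n. smooth d (mesh n) (\<lambda>y. cnj (f y)) x) \<longlonglongrightarrow> (\<integral>v. cnj (f x) * complex_of_real (heat d 1 v) \<partial>Rd d)"
        unfolding smooth_def
      proof (rule integral_dominated_convergence[where w = "\<lambda>v. B * heat d 1 v"])
        show "integrable (Rd d) (\<lambda>v. B * heat d 1 v)" using heat_1_integrable by simp
        show "AE v in Rd d. (\<lambda>n. cnj (f (vaffine d x (mesh n) v)) * complex_of_real (heat d 1 v)) \<longlonglongrightarrow> cnj (f x) * complex_of_real (heat d 1 v)"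
          using elim unfolding ray_continuous_def by (intro AE_I2 tendsto_intros) blast
        show "AE v in Rd d. norm (cnj (f (vaffine d x (mesh n) v)) * complex_of_real (heat d 1 v)) \<le> B * heat d 1 v" for n
          using B[OF vaffine_space] heat_nonneg[of d 1] by (intro AE_I2) (simp add: norm_mult mult_right_mono)
      qed measurable
      also have "(\<integral>v. cnj (f x) * complex_of_real (heat d 1 v) \<partial>Rd d) = cnj (f x)"
        by (simp add: heat_1_integral)
      finally show ?case by (intro tendsto_intros)
    qed
    show "AE x in Rd d. norm (f x * smooth d (mesh n) (\<lambda>y. cnj (f y)) x) \<le> cmod (f x) * B" for n
      using smb by (intro AE_I2) (auto simp: norm_mult mult_left_mono)
    show "(\<lambda>x. f x * smooth d (mesh n) (\<lambda>y. cnj (f y)) x) \<in> borel_measurable (Rd d)" for n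
    proof -
      interpret sigma_finite_measure "Rd d" by (rule sigma_finite_Rd)
      show ?thesis unfolding smooth_def by measurable
    qed
  qed measurable
  have energy: "complex_of_real (\<integral>w. ?F n w \<partial>Rd d) = complex_of_real ((2 * pi) ^ d) * (\<integral>x. f x * smooth d (mesh n) (\<lambda>y. cnj (f y)) x \<partial>Rd d)" for n
  proof -
    have "complex_of_real (\<integral>w. ?F n w \<partial>Rd d) = (\<integral>w. complex_of_real (?F n w) \<partial>Rd d)"
      by (rule integral_complex_of_real[symmetric])
    also have "\<dots> = (\<integral>w. complex_of_real (gauss_weight d (mesh n) w) * cnj (ft d f w) * ft d f w \<partial>Rd d)"
      by (intro Bochner_Integration.integral_cong refl) (simp only: of_real_mult mult.assoc cnj_mult_self)
    finally show ?thesis unfolding weighted_energy[OF mesh_pos f] .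
  qed
  have limF: "(\<lambda>n. (\<integral>w. ?F n w \<partial>Rd d)) \<longlonglongrightarrow> C"
  proof -
    have "(\<lambda>n. complex_of_real (\<integral>w. ?F n w \<partial>Rd d)) \<longlonglongrightarrow> complex_of_real ((2 * pi) ^ d) * (\<integral>x. f x * cnj (f x) \<partial>Rd d)"
      unfolding energy by (intro tendsto_intros lim)
    also have "(\<integral>x. f x * cnj (f x) \<partial>Rd d) = complex_of_real (\<integral>x. (cmod (f x))\<^sup>2 \<partial>Rd d)"
      by (simp add: complex_norm_square[symmetric] flip: integral_complex_of_real)
    finally have "(\<lambda>n. complex_of_real (\<integral>w. ?F n w \<partial>Rd d)) \<longlonglongrightarrow> complex_of_real C"
      by (simp add: C_def)
    then show ?thesis by (simp only: tendsto_of_real_iff)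
  qed
  have Fint: "integrable (Rd d) (?F n)" for n
  proof (rule Bochner_Integration.integrable_bound[where f = "\<lambda>w. (\<integral>z. cmod (f z) \<partial>Rd d)\<^sup>2 * gauss_weight d (mesh n) w"])
    show "integrable (Rd d) (\<lambda>w. (\<integral>z. cmod (f z) \<partial>Rd d)\<^sup>2 * gauss_weight d (mesh n) w)"
      using gauss_weight_integrable[OF mesh_pos] by simp
    show "AE w in Rd d. norm (?F n w) \<le> norm ((\<integral>z. cmod (f z) \<partial>Rd d)\<^sup>2 * gauss_weight d (mesh n) w)"
      using ft_bound[of d f] gauss_weight_range[of d "mesh n"]
      by (intro AE_I2) (auto simp: abs_mult mult.commute intro!: mult_left_mono mult_right_mono power_mono)
  qed measurable
  have mono: "AE w in Rd d. mono (\<lambda>n. ?F n w)"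
  proof (intro AE_I2 monoI mult_right_mono)
    fix w :: vec and m n :: nat assume "m \<le> n"
    then have mn: "mesh n \<le> mesh m" by (simp add: mesh_def frac_le)
    have "(mesh n * w i)\<^sup>2 \<le> (mesh m * w i)\<^sup>2" for i
      using mn mesh_pos[of n] unfolding power_mult_distrib by (intro mult_right_mono power_mono) auto
    then show "gauss_weight d (mesh m) w \<le> gauss_weight d (mesh n) w"
      unfolding gauss_weight_def by (intro prod_mono) auto
  qed simp
  have ptw: "AE w in Rd d. (\<lambda>n. ?F n w) \<longlonglongrightarrow> (cmod (ft d f w))\<^sup>2"
  proof (rule AE_I2)
    fix w
    have "(\<lambda>n. ?F n w) \<longlonglongrightarrow> (\<Prod>i<d. exp (- (0 * w i)\<^sup>2 / 2)) * (cmod (ft d f w))\<^sup>2"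
      unfolding gauss_weight_def by (intro tendsto_intros mesh_lim) auto
    then show "(\<lambda>n. ?F n w) \<longlonglongrightarrow> (cmod (ft d f w))\<^sup>2" by simp
  qed
  show ?A by (rule integrable_monotone_convergence[OF Fint mono ptw limF]) measurable
  show ?B unfolding C_def[symmetric]
    by (rule integral_monotone_convergence[OF Fint mono ptw limF]) measurable
qed

section \<open>The RKHS norm of a band-limited function\<close>

text \<open>
  The squared norm in \<open>\<F>\<^sub>\<tau>\<close> of the function with Plancherel transform \<open>\<pi>\<^sup>d H\<close> on the cube and 0 outside:
  the constants combine to \<open>(2 \<pi>)\<^sup>-\<^sup>d \<pi>\<^sup>2\<^sup>d / \<pi>\<^sup>d = 2\<^sup>-\<^sup>d\<close>.
\<close>

definition band_energy :: "nat \<Rightarrow> real \<Rightarrow> (vec \<Rightarrow> complex) \<Rightarrow> real" where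
  "band_energy d \<tau> H = (1 / 2) ^ d * (\<integral>w. indicator (cube d (1 / \<tau>)) w * (cmod (H w))\<^sup>2 \<partial>Rd d)"

text \<open>
  Two limits in the mean of the same family coincide almost everywhere; so the infimum in the definition of
  the RKHS norm can be computed with any one Plancherel transform.
\<close>

lemma is_fourier_L2_unique:
  assumes "is_fourier_L2 d g h1" "is_fourier_L2 d g h2"
  shows "AE w in Rd d. h1 w = h2 w"
proof -
  let ?F = "\<lambda>R. fourier d (\<lambda>z. indicator (cube d R) z * g z)"
  have m [measurable]: "h1 \<in> borel_measurable (Rd d)" "h2 \<in> borel_measurable (Rd d)" "g \<in> borel_measurable (Rd d)"
    using assms by (auto simp: is_fourier_L2_def)
  have Fm [measurable]: "?F R \<in> borel_measurable (Rd d)" for R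
    unfolding fourier_eq_ft by measurable
  let ?N = "\<lambda>h R. \<integral>\<^sup>+w. ennreal ((cmod (h w - ?F R w))\<^sup>2) \<partial>Rd d"
  have "(\<integral>\<^sup>+w. ennreal ((cmod (h1 w - h2 w))\<^sup>2) \<partial>Rd d) \<le> 2 * ?N h1 R + 2 * ?N h2 R" for R
  proof -
    have "(\<integral>\<^sup>+w. ennreal ((cmod (h1 w - h2 w))\<^sup>2) \<partial>Rd d)
       \<le> (\<integral>\<^sup>+w. 2 * ennreal ((cmod (h1 w - ?F R w))\<^sup>2) + 2 * ennreal ((cmod (h2 w - ?F R w))\<^sup>2) \<partial>Rd d)"
    proof (intro nn_integral_mono)
      fix w
      have "cmod (h1 w - h2 w) \<le> cmod (h1 w - ?F R w) + cmod (h2 w - ?F R w)"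
        using norm_triangle_ineq4[of "h1 w - ?F R w" "h2 w - ?F R w"] by simp
      then have "(cmod (h1 w - h2 w))\<^sup>2 \<le> (cmod (h1 w - ?F R w) + cmod (h2 w - ?F R w))\<^sup>2"
        by (intro power_mono) auto
      also have "\<dots> \<le> 2 * (cmod (h1 w - ?F R w))\<^sup>2 + 2 * (cmod (h2 w - ?F R w))\<^sup>2"
        using sum_squares_bound[of "cmod (h1 w - ?F R w)" "cmod (h2 w - ?F R w)"]
        by (simp add: power2_sum)
      finally have "ennreal ((cmod (h1 w - h2 w))\<^sup>2) \<le> ennreal (2 * (cmod (h1 w - ?F R w))\<^sup>2 + 2 * (cmod (h2 w - ?F R w))\<^sup>2)"
        by (rule ennreal_leI)
      then show "ennreal ((cmod (h1 w - h2 w))\<^sup>2) \<le> 2 * ennreal ((cmod (h1 w - ?F R w))\<^sup>2) + 2 * ennreal ((cmod (h2 w - ?F R w))\<^sup>2)"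
        by (simp add: ennreal_mult)
    qed
    also have "\<dots> = 2 * ?N h1 R + 2 * ?N h2 R"
      by (subst nn_integral_add) (auto simp: nn_integral_cmult)
    finally show ?thesis .
  qed
  moreover have "((\<lambda>R. 2 * ?N h1 R + 2 * ?N h2 R) \<longlongrightarrow> 2 * 0 + 2 * 0) at_top"
    using assms unfolding is_fourier_L2_def
    by (intro tendsto_add ennreal_tendsto_cmult) auto
  ultimately have "(\<integral>\<^sup>+w. ennreal ((cmod (h1 w - h2 w))\<^sup>2) \<partial>Rd d) \<le> 2 * 0 + 2 * 0"
    by (intro tendsto_lowerbound[where F = at_top]) auto
  then have "AE w in Rd d. ennreal ((cmod (h1 w - h2 w))\<^sup>2) = 0"
    by (subst nn_integral_0_iff_AE[symmetric]) auto
  then show ?thesis by eventually_elim simp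
qed

text \<open>
  A point off the hyperplanes \<open>x i = \<plusminus>R\<close> lies in the interior or in the exterior of the cube, and the indicator
  is eventually constant on any sequence that converges to it.
\<close>

lemma ray_continuous_cube:
  fixes f :: "vec \<Rightarrow> 'b :: real_normed_vector"
  assumes f: "\<And>x. x \<in> space (Rd d) \<Longrightarrow> ray_continuous d f x"
  shows "AE x in Rd d. ray_continuous d (\<lambda>x. indicator (cube d R) x *\<^sub>R f x) x"
proof -
  have "AE x in Rd d. \<forall>i\<in>{..<d}. x i \<noteq> R \<and> x i \<noteq> - R"
    using AE_Rd_component_neq by (intro AE_finite_allI) auto
  then show ?thesis using AE_space
  proof eventually_elim
    case (elim x)
    show ?case unfolding ray_continuous_def
    proof
      fix v assume v: "v \<in> space (Rd d)"
      have comp: "(\<lambda>n. vaffine d x (mesh n) v i) \<longlonglongrightarrow> x i" if "i < d" for i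
      proof -
        have "(\<lambda>n. x i + mesh n * v i) \<longlonglongrightarrow> x i + 0 * v i" by (intro tendsto_intros mesh_lim)
        then show ?thesis using that by (simp add: vaffine_def)
      qed
      have "\<forall>\<^sub>F n in sequentially. indicator (cube d R) (vaffine d x (mesh n) v) = (indicator (cube d R) x :: real)"
      proof (cases "x \<in> cube d R")
        case True
        have "\<forall>\<^sub>F n in sequentially. \<forall>i\<in>{..<d}. \<bar>vaffine d x (mesh n) v i\<bar> < R"
        proof (intro eventually_ball_finite ballI finite_lessThan)
          fix i assume i: "i \<in> {..<d}"
          then have "\<bar>x i\<bar> < R" using True elim by (force simp: cube_def abs_le_iff abs_less_iff)
          then show "\<forall>\<^sub>F n in sequentially. \<bar>vaffine d x (mesh n) v i\<bar> < R"
            using i by (intro order_tendstoD[OF tendsto_rabs[OF comp]]) auto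
        qed
        then show ?thesis
          by (rule eventually_mono) (use True in \<open>auto simp: cube_def indicator_def intro: less_imp_le\<close>)
      next
        case False
        then obtain i where i: "i < d" "R < \<bar>x i\<bar>" using elim by (auto simp: cube_def)
        then have "\<forall>\<^sub>F n in sequentially. R < \<bar>vaffine d x (mesh n) v i\<bar>"
          by (intro order_tendstoD[OF tendsto_rabs[OF comp]]) auto
        then show ?thesis
          by (rule eventually_mono) (use False i in \<open>auto simp: cube_def indicator_def\<close>)
      qed
      then have "(\<lambda>n. indicator (cube d R) (vaffine d x (mesh n) v) :: real) \<longlonglongrightarrow> indicator (cube d R) x"
        by (rule tendsto_eventually)
      moreover have "(\<lambda>n. f (vaffine d x (mesh n) v)) \<longlonglongrightarrow> f x"
        using f[OF elim(2)] v by (simp add: ray_continuous_def)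
      ultimately show "(\<lambda>n. indicator (cube d R) (vaffine d x (mesh n) v) *\<^sub>R f (vaffine d x (mesh n) v)) \<longlonglongrightarrow> indicator (cube d R) x *\<^sub>R f x"
        by (rule tendsto_scaleR)
    qed
  qed
qed

text \<open>
  A real function that is the inverse transform of a bounded symbol on the cube. The norm of such a
  function is computed through the integrable function \<open>f\<close> below, of which \<open>g\<close> is a multiple of the forward
  transform: \<open>g\<close> is real, so it equals its own conjugate.
\<close>

locale band_limited =
  fixes d :: nat and \<tau> :: real and H :: "vec \<Rightarrow> complex" and B :: real and g :: "vec \<Rightarrow> real"
  assumes Hm [measurable]: "H \<in> borel_measurable (Rd d)"
    and HB: "\<And>w. w \<in> space (Rd d) \<Longrightarrow> cmod (H w) \<le> B"
    and Hray: "\<And>w. w \<in> space (Rd d) \<Longrightarrow> ray_continuous d H w"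
    and g: "\<And>x. x \<in> space (Rd d) \<Longrightarrow> complex_of_real (g x) =
        (1 / 2) ^ d * (\<integral>w. (indicator (cube d (1 / \<tau>)) w *\<^sub>R H w) * cis (dotv d w x) \<partial>Rd d)"
begin

definition f :: "vec \<Rightarrow> complex" where "f w = indicator (cube d (1 / \<tau>)) w *\<^sub>R cnj (H w)"

lemma f_int: "integrable (Rd d) f"
  unfolding f_def by (rule integrable_cube_bounded[where B = B]) (use HB in auto)

lemma f_bound: "x \<in> space (Rd d) \<Longrightarrow> cmod (f x) \<le> B"
  using HB[of x] norm_ge_zero[of "H x"] by (auto simp: f_def indicator_def simp del: norm_ge_zero)

lemma f_ray: "AE x in Rd d. ray_continuous d f x"
  unfolding f_def
  by (rule ray_continuous_cube) (use Hray in \<open>auto simp: ray_continuous_def intro!: tendsto_intros\<close>)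

lemma fm [measurable]: "f \<in> borel_measurable (Rd d)" using f_int by simp

lemma g_ft: "x \<in> space (Rd d) \<Longrightarrow> complex_of_real (g x) = (1 / 2) ^ d * ft d f x"
proof -
  assume x: "x \<in> space (Rd d)"
  have "complex_of_real (g x) = cnj (complex_of_real (g x))" by simp
  also have "\<dots> = (1 / 2) ^ d * cnj (\<integral>w. (indicator (cube d (1 / \<tau>)) w *\<^sub>R H w) * cis (dotv d w x) \<partial>Rd d)"
    unfolding g[OF x] by simp
  also have "cnj (\<integral>w. (indicator (cube d (1 / \<tau>)) w *\<^sub>R H w) * cis (dotv d w x) \<partial>Rd d)
     = (\<integral>w. cnj ((indicator (cube d (1 / \<tau>)) w *\<^sub>R H w) * cis (dotv d w x)) \<partial>Rd d)"
    by (rule Bochner_Integration.integral_cnj[symmetric])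
  also have "\<dots> = ft d f x"
    unfolding ft_def f_def by (intro Bochner_Integration.integral_cong refl) (simp add: cis_cnj dotv_commute)
  finally show ?thesis .
qed

lemma gm [measurable]: "g \<in> borel_measurable (Rd d)"
proof -
  have "(\<lambda>x. Re ((1 / 2) ^ d * ft d f x)) \<in> borel_measurable (Rd d)" by measurable
  moreover have "g x = Re ((1 / 2) ^ d * ft d f x)" if "x \<in> space (Rd d)" for x
    using g_ft[OF that] by (metis Re_complex_of_real)
  ultimately show ?thesis by (simp cong: measurable_cong)
qed

lemma g_sq: "x \<in> space (Rd d) \<Longrightarrow> (g x)\<^sup>2 = (1 / 4) ^ d * (cmod (ft d f x))\<^sup>2"
proof -
  assume x: "x \<in> space (Rd d)"
  have "\<bar>g x\<bar> = cmod (complex_of_real (g x))" by simp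
  also have "\<dots> = (1 / 2) ^ d * cmod (ft d f x)" unfolding g_ft[OF x] by (simp add: norm_mult norm_power norm_divide)
  finally have "\<bar>g x\<bar>\<^sup>2 = ((1 / 2) ^ d * cmod (ft d f x))\<^sup>2" by simp
  moreover have "((1 / 2) ^ d)\<^sup>2 = (1 / 4 :: real) ^ d"
    unfolding power2_eq_square power_mult_distrib[symmetric] by simp
  ultimately show ?thesis by (simp only: power_mult_distrib power2_abs)
qed

lemma g_sq_int: "integrable (Rd d) (\<lambda>x. (g x)\<^sup>2)"
proof -
  have "integrable (Rd d) (\<lambda>x. (1 / 4) ^ d * (cmod (ft d f x))\<^sup>2)"
    using plancherel(1)[OF f_int f_bound f_ray] by simp
  then show ?thesis by (subst Bochner_Integration.integrable_cong[OF refl g_sq]) auto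
qed

lemma g_sq_integral: "(\<integral>x. (g x)\<^sup>2 \<partial>Rd d) = (pi / 2) ^ d * (\<integral>w. (cmod (f w))\<^sup>2 \<partial>Rd d)"
proof -
  have "(\<integral>x. (g x)\<^sup>2 \<partial>Rd d) = (\<integral>x. (1 / 4) ^ d * (cmod (ft d f x))\<^sup>2 \<partial>Rd d)"
    by (intro Bochner_Integration.integral_cong refl g_sq)
  also have "\<dots> = (1 / 4) ^ d * ((2 * pi) ^ d * (\<integral>w. (cmod (f w))\<^sup>2 \<partial>Rd d))"
    using plancherel(2)[OF f_int f_bound f_ray] by simp
  also have "(1 / 4 :: real) ^ d * ((2 * pi) ^ d * (\<integral>w. (cmod (f w))\<^sup>2 \<partial>Rd d)) = (pi / 2) ^ d * (\<integral>w. (cmod (f w))\<^sup>2 \<partial>Rd d)"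
    unfolding mult.assoc[symmetric] power_mult_distrib[symmetric] by simp
  finally show ?thesis .
qed

lemma g_bound: "x \<in> space (Rd d) \<Longrightarrow> \<bar>g x\<bar> \<le> (1 / 2) ^ d * (\<integral>z. cmod (f z) \<partial>Rd d)"
proof -
  assume x: "x \<in> space (Rd d)"
  have "\<bar>g x\<bar> = cmod (complex_of_real (g x))" by simp
  also have "\<dots> = (1 / 2) ^ d * cmod (ft d f x)" unfolding g_ft[OF x] by (simp add: norm_mult norm_power norm_divide)
  finally show ?thesis using ft_bound[of d f x] by (simp add: mult_left_mono)
qed

lemma g_ray: "x \<in> space (Rd d) \<Longrightarrow> ray_continuous d g x"
  unfolding ray_continuous_def
proof
  fix v assume x: "x \<in> space (Rd d)" and v: "v \<in> space (Rd d)"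
  have "(\<lambda>n. ft d f (vaffine d x (mesh n) v)) \<longlonglongrightarrow> ft d f x"
    unfolding ft_def
  proof (rule integral_dominated_convergence[where w = "\<lambda>z. cmod (f z)"])
    show "integrable (Rd d) (\<lambda>z. cmod (f z))" using f_int by simp
    show "AE z in Rd d. (\<lambda>n. f z * cis (- dotv d (vaffine d x (mesh n) v) z)) \<longlonglongrightarrow> f z * cis (- dotv d x z)"
    proof (rule AE_I2)
      fix z
      have "(\<lambda>n. \<Sum>i<d. (x i + mesh n * v i) * z i) \<longlonglongrightarrow> (\<Sum>i<d. (x i + 0 * v i) * z i)"
        by (intro tendsto_intros mesh_lim)
      then have "(\<lambda>n. dotv d (vaffine d x (mesh n) v) z) \<longlonglongrightarrow> dotv d x z"
        by (simp add: dotv_def vaffine_def)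
      then show "(\<lambda>n. f z * cis (- dotv d (vaffine d x (mesh n) v) z)) \<longlonglongrightarrow> f z * cis (- dotv d x z)"
        by (intro tendsto_intros)
    qed
  qed (use x in \<open>auto simp: norm_mult\<close>)
  then have "(\<lambda>n. (1 / 2) ^ d * ft d f (vaffine d x (mesh n) v)) \<longlonglongrightarrow> (1 / 2) ^ d * ft d f x"
    by (intro tendsto_intros)
  then have "(\<lambda>n. complex_of_real (g (vaffine d x (mesh n) v))) \<longlonglongrightarrow> complex_of_real (g x)"
    by (simp only: g_ft[OF vaffine_space] g_ft[OF x])
  then show "(\<lambda>n. g (vaffine d x (mesh n) v)) \<longlonglongrightarrow> g x" by (simp only: tendsto_of_real_iff)
qed

definition h :: "vec \<Rightarrow> complex" where "h w = complex_of_real (pi ^ d) * (indicator (cube d (1 / \<tau>)) w *\<^sub>R H w)"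

text \<open>
  Expand the square. The squares of \<open>h\<close> and of \<open>F\<close> are given by Plancherel, and the cross term equals the
  energy of the truncated \<open>g\<close> by Fubini and the inversion formula in the locale. What remains is the energy
  of \<open>g\<close> outside of the cube of size \<open>R\<close>.
\<close>

lemma truncation_error:
  fixes R :: real
  defines "F \<equiv> fourier d (\<lambda>z. indicator (cube d R) z * g z)"
  shows "integrable (Rd d) (\<lambda>w. (cmod (h w - F w))\<^sup>2)"
    and "(\<integral>w. (cmod (h w - F w))\<^sup>2 \<partial>Rd d) = (2 * pi) ^ d * ((\<integral>x. (g x)\<^sup>2 \<partial>Rd d) - (\<integral>x. indicator (cube d R) x * (g x)\<^sup>2 \<partial>Rd d))"
proof -
  define u where "u z = indicator (cube d R) z *\<^sub>R complex_of_real (g z)" for z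
  define C where "C = (1 / 2) ^ d * (\<integral>z. cmod (f z) \<partial>Rd d)"
  have F: "F = ft d u"
    unfolding F_def fourier_eq_ft u_def by (simp add: scaleR_conv_of_real)
  have u_int: "integrable (Rd d) u"
    unfolding u_def by (rule integrable_cube_bounded[where B = C]) (use g_bound in \<open>auto simp: C_def\<close>)
  have um [measurable]: "u \<in> borel_measurable (Rd d)" using u_int by simp
  have u_bd: "cmod (u x) \<le> C" if "x \<in> space (Rd d)" for x
    using g_bound[OF that] abs_ge_zero[of "g x"] by (auto simp: u_def C_def indicator_def simp del: abs_ge_zero)
  have u_ray: "AE x in Rd d. ray_continuous d u x"
    unfolding u_def by (rule ray_continuous_cube) (use g_ray in \<open>auto simp: ray_continuous_def intro!: tendsto_intros\<close>)
  have P1: "integrable (Rd d) (\<lambda>w. (cmod (ft d u w))\<^sup>2)"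
    and P2: "(\<integral>w. (cmod (ft d u w))\<^sup>2 \<partial>Rd d) = (2 * pi) ^ d * (\<integral>x. (cmod (u x))\<^sup>2 \<partial>Rd d)"
    by (rule plancherel[OF u_int u_bd u_ray]; assumption)+
  have hm [measurable]: "h \<in> borel_measurable (Rd d)" unfolding h_def by measurable
  have Fm [measurable]: "F \<in> borel_measurable (Rd d)" unfolding F by measurable
  have hf: "h w = complex_of_real (pi ^ d) * cnj (f w)" for w by (simp add: h_def f_def)
  have h_int: "integrable (Rd d) h"
    unfolding hf using f_int by (intro integrable_mult_right integrable_cnj)
  have fsq: "integrable (Rd d) (\<lambda>w. (cmod (f w))\<^sup>2)"
  proof (rule Bochner_Integration.integrable_bound[where f = "\<lambda>w. B * cmod (f w)"])
    show "integrable (Rd d) (\<lambda>w. B * cmod (f w))" using f_int by simp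
    show "AE w in Rd d. norm ((cmod (f w))\<^sup>2) \<le> norm (B * cmod (f w))"
    proof (rule AE_I2)
      fix w assume "w \<in> space (Rd d)"
      then have "cmod (f w) * cmod (f w) \<le> \<bar>B\<bar> * cmod (f w)" using f_bound[of w] by (intro mult_right_mono) auto
      then show "norm ((cmod (f w))\<^sup>2) \<le> norm (B * cmod (f w))" by (simp add: power2_eq_square abs_mult)
    qed
  qed measurable
  have hsq: "(cmod (h w))\<^sup>2 = pi ^ d * pi ^ d * (cmod (f w))\<^sup>2" for w
    unfolding hf by (simp add: norm_mult norm_power power_mult_distrib power2_eq_square)
  have hsq_int: "integrable (Rd d) (\<lambda>w. (cmod (h w))\<^sup>2)" unfolding hsq using fsq by simp
  have hsq_val: "(\<integral>w. (cmod (h w))\<^sup>2 \<partial>Rd d) = (2 * pi) ^ d * (\<integral>x. (g x)\<^sup>2 \<partial>Rd d)"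
  proof -
    have "pi ^ d * pi ^ d = (2 * pi) ^ d * (pi / 2) ^ d" unfolding power_mult_distrib[symmetric] by simp
    then show ?thesis unfolding hsq g_sq_integral integral_mult_right_zero by (simp only: mult.assoc)
  qed
  have Fsq_val: "(\<integral>w. (cmod (F w))\<^sup>2 \<partial>Rd d) = (2 * pi) ^ d * (\<integral>x. indicator (cube d R) x * (g x)\<^sup>2 \<partial>Rd d)"
    unfolding F P2 by (intro arg_cong2[where f = times] refl Bochner_Integration.integral_cong) (auto simp: u_def indicator_def)
  have cross_int: "integrable (Rd d) (\<lambda>w. h w * cnj (F w))"
  proof (rule Bochner_Integration.integrable_bound[where f = "\<lambda>w. (\<integral>z. cmod (u z) \<partial>Rd d) * cmod (h w)"])
    show "integrable (Rd d) (\<lambda>w. (\<integral>z. cmod (u z) \<partial>Rd d) * cmod (h w))" using h_int by simp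
    show "AE w in Rd d. norm (h w * cnj (F w)) \<le> norm ((\<integral>z. cmod (u z) \<partial>Rd d) * cmod (h w))"
      unfolding F using ft_bound[of d u] by (intro AE_I2) (simp add: norm_mult abs_mult mult.commute[of "cmod (h _)"] mult_right_mono)
  qed measurable
  have cross: "(\<integral>w. h w * cnj (F w) \<partial>Rd d) = complex_of_real ((2 * pi) ^ d * (\<integral>x. indicator (cube d R) x * (g x)\<^sup>2 \<partial>Rd d))"
  proof -
    have c: "cnj (F w) = (\<integral>z. u z * cis (dotv d w z) \<partial>Rd d)" for w
    proof -
      have "cnj (F w) = (\<integral>z. cnj (u z * cis (- dotv d w z)) \<partial>Rd d)"
        unfolding F ft_def by (rule Bochner_Integration.integral_cnj[symmetric])
      then show ?thesis by (simp add: cis_cnj u_def)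
    qed
    have "(\<integral>w. h w * cnj (F w) \<partial>Rd d) = (\<integral>z. u z * (\<integral>w. h w * cis (dotv d w z) \<partial>Rd d) \<partial>Rd d)"
      unfolding c
    proof (rule fubini_kernel[OF sigma_finite_Rd sigma_finite_Rd h_int u_int, where C = 1])
      show "(\<lambda>(w, z). cis (dotv d w z)) \<in> borel_measurable (Rd d \<Otimes>\<^sub>M Rd d)"
        unfolding case_prod_beta' by measurable
    qed simp
    also have "\<dots> = (\<integral>z. complex_of_real ((2 * pi) ^ d * (indicator (cube d R) z * (g z)\<^sup>2)) \<partial>Rd d)"
    proof (intro Bochner_Integration.integral_cong refl)
      fix z assume z: "z \<in> space (Rd d)"
      have "(\<integral>w. h w * cis (dotv d w z) \<partial>Rd d) = (\<integral>w. complex_of_real (pi ^ d) * ((indicator (cube d (1 / \<tau>)) w *\<^sub>R H w) * cis (dotv d w z)) \<partial>Rd d)"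
        by (simp only: h_def mult.assoc)
      also have "\<dots> = complex_of_real (pi ^ d) * (\<integral>w. (indicator (cube d (1 / \<tau>)) w *\<^sub>R H w) * cis (dotv d w z) \<partial>Rd d)"
        by (rule integral_mult_right_zero)
      also have "(\<integral>w. (indicator (cube d (1 / \<tau>)) w *\<^sub>R H w) * cis (dotv d w z) \<partial>Rd d) = 2 ^ d * complex_of_real (g z)"
        unfolding g[OF z] mult.assoc[symmetric] power_mult_distrib[symmetric] by simp
      finally show "u z * (\<integral>w. h w * cis (dotv d w z) \<partial>Rd d) = complex_of_real ((2 * pi) ^ d * (indicator (cube d R) z * (g z)\<^sup>2))"
        by (simp add: u_def scaleR_conv_of_real power2_eq_square power_mult_distrib)
    qed
    also have "\<dots> = complex_of_real (\<integral>z. (2 * pi) ^ d * (indicator (cube d R) z * (g z)\<^sup>2) \<partial>Rd d)"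
      by (rule integral_complex_of_real)
    finally show ?thesis by simp
  qed
  have expand: "(cmod (h w - F w))\<^sup>2 = (cmod (h w))\<^sup>2 + (cmod (F w))\<^sup>2 - 2 * Re (h w * cnj (F w))" for w
    unfolding cmod_power2 by (simp add: power2_eq_square algebra_simps)
  have Fsq_int: "integrable (Rd d) (\<lambda>w. (cmod (F w))\<^sup>2)" using P1 unfolding F .
  have re_int: "integrable (Rd d) (\<lambda>w. 2 * Re (h w * cnj (F w)))"
    by (intro integrable_mult_right integrable_Re cross_int)
  show "integrable (Rd d) (\<lambda>w. (cmod (h w - F w))\<^sup>2)"
    unfolding expand by (rule Bochner_Integration.integrable_diff[OF Bochner_Integration.integrable_add[OF hsq_int Fsq_int] re_int])
  have "(\<integral>w. (cmod (h w - F w))\<^sup>2 \<partial>Rd d) = (\<integral>w. (cmod (h w))\<^sup>2 \<partial>Rd d) + (\<integral>w. (cmod (F w))\<^sup>2 \<partial>Rd d) - (\<integral>w. 2 * Re (h w * cnj (F w)) \<partial>Rd d)"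
    unfolding expand
    by (simp only: Bochner_Integration.integral_diff[OF Bochner_Integration.integrable_add[OF hsq_int Fsq_int] re_int]
        Bochner_Integration.integral_add[OF hsq_int Fsq_int])
  also have "(\<integral>w. 2 * Re (h w * cnj (F w)) \<partial>Rd d) = 2 * (\<integral>w. Re (h w * cnj (F w)) \<partial>Rd d)"
    by (rule integral_mult_right_zero)
  also have "(\<integral>w. Re (h w * cnj (F w)) \<partial>Rd d) = Re (\<integral>w. h w * cnj (F w) \<partial>Rd d)"
    by (rule integral_Re[OF cross_int])
  finally show "(\<integral>w. (cmod (h w - F w))\<^sup>2 \<partial>Rd d) = (2 * pi) ^ d * ((\<integral>x. (g x)\<^sup>2 \<partial>Rd d) - (\<integral>x. indicator (cube d R) x * (g x)\<^sup>2 \<partial>Rd d))"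
    unfolding hsq_val Fsq_val cross by (simp add: algebra_simps)
qed

lemma is_fourier_L2_h: "is_fourier_L2 d g h"
  unfolding is_fourier_L2_def
proof (intro conjI)
  show "g \<in> borel_measurable (Rd d)" by measurable
  show "h \<in> borel_measurable (Rd d)" unfolding h_def by measurable
  show "(\<integral>\<^sup>+z. ennreal ((g z)\<^sup>2) \<partial>Rd d) < \<infinity>"
    using g_sq_int by (simp add: nn_integral_eq_integral)
  have lim: "((\<lambda>R. \<integral>x. indicator (cube d R) x * (g x)\<^sup>2 \<partial>Rd d) \<longlongrightarrow> (\<integral>x. (g x)\<^sup>2 \<partial>Rd d)) at_top"
  proof (rule integral_dominated_convergence_at_top[where w = "\<lambda>x. (g x)\<^sup>2"])
    show "AE x in Rd d. ((\<lambda>R. indicator (cube d R) x * (g x)\<^sup>2) \<longlongrightarrow> (g x)\<^sup>2) at_top"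
    proof (rule AE_I2)
      fix x assume x: "x \<in> space (Rd d)"
      have "\<forall>\<^sub>F R in at_top. (\<Sum>i<d. \<bar>x i\<bar>) \<le> R" by (rule eventually_ge_at_top)
      then have "\<forall>\<^sub>F R in at_top. indicator (cube d R) x * (g x)\<^sup>2 = (g x)\<^sup>2"
      proof eventually_elim
        case (elim R)
        have "\<bar>x i\<bar> \<le> (\<Sum>i<d. \<bar>x i\<bar>)" if "i < d" for i using that by (intro member_le_sum) auto
        then have "x \<in> cube d R" using x elim by (force simp: cube_def)
        then show ?case by simp
      qed
      then show "((\<lambda>R. indicator (cube d R) x * (g x)\<^sup>2) \<longlongrightarrow> (g x)\<^sup>2) at_top" by (rule tendsto_eventually)
    qed
    show "\<forall>\<^sub>F R in at_top. AE x in Rd d. norm (indicator (cube d R) x * (g x)\<^sup>2) \<le> (g x)\<^sup>2"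
      by (intro always_eventually allI AE_I2) (auto simp: indicator_def)
  qed (use g_sq_int in measurable)
  have "((\<lambda>R. ennreal ((2 * pi) ^ d * ((\<integral>x. (g x)\<^sup>2 \<partial>Rd d) - (\<integral>x. indicator (cube d R) x * (g x)\<^sup>2 \<partial>Rd d)))) \<longlongrightarrow>
      ennreal ((2 * pi) ^ d * ((\<integral>x. (g x)\<^sup>2 \<partial>Rd d) - (\<integral>x. (g x)\<^sup>2 \<partial>Rd d)))) at_top"
    by (intro tendsto_ennrealI tendsto_intros lim)
  then show "((\<lambda>R. \<integral>\<^sup>+w. ennreal ((cmod (h w - fourier d (\<lambda>z. indicator (cube d R) z * g z) w))\<^sup>2) \<partial>Rd d) \<longlongrightarrow> 0) at_top"
    by (subst nn_integral_eq_integral[OF truncation_error(1)]) (auto simp: truncation_error(2))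
qed

lemma rkhs_norm_sq_eq: "rkhs_norm_sq d \<tau> g = ennreal (band_energy d \<tau> H)"
proof -
  have val: "ennreal (1 / (2 * pi) ^ d) * (\<integral>\<^sup>+w. ennreal ((cmod (k w))\<^sup>2) / ennreal (fourier_lam d \<tau> w) \<partial>Rd d) = ennreal (band_energy d \<tau> H)"
    if k: "is_fourier_L2 d g k" for k
  proof -
    have ae: "AE w in Rd d. k w = h w" by (rule is_fourier_L2_unique[OF k is_fourier_L2_h])
    have "(\<integral>\<^sup>+w. ennreal ((cmod (k w))\<^sup>2) / ennreal (fourier_lam d \<tau> w) \<partial>Rd d)
       = (\<integral>\<^sup>+w. ennreal (pi ^ d * (indicator (cube d (1 / \<tau>)) w * (cmod (H w))\<^sup>2)) \<partial>Rd d)"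
    proof (intro nn_integral_cong_AE)
      show "AE w in Rd d. ennreal ((cmod (k w))\<^sup>2) / ennreal (fourier_lam d \<tau> w) = ennreal (pi ^ d * (indicator (cube d (1 / \<tau>)) w * (cmod (H w))\<^sup>2))"
        using ae
      proof eventually_elim
        case (elim w)
        show ?case
        proof (cases "w \<in> cube d (1 / \<tau>)")
          case True
          then have "ennreal ((cmod (k w))\<^sup>2) / ennreal (fourier_lam d \<tau> w) = ennreal ((pi ^ d * cmod (H w))\<^sup>2 / pi ^ d)"
            unfolding elim h_def fourier_lam_def by (simp add: norm_mult norm_power divide_ennreal)
          then show ?thesis using True by (simp add: power2_eq_square)
        next
          case False
          then show ?thesis unfolding elim h_def fourier_lam_def by simp
        qed
      qed
    qed
    also have "\<dots> = ennreal (\<integral>w. pi ^ d * (indicator (cube d (1 / \<tau>)) w * (cmod (H w))\<^sup>2) \<partial>Rd d)"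
    proof (rule nn_integral_eq_integral)
      have "integrable (Rd d) (\<lambda>w. indicator (cube d (1 / \<tau>)) w *\<^sub>R (cmod (H w))\<^sup>2)"
        by (rule integrable_cube_bounded[where B = "B\<^sup>2"]) (use HB in \<open>auto intro!: power_mono\<close>)
      then show "integrable (Rd d) (\<lambda>w. pi ^ d * (indicator (cube d (1 / \<tau>)) w * (cmod (H w))\<^sup>2))" by simp
    qed simp
    finally have "ennreal (1 / (2 * pi) ^ d) * (\<integral>\<^sup>+w. ennreal ((cmod (k w))\<^sup>2) / ennreal (fourier_lam d \<tau> w) \<partial>Rd d)
      = ennreal (1 / (2 * pi) ^ d * (pi ^ d * (\<integral>w. indicator (cube d (1 / \<tau>)) w * (cmod (H w))\<^sup>2 \<partial>Rd d)))"
      by (simp add: ennreal_mult[symmetric])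
    also have "1 / (2 * pi) ^ d * (pi ^ d * (\<integral>w. indicator (cube d (1 / \<tau>)) w * (cmod (H w))\<^sup>2 \<partial>Rd d)) = band_energy d \<tau> H"
      unfolding band_energy_def by (simp add: power_mult_distrib power_divide)
    finally show ?thesis .
  qed
  show ?thesis unfolding rkhs_norm_sq_def
  proof (rule antisym)
    show "(INF k\<in>{k. is_fourier_L2 d g k}. ennreal (1 / (2 * pi) ^ d) * (\<integral>\<^sup>+w. ennreal ((cmod (k w))\<^sup>2) / ennreal (fourier_lam d \<tau> w) \<partial>Rd d)) \<le> ennreal (band_energy d \<tau> H)"
      using val[OF is_fourier_L2_h] is_fourier_L2_h by (intro INF_lower2[of h]) auto
    show "ennreal (band_energy d \<tau> H) \<le> (INF k\<in>{k. is_fourier_L2 d g k}. ennreal (1 / (2 * pi) ^ d) * (\<integral>\<^sup>+w. ennreal ((cmod (k w))\<^sup>2) / ennreal (fourier_lam d \<tau> w) \<partial>Rd d))"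
      using val by (intro INF_greatest) auto
  qed
qed

end

section \<open>The product kernel and its derivatives\<close>

text \<open>
  A Neumann series: \<open>u n\<close> is \<open>(-M)\<^sup>n t\<close>, whose entries are at most \<open>e\<^sup>n T\<close> as the rows of \<open>M\<close> have absolute
  sum at most \<open>e\<close>.
\<close>

lemma perturbed_identity_solvable:
  fixes M :: "'i \<Rightarrow> 'i \<Rightarrow> real" and t :: "'i \<Rightarrow> real"
  assumes I: "finite I" and row: "\<And>i. i \<in> I \<Longrightarrow> (\<Sum>j\<in>I. \<bar>M i j\<bar>) \<le> e"
    and e: "0 \<le> e" "e \<le> 1 / 2" and t: "\<And>i. i \<in> I \<Longrightarrow> \<bar>t i\<bar> \<le> T"
  obtains c where "\<And>i. i \<in> I \<Longrightarrow> c i + (\<Sum>j\<in>I. M i j * c j) = t i"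
    and "\<And>i. i \<in> I \<Longrightarrow> \<bar>c i - t i\<bar> \<le> 2 * e * T"
proof -
  define u where "u n = ((\<lambda>a i. - (\<Sum>j\<in>I. M i j * a j)) ^^ n) t" for n
  have u0: "u 0 = t" and uS: "u (Suc n) i = - (\<Sum>j\<in>I. M i j * u n j)" for n i
    by (simp_all add: u_def)
  have ub: "\<bar>u n i\<bar> \<le> e ^ n * T" if "i \<in> I" for n i
    using that
  proof (induction n arbitrary: i)
    case 0
    then show ?case using t by (simp add: u0)
  next
    case (Suc n)
    have T: "0 \<le> T" using t[OF Suc.prems] by linarith
    have "\<bar>u (Suc n) i\<bar> \<le> (\<Sum>j\<in>I. \<bar>M i j * u n j\<bar>)"
      unfolding uS abs_minus_cancel by (rule sum_abs)
    also have "\<dots> \<le> (\<Sum>j\<in>I. \<bar>M i j\<bar> * (e ^ n * T))"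
      using Suc.IH by (intro sum_mono) (auto simp: abs_mult intro!: mult_left_mono)
    also have "\<dots> = (\<Sum>j\<in>I. \<bar>M i j\<bar>) * (e ^ n * T)" by (rule sum_distrib_right[symmetric])
    also have "\<dots> \<le> e * (e ^ n * T)" using row[OF Suc.prems] e T by (intro mult_right_mono) auto
    finally show ?case by (simp add: mult.assoc)
  qed
  have sg: "summable (\<lambda>n. e ^ n * T)" using e by (intro summable_mult2 summable_geometric) auto
  have su: "summable (\<lambda>n. u n i)" if "i \<in> I" for i
    using ub[OF that] by (intro summable_comparison_test[OF _ sg]) auto
  define c where "c i = (\<Sum>n. u n i)" for i
  have c_split: "c i = t i + (\<Sum>n. u (Suc n) i)" if "i \<in> I" for i
    using suminf_split_head[OF su[OF that]] by (simp add: c_def u0)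
  show ?thesis
  proof (rule that[of c])
    fix i assume i: "i \<in> I"
    have "(\<Sum>n. u (Suc n) i) = - (\<Sum>n. \<Sum>j\<in>I. M i j * u n j)"
      unfolding uS using su by (intro suminf_minus summable_sum summable_mult)
    also have "(\<Sum>n. \<Sum>j\<in>I. M i j * u n j) = (\<Sum>j\<in>I. \<Sum>n. M i j * u n j)"
      using su by (intro suminf_sum summable_mult)
    also have "\<dots> = (\<Sum>j\<in>I. M i j * c j)"
      unfolding c_def using su by (intro sum.cong refl suminf_mult)
    finally show "c i + (\<Sum>j\<in>I. M i j * c j) = t i" using c_split[OF i] by simp
    have T: "0 \<le> T" using t[OF i] by linarith
    have sg': "summable (\<lambda>n. e ^ Suc n * T)" using sg by (subst summable_Suc_iff)
    have "\<bar>\<Sum>n. u (Suc n) i\<bar> \<le> (\<Sum>n. e ^ Suc n * T)"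
    proof -
      have "norm (\<Sum>n. u (Suc n) i) \<le> (\<Sum>n. e ^ Suc n * T)"
        by (intro norm_suminf_le sg') (simp only: real_norm_def, rule ub[OF i])
      then show ?thesis by simp
    qed
    also have "\<dots> = e * T * (\<Sum>n. e ^ n)"
      using e by (subst suminf_mult[symmetric]) (auto intro!: summable_geometric simp: mult_ac)
    also have "\<dots> = e * T * (1 / (1 - e))" using e by (subst suminf_geometric) auto
    also have "\<dots> \<le> e * T * 2" using e T by (intro mult_left_mono) (auto simp: divide_le_eq)
    finally show "\<bar>c i - t i\<bar> \<le> 2 * e * T" using c_split[OF i] by simp
  qed
qed

text \<open>
  The mixed partial derivative, with multi-index \<open>D\<close>, of the product of the \<open>sinc\<^sup>4 (u i)\<close>; faithful as
  long as no entry of \<open>D\<close> exceeds 3.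
\<close>

definition psi :: "nat \<Rightarrow> (nat \<Rightarrow> nat) \<Rightarrow> (nat \<Rightarrow> real) \<Rightarrow> real" where
  "psi d D u = (\<Prod>i<d. sg (D i) (u i))"

abbreviation psi_order :: "nat \<Rightarrow> (nat \<Rightarrow> nat) \<Rightarrow> nat" where
  "psi_order d D \<equiv> (\<Sum>i<d. D i)"

definition nsq :: "nat \<Rightarrow> (nat \<Rightarrow> real) \<Rightarrow> real" where
  "nsq d u = (\<Sum>i<d. (u i)\<^sup>2)"

lemma order_component: "i < d \<Longrightarrow> D i \<le> psi_order d D"
  by (rule member_le_sum) auto

lemma psi_bound:
  assumes "psi_order d D \<le> 3"
  shows "\<bar>psi d D u\<bar> \<le> 4 ^ psi_order d D"
proof -
  have "\<bar>psi d D u\<bar> = (\<Prod>i<d. \<bar>sg (D i) (u i)\<bar>)" by (simp add: psi_def abs_prod)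
  also have "\<dots> \<le> (\<Prod>i<d. 4 ^ D i)"
  proof (intro prod_mono conjI)
    fix i assume "i \<in> {..<d}"
    then have "D i \<le> 3" using order_component[of i d D] assms by simp
    then show "\<bar>sg (D i) (u i)\<bar> \<le> 4 ^ D i" by (rule sg_bound)
  qed simp
  finally show ?thesis by (simp add: power_sum)
qed

lemma psi_coordinate_decay:
  assumes "psi_order d D \<le> 3" and m: "m < d"
  shows "(u m) ^ 4 * \<bar>psi d D u\<bar> \<le> 16 * 4 ^ psi_order d D"
proof -
  have D3: "D i \<le> 3" if "i < d" for i using order_component[of i d D] assms that by simp
  have md: "{..<d} = insert m ({..<d} - {m})" using m by auto
  have "\<bar>psi d D u\<bar> = \<bar>sg (D m) (u m)\<bar> * (\<Prod>i\<in>{..<d} - {m}. \<bar>sg (D i) (u i)\<bar>)"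
    unfolding psi_def abs_prod using m by (subst prod.remove[of _ m]) auto
  then have "(u m) ^ 4 * \<bar>psi d D u\<bar> = ((u m) ^ 4 * \<bar>sg (D m) (u m)\<bar>) * (\<Prod>i\<in>{..<d} - {m}. \<bar>sg (D i) (u i)\<bar>)"
    by (simp only: mult.assoc)
  also have "\<dots> \<le> (16 * 4 ^ D m) * (\<Prod>i\<in>{..<d} - {m}. 4 ^ D i)"
    using D3 m by (intro mult_mono sg_decay prod_mono conjI sg_bound) (auto intro: prod_nonneg)
  also have "\<dots> = 16 * (4 ^ D m * 4 ^ (\<Sum>i\<in>{..<d} - {m}. D i))" by (simp add: power_sum)
  also have "\<dots> = 16 * 4 ^ psi_order d D"
    unfolding power_add[symmetric] using m by (subst sum.remove[of "{..<d}" m]) auto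
  finally show ?thesis .
qed

text \<open>
  Only the largest coordinate is used for the decay: its square is at least \<open>nsq d u / d\<close>, and the other
  factors are bounded. This is the source of the factor \<open>d\<^sup>2\<close>.
\<close>

lemma psi_decay:
  assumes D: "psi_order d D \<le> 3" and d: "0 < d"
  shows "(nsq d u)\<^sup>2 * \<bar>psi d D u\<bar> \<le> 16 * 4 ^ psi_order d D * (real d)\<^sup>2"
proof -
  have "\<exists>m<d. nsq d u \<le> real d * (u m)\<^sup>2"
  proof (rule ccontr)
    assume "\<not> ?thesis"
    then have lt: "real d * (u m)\<^sup>2 < nsq d u" if "m < d" for m using that by force
    have "real d * nsq d u = (\<Sum>m<d. real d * (u m)\<^sup>2)" by (simp add: nsq_def sum_distrib_left)
    also have "\<dots> < (\<Sum>m<d. nsq d u)" using lt d by (intro sum_strict_mono) auto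
    finally show False by simp
  qed
  then obtain m where m: "m < d" "nsq d u \<le> real d * (u m)\<^sup>2" by blast
  have "0 \<le> nsq d u" by (simp add: nsq_def sum_nonneg)
  then have "(nsq d u)\<^sup>2 \<le> (real d * (u m)\<^sup>2)\<^sup>2" using m by (intro power_mono)
  then have "(nsq d u)\<^sup>2 * \<bar>psi d D u\<bar> \<le> (real d * (u m)\<^sup>2)\<^sup>2 * \<bar>psi d D u\<bar>" by (rule mult_right_mono) simp
  also have "\<dots> = ((u m) ^ 4 * \<bar>psi d D u\<bar>) * (real d)\<^sup>2" by (simp add: power_mult_distrib power_mult[symmetric])
  also have "\<dots> \<le> (16 * 4 ^ psi_order d D) * (real d)\<^sup>2"
    by (intro mult_right_mono psi_coordinate_decay[OF D m(1)]) simp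
  finally show ?thesis .
qed

text \<open>
  On \<open>{..<d}\<close> this is the \<open>j\<close>-th unit multi-index for \<open>j < d\<close> and the zero multi-index for \<open>j = d\<close>. So \<open>j\<close>
  running through \<open>{..d}\<close> enumerates the kernel (\<open>j = d\<close>) and its first partial derivatives.
\<close>

definition unit_index :: "nat \<Rightarrow> nat \<Rightarrow> nat" where
  "unit_index j i = (if i = j then 1 else 0)"

lemma unit_index_order: "psi_order d (unit_index j) = (if j < d then 1 else 0)"
  by (simp add: unit_index_def sum.delta)

lemma order_add: "psi_order d (\<lambda>i. D i + D' i) = psi_order d D + psi_order d D'"
  by (rule sum.distrib)

lemma psi_ray_deriv:
  assumes D: "psi_order d D \<le> 2"
  shows "((\<lambda>s. psi d D (\<lambda>i. c i + s * u i)) has_real_derivative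
     (\<Sum>a<d. u a * psi d (\<lambda>i. D i + unit_index a i) (\<lambda>i. c i + s * u i))) (at s)"
proof -
  have D2: "D i \<le> 2" if "i < d" for i using order_component[of i d D] assms that by simp
  have "((\<lambda>s. \<Prod>i<d. sg (D i) (c i + s * u i)) has_real_derivative
     (\<Sum>a<d. (sg (Suc (D a)) (c a + s * u a) * u a) * (\<Prod>i\<in>{..<d} - {a}. sg (D i) (c i + s * u i)))) (at s)"
  proof (rule has_field_derivative_prod)
    fix i assume "i \<in> {..<d}"
    then have "(sg (D i) has_real_derivative sg (Suc (D i)) (c i + s * u i)) (at (c i + s * u i))"
      using D2 by (intro sg_deriv) auto
    then show "((\<lambda>s. sg (D i) (c i + s * u i)) has_real_derivative sg (Suc (D i)) (c i + s * u i) * u i) (at s)"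
      by (rule DERIV_chain2) (auto intro!: derivative_eq_intros)
  qed
  moreover have "(sg (Suc (D a)) (c a + s * u a) * u a) * (\<Prod>i\<in>{..<d} - {a}. sg (D i) (c i + s * u i))
      = u a * psi d (\<lambda>i. D i + unit_index a i) (\<lambda>i. c i + s * u i)" if "a < d" for a
  proof -
    have "psi d (\<lambda>i. D i + unit_index a i) (\<lambda>i. c i + s * u i) = sg (Suc (D a)) (c a + s * u a) * (\<Prod>i\<in>{..<d} - {a}. sg (D i) (c i + s * u i))"
      unfolding psi_def using that by (subst prod.remove[of _ a]) (auto simp: unit_index_def intro!: prod.cong)
    then show ?thesis by (simp add: mult_ac)
  qed
  then have "(\<Sum>a<d. (sg (Suc (D a)) (c a + s * u a) * u a) * (\<Prod>i\<in>{..<d} - {a}. sg (D i) (c i + s * u i)))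
      = (\<Sum>a<d. u a * psi d (\<lambda>i. D i + unit_index a i) (\<lambda>i. c i + s * u i))"
    by (intro sum.cong) auto
  ultimately show ?thesis unfolding psi_def[of d D] by (simp only:)
qed

lemma psi_0_upper:
  shows "psi d (unit_index d) u \<le> exp (- (3 / 5) * min (nsq d u) 1)" and "0 \<le> psi d (unit_index d) u"
proof -
  have e: "psi d (unit_index d) u = (\<Prod>i<d. sg 0 (u i))"
    unfolding psi_def by (intro prod.cong) (auto simp: unit_index_def)
  show "0 \<le> psi d (unit_index d) u" unfolding e by (intro prod_nonneg sg_0_range)
  have "(\<Prod>i<d. sg 0 (u i)) \<le> (\<Prod>i<d. exp (- (3 / 5) * min ((u i)\<^sup>2) 1))"
    by (intro prod_mono conjI sg_0_range sg_0_upper)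
  also have "\<dots> = exp (\<Sum>i<d. - (3 / 5) * min ((u i)\<^sup>2) 1)" by (rule exp_sum[symmetric]) simp
  also have "(\<Sum>i<d. - (3 / 5) * min ((u i)\<^sup>2) 1) = - (3 / 5) * (\<Sum>i<d. min ((u i)\<^sup>2) 1)"
    by (rule sum_distrib_left[symmetric])
  also have "min (nsq d u) 1 \<le> (\<Sum>i<d. min ((u i)\<^sup>2) 1)"
  proof (cases "\<exists>m<d. 1 \<le> (u m)\<^sup>2")
    case True
    then obtain m where m: "m < d" "1 \<le> (u m)\<^sup>2" by blast
    have "min ((u m)\<^sup>2) 1 \<le> (\<Sum>i<d. min ((u i)\<^sup>2) 1)" using m by (intro member_le_sum) auto
    then show ?thesis using m by simp
  next
    case False
    then have "(\<Sum>i<d. min ((u i)\<^sup>2) 1) = nsq d u" unfolding nsq_def by (intro sum.cong) force+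
    then show ?thesis by simp
  qed
  then have "exp (- (3 / 5) * (\<Sum>i<d. min ((u i)\<^sup>2) 1)) \<le> exp (- (3 / 5) * min (nsq d u) 1)" by simp
  finally show "psi d (unit_index d) u \<le> exp (- (3 / 5) * min (nsq d u) 1)" unfolding e .
qed

text \<open>
  A product of numbers in \<open>[0,1]\<close> is at least 1 minus the sum of their distances to 1.
\<close>

lemma psi_0_lower:
  assumes "nsq d u \<le> 1"
  shows "1 - 7 / 10 * nsq d u \<le> psi d (unit_index d) u"
proof -
  have e: "psi d (unit_index d) u = (\<Prod>i<d. sg 0 (u i))"
    unfolding psi_def by (intro prod.cong) (auto simp: unit_index_def)
  have u1: "\<bar>u i\<bar> \<le> 1" if "i < d" for i
  proof -
    have "(u i)\<^sup>2 \<le> nsq d u" unfolding nsq_def using that by (intro member_le_sum) auto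
    then show ?thesis using assms by (simp add: abs_square_le_1[symmetric])
  qed
  have "1 - (\<Sum>i<m. 1 - sg 0 (u i)) \<le> (\<Prod>i<m. sg 0 (u i))" for m
  proof (induction m)
    case (Suc m)
    have p: "0 \<le> (\<Prod>i<m. sg 0 (u i))" "(\<Prod>i<m. sg 0 (u i)) \<le> 1"
      by (auto intro!: prod_nonneg prod_le_1 sg_0_range)
    have "0 \<le> (1 - (\<Prod>i<m. sg 0 (u i))) * (1 - sg 0 (u m))"
      using p sg_0_range[of "u m"] by (intro mult_nonneg_nonneg) auto
    then show ?case using Suc by (simp add: algebra_simps)
  qed simp
  from this[of d] have "1 - (\<Sum>i<d. 1 - sg 0 (u i)) \<le> psi d (unit_index d) u" unfolding e .
  moreover have "(\<Sum>i<d. 1 - sg 0 (u i)) \<le> (\<Sum>i<d. 7 / 10 * (u i)\<^sup>2)"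
  proof (rule sum_mono)
    fix i assume "i \<in> {..<d}"
    then have "1 - 7 / 10 * (u i)\<^sup>2 \<le> sg 0 (u i)" using u1 by (intro sg_0_lower) auto
    then show "1 - sg 0 (u i) \<le> 7 / 10 * (u i)\<^sup>2" by linarith
  qed
  ultimately show ?thesis by (simp add: nsq_def sum_distrib_left)
qed

text \<open>
  The value, gradient and Hessian of the kernel at 0: the derivatives of \<open>sinc\<^sup>4\<close> of order 0, 1, 2 at 0 are
  1, 0 and -4/3. Thus the interpolation matrix is diagonal for a single spike.
\<close>

lemma psi_unit_at_0:
  assumes "j \<le> d" "k \<le> d"
  shows "psi d (\<lambda>i. unit_index j i + unit_index k i) (\<lambda>i. 0) = (if j = k then (if j = d then 1 else - 4 / 3) else 0)"
proof (cases "j = k")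
  case True
  show ?thesis
  proof (cases "j = d")
    case False
    then have "j < d" using assms by simp
    then have "psi d (\<lambda>i. unit_index j i + unit_index k i) (\<lambda>i. 0) = sg 2 0 * (\<Prod>i\<in>{..<d} - {j}. sg 0 0)"
      unfolding psi_def True[symmetric] by (subst prod.remove[of _ j]) (auto simp: unit_index_def numeral_2_eq_2 intro!: prod.cong)
    then show ?thesis using True False by (simp add: sg_at_0)
  next
    case dd: True
    then have "psi d (\<lambda>i. unit_index j i + unit_index k i) (\<lambda>i. 0) = (\<Prod>i<d. sg 0 0)"
      unfolding psi_def True[symmetric] by (intro prod.cong) (auto simp: unit_index_def)
    then show ?thesis using True dd by (simp add: sg_at_0)
  qed
next
  case False
  then obtain m where m: "m < d" "unit_index j m + unit_index k m = 1"
    using assms unfolding unit_index_def by (metis add_0 add.right_neutral le_neq_implies_less)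
  then have "sg (unit_index j m + unit_index k m) 0 = 0" using sg_at_0(2) by simp
  then have "psi d (\<lambda>i. unit_index j i + unit_index k i) (\<lambda>i. 0) = 0"
    unfolding psi_def using m(1) by (intro prod_zero) auto
  then show ?thesis using False by simp
qed

section \<open>Interpolation at separated centres\<close>

lemma nsq_L2_set: "nsq d u = (L2_set u {..<d})\<^sup>2"
  by (simp add: nsq_def L2_set_def sum_nonneg)

lemma nsq_nonneg: "0 \<le> nsq d u"
  by (simp add: nsq_def sum_nonneg)

text \<open>
  The mean value theorem twice, for a function whose slope vanishes at the start.
\<close>

lemma flat_start_bound:
  fixes f :: "real \<Rightarrow> real"
  assumes f: "\<And>s. (f has_real_derivative f' s) (at s)" and f': "\<And>s. (f' has_real_derivative f'' s) (at s)"
    and z: "f' 0 = 0" and b: "\<And>s. 0 \<le> s \<Longrightarrow> s \<le> 1 \<Longrightarrow> \<bar>f'' s\<bar> \<le> K"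
  shows "\<bar>f 1 - f 0\<bar> \<le> K"
proof -
  obtain s where s: "0 < s" "s < 1" "f 1 - f 0 = (1 - 0) * f' s"
    using MVT2[of 0 1 f f'] f by auto
  obtain r where r: "0 < r" "r < s" "f' s - f' 0 = (s - 0) * f'' r"
    using MVT2[of 0 s f' f''] f' s by auto
  have "\<bar>f 1 - f 0\<bar> = s * \<bar>f'' r\<bar>" using s r z by (simp add: abs_mult)
  also have "\<dots> \<le> 1 * K" using b[of r] r s by (intro mult_mono) auto
  finally show ?thesis by simp
qed

locale separated_centres =
  fixes d s :: nat and v :: "nat \<Rightarrow> nat \<Rightarrow> real"
  assumes d: "1 \<le> d" and s: "1 \<le> s"
    and sep: "\<And>k l. k \<in> {1..s} \<Longrightarrow> l \<in> {1..s} \<Longrightarrow> k \<noteq> l \<Longrightarrow>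
        1862000 * real s * real d ^ 7 \<le> (nsq d (\<lambda>i. v k i - v l i))\<^sup>2"
begin

text \<open>
  The derivative with index \<open>unit_index j'\<close> of the combination, with coefficients \<open>c\<close>, of translates of the
  kernel and of its first partial derivatives. So \<open>interp c d\<close> is the combination itself, and \<open>interp c j\<close>
  for \<open>j < d\<close> is its \<open>j\<close>-th partial derivative.
\<close>

definition interp :: "(nat \<Rightarrow> nat \<Rightarrow> real) \<Rightarrow> nat \<Rightarrow> (nat \<Rightarrow> real) \<Rightarrow> real" where
  "interp c j' x = (\<Sum>l\<in>{1..s}. \<Sum>j\<le>d. c l j * psi d (\<lambda>i. unit_index j i + unit_index j' i) (\<lambda>i. x i - v l i))"

lemma psi_small:
  assumes C: "0 < C" and far: "C * real s * real d ^ 7 \<le> (nsq d x)\<^sup>2" and D: "psi_order d D \<le> q" "q \<le> 3"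
  shows "\<bar>psi d D x\<bar> \<le> 16 * 4 ^ q / (C * real s * real d ^ 5)"
proof -
  have sd: "0 < real s" "0 < real d" using s d by auto
  have "C * real s * real d ^ 7 * \<bar>psi d D x\<bar> \<le> (nsq d x)\<^sup>2 * \<bar>psi d D x\<bar>"
    using far by (rule mult_right_mono) simp
  also have "\<dots> \<le> 16 * 4 ^ psi_order d D * (real d)\<^sup>2" using D d by (intro psi_decay) auto
  also have "\<dots> \<le> 16 * 4 ^ q * (real d)\<^sup>2" using D by (intro mult_right_mono mult_left_mono power_increasing) auto
  finally have "(C * real s * real d ^ 5 * \<bar>psi d D x\<bar>) * (real d)\<^sup>2 \<le> (16 * 4 ^ q) * (real d)\<^sup>2"
    by (simp add: mult_ac power_add[symmetric] flip: power2_eq_square)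
  then have "C * real s * real d ^ 5 * \<bar>psi d D x\<bar> \<le> 16 * 4 ^ q"
    using sd by (simp add: mult_le_cancel_right)
  then show ?thesis using sd C by (simp add: le_divide_eq mult_ac)
qed

lemma order_two: "j \<le> d \<Longrightarrow> j' \<le> d \<Longrightarrow> psi_order d (\<lambda>i. unit_index j i + unit_index j' i) \<le> 2"
  by (simp add: order_add unit_index_order)

text \<open>
  The conditions form a linear system for the \<open>s (d + 1)\<close> coefficients. After multiplying the rows for
  partial derivatives by -3/4, the diagonal blocks are the identity by \<open>psi_unit_at_0\<close>, and each entry between
  different centres is at most \<open>256 / (1862000 s d\<^sup>5)\<close> by decay and separation, so that rows sum to
  \<open>O(d\<^sup>-\<^sup>4)\<close>.
\<close>

lemma interpolation_exists:
  assumes b: "\<And>k. k \<in> {1..s} \<Longrightarrow> \<bar>b k\<bar> \<le> 1"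
  obtains c where "\<And>k. k \<in> {1..s} \<Longrightarrow> interp c d (v k) = b k"
    and "\<And>k j. k \<in> {1..s} \<Longrightarrow> j < d \<Longrightarrow> interp c j (v k) = 0"
    and "\<And>k. k \<in> {1..s} \<Longrightarrow> \<bar>c k d - b k\<bar> \<le> 55 / 100000 / real d ^ 4"
    and "\<And>k j. k \<in> {1..s} \<Longrightarrow> j < d \<Longrightarrow> \<bar>c k j\<bar> \<le> 55 / 100000 / real d ^ 4"
proof -
  \<comment> \<open>the reciprocals of the diagonal entries 1 and -4/3\<close>
  define g :: "nat \<Rightarrow> real" where "g j = (if j = d then 1 else - 3 / 4)" for j
  define M :: "nat \<times> nat \<Rightarrow> nat \<times> nat \<Rightarrow> real" where
    "M = (\<lambda>(k, j') (l, j). if k = l then 0 else g j' * psi d (\<lambda>i. unit_index j i + unit_index j' i) (\<lambda>i. v k i - v l i))"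
  define t :: "nat \<times> nat \<Rightarrow> real" where "t = (\<lambda>(k, j). if j = d then b k else 0)"
  let ?I = "{1..s} \<times> {..d}"
  \<comment> \<open>slightly above the row sum \<open>512 / 1862000 / d\<^sup>4\<close>; the solution is then within \<open>2 e\<close> of the data\<close>
  define e where "e = 275 / 1000000 / real d ^ 4"
  have dp: "1 \<le> real d ^ 4" using d by simp
  have e2: "e \<le> 1 / 2" and e0: "0 \<le> e"
  proof -
    have "275 / 1000000 / real d ^ 4 \<le> 275 / 1000000 / 1" using dp d by (intro divide_left_mono) auto
    then show "e \<le> 1 / 2" "0 \<le> e" by (simp_all add: e_def)
  qed
  have row: "(\<Sum>q\<in>?I. \<bar>M p q\<bar>) \<le> e" if pI: "p \<in> ?I" for p
  proof -
    obtain k j' where p: "p = (k, j')" "k \<in> {1..s}" "j' \<le> d" using pI by (cases p) auto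
    have each: "\<bar>M p q\<bar> \<le> 16 * 4 ^ 2 / (1862000 * real s * real d ^ 5)" if qI: "q \<in> ?I" for q
    proof -
      obtain l j where q: "q = (l, j)" "l \<in> {1..s}" "j \<le> d" using qI by (cases q) auto
      show ?thesis
      proof (cases "k = l")
        case True
        then show ?thesis by (simp add: M_def p q)
      next
        case False
        have "\<bar>M p q\<bar> \<le> 1 * \<bar>psi d (\<lambda>i. unit_index j i + unit_index j' i) (\<lambda>i. v k i - v l i)\<bar>"
          using False unfolding M_def p q by (simp add: abs_mult) (intro mult_left_le_one_le, auto simp: g_def)
        also have "\<dots> \<le> 16 * 4 ^ 2 / (1862000 * real s * real d ^ 5)"
          using psi_small[OF _ sep[OF p(2) q(2) False] order_two[OF q(3) p(3)]] by simp
        finally show ?thesis .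
      qed
    qed
    have "(\<Sum>q\<in>?I. \<bar>M p q\<bar>) \<le> real (card ?I) * (16 * 4 ^ 2 / (1862000 * real s * real d ^ 5))"
      by (rule sum_bounded_above) (rule each)
    also have "\<dots> = (real d + 1) * (256 / (1862000 * real d ^ 5))"
    proof -
      have h: "a * B * (16 * 4 ^ 2 / (1862000 * a * E)) = B * (256 / (1862000 * E))" if "a \<noteq> 0" for a B E :: real
        using that by simp
      have "real (card ?I) = real s * (real d + 1)" by (simp add: card_cartesian_product algebra_simps)
      then show ?thesis using h[of "real s" "real d + 1" "real d ^ 5"] s by simp
    qed
    also have "\<dots> \<le> (real d + real d) * (256 / (1862000 * real d ^ 5))"
      using d by (intro mult_right_mono) auto
    also have "\<dots> = 512 / 1862000 / real d ^ 4" using d by (simp add: field_simps power_numeral_reduce)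
    also have "\<dots> \<le> e" unfolding e_def by (intro divide_right_mono) auto
    finally show ?thesis .
  qed
  have tb: "\<bar>t p\<bar> \<le> 1" if "p \<in> ?I" for p using that b by (auto simp: t_def)
  obtain c where c: "\<And>p. p \<in> ?I \<Longrightarrow> c p + (\<Sum>q\<in>?I. M p q * c q) = t p"
    and cb: "\<And>p. p \<in> ?I \<Longrightarrow> \<bar>c p - t p\<bar> \<le> 2 * e * 1"
  proof (rule perturbed_identity_solvable[of ?I M e t 1])
    show "finite ?I" by simp
  qed (use row e0 e2 tb in \<open>assumption | blast\<close>)+
  define c' where "c' k j = c (k, j)" for k j
  have val: "g j' * interp c' j' (v k) = t (k, j')" if k: "k \<in> {1..s}" and j': "j' \<le> d" for k j'
  proof -
    have "g j' * interp c' j' (v k) = (\<Sum>l\<in>{1..s}. \<Sum>j\<le>d. g j' * (c' l j * psi d (\<lambda>i. unit_index j i + unit_index j' i) (\<lambda>i. v k i - v l i)))"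
      by (simp add: interp_def sum_distrib_left)
    also have "\<dots> = (\<Sum>l\<in>{1..s}. \<Sum>j\<le>d. (if l = k \<and> j = j' then c (k, j') else 0) + M (k, j') (l, j) * c (l, j))"
    proof (intro sum.cong refl)
      fix l j assume "j \<in> {..d}"
      then show "g j' * (c' l j * psi d (\<lambda>i. unit_index j i + unit_index j' i) (\<lambda>i. v k i - v l i))
         = (if l = k \<and> j = j' then c (k, j') else 0) + M (k, j') (l, j) * c (l, j)"
        using psi_unit_at_0[of j d j'] j' by (auto simp: M_def c'_def g_def)
    qed
    also have "\<dots> = (\<Sum>l\<in>{1..s}. \<Sum>j\<le>d. (if l = k \<and> j = j' then c (k, j') else 0)) + (\<Sum>q\<in>?I. M (k, j') q * c q)"
      by (simp add: sum.distrib sum.cartesian_product)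
    also have "(\<Sum>l\<in>{1..s}. \<Sum>j\<le>d. (if l = k \<and> j = j' then c (k, j') else 0)) = (\<Sum>l\<in>{1..s}. if l = k then c (k, j') else 0)"
      using j' by (intro sum.cong refl) simp
    also have "\<dots> = c (k, j')" using k by (simp add: sum.delta)
    finally show ?thesis using c[of "(k, j')"] k j' by simp
  qed
  show ?thesis
  proof (rule that[of c'])
    fix k assume k: "k \<in> {1..s}"
    show "interp c' d (v k) = b k" using val[OF k, of d] by (simp add: g_def t_def)
    show "\<bar>c' k d - b k\<bar> \<le> 55 / 100000 / real d ^ 4"
      using cb[of "(k, d)"] k by (simp add: c'_def t_def e_def)
    fix j assume j: "j < d"
    then show "interp c' j (v k) = 0" using val[OF k, of j] by (simp add: g_def t_def)
    show "\<bar>c' k j\<bar> \<le> 55 / 100000 / real d ^ 4"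
      using cb[of "(k, j)"] k j by (simp add: c'_def t_def e_def)
  qed
qed

text \<open>
  A point near centre \<open>k\<close>, or for which \<open>k\<close> is at most as far as \<open>l\<close>, has at least half the separation
  distance to \<open>l\<close>; in fourth powers this costs a factor 16.
\<close>

lemma dist_other:
  assumes k: "k \<in> {1..s}" and l: "l \<in> {1..s}" and kl: "k \<noteq> l"
    and near: "nsq d (\<lambda>i. x i - v k i) \<le> 1 \<or> nsq d (\<lambda>i. x i - v k i) \<le> nsq d (\<lambda>i. x i - v l i)"
  shows "116000 * real s * real d ^ 7 \<le> (nsq d (\<lambda>i. x i - v l i))\<^sup>2"
proof -
  let ?n = "\<lambda>u. L2_set u {..<d}"
  let ?a = "?n (\<lambda>i. x i - v k i)" and ?b = "?n (\<lambda>i. x i - v l i)" and ?D = "?n (\<lambda>i. v k i - v l i)"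
  have nn: "0 \<le> ?a" "0 \<le> ?b" "0 \<le> ?D" by (auto intro: L2_set_nonneg)
  have tri: "?D \<le> ?a + ?b"
  proof -
    have "?D = ?n (\<lambda>i. (v k i - x i) + (x i - v l i))" by simp
    also have "\<dots> \<le> ?n (\<lambda>i. v k i - x i) + ?b" by (rule L2_set_triangle_ineq)
    also have "?n (\<lambda>i. v k i - x i) = ?a" by (simp add: L2_set_def power2_commute)
    finally show ?thesis .
  qed
  \<comment> \<open>the factor 2 in \<open>?D \<le> 2 * ?b\<close> below becomes 16, and \<open>16 * 116000 \<le> 1862000\<close>\<close>
  have D4: "1862000 * real s * real d ^ 7 \<le> ?D ^ 4"
    using sep[OF k l kl] by (simp add: nsq_L2_set power_mult[symmetric])
  have "1 * 1 \<le> real s * real d ^ 7" using s d by (intro mult_mono) auto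
  then have "16 \<le> ?D ^ 4" using D4 by linarith
  then have D2: "2 \<le> ?D" using power_less_imp_less_base[of 2 4 ?D] nn by (cases "?D < 2") (auto dest: power_strict_mono[of ?D 2 4])
  have "?a \<le> 1 \<or> ?a \<le> ?b"
    using near nn unfolding nsq_L2_set by (auto simp: abs_square_le_1 power2_le_iff_abs_le abs_le_square_iff[symmetric])
  then have "?D \<le> 2 * ?b" using tri D2 by linarith
  then have "?D ^ 4 \<le> (2 * ?b) ^ 4" using nn by (intro power_mono)
  then have "?D ^ 4 \<le> 16 * ?b ^ 4" by (simp add: power_mult_distrib)
  then have "116000 * real s * real d ^ 7 \<le> ?b ^ 4"
    using D4 \<open>1 * 1 \<le> real s * real d ^ 7\<close> by linarith
  then show ?thesis by (simp add: nsq_L2_set power_mult[symmetric])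
qed

text \<open>
  If \<open>x\<close> is far from all centres but \<open>k\<close>, then the interpolant and its derivatives up to order 2 differ
  little from \<open>c k d\<close> times those of the kernel at \<open>k\<close>: the coefficients of the partial derivatives at \<open>k\<close> are small, and all terms of the other
  centres are small by decay.
\<close>

lemma remainder_bound:
  assumes k: "k \<in> {1..s}"
    and c1: "\<And>l. l \<in> {1..s} \<Longrightarrow> \<bar>c l d\<bar> \<le> 2"
    and c2: "\<And>l j. l \<in> {1..s} \<Longrightarrow> j < d \<Longrightarrow> \<bar>c l j\<bar> \<le> 55 / 100000 / real d ^ 4"
    and far: "\<And>l. l \<in> {1..s} \<Longrightarrow> l \<noteq> k \<Longrightarrow> 116000 * real s * real d ^ 7 \<le> (nsq d (\<lambda>i. x i - v l i))\<^sup>2"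
    and D: "psi_order d D \<le> 2"
  shows "\<bar>(\<Sum>l\<in>{1..s}. \<Sum>j\<le>d. c l j * psi d (\<lambda>i. unit_index j i + D i) (\<lambda>i. x i - v l i))
      - c k d * psi d (\<lambda>i. unit_index d i + D i) (\<lambda>i. x i - v k i)\<bar> \<le> 4 / 100 / real d"
proof -
  let ?P = "\<lambda>l j. psi d (\<lambda>i. unit_index j i + D i) (\<lambda>i. x i - v l i)"
  have sd: "1 \<le> real s" "1 \<le> real d" using s d by auto
  have od: "psi_order d (\<lambda>i. unit_index j i + D i) \<le> 3" for j
    using D by (simp add: order_add unit_index_order)
  have dset: "{..d} = insert d {..<d}" by auto
  have split: "(\<Sum>j\<le>d. c l j * ?P l j) = c l d * ?P l d + (\<Sum>j<d. c l j * ?P l j)" for l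
    unfolding dset by simp
  have grad: "\<bar>\<Sum>j<d. c l j * ?P l j\<bar> \<le> real d * (55 / 100000 / real d ^ 4 * Q)"
    if l: "l \<in> {1..s}" and Q: "\<And>j. j < d \<Longrightarrow> \<bar>?P l j\<bar> \<le> Q" for l Q
  proof -
    have "\<bar>\<Sum>j<d. c l j * ?P l j\<bar> \<le> (\<Sum>j<d. \<bar>c l j * ?P l j\<bar>)" by (rule sum_abs)
    also have "\<dots> \<le> real (card {..<d}) * (55 / 100000 / real d ^ 4 * Q)"
    proof (rule sum_bounded_above)
      fix j assume "j \<in> {..<d}"
      then have j: "j < d" by simp
      show "\<bar>c l j * ?P l j\<bar> \<le> 55 / 100000 / real d ^ 4 * Q"
        unfolding abs_mult by (intro mult_mono c2[OF l j] Q[OF j]) auto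
    qed
    finally show ?thesis by simp
  qed
  have own: "\<bar>\<Sum>j<d. c k j * ?P k j\<bar> \<le> real d * (55 / 100000 / real d ^ 4 * 64)"
  proof (rule grad[OF k])
    fix j
    have "\<bar>?P k j\<bar> \<le> 4 ^ psi_order d (\<lambda>i. unit_index j i + D i)" by (rule psi_bound[OF od])
    also have "\<dots> \<le> 4 ^ 3" using od by (intro power_increasing) auto
    finally show "\<bar>?P k j\<bar> \<le> 64" by simp
  qed
  have other: "\<bar>\<Sum>j\<le>d. c l j * ?P l j\<bar> \<le> 2 * (256 / (116000 * real s * real d ^ 5)) + real d * (55 / 100000 / real d ^ 4 * (1024 / (116000 * real s * real d ^ 5)))"
    if l: "l \<in> {1..s} - {k}" for l
  proof -
    have far': "116000 * real s * real d ^ 7 \<le> (nsq d (\<lambda>i. x i - v l i))\<^sup>2" using far l by auto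
    have o2: "psi_order d (\<lambda>i. unit_index d i + D i) \<le> 2" using D by (simp add: order_add unit_index_order)
    have "\<bar>?P l d\<bar> \<le> 256 / (116000 * real s * real d ^ 5)"
      using psi_small[OF _ far' o2] by simp
    then have "\<bar>c l d * ?P l d\<bar> \<le> 2 * (256 / (116000 * real s * real d ^ 5))"
      using c1[of l] l unfolding abs_mult by (intro mult_mono) auto
    moreover have "\<bar>\<Sum>j<d. c l j * ?P l j\<bar> \<le> real d * (55 / 100000 / real d ^ 4 * (1024 / (116000 * real s * real d ^ 5)))"
      using psi_small[OF _ far' od] l by (intro grad) auto
    ultimately show ?thesis unfolding split by linarith
  qed
  have "(\<Sum>l\<in>{1..s}. \<Sum>j\<le>d. c l j * ?P l j) - c k d * ?P k d
     = (\<Sum>j<d. c k j * ?P k j) + (\<Sum>l\<in>{1..s} - {k}. \<Sum>j\<le>d. c l j * ?P l j)"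
    using k by (subst sum.remove[of _ k]) (auto simp: split)
  then have "\<bar>(\<Sum>l\<in>{1..s}. \<Sum>j\<le>d. c l j * ?P l j) - c k d * ?P k d\<bar>
     \<le> \<bar>\<Sum>j<d. c k j * ?P k j\<bar> + (\<Sum>l\<in>{1..s} - {k}. \<bar>\<Sum>j\<le>d. c l j * ?P l j\<bar>)"
    using abs_triangle_ineq[of "\<Sum>j<d. c k j * ?P k j" "\<Sum>l\<in>{1..s} - {k}. \<Sum>j\<le>d. c l j * ?P l j"]
      sum_abs[of "\<lambda>l. \<Sum>j\<le>d. c l j * ?P l j" "{1..s} - {k}"] by linarith
  also have "(\<Sum>l\<in>{1..s} - {k}. \<bar>\<Sum>j\<le>d. c l j * ?P l j\<bar>)
     \<le> real (card ({1..s} - {k})) * (2 * (256 / (116000 * real s * real d ^ 5)) + real d * (55 / 100000 / real d ^ 4 * (1024 / (116000 * real s * real d ^ 5))))"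
    by (rule sum_bounded_above) (rule other)
  also have "\<dots> \<le> real s * (2 * (256 / (116000 * real s * real d ^ 5)) + real d * (55 / 100000 / real d ^ 4 * (1024 / (116000 * real s * real d ^ 5))))"
  proof (intro mult_right_mono)
    have "card ({1..s} - {k}) \<le> card {1..s}" by (intro card_mono) auto
    then show "real (card ({1..s} - {k})) \<le> real s" by simp
  qed (use sd in auto)
  also have "\<dots> = 512 / 116000 / real d ^ 5 + 55 / 100000 * 1024 / 116000 / real d ^ 8"
    using sd by (simp add: field_simps power_numeral_reduce)
  also note own
  also have "real d * (55 / 100000 / real d ^ 4 * 64) = 3520 / 100000 / real d ^ 3"
    using sd by (simp add: field_simps power_numeral_reduce)
  finally have "\<bar>(\<Sum>l\<in>{1..s}. \<Sum>j\<le>d. c l j * ?P l j) - c k d * ?P k d\<bar>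
     \<le> 3520 / 100000 / real d ^ 3 + (512 / 116000 / real d ^ 5 + 55 / 100000 * 1024 / 116000 / real d ^ 8)"
    by simp
  also have "\<dots> \<le> 3520 / 100000 / real d + (445 / 100000 / real d + 1 / 100000 / real d)"
  proof (intro add_mono)
    have p: "real d \<le> real d ^ 3" "real d \<le> real d ^ 5" "real d \<le> real d ^ 8"
      using sd power_increasing[of 1 _ "real d"] by auto
    show "3520 / 100000 / real d ^ 3 \<le> 3520 / 100000 / real d" using p sd by (intro divide_left_mono) auto
    have "512 / 116000 / real d ^ 5 \<le> 512 / 116000 / real d" using p sd by (intro divide_left_mono) auto
    also have "\<dots> \<le> 445 / 100000 / real d" using sd by (intro divide_right_mono) auto
    finally show "512 / 116000 / real d ^ 5 \<le> 445 / 100000 / real d" .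
    have "55 / 100000 * 1024 / 116000 / real d ^ 8 \<le> 55 / 100000 * 1024 / 116000 / real d" using p sd by (intro divide_left_mono) auto
    also have "\<dots> \<le> 1 / 100000 / real d" using sd by (intro divide_right_mono) auto
    finally show "55 / 100000 * 1024 / 116000 / real d ^ 8 \<le> 1 / 100000 / real d" .
  qed
  also have "\<dots> \<le> 4 / 100 / real d" using sd by (simp add: divide_simps)
  finally show ?thesis .
qed

end

section \<open>Dual certificates\<close>

context separated_centres
begin

lemma psi_cong_index: "(\<And>i. i < d \<Longrightarrow> D i = D' i) \<Longrightarrow> psi d D x = psi d D' x"
  unfolding psi_def by (intro prod.cong) auto

text \<open>
  The quantity in \<open>remainder_bound\<close>, as a function of the multi-index, so that it can be differentiated.
\<close>

definition residual :: "(nat \<Rightarrow> nat \<Rightarrow> real) \<Rightarrow> nat \<Rightarrow> (nat \<Rightarrow> nat) \<Rightarrow> (nat \<Rightarrow> real) \<Rightarrow> real" where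
  "residual c k D x = (\<Sum>l\<in>{1..s}. \<Sum>j\<le>d. c l j * psi d (\<lambda>i. unit_index j i + D i) (\<lambda>i. x i - v l i))
      - c k d * psi d (\<lambda>i. unit_index d i + D i) (\<lambda>i. x i - v k i)"

lemma residual_deriv:
  assumes D: "psi_order d D \<le> 1"
  shows "((\<lambda>t. residual c k D (\<lambda>i. v k i + t * u i)) has_real_derivative
     (\<Sum>a<d. u a * residual c k (\<lambda>i. D i + unit_index a i) (\<lambda>i. v k i + t * u i))) (at t)"
proof -
  have P: "((\<lambda>t. psi d (\<lambda>i. unit_index j i + D i) (\<lambda>i. (v k i + t * u i) - v l i)) has_real_derivative
      (\<Sum>a<d. u a * psi d (\<lambda>i. unit_index j i + (D i + unit_index a i)) (\<lambda>i. (v k i + t * u i) - v l i))) (at t)" for j l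
  proof -
    have "psi_order d (\<lambda>i. unit_index j i + D i) \<le> 2" using D by (simp add: order_add unit_index_order)
    from psi_ray_deriv[OF this, of "\<lambda>i. v k i - v l i" u t]
    show ?thesis by (simp add: algebra_simps)
  qed
  have "((\<lambda>t. residual c k D (\<lambda>i. v k i + t * u i)) has_real_derivative
     (\<Sum>l\<in>{1..s}. \<Sum>j\<le>d. c l j * (\<Sum>a<d. u a * psi d (\<lambda>i. unit_index j i + (D i + unit_index a i)) (\<lambda>i. (v k i + t * u i) - v l i)))
     - c k d * (\<Sum>a<d. u a * psi d (\<lambda>i. unit_index d i + (D i + unit_index a i)) (\<lambda>i. (v k i + t * u i) - v k i))) (at t)"
    unfolding residual_def by (intro DERIV_diff DERIV_sum DERIV_cmult P)
  also have "(\<Sum>l\<in>{1..s}. \<Sum>j\<le>d. c l j * (\<Sum>a<d. u a * psi d (\<lambda>i. unit_index j i + (D i + unit_index a i)) (\<lambda>i. (v k i + t * u i) - v l i)))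
     - c k d * (\<Sum>a<d. u a * psi d (\<lambda>i. unit_index d i + (D i + unit_index a i)) (\<lambda>i. (v k i + t * u i) - v k i))
     = (\<Sum>a<d. u a * residual c k (\<lambda>i. D i + unit_index a i) (\<lambda>i. v k i + t * u i))"
  proof -
    have "(\<Sum>l\<in>{1..s}. \<Sum>j\<le>d. c l j * (\<Sum>a<d. u a * Q a l j)) = (\<Sum>a<d. u a * (\<Sum>l\<in>{1..s}. \<Sum>j\<le>d. c l j * Q a l j))"
      for Q :: "nat \<Rightarrow> nat \<Rightarrow> nat \<Rightarrow> real"
    proof -
      have "(\<Sum>l\<in>{1..s}. \<Sum>j\<le>d. c l j * (\<Sum>a<d. u a * Q a l j)) = (\<Sum>l\<in>{1..s}. \<Sum>j\<le>d. \<Sum>a<d. u a * (c l j * Q a l j))"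
        by (simp add: sum_distrib_left mult.left_commute)
      also have "\<dots> = (\<Sum>l\<in>{1..s}. \<Sum>a<d. \<Sum>j\<le>d. u a * (c l j * Q a l j))"
        by (intro sum.cong refl sum.swap)
      also have "\<dots> = (\<Sum>a<d. \<Sum>l\<in>{1..s}. \<Sum>j\<le>d. u a * (c l j * Q a l j))" by (rule sum.swap)
      finally show ?thesis by (simp add: sum_distrib_left)
    qed
    then show ?thesis
      unfolding residual_def right_diff_distrib sum_subtractf by (simp add: sum_distrib_left mult.left_commute)
  qed
  finally show ?thesis .
qed

lemma interp_residual:
  "interp c d x = residual c k (unit_index d) x + c k d * psi d (unit_index d) (\<lambda>i. x i - v k i)"
proof -
  have "psi d (\<lambda>i. unit_index d i + unit_index d i) y = psi d (unit_index d) y" for y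
    by (rule psi_cong_index) (simp add: unit_index_def)
  then show ?thesis by (simp add: interp_def residual_def)
qed

text \<open>
  Along the segment from \<open>v k\<close> to \<open>x\<close> the residual has vanishing initial slope, because the interpolant and
  the kernel both have a critical point at \<open>v k\<close>. Its second derivative is a quadratic form with entries
  at most \<open>4/100 / d\<close>, hence at most \<open>4/100 |x - v k|\<^sup>2\<close> by Cauchy-Schwarz.
\<close>

lemma near_expansion:
  assumes k: "k \<in> {1..s}"
    and val: "interp c d (v k) = b k" and grad: "\<And>a. a < d \<Longrightarrow> interp c a (v k) = 0"
    and c1: "\<And>l. l \<in> {1..s} \<Longrightarrow> \<bar>c l d\<bar> \<le> 2"
    and c2: "\<And>l j. l \<in> {1..s} \<Longrightarrow> j < d \<Longrightarrow> \<bar>c l j\<bar> \<le> 55 / 100000 / real d ^ 4"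
    and near: "nsq d (\<lambda>i. x i - v k i) \<le> 1"
  shows "\<bar>interp c d x - b k - c k d * (psi d (unit_index d) (\<lambda>i. x i - v k i) - 1)\<bar> \<le> 4 / 100 * nsq d (\<lambda>i. x i - v k i)"
proof -
  define u where "u i = x i - v k i" for i
  let ?p = "\<lambda>t i. v k i + t * u i"
  define f where "f t = residual c k (unit_index d) (?p t)" for t
  define f' where "f' t = (\<Sum>a<d. u a * residual c k (\<lambda>i. unit_index d i + unit_index a i) (?p t))" for t
  define f'' where "f'' t = (\<Sum>a<d. u a * (\<Sum>b<d. u b * residual c k (\<lambda>i. (unit_index d i + unit_index a i) + unit_index b i) (?p t)))" for t
  have dp: "0 < real d" using d by simp
  have "\<bar>f 1 - f 0\<bar> \<le> 4 / 100 * nsq d u"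
  proof (rule flat_start_bound)
    show "(f has_real_derivative f' t) (at t)" for t
      unfolding f_def[abs_def] f'_def by (rule residual_deriv) (simp add: unit_index_order)
    show "(f' has_real_derivative f'' t) (at t)" for t
      unfolding f'_def[abs_def] f''_def
    proof (intro DERIV_sum DERIV_cmult residual_deriv)
      fix a assume "a \<in> {..<d}"
      then show "psi_order d (\<lambda>i. unit_index d i + unit_index a i) \<le> 1" by (simp add: order_add unit_index_order)
    qed
    have "residual c k (\<lambda>i. unit_index d i + unit_index a i) (v k) = 0" if a: "a < d" for a
    proof -
      have e: "psi d (\<lambda>i. unit_index j i + (unit_index d i + unit_index a i)) y = psi d (\<lambda>i. unit_index j i + unit_index a i) y" for j y
        by (rule psi_cong_index) (simp add: unit_index_def)
      show ?thesis
        using grad[OF a] psi_unit_at_0[of d d a] a by (simp add: residual_def e interp_def)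
    qed
    then show "f' 0 = 0" by (simp add: f'_def)
    fix t :: real assume t: "0 \<le> t" "t \<le> 1"
    have nt: "nsq d (\<lambda>i. ?p t i - v k i) \<le> 1"
    proof -
      have "nsq d (\<lambda>i. ?p t i - v k i) = t\<^sup>2 * nsq d u"
        by (simp add: nsq_def power_mult_distrib sum_distrib_left)
      also have "\<dots> \<le> 1 * 1" using t near nsq_nonneg[of d u] by (intro mult_mono) (auto simp: u_def[abs_def] power_le_one)
      finally show ?thesis by simp
    qed
    have R: "\<bar>residual c k (\<lambda>i. (unit_index d i + unit_index a i) + unit_index b i) (?p t)\<bar> \<le> 4 / 100 / real d" for a b
      unfolding residual_def
    proof (rule remainder_bound[where c = c and k = k, OF k c1 c2])
      show "116000 * real s * real d ^ 7 \<le> (nsq d (\<lambda>i. ?p t i - v l i))\<^sup>2" if "l \<in> {1..s}" "l \<noteq> k" for l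
        using that k nt by (intro dist_other[of k]) auto
      show "psi_order d (\<lambda>i. unit_index d i + unit_index a i + unit_index b i) \<le> 2"
        by (simp add: order_add unit_index_order)
    qed
    have "\<bar>f'' t\<bar> \<le> (\<Sum>a<d. \<Sum>b<d. \<bar>u a\<bar> * \<bar>u b\<bar> * (4 / 100 / real d))"
      unfolding f''_def sum_distrib_left
      unfolding abs_mult mult.assoc
      by (intro order_trans[OF sum_abs] sum_mono, unfold abs_mult) (intro mult_left_mono R abs_ge_zero)
    also have "\<dots> = (\<Sum>a<d. \<bar>u a\<bar>)\<^sup>2 * (4 / 100 / real d)"
      by (simp only: power2_eq_square sum_distrib_right sum_distrib_left mult.assoc) (rule sum.swap)
    also have "\<dots> \<le> (nsq d u * real d) * (4 / 100 / real d)"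
      using sum_squared_le_sum_of_squares[of "\<lambda>a. \<bar>u a\<bar>" "{..<d}"]
      by (intro mult_right_mono) (auto simp: nsq_def)
    also have "\<dots> = 4 / 100 * nsq d u" using dp by simp
    finally show "\<bar>f'' t\<bar> \<le> 4 / 100 * nsq d u" .
  qed
  moreover have "f 1 = interp c d x - c k d * psi d (unit_index d) (\<lambda>i. x i - v k i)"
    using interp_residual[of c x k] by (simp add: f_def u_def)
  moreover have "f 0 = b k - c k d"
  proof -
    have "psi d (unit_index d) (\<lambda>i. 0) = 1"
      using psi_unit_at_0[of d d d] psi_cong_index[of "unit_index d" "\<lambda>i. unit_index d i + unit_index d i"]
      by (simp add: unit_index_def)
    then show ?thesis using interp_residual[of c "v k" k] val by (simp add: f_def)
  qed
  ultimately show ?thesis by (simp add: u_def[abs_def] algebra_simps)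
qed

lemma exp_neg_le: "0 \<le> x \<Longrightarrow> exp (- x) \<le> 1 / (1 + x)" for x :: real
  using exp_ge_add_one_self[of x] by (simp add: exp_minus divide_simps)

text \<open>
  The interpolant with these data is a certificate. Its coefficients at the kernels differ from \<open>b\<close> by less
  than 1/1000, so near a centre it behaves like \<open>b k\<close> times the kernel (\<open>near_expansion\<close>), and elsewhere it is
  dominated by the kernel at the nearest centre (\<open>remainder_bound\<close>); the bounds on the kernel finish the
  proof. The argument would give about 1/3 in place of 23/96, which is the value that leads to the
  constant \<open>256 \<surd>2 / 23\<close> in \<open>localisation\<close>.
\<close>

theorem certificate_exists:
  assumes b: "\<And>k. k \<in> {1..s} \<Longrightarrow> \<bar>b k\<bar> \<le> 1"
  shows "\<exists>c. (\<forall>k\<in>{1..s}. interp c d (v k) = b k) \<and>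
    (\<forall>k\<in>{1..s}. \<forall>j<d. interp c j (v k) = 0) \<and>
    (\<Sum>k\<in>{1..s}. c k d * b k) \<le> 2 * real s \<and>
    (\<forall>x. \<bar>interp c d x\<bar> \<le> 2) \<and>
    (\<forall>k\<in>{1..s}. \<forall>x. nsq d (\<lambda>i. x i - v k i) \<le> 1 \<longrightarrow> \<bar>interp c d x - b k\<bar> \<le> nsq d (\<lambda>i. x i - v k i)) \<and>
    (\<forall>k\<in>{1..s}. \<forall>x. nsq d (\<lambda>i. x i - v k i) \<le> 1 \<longrightarrow> b k = 1 \<longrightarrow>
       \<bar>interp c d x\<bar> \<le> 1 - 23 / 96 * nsq d (\<lambda>i. x i - v k i)) \<and>
    (\<forall>x. (\<forall>k\<in>{1..s}. 1 \<le> nsq d (\<lambda>i. x i - v k i)) \<longrightarrow> \<bar>interp c d x\<bar> \<le> 1 - 23 / 96)"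
proof -
  obtain c where val: "\<And>k. k \<in> {1..s} \<Longrightarrow> interp c d (v k) = b k"
    and grad: "\<And>k j. k \<in> {1..s} \<Longrightarrow> j < d \<Longrightarrow> interp c j (v k) = 0"
    and ca: "\<And>k. k \<in> {1..s} \<Longrightarrow> \<bar>c k d - b k\<bar> \<le> 55 / 100000 / real d ^ 4"
    and cb: "\<And>k j. k \<in> {1..s} \<Longrightarrow> j < d \<Longrightarrow> \<bar>c k j\<bar> \<le> 55 / 100000 / real d ^ 4"
    using interpolation_exists[where b = b, OF b] by blast
  have d1: "1 \<le> real d" "1 \<le> real d ^ 4" using d by auto
  have ca': "\<bar>c k d - b k\<bar> \<le> 1 / 1000" if "k \<in> {1..s}" for k
  proof -
    have "55 / 100000 / real d ^ 4 \<le> 55 / 100000 / 1" using d1 by (intro divide_left_mono) auto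
    then show ?thesis using ca[OF that] by linarith
  qed
  have cb': "\<bar>c k d\<bar> \<le> 1001 / 1000" if "k \<in> {1..s}" for k
    using ca'[OF that] b[OF that] by linarith
  have cb2: "\<bar>c k d\<bar> \<le> 2" if "k \<in> {1..s}" for k using cb'[OF that] by linarith
  have far: "\<exists>k\<in>{1..s}. \<bar>interp c d x\<bar> \<le> 1001 / 1000 * psi d (unit_index d) (\<lambda>i. x i - v k i) + 4 / 100" for x
  proof -
    obtain k where k: "k \<in> {1..s}" and kmin: "\<And>l. l \<in> {1..s} \<Longrightarrow> nsq d (\<lambda>i. x i - v k i) \<le> nsq d (\<lambda>i. x i - v l i)"
    proof -
      let ?f = "\<lambda>k. nsq d (\<lambda>i. x i - v k i)"
      have "Min (?f ` {1..s}) \<in> ?f ` {1..s}" using s by (intro Min_in) auto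
      then obtain k where k: "k \<in> {1..s}" "?f k = Min (?f ` {1..s})" by auto
      have "?f k \<le> ?f l" if "l \<in> {1..s}" for l unfolding k(2) using that by (intro Min_le) auto
      with k(1) show ?thesis by (rule that)
    qed
    have "\<bar>residual c k (unit_index d) x\<bar> \<le> 4 / 100 / real d"
      unfolding residual_def
    proof (rule remainder_bound[where c = c and k = k, OF k cb2 cb])
      show "116000 * real s * real d ^ 7 \<le> (nsq d (\<lambda>i. x i - v l i))\<^sup>2" if "l \<in> {1..s}" "l \<noteq> k" for l
        using that k kmin[OF that(1)] by (intro dist_other[of k]) auto
      show "psi_order d (unit_index d) \<le> 2" unfolding unit_index_order by simp
    qed
    also have "\<dots> \<le> 4 / 100 / 1" using d1 by (intro divide_left_mono) auto
    finally have r: "\<bar>residual c k (unit_index d) x\<bar> \<le> 4 / 100" by simp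
    have "\<bar>c k d * psi d (unit_index d) (\<lambda>i. x i - v k i)\<bar> \<le> 1001 / 1000 * psi d (unit_index d) (\<lambda>i. x i - v k i)"
      unfolding abs_mult abs_of_nonneg[OF psi_0_upper(2)] by (intro mult_right_mono cb'[OF k] psi_0_upper(2))
    then have "\<bar>interp c d x\<bar> \<le> 1001 / 1000 * psi d (unit_index d) (\<lambda>i. x i - v k i) + 4 / 100"
      using r interp_residual[of c x k] by linarith
    then show ?thesis using k by blast
  qed
  have psi1: "psi d (unit_index d) y \<le> 1" for y
    by (rule order_trans[OF psi_0_upper(1)]) (simp add: nsq_nonneg)
  show ?thesis
  proof (intro exI[of _ c] conjI ballI allI impI)
    show "(\<Sum>k\<in>{1..s}. c k d * b k) \<le> 2 * real s"
    proof -
      have "(\<Sum>k\<in>{1..s}. c k d * b k) \<le> real (card {1..s}) * 2"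
      proof (rule sum_bounded_above)
        fix k assume k: "k \<in> {1..s}"
        have "\<bar>c k d * b k\<bar> \<le> 2 * 1" unfolding abs_mult using cb2[OF k] b[OF k] by (intro mult_mono) auto
        then show "c k d * b k \<le> 2" by linarith
      qed
      then show ?thesis by simp
    qed
    show "\<bar>interp c d x\<bar> \<le> 2" for x
    proof -
      obtain k where "\<bar>interp c d x\<bar> \<le> 1001 / 1000 * psi d (unit_index d) (\<lambda>i. x i - v k i) + 4 / 100"
        using far by blast
      then show ?thesis using psi1[of "\<lambda>i. x i - v k i"] by linarith
    qed
    show "\<bar>interp c d x\<bar> \<le> 1 - 23 / 96" if x: "\<forall>k\<in>{1..s}. 1 \<le> nsq d (\<lambda>i. x i - v k i)" for x
    proof -
      obtain k where k: "k \<in> {1..s}" "\<bar>interp c d x\<bar> \<le> 1001 / 1000 * psi d (unit_index d) (\<lambda>i. x i - v k i) + 4 / 100"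
        using far by blast
      have "psi d (unit_index d) (\<lambda>i. x i - v k i) \<le> exp (- (3 / 5) * 1)"
        using psi_0_upper(1)[of d "\<lambda>i. x i - v k i"] bspec[OF x k(1)] by (simp add: min_def split: if_splits)
      also have "\<dots> \<le> 1 / (1 + 3 / 5)" using exp_neg_le[of "3 / 5"] by simp
      finally show ?thesis using k(2) by simp
    qed
    fix k x assume k: "k \<in> {1..s}" and near: "nsq d (\<lambda>i. x i - v k i) \<le> 1"
    let ?n = "nsq d (\<lambda>i. x i - v k i)" and ?p = "psi d (unit_index d) (\<lambda>i. x i - v k i)"
    have E: "\<bar>interp c d x - b k - c k d * (?p - 1)\<bar> \<le> 4 / 100 * ?n"
      by (rule near_expansion[where c = c and k = k and b = b, OF k val[OF k] grad[OF k] cb2 cb near])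
    have n0: "0 \<le> ?n" by (rule nsq_nonneg)
    have low: "1 - ?p \<le> 7 / 10 * ?n" using psi_0_lower[OF near] by simp
    have p1: "0 \<le> 1 - ?p" using psi1 by simp
    have cp: "\<bar>c k d * (?p - 1)\<bar> \<le> 1001 / 1000 * (7 / 10 * ?n)"
      unfolding abs_mult using cb'[OF k] low p1 by (intro mult_mono) auto
    show "\<bar>interp c d x - b k\<bar> \<le> ?n" using E cp n0 by linarith
    assume b1: "b k = 1"
    have "?p \<le> exp (- (3 / 5 * ?n))" using psi_0_upper(1)[of d "\<lambda>i. x i - v k i"] near by simp
    also have "\<dots> \<le> 1 / (1 + 3 / 5 * ?n)" using n0 by (intro exp_neg_le) simp
    also have "\<dots> \<le> 1 - 3 / 8 * ?n"
    proof -
      have "0 \<le> ?n * (1 - ?n)" using n0 near by simp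
      then have "1 \<le> (1 - 3 / 8 * ?n) * (1 + 3 / 5 * ?n)" by (simp add: algebra_simps)
      then show ?thesis using n0 by (simp add: divide_le_eq)
    qed
    finally have up: "3 / 8 * ?n \<le> 1 - ?p" by simp
    have c_low: "999 / 1000 \<le> c k d" using ca'[OF k] b1 by linarith
    have "999 / 1000 * (3 / 8 * ?n) \<le> c k d * (1 - ?p)" using c_low up n0 by (intro mult_mono) auto
    then have "c k d * (?p - 1) \<le> - (999 / 1000 * (3 / 8 * ?n))" by (simp add: algebra_simps)
    then show "\<bar>interp c d x\<bar> \<le> 1 - 23 / 96 * ?n" using E cp b1 n0 near by linarith
  qed (use val grad in auto)
qed

end

section \<open>Transforms of measures\<close>

text \<open>
  The function \<open>g\<close> is the inverse transform of the symbol \<open>H\<close> on the cube; \<open>\<lambda>\<^sub>\<tau>\<close> has symbol 1.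
\<close>

definition has_band :: "nat \<Rightarrow> real \<Rightarrow> (vec \<Rightarrow> complex) \<Rightarrow> (vec \<Rightarrow> real) \<Rightarrow> bool" where
  "has_band d \<tau> H g \<longleftrightarrow> (\<exists>B. band_limited d \<tau> H B g)"

text \<open>
  The characteristic function of \<open>M\<close> at \<open>-w\<close>.
\<close>

definition measure_ft :: "nat \<Rightarrow> vec measure \<Rightarrow> vec \<Rightarrow> complex" where
  "measure_ft d M w = (\<integral>t. cis (- dotv d w t) \<partial>M)"

lemma has_bandD:
  assumes "has_band d \<tau> H g"
  shows "H \<in> borel_measurable (Rd d)"
    and "\<exists>B. \<forall>w\<in>space (Rd d). cmod (H w) \<le> B"
    and "\<And>w. w \<in> space (Rd d) \<Longrightarrow> ray_continuous d H w"
    and "\<And>x. x \<in> space (Rd d) \<Longrightarrow> complex_of_real (g x) =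
        (1 / 2) ^ d * (\<integral>w. (indicator (cube d (1 / \<tau>)) w *\<^sub>R H w) * cis (dotv d w x) \<partial>Rd d)"
    and "rkhs_norm_sq d \<tau> g = ennreal (band_energy d \<tau> H)"
  using assms unfolding has_band_def
  by (auto dest: band_limited.Hm band_limited.HB band_limited.Hray band_limited.g band_limited.rkhs_norm_sq_eq)

lemma has_bandI:
  assumes "H \<in> borel_measurable (Rd d)"
    and "\<And>w. w \<in> space (Rd d) \<Longrightarrow> cmod (H w) \<le> B"
    and "\<And>w. w \<in> space (Rd d) \<Longrightarrow> ray_continuous d H w"
    and "\<And>x. x \<in> space (Rd d) \<Longrightarrow> complex_of_real (g x) =
        (1 / 2) ^ d * (\<integral>w. (indicator (cube d (1 / \<tau>)) w *\<^sub>R H w) * cis (dotv d w x) \<partial>Rd d)"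
  shows "has_band d \<tau> H g"
  unfolding has_band_def using assms by (intro exI[of _ B]) (simp add: band_limited_def)

lemma has_band_integrable:
  assumes "has_band d \<tau> H g"
  shows "integrable (Rd d) (\<lambda>w. indicator (cube d R) w *\<^sub>R H w)"
proof -
  obtain B where "\<forall>w\<in>space (Rd d). cmod (H w) \<le> B" using has_bandD(2)[OF assms] by blast
  then show ?thesis using has_bandD(1)[OF assms] by (intro integrable_cube_bounded) auto
qed

lemma has_band_diff:
  assumes 1: "has_band d \<tau> H1 g1" and 2: "has_band d \<tau> H2 g2"
  shows "has_band d \<tau> (\<lambda>w. H1 w - H2 w) (\<lambda>x. g1 x - g2 x)"
proof -
  obtain B1 B2 where B: "\<forall>w\<in>space (Rd d). cmod (H1 w) \<le> B1" "\<forall>w\<in>space (Rd d). cmod (H2 w) \<le> B2"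
    using has_bandD(2)[OF 1] has_bandD(2)[OF 2] by blast
  note [measurable] = has_bandD(1)[OF 1] has_bandD(1)[OF 2]
  show ?thesis
  proof (rule has_bandI[where B = "B1 + B2"])
    show "(\<lambda>w. H1 w - H2 w) \<in> borel_measurable (Rd d)" by measurable
    fix w assume w: "w \<in> space (Rd d)"
    show "cmod (H1 w - H2 w) \<le> B1 + B2"
      using B w norm_triangle_ineq4[of "H1 w" "H2 w"] by (meson add_mono order_trans)
    show "ray_continuous d (\<lambda>w. H1 w - H2 w) w"
      using has_bandD(3)[OF 1 w] has_bandD(3)[OF 2 w] unfolding ray_continuous_def by (auto intro: tendsto_diff)
  next
    fix x assume x: "x \<in> space (Rd d)"
    let ?h = "\<lambda>H w. (indicator (cube d (1 / \<tau>)) w *\<^sub>R H w) * cis (dotv d w x)"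
    have [measurable]: "(\<lambda>w. dotv d w x) \<in> borel_measurable (Rd d)" using x by measurable
    have int: "integrable (Rd d) (?h H)" if "integrable (Rd d) (\<lambda>w. indicator (cube d (1 / \<tau>)) w *\<^sub>R H w)" for H :: "vec \<Rightarrow> complex"
    proof (rule Bochner_Integration.integrable_bound[OF that])
      have [measurable]: "(\<lambda>w. indicator (cube d (1 / \<tau>)) w *\<^sub>R H w) \<in> borel_measurable (Rd d)"
        using that by (rule borel_measurable_integrable)
      show "?h H \<in> borel_measurable (Rd d)" by measurable
    qed (simp add: norm_mult)
    have "(\<integral>w. ?h (\<lambda>w. H1 w - H2 w) w \<partial>Rd d) = (\<integral>w. ?h H1 w - ?h H2 w \<partial>Rd d)"
      by (intro Bochner_Integration.integral_cong refl) (simp add: algebra_simps)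
    also have "\<dots> = (\<integral>w. ?h H1 w \<partial>Rd d) - (\<integral>w. ?h H2 w \<partial>Rd d)"
      by (intro Bochner_Integration.integral_diff int has_band_integrable[OF 1] has_band_integrable[OF 2])
    finally show "complex_of_real (g1 x - g2 x) = (1 / 2) ^ d * (\<integral>w. ?h (\<lambda>w. H1 w - H2 w) w \<partial>Rd d)"
      using has_bandD(4)[OF 1 x] has_bandD(4)[OF 2 x] by (simp add: right_diff_distrib)
  qed
qed

lemma dotv_ray_lim:
  "(\<lambda>n. dotv d (vaffine d w (mesh n) v) t) \<longlonglongrightarrow> dotv d w t"
proof -
  have "(\<lambda>n. \<Sum>i<d. (w i + mesh n * v i) * t i) \<longlonglongrightarrow> (\<Sum>i<d. (w i + 0 * v i) * t i)"
    by (intro tendsto_intros mesh_lim)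
  then show ?thesis by (simp add: dotv_def vaffine_def)
qed

text \<open>
  Finite measures on subsets of the coordinate space, such as the Jordan parts of a signed measure on \<open>X\<close>
  or the law of a sample point.
\<close>

locale positioned_measure = finite_measure M for M :: "vec measure" +
  fixes d :: nat
  assumes position [measurable]: "(\<lambda>t. t) \<in> M \<rightarrow>\<^sub>M Rd d"
begin

lemma cis_meas: "w \<in> space (Rd d) \<Longrightarrow> (\<lambda>t. cis (- dotv d w t)) \<in> borel_measurable M"
  by measurable

lemma cis_integrable: "w \<in> space (Rd d) \<Longrightarrow> integrable M (\<lambda>t. cis (- dotv d w t))"
  using cis_meas by (intro integrable_const_bound[where B = 1]) auto

lemma measure_ft_measurable [measurable]: "measure_ft d M \<in> borel_measurable (Rd d)"
proof -
  have "(\<lambda>(w, t). cis (- dotv d w t)) \<in> borel_measurable (Rd d \<Otimes>\<^sub>M M)"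
    unfolding case_prod_beta' by measurable
  then show ?thesis unfolding measure_ft_def[abs_def] by (rule borel_measurable_lebesgue_integral)
qed

lemma measure_ft_bound: "cmod (measure_ft d M w) \<le> measure M (space M)"
proof -
  have "cmod (measure_ft d M w) \<le> (\<integral>t. norm (cis (- dotv d w t)) \<partial>M)" unfolding measure_ft_def by (rule integral_norm_bound)
  then show ?thesis by simp
qed

lemma measure_ft_ray: "w \<in> space (Rd d) \<Longrightarrow> ray_continuous d (measure_ft d M) w"
  unfolding ray_continuous_def measure_ft_def
proof
  fix v assume w: "w \<in> space (Rd d)" and v: "v \<in> space (Rd d)"
  show "(\<lambda>n. \<integral>t. cis (- dotv d (vaffine d w (mesh n) v) t) \<partial>M) \<longlonglongrightarrow> (\<integral>t. cis (- dotv d w t) \<partial>M)"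
  proof (rule integral_dominated_convergence[where w = "\<lambda>_. 1"])
    show "AE t in M. (\<lambda>n. cis (- dotv d (vaffine d w (mesh n) v) t)) \<longlonglongrightarrow> cis (- dotv d w t)"
      by (intro AE_I2 tendsto_intros dotv_ray_lim)
  qed (use w in \<open>auto intro: cis_meas\<close>)
qed

lemma has_band_conv:
  assumes K: "has_band d \<tau> A K"
  shows "has_band d \<tau> (\<lambda>w. A w * measure_ft d M w) (\<lambda>x. \<integral>t. K (vdiff d x t) \<partial>M)"
proof -
  obtain B where B: "\<forall>w\<in>space (Rd d). cmod (A w) \<le> B" using has_bandD(2)[OF K] by blast
  note [measurable] = has_bandD(1)[OF K]
  show ?thesis
  proof (rule has_bandI[where B = "\<bar>B\<bar> * measure M (space M)"])
    show "(\<lambda>w. A w * measure_ft d M w) \<in> borel_measurable (Rd d)" by measurable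
    fix w assume w: "w \<in> space (Rd d)"
    show "cmod (A w * measure_ft d M w) \<le> \<bar>B\<bar> * measure M (space M)"
      using B w measure_ft_bound[of w] unfolding norm_mult by (intro mult_mono) (auto intro: order_trans[OF _ abs_ge_self])
    show "ray_continuous d (\<lambda>w. A w * measure_ft d M w) w"
      using has_bandD(3)[OF K w] measure_ft_ray[OF w] unfolding ray_continuous_def by (auto intro: tendsto_mult)
  next
    fix x assume x: "x \<in> space (Rd d)"
    let ?a = "\<lambda>w. indicator (cube d (1 / \<tau>)) w *\<^sub>R A w"
    have "complex_of_real (\<integral>t. K (vdiff d x t) \<partial>M) = (\<integral>t. complex_of_real (K (vdiff d x t)) \<partial>M)"
      by (rule integral_complex_of_real[symmetric])
    also have "\<dots> = (\<integral>t. (1 / 2) ^ d * (1 * (\<integral>w. ?a w * cis (dotv d w (vdiff d x t)) \<partial>Rd d)) \<partial>M)"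
      by (simp add: has_bandD(4)[OF K vdiff_space])
    also have "\<dots> = (1 / 2) ^ d * (\<integral>t. 1 * (\<integral>w. ?a w * cis (dotv d w (vdiff d x t)) \<partial>Rd d) \<partial>M)"
      by (rule integral_mult_right_zero)
    also have "(\<integral>t. 1 * (\<integral>w. ?a w * cis (dotv d w (vdiff d x t)) \<partial>Rd d) \<partial>M)
        = (\<integral>w. ?a w * (\<integral>t. 1 * cis (dotv d w (vdiff d x t)) \<partial>M) \<partial>Rd d)"
    proof (rule fubini_kernel[OF sigma_finite_measure_axioms sigma_finite_Rd _ has_band_integrable[OF K], where C = 1])
      show "(\<lambda>(t, w). cis (dotv d w (vdiff d x t))) \<in> borel_measurable (M \<Otimes>\<^sub>M Rd d)"
      proof -
        have [measurable]: "(\<lambda>p. fst p) \<in> M \<Otimes>\<^sub>M Rd d \<rightarrow>\<^sub>M Rd d"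
          by (rule measurable_compose[OF measurable_fst position])
        show ?thesis unfolding case_prod_beta' using x
          by (intro measurable_compose[OF _ cis_measurable] dotv_measurable vdiff_measurable) auto
      qed
    qed auto
    also have "\<dots> = (\<integral>w. (indicator (cube d (1 / \<tau>)) w *\<^sub>R (A w * measure_ft d M w)) * cis (dotv d w x) \<partial>Rd d)"
    proof (intro Bochner_Integration.integral_cong refl)
      fix w
      have "(\<integral>t. 1 * cis (dotv d w (vdiff d x t)) \<partial>M) = (\<integral>t. cis (dotv d w x) * cis (- dotv d w t) \<partial>M)"
        by (simp add: dotv_vdiff cis_mult)
      also have "\<dots> = cis (dotv d w x) * measure_ft d M w" unfolding measure_ft_def by (rule integral_mult_right_zero)
      finally show "?a w * (\<integral>t. 1 * cis (dotv d w (vdiff d x t)) \<partial>M) = (indicator (cube d (1 / \<tau>)) w *\<^sub>R (A w * measure_ft d M w)) * cis (dotv d w x)"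
        by (simp add: scaleR_conv_of_real mult_ac)
    qed
    finally show "complex_of_real (\<integral>t. K (vdiff d x t) \<partial>M) = (1 / 2) ^ d * (\<integral>w. (indicator (cube d (1 / \<tau>)) w *\<^sub>R (A w * measure_ft d M w)) * cis (dotv d w x) \<partial>Rd d)" .
  qed
qed

end

lemma indicator_cube_prod:
  "w \<in> space (Rd d) \<Longrightarrow> indicator (cube d R) w = (\<Prod>i<d. indicator {-R..R} (w i) :: real)"
proof -
  assume w: "w \<in> space (Rd d)"
  have "(\<Prod>i<d. indicator {-R..R} (w i) :: real) = (if \<forall>i<d. w i \<in> {-R..R} then 1 else 0)"
    by (induction d) (auto simp: indicator_def less_Suc_eq)
  moreover have "w \<in> cube d R \<longleftrightarrow> (\<forall>i<d. w i \<in> {-R..R})"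
    using w by (auto simp: cube_def abs_le_iff minus_le_iff)
  ultimately show ?thesis by (simp add: indicator_def)
qed

lemma integral_box_scaled:
  assumes \<tau>: "0 < \<tau>"
  shows "integrable lborel (\<lambda>w. indicator {-(1/\<tau>)..1/\<tau>} w *\<^sub>R cis (w * x))"
    and "(\<integral>w. indicator {-(1/\<tau>)..1/\<tau>} w *\<^sub>R cis (w * x) \<partial>lborel) = complex_of_real (2 * (sinc (x / \<tau>) / \<tau>))"
proof -
  show "integrable lborel (\<lambda>w. indicator {-(1/\<tau>)..1/\<tau>} w *\<^sub>R cis (w * x))"
    using borel_integrable_atLeastAtMost'[of "-(1/\<tau>)" "1/\<tau>" "\<lambda>w. cis (w * x)"]
    by (simp add: set_integrable_def continuous_intros)
  have i: "indicator {-1..1} (0 + \<tau> * w) = (indicator {-(1/\<tau>)..1/\<tau>} w :: real)" for w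
    using \<tau> by (auto simp: indicator_def field_simps)
  have "complex_of_real (sincd 0 (x / \<tau>)) = \<tau> *\<^sub>R (\<integral>w. (indicator {-1..1} (0 + \<tau> * w) / 2) *\<^sub>R cis ((0 + \<tau> * w) * (x / \<tau>)) \<partial>lborel)"
    using \<tau> unfolding integral_box_cis[symmetric]
    by (subst lborel_integral_real_affine[where c = \<tau> and t = 0]) auto
  also have "(\<integral>w. (indicator {-1..1} (0 + \<tau> * w) / 2) *\<^sub>R cis ((0 + \<tau> * w) * (x / \<tau>)) \<partial>lborel)
     = (\<integral>w. (1 / 2) *\<^sub>R (indicator {-(1/\<tau>)..1/\<tau>} w *\<^sub>R cis (w * x)) \<partial>lborel)"
    unfolding i using \<tau> by (intro Bochner_Integration.integral_cong refl) simp
  also have "\<dots> = (1 / 2) *\<^sub>R (\<integral>w. indicator {-(1/\<tau>)..1/\<tau>} w *\<^sub>R cis (w * x) \<partial>lborel)"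
    by (rule integral_scaleR_right)
  finally have e: "complex_of_real (sincd 0 (x / \<tau>)) = \<tau> *\<^sub>R (1 / 2) *\<^sub>R (\<integral>w. indicator {-(1/\<tau>)..1/\<tau>} w *\<^sub>R cis (w * x) \<partial>lborel)" .
  show "(\<integral>w. indicator {-(1/\<tau>)..1/\<tau>} w *\<^sub>R cis (w * x) \<partial>lborel) = complex_of_real (2 * (sinc (x / \<tau>) / \<tau>))"
    unfolding sincd_0[symmetric] of_real_mult of_real_divide e using \<tau> by (simp add: scaleR_conv_of_real)
qed

lemma has_band_lam:
  assumes \<tau>: "0 < \<tau>"
  shows "has_band d \<tau> (\<lambda>_. 1) (lam d \<tau>)"
proof (rule has_bandI[where B = 1])
  fix x
  have "(\<integral>w. (indicator (cube d (1 / \<tau>)) w *\<^sub>R 1) * cis (dotv d w x) \<partial>Rd d)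
     = (\<integral>w. (\<Prod>i<d. indicator {-(1/\<tau>)..1/\<tau>} (w i) *\<^sub>R cis (w i * x i)) \<partial>Rd d)"
    by (intro Bochner_Integration.integral_cong refl)
       (simp add: indicator_cube_prod cis_dotv scaleR_conv_of_real prod.distrib)
  also have "\<dots> = (\<Prod>i<d. complex_of_real (2 * (sinc (x i / \<tau>) / \<tau>)))"
    unfolding Rd_def integral_box_scaled(2)[OF \<tau>, symmetric]
    by (rule Rd_factors.product_integral_prod, rule finite_lessThan, rule integral_box_scaled(1)[OF \<tau>])
  also have "\<dots> = complex_of_real (2 ^ d * lam d \<tau> x)"
    unfolding of_real_prod[symmetric] prod.distrib prod_dividef by (simp add: lam_def sinc_vec_def)
  finally show "complex_of_real (lam d \<tau> x) = (1 / 2) ^ d * (\<integral>w. (indicator (cube d (1 / \<tau>)) w *\<^sub>R 1) * cis (dotv d w x) \<partial>Rd d)"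
    by (simp add: power_mult_distrib[symmetric] mult.assoc[symmetric])
qed (auto simp: ray_continuous_def)

text \<open>
  The template as a probability measure: its transform and the convolutions with it are integrals with
  respect to that measure, so the results on finite measures apply.
\<close>

lemma template_measure:
  assumes \<phi>: "probability_density d \<phi>"
  shows "prob_space (density (Rd d) (\<lambda>x. ennreal (\<phi> x)))"
    and "positioned_measure (density (Rd d) (\<lambda>x. ennreal (\<phi> x))) d"
    and "measure_ft d (density (Rd d) (\<lambda>x. ennreal (\<phi> x))) = fourier d \<phi>"
    and "\<And>K. K \<in> borel_measurable (Rd d) \<Longrightarrow>
          conv d K \<phi> = (\<lambda>u. \<integral>t. K (vdiff d u t) \<partial>density (Rd d) (\<lambda>x. ennreal (\<phi> x)))"
proof -
  have \<phi>m [measurable]: "\<phi> \<in> borel_measurable (Rd d)" and \<phi>0: "\<And>x. x \<in> space (Rd d) \<Longrightarrow> 0 \<le> \<phi> x"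
    and \<phi>1: "(\<integral>\<^sup>+x. ennreal (\<phi> x) \<partial>Rd d) = 1"
    using \<phi> by (auto simp: probability_density_def)
  show p: "prob_space (density (Rd d) (\<lambda>x. ennreal (\<phi> x)))"
    by (rule prob_spaceI) (simp add: emeasure_density \<phi>1 cong: nn_integral_cong)
  show "positioned_measure (density (Rd d) (\<lambda>x. ennreal (\<phi> x))) d"
    using p unfolding positioned_measure_def positioned_measure_axioms_def by (auto simp: prob_space_def)
  have "measure_ft d (density (Rd d) (\<lambda>x. ennreal (\<phi> x))) w = fourier d \<phi> w" for w
  proof -
    have "(\<integral>t. cis (- dotv d w t) \<partial>density (Rd d) (\<lambda>x. ennreal (\<phi> x))) = (\<integral>t. \<phi> t *\<^sub>R cis (- dotv d w t) \<partial>Rd d)"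
      if w: "w \<in> space (Rd d)" for w
      using \<phi>0 w by (intro integral_density) auto
    moreover have "dotv d w t = dotv d (restrict w {..<d}) t" for t by (simp add: dotv_def)
    ultimately show ?thesis
      unfolding measure_ft_def fourier_eq_ft ft_def by (metis (no_types, lifting) scaleR_conv_of_real restrict_extensional space_Rd Bochner_Integration.integral_cong)
  qed
  then show "measure_ft d (density (Rd d) (\<lambda>x. ennreal (\<phi> x))) = fourier d \<phi>" by (rule ext)
  fix K :: "vec \<Rightarrow> real" assume K [measurable]: "K \<in> borel_measurable (Rd d)"
  show "conv d K \<phi> = (\<lambda>u. \<integral>t. K (vdiff d u t) \<partial>density (Rd d) (\<lambda>x. ennreal (\<phi> x)))"
  proof
    fix u
    have vm: "vdiff d u \<in> Rd d \<rightarrow>\<^sub>M Rd d"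
      unfolding vdiff_def by (intro Rd_measurableI borel_measurable_diff component_measurable) auto
    have "(\<lambda>t. K (vdiff d u t)) \<in> borel_measurable (Rd d)" by (rule measurable_compose[OF vm K])
    then have "(\<integral>t. K (vdiff d u t) \<partial>density (Rd d) (\<lambda>x. ennreal (\<phi> x))) = (\<integral>t. \<phi> t *\<^sub>R K (vdiff d u t) \<partial>Rd d)"
      using \<phi>0 by (intro integral_density) auto
    then show "conv d K \<phi> u = (\<integral>t. K (vdiff d u t) \<partial>density (Rd d) (\<lambda>x. ennreal (\<phi> x)))"
      by (simp add: conv_def mult.commute)
  qed
qed

lemma lam_measurable [measurable]: "lam d \<tau> \<in> borel_measurable (Rd d)"
proof -
  have "(\<lambda>x. sinc (x i / \<tau>)) \<in> borel_measurable (Rd d)" if "i < d" for i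
    by (rule measurable_compose[OF _ borel_measurable_sinc]) (use component_measurable[OF that] in measurable)
  then show ?thesis
    unfolding lam_def[abs_def] sinc_vec_def by (intro borel_measurable_divide borel_measurable_prod) auto
qed

lemma has_band_template:
  assumes "0 < \<tau>" "probability_density d \<phi>"
  shows "has_band d \<tau> (fourier d \<phi>) (conv d (lam d \<tau>) \<phi>)"
  using positioned_measure.has_band_conv[OF template_measure(2)[OF assms(2)] has_band_lam[OF assms(1)]]
  by (simp add: template_measure(3)[OF assms(2)] template_measure(4)[OF assms(2) lam_measurable])

definition signed_ft :: "nat \<Rightarrow> vec measure \<Rightarrow> (vec set \<Rightarrow> real) \<Rightarrow> vec \<Rightarrow> complex" where
  "signed_ft d M \<mu> w = measure_ft d (jordan_pos M \<mu>) w - measure_ft d (jordan_neg M \<mu>) w"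

lemma positioned_jordan:
  assumes "signed_measure M \<mu>" "variation M \<mu> (space M) < \<infinity>" "(\<lambda>t. t) \<in> M \<rightarrow>\<^sub>M Rd d"
  shows "positioned_measure (jordan_pos M \<mu>) d" "positioned_measure (jordan_neg M \<mu>) d"
  using finite_measure_jordan[OF assms(1,2)] assms(3)
  by (simp_all add: positioned_measure_def positioned_measure_axioms_def cong: measurable_cong_sets)

lemma has_band_signed:
  assumes M: "signed_measure M \<mu>" "variation M \<mu> (space M) < \<infinity>" "(\<lambda>t. t) \<in> M \<rightarrow>\<^sub>M Rd d"
    and K: "has_band d \<tau> A K"
  shows "has_band d \<tau> (\<lambda>w. A w * signed_ft d M \<mu> w) (conv_measure d M K \<mu>)"
proof -
  have "has_band d \<tau> (\<lambda>w. A w * measure_ft d (jordan_pos M \<mu>) w - A w * measure_ft d (jordan_neg M \<mu>) w)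
      (\<lambda>x. (\<integral>t. K (vdiff d x t) \<partial>jordan_pos M \<mu>) - (\<integral>t. K (vdiff d x t) \<partial>jordan_neg M \<mu>))"
    by (intro has_band_diff positioned_measure.has_band_conv positioned_jordan[OF M] K)
  then show ?thesis by (simp add: signed_ft_def conv_measure_def[abs_def] signed_integral_def right_diff_distrib)
qed

lemma position_borel_on: "(\<lambda>t. t) \<in> borel_on d X \<rightarrow>\<^sub>M Rd d"
  unfolding borel_on_def by (rule measurable_restrict_space1) simp

lemma signed_ft_discrete:
  assumes I: "finite I" "\<And>k. k \<in> I \<Longrightarrow> 0 \<le> w k" "\<And>k. k \<in> I \<Longrightarrow> x k \<in> space M" and id: "(\<lambda>t. t) \<in> M \<rightarrow>\<^sub>M Rd d"
    and u: "u \<in> space (Rd d)"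
  shows "signed_ft d M (discrete_measure I w x) u = (\<Sum>k\<in>I. w k *\<^sub>R cis (- dotv d u (x k)))"
proof -
  have m: "(\<lambda>t. cis (- dotv d u t)) \<in> borel_measurable M"
    by (intro measurable_compose[OF _ cis_measurable] borel_measurable_uminus dotv_measurable id) (use u in simp)
  have "(\<integral>t. cis (- dotv d u t) \<partial>jordan_pos M (discrete_measure I w x)) = (\<Sum>k\<in>I. w k *\<^sub>R cis (- dotv d u (x k)))"
    using I m by (rule integral_jordan_pos_discrete)
  moreover have "(\<integral>t. cis (- dotv d u t) \<partial>jordan_neg M (discrete_measure I w x)) = 0"
    using I m by (rule integral_jordan_neg_discrete)
  ultimately show ?thesis unfolding signed_ft_def measure_ft_def by simp
qed

section \<open>The sinc-4 kernel and the kernel switch constant\<close>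

text \<open>
  The spectral density of the sinc-4 kernel: up to the factor \<open>(2 \<pi>)\<^sup>d\<close> its Fourier transform. The
  rescaling by \<open>4 \<tau>\<close> maps the support \<open>[-4,4]\<close> of the spline to \<open>[-1/\<tau>, 1/\<tau>]\<close>.
\<close>

definition psi_spectrum :: "nat \<Rightarrow> real \<Rightarrow> vec \<Rightarrow> real" where
  "psi_spectrum d \<tau> w = (\<Prod>i<d. 4 * \<tau> * spline (4 * \<tau> * w i))"

text \<open>
  The Fourier multiplier of the derivative with multi-index \<open>D\<close> in the scaled coordinates \<open>y / (4 \<tau>)\<close>.
\<close>

definition deriv_multiplier :: "nat \<Rightarrow> real \<Rightarrow> (nat \<Rightarrow> nat) \<Rightarrow> vec \<Rightarrow> complex" where
  "deriv_multiplier d \<tau> D w = (\<Prod>i<d. (\<i> * complex_of_real (4 * \<tau> * w i)) ^ D i)"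

lemma scaled_spline_moment:
  assumes \<tau>: "0 < \<tau>"
  shows "integrable lborel (\<lambda>w. (4 * \<tau> * spline (4 * \<tau> * w)) *\<^sub>R ((\<i> * complex_of_real (4 * \<tau> * w)) ^ j * cis (w * u)))"
    and "j \<le> 3 \<Longrightarrow> (\<integral>w. (4 * \<tau> * spline (4 * \<tau> * w)) *\<^sub>R ((\<i> * complex_of_real (4 * \<tau> * w)) ^ j * cis (w * u)) \<partial>lborel) = complex_of_real (sg j (u / (4 * \<tau>)))"
proof -
  let ?F = "\<lambda>t. spline t *\<^sub>R ((\<i> * complex_of_real t) ^ j * cis (t * (u / (4 * \<tau>))))"
  have e: "(4 * \<tau> * spline (4 * \<tau> * w)) *\<^sub>R ((\<i> * complex_of_real (4 * \<tau> * w)) ^ j * cis (w * u)) = (4 * \<tau>) *\<^sub>R ?F (0 + 4 * \<tau> * w)" for w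
    using \<tau> by simp
  show "integrable lborel (\<lambda>w. (4 * \<tau> * spline (4 * \<tau> * w)) *\<^sub>R ((\<i> * complex_of_real (4 * \<tau> * w)) ^ j * cis (w * u)))"
    unfolding e using \<tau> by (intro integrable_scaleR_right lborel_integrable_real_affine spline_moment_integrable) auto
  assume j: "j \<le> 3"
  have "complex_of_real (sg j (u / (4 * \<tau>))) = \<bar>4 * \<tau>\<bar> *\<^sub>R (\<integral>w. ?F (0 + 4 * \<tau> * w) \<partial>lborel)"
    unfolding spline_moment[OF j, symmetric] using \<tau> by (intro lborel_integral_real_affine) auto
  then show "(\<integral>w. (4 * \<tau> * spline (4 * \<tau> * w)) *\<^sub>R ((\<i> * complex_of_real (4 * \<tau> * w)) ^ j * cis (w * u)) \<partial>lborel) = complex_of_real (sg j (u / (4 * \<tau>)))"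
    unfolding e integral_scaleR_right using \<tau> by simp
qed

lemma psi_spectrum_deriv_multiplier_cis:
  "complex_of_real (psi_spectrum d \<tau> w) * deriv_multiplier d \<tau> D w * cis (dotv d w u)
    = (\<Prod>i<d. (4 * \<tau> * spline (4 * \<tau> * w i)) *\<^sub>R ((\<i> * complex_of_real (4 * \<tau> * w i)) ^ D i * cis (w i * u i)))"
  unfolding psi_spectrum_def deriv_multiplier_def cis_dotv of_real_prod prod.distrib[symmetric]
  by (simp add: scaleR_conv_of_real mult.assoc)

lemma psi_fourier:
  assumes \<tau>: "0 < \<tau>"
  shows "integrable (Rd d) (\<lambda>w. complex_of_real (psi_spectrum d \<tau> w) * deriv_multiplier d \<tau> D w * cis (dotv d w u))"
    and "(\<And>i. i < d \<Longrightarrow> D i \<le> 3) \<Longrightarrow>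
      (\<integral>w. complex_of_real (psi_spectrum d \<tau> w) * deriv_multiplier d \<tau> D w * cis (dotv d w u) \<partial>Rd d) = complex_of_real (psi d D (\<lambda>i. u i / (4 * \<tau>)))"
proof -
  show "integrable (Rd d) (\<lambda>w. complex_of_real (psi_spectrum d \<tau> w) * deriv_multiplier d \<tau> D w * cis (dotv d w u))"
    unfolding psi_spectrum_deriv_multiplier_cis Rd_def
    by (rule Rd_factors.product_integrable_prod, rule finite_lessThan, rule scaled_spline_moment(1)[OF \<tau>])
  assume D: "\<And>i. i < d \<Longrightarrow> D i \<le> 3"
  have "(\<integral>w. complex_of_real (psi_spectrum d \<tau> w) * deriv_multiplier d \<tau> D w * cis (dotv d w u) \<partial>Rd d)
     = (\<Prod>i<d. (\<integral>t. (4 * \<tau> * spline (4 * \<tau> * t)) *\<^sub>R ((\<i> * complex_of_real (4 * \<tau> * t)) ^ D i * cis (t * u i)) \<partial>lborel))"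
    unfolding psi_spectrum_deriv_multiplier_cis Rd_def
    by (rule Rd_factors.product_integral_prod, rule finite_lessThan, rule scaled_spline_moment(1)[OF \<tau>])
  also have "\<dots> = (\<Prod>i<d. complex_of_real (sg (D i) (u i / (4 * \<tau>))))"
    using D by (intro prod.cong refl scaled_spline_moment(2)[OF \<tau>]) auto
  finally show "(\<integral>w. complex_of_real (psi_spectrum d \<tau> w) * deriv_multiplier d \<tau> D w * cis (dotv d w u) \<partial>Rd d) = complex_of_real (psi d D (\<lambda>i. u i / (4 * \<tau>)))"
    by (simp add: psi_def)
qed

lemma deriv_multiplier_add: "deriv_multiplier d \<tau> (\<lambda>i. D i + D' i) w = deriv_multiplier d \<tau> D w * deriv_multiplier d \<tau> D' w"
  by (simp add: deriv_multiplier_def power_add prod.distrib)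

lemma deriv_multiplier_unit:
  shows "j < d \<Longrightarrow> deriv_multiplier d \<tau> (unit_index j) w = \<i> * complex_of_real (4 * \<tau> * w j)"
    and "deriv_multiplier d \<tau> (unit_index d) w = 1"
proof -
  assume j: "j < d"
  have "deriv_multiplier d \<tau> (unit_index j) w = (\<i> * complex_of_real (4 * \<tau> * w j)) ^ unit_index j j * (\<Prod>i\<in>{..<d} - {j}. (\<i> * complex_of_real (4 * \<tau> * w i)) ^ unit_index j i)"
    unfolding deriv_multiplier_def using j by (subst prod.remove[of _ j]) auto
  also have "(\<Prod>i\<in>{..<d} - {j}. (\<i> * complex_of_real (4 * \<tau> * w i)) ^ unit_index j i) = 1"
    by (intro prod.neutral) (auto simp: unit_index_def)
  finally show "deriv_multiplier d \<tau> (unit_index j) w = \<i> * complex_of_real (4 * \<tau> * w j)" by (simp add: unit_index_def[of j j])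
next
  show "deriv_multiplier d \<tau> (unit_index d) w = 1" unfolding deriv_multiplier_def by (intro prod.neutral) (auto simp: unit_index_def)
qed

lemma psi_spectrum_nonneg: "0 < \<tau> \<Longrightarrow> 0 \<le> psi_spectrum d \<tau> w"
  using spline_bump unfolding psi_spectrum_def bump_def by (intro prod_nonneg) auto

lemma psi_spectrum_outside:
  assumes \<tau>: "0 < \<tau>" and w: "w \<in> space (Rd d)" "w \<notin> cube d (1 / \<tau>)"
  shows "psi_spectrum d \<tau> w = 0"
proof -
  obtain i where i: "i < d" "1 / \<tau> < \<bar>w i\<bar>" using w by (auto simp: cube_def)
  then have "4 < \<bar>4 * \<tau> * w i\<bar>" using \<tau> by (simp add: abs_mult field_simps)
  then have "spline (4 * \<tau> * w i) = 0" using spline_bump by (simp add: bump_def)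
  then show ?thesis unfolding psi_spectrum_def using i(1) by (intro prod_zero) auto
qed

lemma psi_spectrum_measurable [measurable]: "psi_spectrum d \<tau> \<in> borel_measurable (Rd d)"
proof -
  have "(\<lambda>w. 4 * \<tau> * spline (4 * \<tau> * w i)) \<in> borel_measurable (Rd d)" if "i < d" for i
    using component_measurable[OF that] by measurable
  then show ?thesis unfolding psi_spectrum_def[abs_def] by (intro borel_measurable_prod) auto
qed

lemma fourier_sinc4:
  assumes \<tau>: "0 < \<tau>"
  shows "fourier d (sinc4 d \<tau>) w = complex_of_real ((2 * pi) ^ d * psi_spectrum d \<tau> w)"
proof -
  have s4: "sinc4 d \<tau> u = (\<Prod>i<d. sg 0 (u i / (4 * \<tau>)))" for u
    by (simp add: sinc4_def sinc_vec_def sg_0 sincd_0 prod_power_distrib)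
  have c: "cis (- dotv d w u) = (\<Prod>i<d. cis (- (w i * u i)))" for u
    by (simp add: dotv_def sum_negf[symmetric] cis_sum)
  let ?f = "\<lambda>i t. complex_of_real (sg 0 (t / (4 * \<tau>))) * cis (- (w i * t))"
  have scale: "?f i t = (\<lambda>v. complex_of_real (sg 0 v) * cis (- ((4 * \<tau> * w i) * v))) (0 + 1 / (4 * \<tau>) * t)" for i t
    using \<tau> by (simp add: field_simps)
  have int0: "integrable lborel (\<lambda>v. complex_of_real (sg 0 v) * cis (- (a * v)))" for a
    by (rule Bochner_Integration.integrable_bound[OF sg_0_integrable])
       (use borel_measurable_integrable[OF sg_0_integrable] in \<open>auto simp: norm_mult\<close>)
  have int: "integrable lborel (?f i)" for i
    unfolding scale using \<tau> by (intro lborel_integrable_real_affine int0) auto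
  have val: "(\<integral>t. ?f i t \<partial>lborel) = complex_of_real (2 * pi * (4 * \<tau> * spline (4 * \<tau> * w i)))" for i
  proof -
    have "complex_of_real (2 * pi * spline (4 * \<tau> * w i)) = \<bar>1 / (4 * \<tau>)\<bar> *\<^sub>R (\<integral>t. ?f i t \<partial>lborel)"
      unfolding scale spline_inversion[of "4 * \<tau> * w i", symmetric]
      using \<tau> by (intro lborel_integral_real_affine) auto
    then have "complex_of_real (4 * \<tau>) * complex_of_real (2 * pi * spline (4 * \<tau> * w i)) = complex_of_real (4 * \<tau> * \<bar>1 / (4 * \<tau>)\<bar>) * (\<integral>t. ?f i t \<partial>lborel)"
      by (simp add: scaleR_conv_of_real)
    then show ?thesis using \<tau> by (simp add: mult_ac)
  qed
  have "fourier d (sinc4 d \<tau>) w = (\<integral>u. (\<Prod>i<d. ?f i (u i)) \<partial>Rd d)"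
    unfolding fourier_eq_ft ft_def s4 c of_real_prod prod.distrib[symmetric] ..
  also have "\<dots> = (\<Prod>i<d. complex_of_real (2 * pi * (4 * \<tau> * spline (4 * \<tau> * w i))))"
    unfolding Rd_def val[symmetric]
    by (rule Rd_factors.product_integral_prod, rule finite_lessThan, rule int)
  also have "\<dots> = complex_of_real ((2 * pi) ^ d * psi_spectrum d \<tau> w)"
    unfolding of_real_prod[symmetric] prod.distrib by (simp add: psi_spectrum_def prod.distrib)
  finally show ?thesis .
qed

text \<open>
  The central value is the integral of \<open>sinc\<^sup>4\<close> up to \<open>2 \<pi>\<close>, and \<open>sinc\<^sup>4\<close> is at least 3/10 on \<open>[-1,1]\<close>.
\<close>

lemma spline_0_pos: "0 < spline 0"
proof -
  have "complex_of_real (\<integral>v. sg 0 v \<partial>lborel) = complex_of_real (2 * pi * spline 0)"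
    using spline_inversion[of 0] by simp
  then have e: "(\<integral>v. sg 0 v \<partial>lborel) = 2 * pi * spline 0" by (simp only: of_real_eq_iff)
  have "(\<integral>v. 3 / 10 * indicator {-1..1::real} v \<partial>lborel) \<le> (\<integral>v. sg 0 v \<partial>lborel)"
  proof (rule integral_mono)
    show "integrable lborel (\<lambda>v::real. 3 / 10 * indicator {-1..1} v :: real)"
      by (intro integrable_mult_right integrable_real_indicator) (auto simp: emeasure_lborel_Icc_eq)
    show "integrable lborel (sg 0)" by (rule sg_0_integrable)
    fix v :: real
    show "3 / 10 * indicator {-1..1} v \<le> sg 0 v"
    proof (cases "\<bar>v\<bar> \<le> 1")
      case True
      then have "v\<^sup>2 \<le> 1" by (simp add: abs_square_le_1)
      then show ?thesis using sg_0_lower[OF True] by (simp add: indicator_def) 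
    next
      case False
      then show ?thesis using sg_0_range(1)[of v] by (auto simp: indicator_def)
    qed
  qed
  then have "0 < 2 * pi * spline 0" unfolding e by simp
  then show ?thesis by (simp add: zero_less_mult_iff)
qed

lemma psi_spectrum_0_pos: "0 < \<tau> \<Longrightarrow> 0 < psi_spectrum d \<tau> (\<lambda>i\<in>{..<d}. 0)"
  unfolding psi_spectrum_def using spline_0_pos by (intro prod_pos) auto

text \<open>
  This unfolds the kernel switch constant: the factors \<open>(2 \<pi>)\<^sup>d\<close> of the spectrum and \<open>\<pi>\<^sup>d\<close> of the smoothing
  kernel leave \<open>2\<^sup>-\<^sup>d\<close>. Where the transform of the template vanishes, finiteness of the constant forces the
  spectrum to vanish as well.
\<close>

lemma switch_bound:
  assumes \<tau>: "0 < \<tau>" and fin: "C_switch d \<tau> \<phi> < \<infinity>" and Cs: "Cs = enn2real (C_switch d \<tau> \<phi>)"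
    and w: "w \<in> cube d (1 / \<tau>)"
  shows "psi_spectrum d \<tau> w \<le> Cs\<^sup>2 * ((1 / 2) ^ d * (cmod (fourier d \<phi> w))\<^sup>2)"
proof -
  have C: "C_switch d \<tau> \<phi> = ennreal Cs" and Cs0: "0 \<le> Cs" using fin by (auto simp: Cs)
  have re: "Re (fourier d (sinc4 d \<tau>) w) = (2 * pi) ^ d * psi_spectrum d \<tau> w" unfolding fourier_sinc4[OF \<tau>] by simp
  have p0: "0 \<le> (2 * pi) ^ d * psi_spectrum d \<tau> w" using psi_spectrum_nonneg[OF \<tau>] by simp
  have fl: "fourier_lam d \<tau> w = pi ^ d" using w by (simp add: fourier_lam_def)
  define q where "q = ennreal ((2 * pi) ^ d * psi_spectrum d \<tau> w) / (ennreal (pi ^ d) * ennreal ((cmod (fourier d \<phi> w))\<^sup>2))"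
  have "ennsqrt q \<le> C_switch d \<tau> \<phi>"
    unfolding C_switch_def q_def by (rule SUP_upper2[OF w]) (simp add: re fl)
  then have le: "ennsqrt q \<le> ennreal Cs" unfolding C .
  have qfin: "q \<noteq> \<infinity>" using le by (auto simp: ennsqrt_def top_unique)
  show ?thesis
  proof (cases "fourier d \<phi> w = 0")
    case True
    have "(2 * pi) ^ d * psi_spectrum d \<tau> w = 0"
    proof (rule ccontr)
      assume "(2 * pi) ^ d * psi_spectrum d \<tau> w \<noteq> 0"
      then have "q = \<infinity>" using p0 True by (simp add: q_def divide_ennreal_def ennreal_top_mult ennreal_mult_top)
      then show False using qfin by simp
    qed
    then show ?thesis using True by simp
  next
    case False
    define r where "r = (2 * pi) ^ d * psi_spectrum d \<tau> w / (pi ^ d * (cmod (fourier d \<phi> w))\<^sup>2)"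
    have r0: "0 \<le> r" unfolding r_def by (intro divide_nonneg_nonneg p0) auto
    have "q = ennreal r" unfolding q_def r_def using p0 False
      by (simp add: ennreal_mult[symmetric] divide_ennreal)
    then have "ennreal (sqrt r) \<le> ennreal Cs" using le r0 by (simp add: ennsqrt_def)
    then have "sqrt r \<le> Cs" using Cs0 by (simp add: ennreal_le_iff)
    then have "(sqrt r)\<^sup>2 \<le> Cs\<^sup>2" using r0 by (intro power_mono) auto
    then have "r \<le> Cs\<^sup>2" using r0 by simp
    then have "(2 * pi) ^ d * psi_spectrum d \<tau> w \<le> Cs\<^sup>2 * (pi ^ d * (cmod (fourier d \<phi> w))\<^sup>2)"
      using False by (simp add: r_def divide_le_eq)
    then have "(2 ^ d * psi_spectrum d \<tau> w) * pi ^ d \<le> (Cs\<^sup>2 * (cmod (fourier d \<phi> w))\<^sup>2) * pi ^ d"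
      by (simp add: power_mult_distrib mult_ac)
    then have "2 ^ d * psi_spectrum d \<tau> w \<le> Cs\<^sup>2 * (cmod (fourier d \<phi> w))\<^sup>2" by (rule mult_right_le_imp_le) simp
    then show ?thesis by (simp add: power_divide field_simps)
  qed
qed

text \<open>
  At the frequency 0 the spectrum is positive.
\<close>

lemma switch_pos:
  assumes \<tau>: "0 < \<tau>" and fin: "C_switch d \<tau> \<phi> < \<infinity>" and Cs: "Cs = enn2real (C_switch d \<tau> \<phi>)"
  shows "0 < Cs"
proof (rule ccontr)
  assume "\<not> 0 < Cs"
  moreover have "0 \<le> Cs" by (simp add: Cs)
  ultimately have "Cs = 0" by simp
  moreover have "(\<lambda>i\<in>{..<d}. 0) \<in> cube d (1 / \<tau>)" using \<tau> by (simp add: cube_def space_Rd)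
  ultimately show False using switch_bound[OF assms, of "\<lambda>i\<in>{..<d}. 0"] psi_spectrum_0_pos[OF \<tau>, of d] by simp
qed

section \<open>Spectral representation of the certificates\<close>

text \<open>
  Dividing positions by \<open>4 \<tau>\<close> makes the spikes separated centres for the kernel of unit scale.
\<close>

locale spike_configuration =
  fixes d s :: nat and \<tau> :: real and x :: "nat \<Rightarrow> vec"
  assumes d: "1 \<le> d" and s: "1 \<le> s" and \<tau>: "0 < \<tau>"
    and x_space: "\<And>k. k \<in> {1..s} \<Longrightarrow> x k \<in> space (Rd d)"
    and separation: "\<And>k l. k \<in> {1..s} \<Longrightarrow> l \<in> {1..s} \<Longrightarrow> k \<noteq> l \<Longrightarrow>
        1862000 * real s * real d ^ 7 \<le> (nsq d (\<lambda>i. x k i / (4 * \<tau>) - x l i / (4 * \<tau>)))\<^sup>2"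
begin

sublocale separated_centres d s "\<lambda>k i. x k i / (4 * \<tau>)"
  using d s separation by unfold_locales

definition cert :: "(nat \<Rightarrow> nat \<Rightarrow> real) \<Rightarrow> vec \<Rightarrow> real" where
  "cert c y = interp c d (\<lambda>i. y i / (4 * \<tau>))"

text \<open>
  The trigonometric factor in the spectral representation of a certificate: translations become phases and
  partial derivatives become multipliers.
\<close>

definition amplitude :: "(nat \<Rightarrow> nat \<Rightarrow> real) \<Rightarrow> vec \<Rightarrow> complex" where
  "amplitude c w = (\<Sum>l\<in>{1..s}. \<Sum>j\<le>d. complex_of_real (c l j) * (deriv_multiplier d \<tau> (unit_index j) w * cis (- dotv d w (x l))))"

lemma amplitude_term:
  "complex_of_real (psi_spectrum d \<tau> w) * amplitude c w * (deriv_multiplier d \<tau> (unit_index j') w * cis (dotv d w y))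
    = (\<Sum>l\<in>{1..s}. \<Sum>j\<le>d. complex_of_real (c l j) *
        (complex_of_real (psi_spectrum d \<tau> w) * deriv_multiplier d \<tau> (\<lambda>i. unit_index j i + unit_index j' i) w * cis (dotv d w (vdiff d y (x l)))))"
proof -
  have t: "complex_of_real (psi_spectrum d \<tau> w) * (complex_of_real (c l j) * (deriv_multiplier d \<tau> (unit_index j) w * cis (- dotv d w (x l)))) * (deriv_multiplier d \<tau> (unit_index j') w * cis (dotv d w y))
    = complex_of_real (c l j) * (complex_of_real (psi_spectrum d \<tau> w) * deriv_multiplier d \<tau> (\<lambda>i. unit_index j i + unit_index j' i) w * cis (dotv d w (vdiff d y (x l))))" for l j
  proof -
    have "cis (dotv d w (vdiff d y (x l))) = cis (- dotv d w (x l)) * cis (dotv d w y)" by (simp add: dotv_vdiff cis_mult)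
    then show ?thesis by (simp only: deriv_multiplier_add mult_ac)
  qed
  show ?thesis unfolding amplitude_def sum_distrib_left sum_distrib_right t ..
qed

lemma amplitude_integral:
  shows "integrable (Rd d) (\<lambda>w. complex_of_real (psi_spectrum d \<tau> w) * amplitude c w * (deriv_multiplier d \<tau> (unit_index j') w * cis (dotv d w y)))"
    and "(\<integral>w. complex_of_real (psi_spectrum d \<tau> w) * amplitude c w * (deriv_multiplier d \<tau> (unit_index j') w * cis (dotv d w y)) \<partial>Rd d)
      = complex_of_real (interp c j' (\<lambda>i. y i / (4 * \<tau>)))"
proof -
  let ?T = "\<lambda>l j w. complex_of_real (psi_spectrum d \<tau> w) * deriv_multiplier d \<tau> (\<lambda>i. unit_index j i + unit_index j' i) w * cis (dotv d w (vdiff d y (x l)))"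
  have int: "integrable (Rd d) (?T l j)" for l j by (rule psi_fourier(1)[OF \<tau>])
  show "integrable (Rd d) (\<lambda>w. complex_of_real (psi_spectrum d \<tau> w) * amplitude c w * (deriv_multiplier d \<tau> (unit_index j') w * cis (dotv d w y)))"
    unfolding amplitude_term by (intro Bochner_Integration.integrable_sum integrable_mult_right int)
  have val: "(\<integral>w. ?T l j w \<partial>Rd d) = complex_of_real (psi d (\<lambda>i. unit_index j i + unit_index j' i) (\<lambda>i. y i / (4 * \<tau>) - x l i / (4 * \<tau>)))" for l j
  proof -
    have "(\<integral>w. ?T l j w \<partial>Rd d) = complex_of_real (psi d (\<lambda>i. unit_index j i + unit_index j' i) (\<lambda>i. vdiff d y (x l) i / (4 * \<tau>)))"
      by (rule psi_fourier(2)[OF \<tau>]) (simp add: unit_index_def)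
    also have "psi d (\<lambda>i. unit_index j i + unit_index j' i) (\<lambda>i. vdiff d y (x l) i / (4 * \<tau>))
        = psi d (\<lambda>i. unit_index j i + unit_index j' i) (\<lambda>i. y i / (4 * \<tau>) - x l i / (4 * \<tau>))"
      unfolding psi_def by (intro prod.cong) (auto simp: vdiff_def diff_divide_distrib)
    finally show ?thesis .
  qed
  have "(\<integral>w. complex_of_real (psi_spectrum d \<tau> w) * amplitude c w * (deriv_multiplier d \<tau> (unit_index j') w * cis (dotv d w y)) \<partial>Rd d)
     = (\<Sum>l\<in>{1..s}. \<Sum>j\<le>d. complex_of_real (c l j) * (\<integral>w. ?T l j w \<partial>Rd d))"
    unfolding amplitude_term
    by (subst Bochner_Integration.integral_sum, intro Bochner_Integration.integrable_sum integrable_mult_right int)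
       (intro sum.cong refl, subst Bochner_Integration.integral_sum, intro integrable_mult_right int, intro sum.cong refl integral_mult_right_zero)
  then show "(\<integral>w. complex_of_real (psi_spectrum d \<tau> w) * amplitude c w * (deriv_multiplier d \<tau> (unit_index j') w * cis (dotv d w y)) \<partial>Rd d)
      = complex_of_real (interp c j' (\<lambda>i. y i / (4 * \<tau>)))"
    by (simp add: val interp_def)
qed

lemma psi_spectrum_amplitude_integrable: "integrable (Rd d) (\<lambda>w. complex_of_real (psi_spectrum d \<tau> w) * amplitude c w)"
  using amplitude_integral(1)[of c d "\<lambda>_. 0"] by (simp add: deriv_multiplier_unit(2) dotv_def)

lemma cert_fourier: "(\<integral>w. complex_of_real (psi_spectrum d \<tau> w) * amplitude c w * cis (dotv d w y) \<partial>Rd d) = complex_of_real (cert c y)"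
  using amplitude_integral(2)[of c d y] by (simp add: deriv_multiplier_unit(2) cert_def)

lemma cert_measurable [measurable]: "cert c \<in> borel_measurable (Rd d)"
proof -
  have ps: "(\<lambda>y. psi d D (\<lambda>i. y i / (4 * \<tau>) - u i)) \<in> borel_measurable (Rd d)" if "\<And>i. i < d \<Longrightarrow> D i \<le> 2" for D u
    unfolding psi_def
  proof (intro borel_measurable_prod)
    fix i assume "i \<in> {..<d}"
    then have i: "i < d" by simp
    have "isCont (sg (D i)) v" for v using sg_deriv[OF that[OF i]] by (auto intro: DERIV_isCont)
    then have "sg (D i) \<in> borel_measurable borel"
      by (intro borel_measurable_continuous_onI continuous_at_imp_continuous_on) auto
    then show "(\<lambda>y. sg (D i) (y i / (4 * \<tau>) - u i)) \<in> borel_measurable (Rd d)"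
      by (rule measurable_compose[rotated]) (use component_measurable[OF i] in measurable)
  qed
  show ?thesis unfolding cert_def[abs_def] interp_def
    by (intro borel_measurable_sum borel_measurable_times borel_measurable_const ps) (auto simp: unit_index_def)
qed

text \<open>
  Integrating \<open>p |A|\<^sup>2\<close> against one copy of the expanded \<open>A\<close> evaluates the certificate and its partial
  derivatives at the spikes. The latter vanish, so only the kernel coefficients times the values remain.
\<close>

lemma amplitude_energy:
  assumes val: "\<And>k. k \<in> {1..s} \<Longrightarrow> cert c (x k) = b k"
    and grad: "\<And>k j. k \<in> {1..s} \<Longrightarrow> j < d \<Longrightarrow> interp c j (\<lambda>i. x k i / (4 * \<tau>)) = 0"
  shows "integrable (Rd d) (\<lambda>w. psi_spectrum d \<tau> w * (cmod (amplitude c w))\<^sup>2)"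
    and "(\<integral>w. psi_spectrum d \<tau> w * (cmod (amplitude c w))\<^sup>2 \<partial>Rd d) = (\<Sum>k\<in>{1..s}. c k d * b k)"
proof -
  \<comment> \<open>the multiplier of a first derivative is imaginary, that of the kernel is 1\<close>
  define sgn :: "nat \<Rightarrow> complex" where "sgn j = (if j = d then 1 else -1)" for j
  have cm: "cnj (deriv_multiplier d \<tau> (unit_index j) w) = sgn j * deriv_multiplier d \<tau> (unit_index j) w" if "j \<le> d" for j w
    using that deriv_multiplier_unit(1)[of j d \<tau> w] deriv_multiplier_unit(2)[of d \<tau> w] by (cases "j = d") (auto simp: sgn_def)
  have ca: "cnj (amplitude c w) = (\<Sum>l\<in>{1..s}. \<Sum>j\<le>d. (complex_of_real (c l j) * sgn j) * (deriv_multiplier d \<tau> (unit_index j) w * cis (dotv d w (x l))))" for w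
    unfolding amplitude_def cnj_sum
  proof (intro sum.cong refl)
    fix l j assume "j \<in> {..d}"
    then show "cnj (complex_of_real (c l j) * (deriv_multiplier d \<tau> (unit_index j) w * cis (- dotv d w (x l))))
       = (complex_of_real (c l j) * sgn j) * (deriv_multiplier d \<tau> (unit_index j) w * cis (dotv d w (x l)))"
      using cm[of j w] by (simp add: cis_cnj)
  qed
  let ?T = "\<lambda>l j w. complex_of_real (psi_spectrum d \<tau> w) * amplitude c w * (deriv_multiplier d \<tau> (unit_index j) w * cis (dotv d w (x l)))"
  have expand: "complex_of_real (psi_spectrum d \<tau> w * (cmod (amplitude c w))\<^sup>2) = (\<Sum>l\<in>{1..s}. \<Sum>j\<le>d. (complex_of_real (c l j) * sgn j) * ?T l j w)" for w
  proof -
    have "complex_of_real (psi_spectrum d \<tau> w * (cmod (amplitude c w))\<^sup>2) = complex_of_real (psi_spectrum d \<tau> w) * amplitude c w * cnj (amplitude c w)"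
      by (simp only: of_real_mult mult.assoc mult.commute[of "amplitude c w" "cnj _"] cnj_mult_self)
    also have "\<dots> = (\<Sum>l\<in>{1..s}. \<Sum>j\<le>d. (complex_of_real (c l j) * sgn j) * ?T l j w)"
      unfolding ca sum_distrib_left by (intro sum.cong refl) (simp only: mult_ac)
    finally show ?thesis .
  qed
  have "integrable (Rd d) (\<lambda>w. complex_of_real (psi_spectrum d \<tau> w * (cmod (amplitude c w))\<^sup>2))"
    unfolding expand by (intro Bochner_Integration.integrable_sum integrable_mult_right amplitude_integral(1))
  then show "integrable (Rd d) (\<lambda>w. psi_spectrum d \<tau> w * (cmod (amplitude c w))\<^sup>2)" by (simp only: complex_of_real_integrable_eq)
  have "complex_of_real (\<integral>w. psi_spectrum d \<tau> w * (cmod (amplitude c w))\<^sup>2 \<partial>Rd d) = (\<integral>w. (\<Sum>l\<in>{1..s}. \<Sum>j\<le>d. (complex_of_real (c l j) * sgn j) * ?T l j w) \<partial>Rd d)"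
    unfolding integral_complex_of_real[symmetric] expand ..
  also have "\<dots> = (\<Sum>l\<in>{1..s}. \<Sum>j\<le>d. (complex_of_real (c l j) * sgn j) * (\<integral>w. ?T l j w \<partial>Rd d))"
    by (subst Bochner_Integration.integral_sum, intro Bochner_Integration.integrable_sum integrable_mult_right amplitude_integral(1))
       (intro sum.cong refl, subst Bochner_Integration.integral_sum, intro integrable_mult_right amplitude_integral(1), intro sum.cong refl integral_mult_right_zero)
  also have "\<dots> = (\<Sum>l\<in>{1..s}. \<Sum>j\<le>d. if j = d then complex_of_real (c l d * b l) else 0)"
  proof (intro sum.cong refl)
    fix l j assume l: "l \<in> {1..s}" and j: "j \<in> {..d}"
    show "(complex_of_real (c l j) * sgn j) * (\<integral>w. ?T l j w \<partial>Rd d) = (if j = d then complex_of_real (c l d * b l) else 0)"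
      using val[OF l] grad[OF l, of j] j unfolding amplitude_integral(2) by (auto simp: sgn_def cert_def)
  qed
  also have "\<dots> = complex_of_real (\<Sum>k\<in>{1..s}. c k d * b k)" by simp
  finally show "(\<integral>w. psi_spectrum d \<tau> w * (cmod (amplitude c w))\<^sup>2 \<partial>Rd d) = (\<Sum>k\<in>{1..s}. c k d * b k)"
    by (simp only: of_real_eq_iff)
qed

text \<open>
  Parseval for a finite measure, which is Fubini for the spectral representation.
\<close>

lemma cert_pairing:
  assumes M: "positioned_measure M d"
  shows "complex_of_real (\<integral>t. cert c t \<partial>M) = (\<integral>w. complex_of_real (psi_spectrum d \<tau> w) * amplitude c w * cnj (measure_ft d M w) \<partial>Rd d)"
proof -
  interpret positioned_measure M d by fact
  have "complex_of_real (\<integral>t. cert c t \<partial>M) = (\<integral>t. complex_of_real (cert c t) \<partial>M)" by (rule integral_complex_of_real[symmetric])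
  also have "\<dots> = (\<integral>t. 1 * (\<integral>w. complex_of_real (psi_spectrum d \<tau> w) * amplitude c w * cis (dotv d w t) \<partial>Rd d) \<partial>M)"
    by (simp only: cert_fourier mult_1)
  also have "\<dots> = (\<integral>w. complex_of_real (psi_spectrum d \<tau> w) * amplitude c w * (\<integral>t. 1 * cis (dotv d w t) \<partial>M) \<partial>Rd d)"
  proof (rule fubini_kernel[OF sigma_finite_measure_axioms sigma_finite_Rd _ psi_spectrum_amplitude_integrable, where C = 1])
    show "(\<lambda>(t, w). cis (dotv d w t)) \<in> borel_measurable (M \<Otimes>\<^sub>M Rd d)"
    proof -
      have [measurable]: "(\<lambda>p. fst p) \<in> M \<Otimes>\<^sub>M Rd d \<rightarrow>\<^sub>M Rd d"
        by (rule measurable_compose[OF measurable_fst position])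
      show ?thesis unfolding case_prod_beta' by measurable
    qed
  qed auto
  also have "(\<lambda>w. \<integral>t. 1 * cis (dotv d w t) \<partial>M) = (\<lambda>w. cnj (measure_ft d M w))"
  proof
    fix w
    have "cnj (measure_ft d M w) = (\<integral>t. cnj (cis (- dotv d w t)) \<partial>M)"
      unfolding measure_ft_def by (rule Bochner_Integration.integral_cnj[symmetric])
    then show "(\<integral>t. 1 * cis (dotv d w t) \<partial>M) = cnj (measure_ft d M w)" by (simp add: cis_cnj)
  qed
  finally show ?thesis .
qed

lemma amplitude_measurable [measurable]: "amplitude c \<in> borel_measurable (Rd d)"
proof -
  have "(\<lambda>w. deriv_multiplier d \<tau> D w) \<in> borel_measurable (Rd d)" for D
  proof -
    have "(\<lambda>w. (\<i> * complex_of_real (4 * \<tau> * w i)) ^ D i) \<in> borel_measurable (Rd d)" if "i < d" for i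
      using component_measurable[OF that] by measurable
    then show ?thesis unfolding deriv_multiplier_def by (intro borel_measurable_prod) auto
  qed
  moreover have "(\<lambda>w. cis (- dotv d w (x l))) \<in> borel_measurable (Rd d)" if "l \<in> {1..s}" for l
    using x_space[OF that] by measurable
  ultimately show ?thesis unfolding amplitude_def[abs_def]
    by (intro borel_measurable_sum borel_measurable_times borel_measurable_const) auto
qed

text \<open>
  Pointwise, \<open>2 p |A| |\<Delta>| \<le> m p |A|\<^sup>2 + p |\<Delta>|\<^sup>2 / m\<close> for any \<open>m > 0\<close>, and in the last term the spectrum \<open>p\<close> is
  dominated by the transform of the template. This is the kernel switch: a certificate made of sinc-4
  kernels is tested against a residual that is measured in the norm of \<open>\<F>\<^sub>\<tau>\<close>. A free weight \<open>m\<close> in place of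
  the optimal one lets the residual be absorbed when objectives are compared.
\<close>

lemma pairing_bound:
  assumes val: "\<And>k. k \<in> {1..s} \<Longrightarrow> cert c (x k) = b k"
    and grad: "\<And>k j. k \<in> {1..s} \<Longrightarrow> j < d \<Longrightarrow> interp c j (\<lambda>i. x k i / (4 * \<tau>)) = 0"
    and E: "(\<Sum>k\<in>{1..s}. c k d * b k) \<le> 2 * real s"
    and dom: "\<And>w. w \<in> cube d (1 / \<tau>) \<Longrightarrow> psi_spectrum d \<tau> w \<le> C\<^sup>2 * ((1 / 2) ^ d * (cmod (\<Phi> w))\<^sup>2)"
    and \<Delta> [measurable]: "\<Delta> \<in> borel_measurable (Rd d)" "\<Phi> \<in> borel_measurable (Rd d)"
    and bd: "\<And>w. w \<in> space (Rd d) \<Longrightarrow> cmod (\<Phi> w * \<Delta> w) \<le> B"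
    and m: "0 < m"
  shows "cmod (\<integral>w. complex_of_real (psi_spectrum d \<tau> w) * amplitude c w * cnj (\<Delta> w) \<partial>Rd d)
      \<le> (m * (2 * real s) + C\<^sup>2 * band_energy d \<tau> (\<lambda>w. \<Phi> w * \<Delta> w) / m) / 2"
proof -
  let ?e = "\<lambda>w. psi_spectrum d \<tau> w * (cmod (amplitude c w))\<^sup>2"
  let ?n = "\<lambda>w. indicator (cube d (1 / \<tau>)) w * (cmod (\<Phi> w * \<Delta> w))\<^sup>2"
  have en: "integrable (Rd d) ?e" "(\<integral>w. ?e w \<partial>Rd d) = (\<Sum>k\<in>{1..s}. c k d * b k)"
    using amplitude_energy[OF val grad] by auto
  have ni: "integrable (Rd d) ?n"
  proof -
    have "integrable (Rd d) (\<lambda>w. indicator (cube d (1 / \<tau>)) w *\<^sub>R (cmod (\<Phi> w * \<Delta> w))\<^sup>2)"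
      using bd by (intro integrable_cube_bounded[where B = "B\<^sup>2"]) (auto intro!: power_mono)
    then show ?thesis by simp
  qed
  let ?U = "\<lambda>w. (m * ?e w + C\<^sup>2 * ((1 / 2) ^ d * ?n w) / m) / 2"
  have Ui: "integrable (Rd d) ?U" using en(1) ni by (intro integrable_divide_zero Bochner_Integration.integrable_add integrable_mult_right) auto
  have ptw: "cmod (complex_of_real (psi_spectrum d \<tau> w) * amplitude c w * cnj (\<Delta> w)) \<le> ?U w" if w: "w \<in> space (Rd d)" for w
  proof (cases "w \<in> cube d (1 / \<tau>)")
    case True
    let ?p = "psi_spectrum d \<tau> w" and ?a = "cmod (amplitude c w)" and ?D = "cmod (\<Delta> w)"
    have p0: "0 \<le> ?p" by (rule psi_spectrum_nonneg[OF \<tau>])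
    have "0 \<le> (m * ?a - ?D)\<^sup>2" by simp
    then have "2 * m * (?a * ?D) \<le> m\<^sup>2 * ?a\<^sup>2 + ?D\<^sup>2" by (simp add: power2_diff power_mult_distrib mult_ac)
    then have "(2 * m * (?a * ?D)) / m \<le> (m\<^sup>2 * ?a\<^sup>2 + ?D\<^sup>2) / m" using m by (intro divide_right_mono) auto
    then have "2 * (?a * ?D) \<le> m * ?a\<^sup>2 + ?D\<^sup>2 / m" using m by (simp add: add_divide_distrib power2_eq_square)
    then have "?p * (2 * (?a * ?D)) \<le> ?p * (m * ?a\<^sup>2 + ?D\<^sup>2 / m)" using p0 by (rule mult_left_mono)
    also have "\<dots> = m * (?p * ?a\<^sup>2) + (?p * ?D\<^sup>2) / m" by (simp add: algebra_simps)
    also have "\<dots> \<le> m * (?p * ?a\<^sup>2) + (C\<^sup>2 * ((1 / 2) ^ d * (cmod (\<Phi> w))\<^sup>2) * ?D\<^sup>2) / m"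
      using dom[OF True] m by (intro add_left_mono divide_right_mono mult_right_mono) auto
    finally have "2 * (?p * ?a * ?D) \<le> m * (?p * ?a\<^sup>2) + C\<^sup>2 * ((1 / 2) ^ d * ((cmod (\<Phi> w))\<^sup>2 * ?D\<^sup>2)) / m"
      by (simp add: mult_ac)
    then show ?thesis using True p0 by (simp add: norm_mult power_mult_distrib)
  next
    case False
    then show ?thesis using psi_spectrum_outside[OF \<tau> w False] by simp
  qed
  have int: "integrable (Rd d) (\<lambda>w. complex_of_real (psi_spectrum d \<tau> w) * amplitude c w * cnj (\<Delta> w))"
  proof (rule Bochner_Integration.integrable_bound[OF Ui])
    show "AE w in Rd d. norm (complex_of_real (psi_spectrum d \<tau> w) * amplitude c w * cnj (\<Delta> w)) \<le> norm (?U w)"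
      using ptw by (intro AE_I2) (auto intro: order_trans[OF _ abs_ge_self])
  qed measurable
  have "cmod (\<integral>w. complex_of_real (psi_spectrum d \<tau> w) * amplitude c w * cnj (\<Delta> w) \<partial>Rd d)
      \<le> (\<integral>w. norm (complex_of_real (psi_spectrum d \<tau> w) * amplitude c w * cnj (\<Delta> w)) \<partial>Rd d)"
    by (rule integral_norm_bound)
  also have "\<dots> \<le> (\<integral>w. ?U w \<partial>Rd d)"
    using int by (intro integral_mono Ui ptw integrable_norm)
  also have "\<dots> = (m * (\<integral>w. ?e w \<partial>Rd d) + C\<^sup>2 * ((1 / 2) ^ d * (\<integral>w. ?n w \<partial>Rd d)) / m) / 2"
    using en(1) ni by simp
  also have "\<dots> \<le> (m * (2 * real s) + C\<^sup>2 * band_energy d \<tau> (\<lambda>w. \<Phi> w * \<Delta> w) / m) / 2"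
    unfolding en(2) band_energy_def using E m by (intro divide_right_mono add_right_mono mult_left_mono) auto
  finally show ?thesis .
qed

end

section \<open>The noise level\<close>

definition bounded_symbol :: "nat \<Rightarrow> (vec \<Rightarrow> complex) \<Rightarrow> real \<Rightarrow> bool" where
  "bounded_symbol d H B \<longleftrightarrow> H \<in> borel_measurable (Rd d) \<and> (\<forall>w\<in>space (Rd d). cmod (H w) \<le> B)"

lemma bounded_symbol_energy_integrable:
  assumes "bounded_symbol d H B"
  shows "integrable (Rd d) (\<lambda>w. indicator (cube d R) w * (cmod (H w))\<^sup>2)"
proof -
  have [measurable]: "H \<in> borel_measurable (Rd d)" using assms by (simp add: bounded_symbol_def)
  have "integrable (Rd d) (\<lambda>w. indicator (cube d R) w *\<^sub>R (cmod (H w))\<^sup>2)"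
    using assms by (intro integrable_cube_bounded[where B = "B\<^sup>2"]) (auto simp: bounded_symbol_def intro!: power_mono)
  then show ?thesis by simp
qed

lemma bounded_symbol_diff:
  "bounded_symbol d H1 B1 \<Longrightarrow> bounded_symbol d H2 B2 \<Longrightarrow> bounded_symbol d (\<lambda>w. H1 w - H2 w) (B1 + B2)"
  unfolding bounded_symbol_def by (auto intro: norm_triangle_le_diff add_mono)

lemma band_energy_nonneg: "0 \<le> band_energy d \<tau> H"
  unfolding band_energy_def by (intro mult_nonneg_nonneg integral_nonneg_AE) auto

lemma band_energy_le:
  assumes "bounded_symbol d H B" and \<tau>: "0 < \<tau>"
  shows "band_energy d \<tau> H \<le> (1 / \<tau>) ^ d * B\<^sup>2"
proof -
  have "(\<integral>w. indicator (cube d (1 / \<tau>)) w * (cmod (H w))\<^sup>2 \<partial>Rd d) \<le> (\<integral>w. B\<^sup>2 * indicator (cube d (1 / \<tau>)) w \<partial>Rd d)"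
  proof (rule integral_mono[OF bounded_symbol_energy_integrable[OF assms(1)]])
    show "integrable (Rd d) (\<lambda>w. B\<^sup>2 * indicator (cube d (1 / \<tau>)) w)"
      by (intro integrable_mult_right integrable_real_indicator) (auto simp: emeasure_cube)
    show "indicator (cube d (1 / \<tau>)) w * (cmod (H w))\<^sup>2 \<le> B\<^sup>2 * indicator (cube d (1 / \<tau>)) w" if "w \<in> space (Rd d)" for w
      using assms(1) that by (auto simp: bounded_symbol_def indicator_def intro!: power_mono)
  qed
  also have "\<dots> = B\<^sup>2 * (2 / \<tau>) ^ d"
    using \<tau> by (simp add: measure_def emeasure_cube)
  finally have "band_energy d \<tau> H \<le> (1 / 2) ^ d * (B\<^sup>2 * (2 / \<tau>) ^ d)"
    unfolding band_energy_def by (intro mult_left_mono) auto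
  also have "\<dots> = (1 / \<tau>) ^ d * B\<^sup>2" by (simp add: power_divide)
  finally show ?thesis .
qed

lemma band_energy_quasi_triangle:
  assumes 1: "bounded_symbol d H1 B1" and 2: "bounded_symbol d H2 B2" and m: "0 < m"
  shows "band_energy d \<tau> H1 \<le> (1 + m) * band_energy d \<tau> H2 + (1 + 1 / m) * band_energy d \<tau> (\<lambda>w. H1 w - H2 w)"
proof -
  let ?I = "\<lambda>H w. indicator (cube d (1 / \<tau>)) w * (cmod (H w))\<^sup>2"
  have i: "integrable (Rd d) (?I H1)" "integrable (Rd d) (?I H2)" "integrable (Rd d) (?I (\<lambda>w. H1 w - H2 w))"
    using 1 2 bounded_symbol_diff[OF 1 2] by (auto intro: bounded_symbol_energy_integrable)
  have pt: "(cmod a)\<^sup>2 \<le> (1 + m) * (cmod b)\<^sup>2 + (1 + 1 / m) * (cmod (a - b))\<^sup>2" for a b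
  proof -
    have "cmod a \<le> cmod b + cmod (a - b)" using norm_triangle_ineq[of b "a - b"] by simp
    then have "(cmod a)\<^sup>2 \<le> (cmod b + cmod (a - b))\<^sup>2" by (intro power_mono) auto
    also have "\<dots> = (cmod b)\<^sup>2 + 2 * (cmod b * cmod (a - b)) + (cmod (a - b))\<^sup>2" by (simp add: power2_sum)
    also have "2 * (cmod b * cmod (a - b)) \<le> m * (cmod b)\<^sup>2 + (cmod (a - b))\<^sup>2 / m"
    proof -
      have "0 \<le> (m * cmod b - cmod (a - b))\<^sup>2 / m" using m by simp
      also have "\<dots> = m * (cmod b)\<^sup>2 - 2 * (cmod b * cmod (a - b)) + (cmod (a - b))\<^sup>2 / m"
        using m by (simp add: power2_diff field_simps power2_eq_square)
      finally show ?thesis by simp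
    qed
    finally show ?thesis by (simp add: algebra_simps)
  qed
  have "(\<integral>w. ?I H1 w \<partial>Rd d) \<le> (\<integral>w. (1 + m) * ?I H2 w + (1 + 1 / m) * ?I (\<lambda>w. H1 w - H2 w) w \<partial>Rd d)"
    using i pt by (intro integral_mono Bochner_Integration.integrable_add integrable_mult_right) (auto simp: indicator_def)
  also have "\<dots> = (1 + m) * (\<integral>w. ?I H2 w \<partial>Rd d) + (1 + 1 / m) * (\<integral>w. ?I (\<lambda>w. H1 w - H2 w) w \<partial>Rd d)"
    using i by (subst Bochner_Integration.integral_add) auto
  finally have "(1 / 2) ^ d * (\<integral>w. ?I H1 w \<partial>Rd d) \<le> (1 / 2) ^ d * ((1 + m) * (\<integral>w. ?I H2 w \<partial>Rd d) + (1 + 1 / m) * (\<integral>w. ?I (\<lambda>w. H1 w - H2 w) w \<partial>Rd d))"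
    by (rule mult_left_mono) simp
  then show ?thesis unfolding band_energy_def by (simp only: distrib_left mult.left_commute)
qed

text \<open>
  Minkowski's inequality for the norm \<open>band_energy\<^sup>1\<^sup>/\<^sup>2\<close>, from the weighted inequality above with
  the weight \<open>m\<close> chosen as the quotient of the two norms. They are made positive by \<open>e / 2\<close> first, since the
  optimal weight is not defined if one of them is 0.
\<close>

lemma band_norm_triangle:
  assumes 1: "bounded_symbol d H1 B1" and 2: "bounded_symbol d H2 B2"
  shows "sqrt (band_energy d \<tau> H1) \<le> sqrt (band_energy d \<tau> H2) + sqrt (band_energy d \<tau> (\<lambda>w. H1 w - H2 w))"
proof (rule field_le_epsilon)
  fix e :: real assume e: "0 < e"
  let ?X = "band_energy d \<tau> H1" and ?a = "sqrt (band_energy d \<tau> H2)" and ?b = "sqrt (band_energy d \<tau> (\<lambda>w. H1 w - H2 w))"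
  define a b where "a = ?a + e / 2" and "b = ?b + e / 2"
  have a: "0 < a" "?a \<le> a" "0 \<le> ?a" and b: "0 < b" "?b \<le> b" "0 \<le> ?b"
    using e band_energy_nonneg by (auto simp: a_def b_def intro: add_nonneg_pos)
  have "?X \<le> (1 + b / a) * ?a\<^sup>2 + (1 + 1 / (b / a)) * ?b\<^sup>2"
    using band_energy_quasi_triangle[OF 1 2, of "b / a"] a b band_energy_nonneg by simp
  also have "\<dots> \<le> (1 + b / a) * a\<^sup>2 + (1 + 1 / (b / a)) * b\<^sup>2"
    using a b by (intro add_mono mult_left_mono power_mono) auto
  also have "\<dots> = (a + b)\<^sup>2" using a b by (simp add: field_simps power2_eq_square)
  finally have "sqrt ?X \<le> sqrt ((a + b)\<^sup>2)" by (rule real_sqrt_le_mono)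
  then show "sqrt ?X \<le> ?a + ?b + e" using a b by (simp add: a_def b_def)
qed

text \<open>
  The transform of the empirical measure; \<open>signed_ft\<close> reduces to this sum for sample points in the space.
\<close>

definition empirical_ft :: "nat \<Rightarrow> nat \<Rightarrow> (nat \<Rightarrow> vec) \<Rightarrow> vec \<Rightarrow> complex" where
  "empirical_ft d n z w = (\<Sum>j\<in>{1..n}. (1 / real n) *\<^sub>R cis (- dotv d w (z j)))"

locale sampling = Q: prob_space Q for Q :: "vec measure" +
  fixes d n :: nat and \<tau> :: real
  assumes Q_sets: "sets Q = sets (Rd d)" and n: "1 \<le> n" and \<tau>: "0 < \<tau>"
begin

abbreviation "P \<equiv> PiM {1..n} (\<lambda>_. Q)"

sublocale PP: prob_space P by (intro prob_space_PiM Q.prob_space_axioms)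

lemma Q_space: "space Q = space (Rd d)" by (rule sets_eq_imp_space_eq[OF Q_sets])

sublocale PQ: positioned_measure Q d
  by unfold_locales (simp add: measurable_cong_sets[OF Q_sets refl])

lemma sample_in_space: "z \<in> space P \<Longrightarrow> j \<in> {1..n} \<Longrightarrow> z j \<in> space (Rd d)"
  using Q_space by (auto simp: space_PiM PiE_iff)

lemma empirical_ft_measurable:
  assumes "z \<in> space P"
  shows "empirical_ft d n z \<in> borel_measurable (Rd d)"
  unfolding empirical_ft_def[abs_def]
proof (intro borel_measurable_sum borel_measurable_scaleR borel_measurable_const)
  fix j assume "j \<in> {1..n}"
  then have "z j \<in> space (Rd d)" using sample_in_space[OF assms] by blast
  then show "(\<lambda>w. cis (- dotv d w (z j))) \<in> borel_measurable (Rd d)" by measurable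
qed

lemma empirical_ft_bound: "cmod (empirical_ft d n z w) \<le> 1"
proof -
  have "cmod (empirical_ft d n z w) \<le> (\<Sum>j\<in>{1..n}. norm ((1 / real n) *\<^sub>R cis (- dotv d w (z j))))"
    unfolding empirical_ft_def by (rule norm_sum)
  also have "\<dots> = 1" using n by simp
  finally show ?thesis .
qed

lemma measure_ft_le_1: "cmod (measure_ft d Q w) \<le> 1"
  using PQ.measure_ft_bound[of w] by (simp add: Q.prob_space)

definition noise :: "(nat \<Rightarrow> vec) \<Rightarrow> real" where
  "noise z = sqrt (band_energy d \<tau> (\<lambda>w. empirical_ft d n z w - measure_ft d Q w))"

lemma deviation_symbol:
  assumes "z \<in> space P"
  shows "bounded_symbol d (\<lambda>w. empirical_ft d n z w - measure_ft d Q w) (1 + 1)"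
  using empirical_ft_measurable[OF assms] empirical_ft_bound PQ.measure_ft_measurable measure_ft_le_1
  by (intro bounded_symbol_diff) (auto simp: bounded_symbol_def)

lemma joint_measurable:
  "(\<lambda>(z, w). empirical_ft d n z w - measure_ft d Q w) \<in> borel_measurable (P \<Otimes>\<^sub>M Rd d)"
proof -
  have c: "(\<lambda>p. fst p j) \<in> P \<Otimes>\<^sub>M Rd d \<rightarrow>\<^sub>M Rd d" if "j \<in> {1..n}" for j
  proof -
    have "(\<lambda>z. z j) \<in> P \<rightarrow>\<^sub>M Q" using that by (rule measurable_component_singleton)
    then have "(\<lambda>z. z j) \<in> P \<rightarrow>\<^sub>M Rd d" by (simp add: measurable_cong_sets[OF refl Q_sets])
    then show ?thesis by (rule measurable_compose[OF measurable_fst])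
  qed
  have "(\<lambda>p. cis (- dotv d (snd p) (fst p j))) \<in> borel_measurable (P \<Otimes>\<^sub>M Rd d)" if "j \<in> {1..n}" for j
    by (intro measurable_compose[OF _ cis_measurable] borel_measurable_uminus dotv_measurable c[OF that] measurable_snd)
  moreover have "(\<lambda>p. measure_ft d Q (snd p)) \<in> borel_measurable (P \<Otimes>\<^sub>M Rd d)"
    by (rule measurable_compose[OF measurable_snd PQ.measure_ft_measurable])
  ultimately show ?thesis unfolding case_prod_beta' empirical_ft_def
    by (intro borel_measurable_diff borel_measurable_sum borel_measurable_scaleR borel_measurable_const) auto
qed

lemma energy_measurable: "(\<lambda>z. band_energy d \<tau> (\<lambda>w. empirical_ft d n z w - measure_ft d Q w)) \<in> borel_measurable P"
proof -
  interpret R: sigma_finite_measure "Rd d" by (rule sigma_finite_Rd)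
  have [measurable]: "(\<lambda>p. empirical_ft d n (fst p) (snd p) - measure_ft d Q (snd p)) \<in> borel_measurable (P \<Otimes>\<^sub>M Rd d)"
    using joint_measurable by (simp add: case_prod_beta')
  have "(\<lambda>z. \<integral>w. indicator (cube d (1 / \<tau>)) w * (cmod (empirical_ft d n z w - measure_ft d Q w))\<^sup>2 \<partial>Rd d) \<in> borel_measurable P"
    by (rule R.borel_measurable_lebesgue_integral) (unfold case_prod_beta', measurable)
  then show ?thesis unfolding band_energy_def by simp
qed

lemma noise_measurable [measurable]: "noise \<in> borel_measurable P"
  unfolding noise_def[abs_def] using energy_measurable by (rule borel_measurable_sqrt[THEN measurable_compose[rotated]])

lemma noise_range: "z \<in> space P \<Longrightarrow> 0 \<le> noise z \<and> noise z \<le> sqrt ((1 / \<tau>) ^ d * 4)"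
  unfolding noise_def using band_energy_le[OF deviation_symbol \<tau>, of z] band_energy_nonneg by auto

text \<open>
  Replacing one sample point changes the transform by the difference of two numbers of modulus 1, divided
  by \<open>n\<close>.
\<close>

lemma noise_difference:
  assumes j: "j \<in> {1..n}" and z: "z \<in> space P" and u: "u \<in> space Q" and v: "v \<in> space Q"
  shows "\<bar>noise (z(j := u)) - noise (z(j := v))\<bar> \<le> 2 * sqrt ((1 / \<tau>) ^ d) / real n"
proof -
  have upd: "z(j := t) \<in> space P" if "t \<in> space Q" for t
    using z j that by (auto simp: space_PiM PiE_iff extensional_def)
  have one: "noise (z(j := u)) \<le> noise (z(j := v)) + 2 * sqrt ((1 / \<tau>) ^ d) / real n"
    if u: "u \<in> space Q" and v: "v \<in> space Q" for u v
  proof -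
    let ?H = "\<lambda>t w. empirical_ft d n (z(j := t)) w - measure_ft d Q w"
    have diff: "?H u w - ?H v w = (1 / real n) *\<^sub>R (cis (- dotv d w u) - cis (- dotv d w v))" for w
    proof -
      have "empirical_ft d n (z(j := t)) w = (1 / real n) *\<^sub>R cis (- dotv d w t) + (\<Sum>i\<in>{1..n} - {j}. (1 / real n) *\<^sub>R cis (- dotv d w (z i)))" for t
        unfolding empirical_ft_def using j by (subst sum.remove[of _ j]) (auto intro!: sum.cong)
      then show ?thesis by (simp add: scaleR_diff_right)
    qed
    have "bounded_symbol d (\<lambda>w. ?H u w - ?H v w) (2 / real n)"
      unfolding bounded_symbol_def
    proof (intro conjI ballI)
      show "(\<lambda>w. ?H u w - ?H v w) \<in> borel_measurable (Rd d)"
        using empirical_ft_measurable[OF upd[OF u]] empirical_ft_measurable[OF upd[OF v]] PQ.measure_ft_measurable by measurable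
      fix w
      have "cmod (cis (- dotv d w u) - cis (- dotv d w v)) \<le> 2"
        using norm_triangle_ineq4[of "cis (- dotv d w u)" "cis (- dotv d w v)"] by simp
      then show "cmod (?H u w - ?H v w) \<le> 2 / real n" unfolding diff using n by (simp add: divide_right_mono)
    qed
    then have "band_energy d \<tau> (\<lambda>w. ?H u w - ?H v w) \<le> (1 / \<tau>) ^ d * (2 / real n)\<^sup>2"
      by (rule band_energy_le[OF _ \<tau>])
    then have "sqrt (band_energy d \<tau> (\<lambda>w. ?H u w - ?H v w)) \<le> sqrt ((1 / \<tau>) ^ d * (2 / real n)\<^sup>2)"
      by (rule real_sqrt_le_mono)
    also have "\<dots> = 2 * sqrt ((1 / \<tau>) ^ d) / real n" by (simp add: real_sqrt_mult)
    finally show ?thesis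
      using band_norm_triangle[OF deviation_symbol[OF upd[OF u]] deviation_symbol[OF upd[OF v]], of \<tau>] unfolding noise_def by linarith
  qed
  show ?thesis using one[OF u v] one[OF v u] by linarith
qed

text \<open>
  At each frequency the mean square deviation is the variance of a character divided by \<open>n\<close>, so at most
  \<open>1 / n\<close>; integrating over the cube, of volume \<open>(2 / \<tau>)\<^sup>d\<close>, bounds the second moment, and Jensen the first.
\<close>

lemma mean_noise: "(\<integral>z. noise z \<partial>P) \<le> sqrt ((1 / \<tau>) ^ d / real n)"
proof -
  let ?N = "\<lambda>z. band_energy d \<tau> (\<lambda>w. empirical_ft d n z w - measure_ft d Q w)"
  have nsq: "(noise z)\<^sup>2 = ?N z" for z unfolding noise_def using band_energy_nonneg by simp
  have ni: "integrable P noise"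
    using noise_range by (intro PP.integrable_const_bound[where B = "sqrt ((1 / \<tau>) ^ d * 4)"] AE_I2 noise_measurable) auto
  have nsi: "integrable P (\<lambda>z. (noise z)\<^sup>2)"
  proof (rule PP.integrable_const_bound[where B = "(1 / \<tau>) ^ d * 4"])
    show "AE z in P. norm ((noise z)\<^sup>2) \<le> (1 / \<tau>) ^ d * 4"
      unfolding nsq using band_energy_le[OF deviation_symbol \<tau>] band_energy_nonneg by (intro AE_I2) auto
  qed measurable
  have var: "(\<integral>z. (cmod (empirical_ft d n z w - measure_ft d Q w))\<^sup>2 \<partial>P) \<le> 1 / real n" if w: "w \<in> space (Rd d)" for w
  proof -
    define \<zeta> where "\<zeta> t = cis (- dotv d w t) - measure_ft d Q w" for t
    have cm [measurable]: "(\<lambda>t. cis (- dotv d w t)) \<in> borel_measurable Q" by (rule PQ.cis_meas[OF w])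
    have ci: "integrable Q (\<lambda>t. cis (- dotv d w t))" by (rule PQ.cis_integrable[OF w])
    have zm: "\<zeta> \<in> borel_measurable Q" unfolding \<zeta>_def[abs_def] by measurable
    have zb: "cmod (\<zeta> t) \<le> 2" for t
      using norm_triangle_ineq4[of "cis (- dotv d w t)" "measure_ft d Q w"] measure_ft_le_1[of w] unfolding \<zeta>_def by simp
    have z0: "integral\<^sup>L Q \<zeta> = 0"
      unfolding \<zeta>_def[abs_def] using ci by (simp add: Bochner_Integration.integral_diff Q.prob_space measure_ft_def)
    have z1: "(\<integral>t. (cmod (\<zeta> t))\<^sup>2 \<partial>Q) \<le> 1"
    proof -
      have e: "(cmod (\<zeta> t))\<^sup>2 = 1 + (cmod (measure_ft d Q w))\<^sup>2 - 2 * Re (cis (- dotv d w t) * cnj (measure_ft d Q w))" for t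
      proof -
        have "(cmod (a - b))\<^sup>2 = (cmod a)\<^sup>2 + (cmod b)\<^sup>2 - 2 * Re (a * cnj b)" for a b :: complex
          unfolding cmod_power2 by (simp add: power2_eq_square algebra_simps)
        from this[of "cis (- dotv d w t)" "measure_ft d Q w"] show ?thesis by (simp add: \<zeta>_def)
      qed
      have ri: "integrable Q (\<lambda>t. Re (cis (- dotv d w t) * cnj (measure_ft d Q w)))" using ci by (intro integrable_Re integrable_mult_left) auto
      have rv: "(\<integral>t. Re (cis (- dotv d w t) * cnj (measure_ft d Q w)) \<partial>Q) = (cmod (measure_ft d Q w))\<^sup>2"
      proof -
        have "(\<integral>t. Re (cis (- dotv d w t) * cnj (measure_ft d Q w)) \<partial>Q) = Re (\<integral>t. cis (- dotv d w t) * cnj (measure_ft d Q w) \<partial>Q)"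
          using ci by (intro integral_Re integrable_mult_left) auto
        also have "(\<integral>t. cis (- dotv d w t) * cnj (measure_ft d Q w) \<partial>Q) = measure_ft d Q w * cnj (measure_ft d Q w)"
          unfolding measure_ft_def by (rule integral_mult_left_zero)
        also have "Re (measure_ft d Q w * cnj (measure_ft d Q w)) = (cmod (measure_ft d Q w))\<^sup>2"
          by (simp add: complex_norm_square[symmetric] del: of_real_power)
        finally show ?thesis .
      qed
      have "(\<integral>t. (cmod (\<zeta> t))\<^sup>2 \<partial>Q) = 1 + (cmod (measure_ft d Q w))\<^sup>2 - 2 * (cmod (measure_ft d Q w))\<^sup>2"
      proof -
        have gen: "(\<integral>t. K - 2 * R t \<partial>Q) = K - 2 * (\<integral>t. R t \<partial>Q)" if "integrable Q R" for K :: real and R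
          using that by (simp add: Q.prob_space)
        show ?thesis unfolding e gen[OF ri] rv ..
      qed
      then show ?thesis by simp
    qed
    have "empirical_ft d n z w - measure_ft d Q w = (1 / real n) *\<^sub>R (\<Sum>j\<in>{1..n}. \<zeta> (z j))" for z
    proof -
      have "(1 / real n) *\<^sub>R (\<Sum>j\<in>{1..n}. \<zeta> (z j)) = empirical_ft d n z w - (1 / real n) *\<^sub>R (of_nat n * measure_ft d Q w)"
        by (simp add: \<zeta>_def empirical_ft_def sum_subtractf scaleR_diff_right scaleR_sum_right)
      also have "(1 / real n) *\<^sub>R (of_nat n * measure_ft d Q w) = measure_ft d Q w" using n by (simp add: scaleR_conv_of_real)
      finally show ?thesis by simp
    qed
    then have "(\<integral>z. (cmod (empirical_ft d n z w - measure_ft d Q w))\<^sup>2 \<partial>P) = (\<integral>z. (1 / real n)\<^sup>2 * (cmod (\<Sum>j\<in>{1..n}. \<zeta> (z j)))\<^sup>2 \<partial>P)"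
      by (simp add: power_mult_distrib power_divide)
    also have "\<dots> = (1 / real n)\<^sup>2 * (\<integral>z. (cmod (\<Sum>j\<in>{1..n}. \<zeta> (z j)))\<^sup>2 \<partial>P)" by (rule integral_mult_right_zero)
    also have "\<dots> = (1 / real n)\<^sup>2 * (real n * (\<integral>t. (cmod (\<zeta> t))\<^sup>2 \<partial>Q))"
      using expectation_cmod_sum_sq[OF Q.prob_space_axioms, of "{1..n}" \<zeta> 2] zm zb z0 by simp
    also have "\<dots> \<le> (1 / real n)\<^sup>2 * (real n * 1)" using z1 by (intro mult_left_mono) auto
    also have "\<dots> = 1 / real n" using n by (simp add: power2_eq_square)
    finally show ?thesis .
  qed
  have "(\<integral>z. ?N z \<partial>P) \<le> (1 / \<tau>) ^ d / real n"
  proof -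
    let ?k = "\<lambda>z w. complex_of_real ((cmod (empirical_ft d n z w - measure_ft d Q w))\<^sup>2)"
    let ?b = "\<lambda>w. indicator (cube d (1 / \<tau>)) w *\<^sub>R (1 :: complex)"
    have jm [measurable]: "(\<lambda>p. empirical_ft d n (fst p) (snd p) - measure_ft d Q (snd p)) \<in> borel_measurable (P \<Otimes>\<^sub>M Rd d)"
      using joint_measurable by (simp add: case_prod_beta')
    have bi: "integrable (Rd d) ?b" by (rule integrable_cube_bounded[where B = 1]) auto
    have fub: "(\<integral>z. 1 * (\<integral>w. ?b w * ?k z w \<partial>Rd d) \<partial>P) = (\<integral>w. ?b w * (\<integral>z. 1 * ?k z w \<partial>P) \<partial>Rd d)"
    proof (rule fubini_kernel[OF PP.sigma_finite_measure_axioms sigma_finite_Rd PP.integrable_const bi, where C = 4])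
      show "(\<lambda>(z, w). ?k z w) \<in> borel_measurable (P \<Otimes>\<^sub>M Rd d)" unfolding case_prod_beta' by measurable
      fix z w assume z: "z \<in> space P" and w: "w \<in> space (Rd d)"
      have "(cmod (empirical_ft d n z w - measure_ft d Q w))\<^sup>2 \<le> (1 + 1)\<^sup>2"
        using deviation_symbol[OF z] w unfolding bounded_symbol_def by (intro power_mono) auto
      then show "cmod (?k z w) \<le> 4" by (simp only: norm_of_real) simp
    qed
    have l: "(\<integral>w. ?b w * ?k z w \<partial>Rd d) = complex_of_real (\<integral>w. indicator (cube d (1 / \<tau>)) w * (cmod (empirical_ft d n z w - measure_ft d Q w))\<^sup>2 \<partial>Rd d)" for z
      unfolding integral_complex_of_real[symmetric] by (intro Bochner_Integration.integral_cong refl) (simp add: scaleR_conv_of_real)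
    define V where "V w = (\<integral>z. (cmod (empirical_ft d n z w - measure_ft d Q w))\<^sup>2 \<partial>P)" for w
    have r: "(\<integral>z. 1 * ?k z w \<partial>P) = complex_of_real (V w)" for w
      unfolding V_def mult_1 by (rule integral_complex_of_real)
    have "complex_of_real (\<integral>z. (\<integral>w. indicator (cube d (1 / \<tau>)) w * (cmod (empirical_ft d n z w - measure_ft d Q w))\<^sup>2 \<partial>Rd d) \<partial>P)
       = (\<integral>w. ?b w * complex_of_real (V w) \<partial>Rd d)"
      using fub unfolding l mult_1 integral_complex_of_real V_def .
    also have "\<dots> = complex_of_real (\<integral>w. indicator (cube d (1 / \<tau>)) w * V w \<partial>Rd d)"
      unfolding integral_complex_of_real[symmetric] by (intro Bochner_Integration.integral_cong refl) (simp add: scaleR_conv_of_real)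
    finally have sw: "(\<integral>z. (\<integral>w. indicator (cube d (1 / \<tau>)) w * (cmod (empirical_ft d n z w - measure_ft d Q w))\<^sup>2 \<partial>Rd d) \<partial>P)
       = (\<integral>w. indicator (cube d (1 / \<tau>)) w * V w \<partial>Rd d)" by (simp only: of_real_eq_iff)
    have "(\<integral>w. indicator (cube d (1 / \<tau>)) w * V w \<partial>Rd d) \<le> (\<integral>w. indicator (cube d (1 / \<tau>)) w * (1 / real n) \<partial>Rd d)"
    proof (rule integral_mono')
      show "integrable (Rd d) (\<lambda>w. indicator (cube d (1 / \<tau>)) w * (1 / real n))"
        by (intro integrable_mult_left integrable_real_indicator) (auto simp: emeasure_cube)
      fix w assume w: "w \<in> space (Rd d)"
      show "indicator (cube d (1 / \<tau>)) w * V w \<le> indicator (cube d (1 / \<tau>)) w * (1 / real n)"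
        unfolding V_def by (intro mult_left_mono var[OF w]) simp
      show "0 \<le> indicator (cube d (1 / \<tau>)) w * (1 / real n)" by simp
    qed
    also have "\<dots> = (2 / \<tau>) ^ d / real n" using \<tau> by (simp add: measure_def emeasure_cube)
    finally have "(1 / 2) ^ d * (\<integral>w. indicator (cube d (1 / \<tau>)) w * V w \<partial>Rd d) \<le> (1 / 2) ^ d * ((2 / \<tau>) ^ d / real n)"
      by (rule mult_left_mono) simp
    moreover have "(\<integral>z. ?N z \<partial>P) = (1 / 2) ^ d * (\<integral>w. indicator (cube d (1 / \<tau>)) w * V w \<partial>Rd d)"
      unfolding band_energy_def integral_mult_right_zero sw ..
    ultimately show ?thesis by (simp add: power_divide)
  qed
  moreover have "(\<integral>z. noise z \<partial>P)\<^sup>2 \<le> (\<integral>z. (noise z)\<^sup>2 \<partial>P)"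
  proof -
    let ?m = "\<integral>z. noise z \<partial>P"
    have "0 \<le> (\<integral>z. (noise z - ?m)\<^sup>2 \<partial>P)" by simp
    also have "\<dots> = (\<integral>z. (noise z)\<^sup>2 - 2 * ?m * noise z + ?m\<^sup>2 \<partial>P)"
      by (intro Bochner_Integration.integral_cong refl) (simp add: power2_diff algebra_simps)
    also have "\<dots> = (\<integral>z. (noise z)\<^sup>2 \<partial>P) - ?m\<^sup>2"
    proof -
      have gen: "(\<integral>z. f z - c * g z + k \<partial>P) = (\<integral>z. f z \<partial>P) - c * (\<integral>z. g z \<partial>P) + k"
        if "integrable P f" "integrable P g" for f g :: "(nat \<Rightarrow> vec) \<Rightarrow> real" and c k
        by (subst Bochner_Integration.integral_add[OF Bochner_Integration.integrable_diff[OF that(1) integrable_mult_right[OF that(2)]] PP.integrable_const],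
            subst Bochner_Integration.integral_diff[OF that(1) integrable_mult_right[OF that(2)]]) (simp add: PP.prob_space del: One_nat_def)
      show ?thesis unfolding gen[OF nsi ni] by (simp add: power2_eq_square)
    qed
    finally show ?thesis by simp
  qed
  ultimately have "(\<integral>z. noise z \<partial>P)\<^sup>2 \<le> (1 / \<tau>) ^ d / real n" by (simp add: nsq)
  then show ?thesis by (rule real_le_rsqrt)
qed

text \<open>
  With \<open>\<sigma>\<^sup>2 = \<tau>\<^sup>-\<^sup>d / n\<close>, the mean is at most \<open>\<sigma>\<close> and McDiarmid's inequality at level \<open>u \<sigma>\<close> with
  \<open>u\<^sup>2 = 2 log (1/\<alpha>)\<close> fails with probability at most \<open>\<alpha>\<close>; finally \<open>(1 + u)\<^sup>2 \<le> 2 + 2 u\<^sup>2\<close>.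
\<close>

theorem noise_bound:
  assumes \<alpha>: "0 < \<alpha>" "\<alpha> < 1"
  shows "\<exists>E\<in>sets P. 1 - \<alpha> \<le> measure P E \<and>
    (\<forall>z\<in>E. band_energy d \<tau> (\<lambda>w. empirical_ft d n z w - measure_ft d Q w) \<le> 4 * (1 + ln (1 / \<alpha>)) * ((1 / \<tau>) ^ d / real n))"
proof -
  define \<sigma> where "\<sigma> = sqrt ((1 / \<tau>) ^ d / real n)"
  define u where "u = sqrt (2 * ln (1 / \<alpha>))"
  have L: "0 < ln (1 / \<alpha>)" using \<alpha> by simp
  have u: "0 < u" "u\<^sup>2 = 2 * ln (1 / \<alpha>)" using L by (auto simp: u_def)
  have \<sigma>: "0 < \<sigma>" "\<sigma>\<^sup>2 = (1 / \<tau>) ^ d / real n" using \<tau> n by (auto simp: \<sigma>_def)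
  let ?c = "2 * sqrt ((1 / \<tau>) ^ d) / real n"
  let ?S = "{z \<in> space P. integral\<^sup>L P noise + u * \<sigma> \<le> noise z}"
  have "measure P ?S \<le> exp (- 2 * (u * \<sigma>)\<^sup>2 / (?c\<^sup>2 * real (card {1..n})))"
  proof (rule mcdiarmid[OF Q.prob_space_axioms])
    show "noise \<in> borel_measurable P" by (rule noise_measurable)
    show "\<bar>noise z\<bar> \<le> sqrt ((1 / \<tau>) ^ d * 4)" if "z \<in> space P" for z using noise_range[OF that] by simp
    show "0 < ?c" "0 < u * \<sigma>" using \<tau> n u \<sigma> by auto
  qed (use n noise_difference in auto)
  also have "- 2 * (u * \<sigma>)\<^sup>2 / (?c\<^sup>2 * real (card {1..n})) = - ln (1 / \<alpha>)"
  proof -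
    have T: "0 < (1 / \<tau>) ^ d" using \<tau> by simp
    have c2: "?c\<^sup>2 * real (card {1..n}) = 4 * \<sigma>\<^sup>2"
      using n T unfolding \<sigma>(2) by (simp add: power_divide power_mult_distrib power2_eq_square)
    have "- 2 * (u * \<sigma>)\<^sup>2 / (4 * \<sigma>\<^sup>2) = - (u\<^sup>2) / 2" using \<sigma>(1) by (simp add: power_mult_distrib)
    then show ?thesis unfolding c2 u(2) by simp
  qed
  also have "exp (- ln (1 / \<alpha>)) = \<alpha>" using \<alpha> by (simp add: ln_div)
  finally have S: "measure P ?S \<le> \<alpha>" .
  have Sm: "?S \<in> sets P" by measurable
  show ?thesis
  proof (intro bexI[of _ "space P - ?S"] conjI ballI)
    show "space P - ?S \<in> sets P" using Sm by auto
    show "1 - \<alpha> \<le> measure P (space P - ?S)" using S PP.prob_compl[OF Sm] by simp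
    fix z assume z: "z \<in> space P - ?S"
    then have "noise z \<le> integral\<^sup>L P noise + u * \<sigma>" by auto
    also have "\<dots> \<le> (1 + u) * \<sigma>" using mean_noise unfolding \<sigma>_def by (simp add: algebra_simps)
    finally have "(noise z)\<^sup>2 \<le> ((1 + u) * \<sigma>)\<^sup>2" using noise_range z by (intro power_mono) auto
    also have "\<dots> = (1 + u)\<^sup>2 * \<sigma>\<^sup>2" by (rule power_mult_distrib)
    also have "\<dots> \<le> (4 * (1 + ln (1 / \<alpha>))) * \<sigma>\<^sup>2"
    proof (rule mult_right_mono)
      have "(1 + u)\<^sup>2 \<le> 2 + 2 * u\<^sup>2" using sum_squares_bound[of 1 u] by (simp add: power2_sum)
      then show "(1 + u)\<^sup>2 \<le> 4 * (1 + ln (1 / \<alpha>))" using u(2) by simp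
    qed simp
    finally show "band_energy d \<tau> (\<lambda>w. empirical_ft d n z w - measure_ft d Q w) \<le> 4 * (1 + ln (1 / \<alpha>)) * ((1 / \<tau>) ^ d / real n)"
      unfolding \<sigma>(2) noise_def using band_energy_nonneg by simp
  qed
qed

end

section \<open>Pairing certificates with a signed measure\<close>

locale finite_signed =
  fixes M :: "vec measure" and \<mu> :: "vec set \<Rightarrow> real" and d :: nat
  assumes sm: "signed_measure M \<mu>" and fin: "variation M \<mu> (space M) < \<infinity>"
    and id: "(\<lambda>t. t) \<in> M \<rightarrow>\<^sub>M Rd d"
begin

sublocale pos: positioned_measure "jordan_pos M \<mu>" d by (rule positioned_jordan(1)[OF sm fin id])
sublocale neg: positioned_measure "jordan_neg M \<mu>" d by (rule positioned_jordan(2)[OF sm fin id])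

definition tv_integral :: "(vec \<Rightarrow> real) \<Rightarrow> real" where
  "tv_integral f = integral\<^sup>L (jordan_pos M \<mu>) f + integral\<^sup>L (jordan_neg M \<mu>) f"

lemma bounded_integrable:
  fixes f :: "vec \<Rightarrow> real"
  assumes "f \<in> borel_measurable M" "\<And>t. t \<in> space M \<Longrightarrow> \<bar>f t\<bar> \<le> B"
  shows "integrable (jordan_pos M \<mu>) f" "integrable (jordan_neg M \<mu>) f"
  using assms by (auto intro!: pos.integrable_const_bound[where B = B] neg.integrable_const_bound[where B = B] AE_I2
      simp: measurable_cong_sets[OF sets_jordan(1) refl] measurable_cong_sets[OF sets_jordan(2) refl])

lemma tv_integral_mono:
  assumes "f \<in> borel_measurable M" "g \<in> borel_measurable M"
    and "\<And>t. t \<in> space M \<Longrightarrow> \<bar>f t\<bar> \<le> B" "\<And>t. t \<in> space M \<Longrightarrow> \<bar>g t\<bar> \<le> B'"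
    and "\<And>t. t \<in> space M \<Longrightarrow> f t \<le> g t"
  shows "tv_integral f \<le> tv_integral g"
  unfolding tv_integral_def using assms
  by (intro add_mono integral_mono bounded_integrable[where f = f and B = B] bounded_integrable[where f = g and B = B']) auto

lemma tv_integral_linear:
  assumes "f \<in> borel_measurable M" "g \<in> borel_measurable M"
    and "\<And>t. t \<in> space M \<Longrightarrow> \<bar>f t\<bar> \<le> B" "\<And>t. t \<in> space M \<Longrightarrow> \<bar>g t\<bar> \<le> B'"
  shows "tv_integral (\<lambda>t. a * f t + b * g t) = a * tv_integral f + b * tv_integral g"
  unfolding tv_integral_def
  using bounded_integrable[where f = f and B = B, OF assms(1,3)] bounded_integrable[where f = g and B = B', OF assms(2,4)]
  by (simp add: algebra_simps)

lemma tv_integral_indicator: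
  assumes A: "A \<in> sets M"
  shows "ennreal (tv_integral (indicator A)) = variation M \<mu> A"
  using measure_jordan(2)[OF sm fin A] A sets.sets_into_space[OF A] by (simp add: tv_integral_def Int_absorb2)

lemma measure_eq_signed_integral:
  assumes A: "A \<in> sets M"
  shows "\<mu> A = signed_integral M \<mu> (indicator A)"
  using measure_jordan(1)[OF sm fin A] A sets.sets_into_space[OF A] by (simp add: signed_integral_def Int_absorb2)

lemma abs_signed_integral_le:
  assumes "f \<in> borel_measurable M" "\<And>t. t \<in> space M \<Longrightarrow> \<bar>f t\<bar> \<le> B"
  shows "\<bar>signed_integral M \<mu> f\<bar> \<le> tv_integral (\<lambda>t. \<bar>f t\<bar>)"
  unfolding signed_integral_def tv_integral_def
  using integral_abs_bound[of "jordan_pos M \<mu>" f] integral_abs_bound[of "jordan_neg M \<mu>" f] by linarith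

lemma signed_integral_diff:
  assumes "f \<in> borel_measurable M" "g \<in> borel_measurable M"
    and "\<And>t. t \<in> space M \<Longrightarrow> \<bar>f t\<bar> \<le> B" "\<And>t. t \<in> space M \<Longrightarrow> \<bar>g t\<bar> \<le> B'"
  shows "signed_integral M \<mu> (\<lambda>t. f t - g t) = signed_integral M \<mu> f - signed_integral M \<mu> g"
  unfolding signed_integral_def
  using bounded_integrable[where f = f and B = B, OF assms(1,3)] bounded_integrable[where f = g and B = B', OF assms(2,4)]
  by simp

end

lemma (in spike_configuration) signed_cert_pairing:
  assumes "finite_signed M \<mu> d"
  shows "complex_of_real (signed_integral M \<mu> (cert c)) = (\<integral>w. complex_of_real (psi_spectrum d \<tau> w) * amplitude c w * cnj (signed_ft d M \<mu> w) \<partial>Rd d)"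
    and "integrable (Rd d) (\<lambda>w. complex_of_real (psi_spectrum d \<tau> w) * amplitude c w * cnj (signed_ft d M \<mu> w))"
proof -
  interpret finite_signed M \<mu> d by fact
  have i: "integrable (Rd d) (\<lambda>w. complex_of_real (psi_spectrum d \<tau> w) * amplitude c w * cnj (measure_ft d N w))"
    if "positioned_measure N d" for N
  proof -
    interpret N: positioned_measure N d by fact
    show ?thesis
    proof (rule Bochner_Integration.integrable_bound[where f = "\<lambda>w. cmod (complex_of_real (psi_spectrum d \<tau> w) * amplitude c w) * measure N (space N)"])
      show "integrable (Rd d) (\<lambda>w. cmod (complex_of_real (psi_spectrum d \<tau> w) * amplitude c w) * measure N (space N))"
        using psi_spectrum_amplitude_integrable[of c] by (intro integrable_mult_left integrable_norm) auto
      show "AE w in Rd d. norm (complex_of_real (psi_spectrum d \<tau> w) * amplitude c w * cnj (measure_ft d N w)) \<le> norm (cmod (complex_of_real (psi_spectrum d \<tau> w) * amplitude c w) * measure N (space N))"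
        using N.measure_ft_bound by (intro AE_I2) (auto simp: norm_mult abs_mult intro!: mult_left_mono)
    qed measurable
  qed
  note ip = i[OF pos.positioned_measure_axioms] and ineg = i[OF neg.positioned_measure_axioms]
  have e: "complex_of_real (psi_spectrum d \<tau> w) * amplitude c w * cnj (signed_ft d M \<mu> w)
     = complex_of_real (psi_spectrum d \<tau> w) * amplitude c w * cnj (measure_ft d (jordan_pos M \<mu>) w) - complex_of_real (psi_spectrum d \<tau> w) * amplitude c w * cnj (measure_ft d (jordan_neg M \<mu>) w)" for w
    by (simp add: signed_ft_def right_diff_distrib)
  show "integrable (Rd d) (\<lambda>w. complex_of_real (psi_spectrum d \<tau> w) * amplitude c w * cnj (signed_ft d M \<mu> w))"
    unfolding e using ip ineg by (rule Bochner_Integration.integrable_diff)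
  show "complex_of_real (signed_integral M \<mu> (cert c)) = (\<integral>w. complex_of_real (psi_spectrum d \<tau> w) * amplitude c w * cnj (signed_ft d M \<mu> w) \<partial>Rd d)"
    unfolding e Bochner_Integration.integral_diff[OF ip ineg] signed_integral_def of_real_diff
      cert_pairing[OF pos.positioned_measure_axioms] cert_pairing[OF neg.positioned_measure_axioms] ..
qed

text \<open>
  A measure \<open>\<mu>\<close> whose objective does not exceed that of the spikes, in terms of symbols: \<open>\<Phi>\<close> and \<open>Y\<close> are the
  transforms of the template and of the data, and \<open>\<rho>\<^sup>2\<close> bounds the residual of the spikes. In \<open>T2\<close> and \<open>G2\<close> below, the
  squared residuals are those of \<open>\<mu>\<close> and of the spikes.
\<close>

locale comparison = spike_configuration d s \<tau> x + mu: finite_signed M \<mu> d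
  for d s \<tau> x M \<mu> +
  fixes a :: "nat \<Rightarrow> real" and \<Phi> :: "vec \<Rightarrow> complex" and Y :: "vec \<Rightarrow> complex" and Cs \<rho> \<kappa> :: real and BY :: real
  assumes a_pos: "\<And>k. k \<in> {1..s} \<Longrightarrow> 0 < a k" and a_sum: "(\<Sum>k\<in>{1..s}. a k) = 1"
    and x_M: "\<And>k. k \<in> {1..s} \<Longrightarrow> x k \<in> space M"
    and \<Phi>m: "\<Phi> \<in> borel_measurable (Rd d)" and \<Phi>1: "\<And>w. cmod (\<Phi> w) \<le> 1"
    and Y: "bounded_symbol d Y BY"
    and dom: "\<And>w. w \<in> cube d (1 / \<tau>) \<Longrightarrow> psi_spectrum d \<tau> w \<le> Cs\<^sup>2 * ((1 / 2) ^ d * (cmod (\<Phi> w))\<^sup>2)"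
    and Cs: "0 < Cs" and \<rho>: "0 < \<rho>" and \<kappa>: "\<kappa> = \<rho> / (sqrt 2 * Cs * sqrt (real s))"
    and noise: "band_energy d \<tau> (\<lambda>w. Y w - \<Phi> w * signed_ft d M (discrete_measure {1..s} a x) w) \<le> \<rho>\<^sup>2"
    and better: "band_energy d \<tau> (\<lambda>w. Y w - \<Phi> w * signed_ft d M \<mu> w) / 2 + \<kappa> * mu.tv_integral (\<lambda>_. 1)
       \<le> band_energy d \<tau> (\<lambda>w. Y w - \<Phi> w * signed_ft d M (discrete_measure {1..s} a x) w) / 2 + \<kappa>"
begin

abbreviation "\<mu>0 \<equiv> discrete_measure {1..s} a x"
abbreviation "T2 \<equiv> band_energy d \<tau> (\<lambda>w. Y w - \<Phi> w * signed_ft d M \<mu> w)"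
abbreviation "G2 \<equiv> band_energy d \<tau> (\<lambda>w. Y w - \<Phi> w * signed_ft d M \<mu>0 w)"

lemma a_nonneg: "k \<in> {1..s} \<Longrightarrow> 0 \<le> a k" using a_pos by (simp add: less_imp_le)

lemma mu0_signed: "finite_signed M \<mu>0 d"
proof
  show "signed_measure M \<mu>0" by (rule signed_measure_discrete) simp
  show "variation M \<mu>0 (space M) < \<infinity>" using a_nonneg by (subst variation_discrete) auto
qed (rule mu.id)

lemma signed_ft_symbol:
  assumes "finite_signed M \<nu> d"
  shows "\<exists>B. bounded_symbol d (\<lambda>w. \<Phi> w * signed_ft d M \<nu> w) B" and "signed_ft d M \<nu> \<in> borel_measurable (Rd d)"
proof -
  interpret nu: finite_signed M \<nu> d by fact
  show m: "signed_ft d M \<nu> \<in> borel_measurable (Rd d)" unfolding signed_ft_def[abs_def] by measurable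
  let ?B = "measure (jordan_pos M \<nu>) (space (jordan_pos M \<nu>)) + measure (jordan_neg M \<nu>) (space (jordan_neg M \<nu>))"
  have "cmod (signed_ft d M \<nu> w) \<le> ?B" for w
    unfolding signed_ft_def by (rule norm_triangle_le_diff[OF add_mono[OF nu.pos.measure_ft_bound nu.neg.measure_ft_bound]])
  then have "cmod (\<Phi> w * signed_ft d M \<nu> w) \<le> 1 * ?B" for w
    unfolding norm_mult using \<Phi>1 by (intro mult_mono) auto
  then show "\<exists>B. bounded_symbol d (\<lambda>w. \<Phi> w * signed_ft d M \<nu> w) B"
    using m \<Phi>m unfolding bounded_symbol_def by (intro exI[of _ "1 * ?B"]) auto
qed

lemma signed_integral_mu0:
  assumes f: "f \<in> borel_measurable M"
  shows "signed_integral M \<mu>0 f = (\<Sum>k\<in>{1..s}. a k * f (x k))"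
proof -
  have fin: "finite {1..s}" by simp
  have "integral\<^sup>L (jordan_pos M \<mu>0) f = (\<Sum>k\<in>{1..s}. a k *\<^sub>R f (x k))"
    using fin a_nonneg x_M f by (rule integral_jordan_pos_discrete)
  moreover have "integral\<^sup>L (jordan_neg M \<mu>0) f = 0"
    using fin a_nonneg x_M f by (rule integral_jordan_neg_discrete)
  ultimately show ?thesis by (simp add: signed_integral_def)
qed

lemma cert_measurable_M: "cert c \<in> borel_measurable M"
  by (rule measurable_compose[OF mu.id cert_measurable])

text \<open>
  The pairing bound for \<open>\<mu> - \<mu>\<^sup>0\<close>, whose transform times \<open>\<Phi>\<close> is the difference of the residual symbols of \<open>\<mu>\<close> and of the spikes.
\<close>

lemma cert_difference:
  assumes val: "\<And>k. k \<in> {1..s} \<Longrightarrow> cert c (x k) = b k"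
    and grad: "\<And>k j. k \<in> {1..s} \<Longrightarrow> j < d \<Longrightarrow> interp c j (\<lambda>i. x k i / (4 * \<tau>)) = 0"
    and E: "(\<Sum>k\<in>{1..s}. c k d * b k) \<le> 2 * real s"
    and m: "0 < m"
  shows "\<bar>signed_integral M \<mu> (cert c) - (\<Sum>k\<in>{1..s}. a k * b k)\<bar> \<le> m * real s + Cs\<^sup>2 * (T2 + G2) / m"
proof -
  let ?D = "\<lambda>w. signed_ft d M \<mu> w - signed_ft d M \<mu>0 w"
  obtain B1 where B1: "bounded_symbol d (\<lambda>w. \<Phi> w * signed_ft d M \<mu> w) B1" using signed_ft_symbol(1)[OF mu.finite_signed_axioms] by blast
  obtain B2 where B2: "bounded_symbol d (\<lambda>w. \<Phi> w * signed_ft d M \<mu>0 w) B2" using signed_ft_symbol(1)[OF mu0_signed] by blast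
  have Deq: "\<Phi> w * ?D w = \<Phi> w * signed_ft d M \<mu> w - \<Phi> w * signed_ft d M \<mu>0 w" for w by (simp add: right_diff_distrib)
  have BD: "bounded_symbol d (\<lambda>w. \<Phi> w * ?D w) (B1 + B2)" unfolding Deq by (rule bounded_symbol_diff[OF B1 B2])
  have "band_energy d \<tau> (\<lambda>w. \<Phi> w * ?D w) \<le> 2 * (T2 + G2)"
  proof -
    have "bounded_symbol d (\<lambda>w. Y w - \<Phi> w * signed_ft d M \<mu>0 w) (BY + B2)" by (rule bounded_symbol_diff[OF Y B2])
    from band_energy_quasi_triangle[OF BD this, of 1 \<tau>]
    have "band_energy d \<tau> (\<lambda>w. \<Phi> w * ?D w) \<le> 2 * G2 + 2 * band_energy d \<tau> (\<lambda>w. \<Phi> w * ?D w - (Y w - \<Phi> w * signed_ft d M \<mu>0 w))" by simp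
    also have "band_energy d \<tau> (\<lambda>w. \<Phi> w * ?D w - (Y w - \<Phi> w * signed_ft d M \<mu>0 w)) = T2"
      unfolding band_energy_def Deq by (simp add: norm_minus_commute)
    finally show ?thesis by simp
  qed
  note be = this
  have "signed_integral M \<mu>0 (cert c) = (\<Sum>k\<in>{1..s}. a k * b k)"
    unfolding signed_integral_mu0[OF cert_measurable_M] by (rule sum.cong[OF refl]) (simp only: val)
  then have "complex_of_real (signed_integral M \<mu> (cert c) - (\<Sum>k\<in>{1..s}. a k * b k))
     = complex_of_real (signed_integral M \<mu> (cert c)) - complex_of_real (signed_integral M \<mu>0 (cert c))" by simp
  also have "\<dots> = (\<integral>w. complex_of_real (psi_spectrum d \<tau> w) * amplitude c w * cnj (?D w) \<partial>Rd d)"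
    unfolding signed_cert_pairing(1)[OF mu.finite_signed_axioms] signed_cert_pairing(1)[OF mu0_signed]
    by (subst Bochner_Integration.integral_diff[OF signed_cert_pairing(2)[OF mu.finite_signed_axioms] signed_cert_pairing(2)[OF mu0_signed], symmetric])
       (simp add: right_diff_distrib)
  finally have "\<bar>signed_integral M \<mu> (cert c) - (\<Sum>k\<in>{1..s}. a k * b k)\<bar> = cmod (\<integral>w. complex_of_real (psi_spectrum d \<tau> w) * amplitude c w * cnj (?D w) \<partial>Rd d)"
    by (metis norm_of_real real_norm_def)
  also have "\<dots> \<le> (m * (2 * real s) + Cs\<^sup>2 * band_energy d \<tau> (\<lambda>w. \<Phi> w * ?D w) / m) / 2"
  proof (rule pairing_bound[OF val grad E dom _ \<Phi>m _ m])
    show "?D \<in> borel_measurable (Rd d)"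
      using signed_ft_symbol(2)[OF mu.finite_signed_axioms] signed_ft_symbol(2)[OF mu0_signed] by measurable
    show "cmod (\<Phi> w * ?D w) \<le> B1 + B2" if "w \<in> space (Rd d)" for w using BD that unfolding bounded_symbol_def by blast
  qed
  also have "\<dots> \<le> (m * (2 * real s) + Cs\<^sup>2 * (2 * (T2 + G2)) / m) / 2"
    using be m by (intro divide_right_mono add_left_mono mult_left_mono) auto
  also have "\<dots> = m * real s + Cs\<^sup>2 * (T2 + G2) / m"
  proof -
    have "(m * (2 * S) + K * (2 * X) / m) / 2 = m * S + K * X / m" for S K X :: real by (simp add: add_divide_distrib)
    then show ?thesis .
  qed
  finally show ?thesis .
qed

end

section \<open>Localisation of the mass\<close>

text \<open>
  The factor 4/3 converts the metric of the near and far regions, with scale \<open>2 \<surd>3 \<tau>\<close>, to the coordinates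
  of the kernel, with scale \<open>4 \<tau>\<close>.
\<close>

lemma scaled_dist_nsq:
  assumes "0 < \<tau>"
  shows "(scaled_dist d \<tau> t y)\<^sup>2 = 4 / 3 * nsq d (\<lambda>i. t i / (4 * \<tau>) - y i / (4 * \<tau>))"
proof -
  have "nsq d (\<lambda>i. t i / (4 * \<tau>) - y i / (4 * \<tau>)) = (\<Sum>i<d. (t i - y i)\<^sup>2) / (16 * \<tau>\<^sup>2)"
    unfolding nsq_def sum_divide_distrib
    by (intro sum.cong refl) (simp add: diff_divide_distrib[symmetric] power_divide power_mult_distrib)
  moreover have "(vdist d t y)\<^sup>2 = (\<Sum>i<d. (t i - y i)\<^sup>2)"
    by (simp add: vdist_def L2_set_def sum_nonneg)
  ultimately show ?thesis using assms by (simp add: scaled_dist_def power_mult_distrib power_divide)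
qed

lemma scaled_dist_nonneg: "0 < \<tau> \<Longrightarrow> 0 \<le> scaled_dist d \<tau> t y"
  by (simp add: scaled_dist_def vdist_def L2_set_nonneg)

context comparison
begin

lemma \<kappa>_pos: "0 < \<kappa>" and \<kappa>_identity: "2 * real s * \<kappa>\<^sup>2 * Cs\<^sup>2 = \<rho>\<^sup>2"
proof -
  have s0: "0 < real s" using s by simp
  show "0 < \<kappa>" unfolding \<kappa> using \<rho> Cs s0 by simp
  show "2 * real s * \<kappa>\<^sup>2 * Cs\<^sup>2 = \<rho>\<^sup>2"
    unfolding \<kappa> using Cs s0 by (simp add: power_divide power_mult_distrib)
qed

text \<open>
  The scale of all errors: \<open>\<rho>\<^sup>2 / \<kappa> = \<surd>2 Z\<close>.
\<close>

definition Z :: real where "Z = Cs * sqrt (real s) * \<rho>"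

lemma Z_pos: "0 < Z" unfolding Z_def using Cs \<rho> s by simp

lemma \<rho>_over_\<kappa>: "\<rho>\<^sup>2 / \<kappa> = sqrt 2 * Z"
  unfolding \<kappa> Z_def using \<rho> Cs s by (simp add: power2_eq_square)

text \<open>
  The certificate with values 1 is a subgradient of the total variation at the spikes, and the integral of
  \<open>1 - |\<eta>|\<close> is bounded by the Bregman divergence. Comparing objectives bounds \<open>\<kappa>\<close> times this divergence by
  \<open>(G2 - T2) / 2\<close> plus \<open>\<kappa>\<close> times the pairing with \<open>\<mu> - \<mu>\<^sup>0\<close>, for any weight \<open>m\<close> in the pairing bound. With
  \<open>m = p \<kappa> Cs\<^sup>2\<close> the latter is \<open>(p/2) \<rho>\<^sup>2 + (T2 + G2) / p\<close>: the choice \<open>p = 2\<close> cancels the unknown residual \<open>T2\<close>, and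
  \<open>p = 4\<close> leaves it with a negative coefficient, which bounds it.
\<close>

lemma bregman:
  assumes c1: "\<And>k. k \<in> {1..s} \<Longrightarrow> cert c (x k) = 1"
    and grad: "\<And>k j. k \<in> {1..s} \<Longrightarrow> j < d \<Longrightarrow> interp c j (\<lambda>i. x k i / (4 * \<tau>)) = 0"
    and E: "(\<Sum>k\<in>{1..s}. c k d * 1) \<le> 2 * real s"
    and le1: "\<And>t. t \<in> space M \<Longrightarrow> \<bar>cert c t\<bar> \<le> 1"
  shows "mu.tv_integral (\<lambda>t. 1 - \<bar>cert c t\<bar>) \<le> 2 * sqrt 2 * Z"
    and "T2 \<le> 11 * \<rho>\<^sup>2"
proof -
  let ?D = "mu.tv_integral (\<lambda>t. 1 - \<bar>cert c t\<bar>)" and ?m = "mu.tv_integral (\<lambda>_. 1)"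
  note cm = cert_measurable_M[of c]
  have abm: "(\<lambda>t. \<bar>cert c t\<bar>) \<in> borel_measurable M" using cm by measurable
  have D: "?D = ?m - mu.tv_integral (\<lambda>t. \<bar>cert c t\<bar>)"
    using mu.tv_integral_linear[of "\<lambda>_. 1" "\<lambda>t. \<bar>cert c t\<bar>" 1 1 1 "-1", OF _ abm] le1 by simp
  have D0: "0 \<le> ?D"
    using mu.tv_integral_mono[of "\<lambda>_. 0" "\<lambda>t. 1 - \<bar>cert c t\<bar>" 0 1] le1 abm by (simp add: mu.tv_integral_def)
  have "signed_integral M \<mu> (cert c) \<le> mu.tv_integral (\<lambda>t. \<bar>cert c t\<bar>)"
    using mu.abs_signed_integral_le[OF cm le1] by linarith
  then have DS: "?D \<le> ?m - signed_integral M \<mu> (cert c)" unfolding D by linarith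
  have key: "\<kappa> * ?D \<le> (G2 - T2) / 2 + \<kappa> * (m * real s + Cs\<^sup>2 * (T2 + G2) / m)" if m: "0 < m" for m
  proof -
    have "\<bar>signed_integral M \<mu> (cert c) - (\<Sum>k\<in>{1..s}. a k * 1)\<bar> \<le> m * real s + Cs\<^sup>2 * (T2 + G2) / m"
      by (rule cert_difference[where b = "\<lambda>_. 1", OF c1 grad E m])
    then have "1 - signed_integral M \<mu> (cert c) \<le> m * real s + Cs\<^sup>2 * (T2 + G2) / m"
      using a_sum by (simp del: One_nat_def)
    then have "?D \<le> (?m - 1) + (m * real s + Cs\<^sup>2 * (T2 + G2) / m)" using DS by linarith
    then have "\<kappa> * ?D \<le> \<kappa> * ((?m - 1) + (m * real s + Cs\<^sup>2 * (T2 + G2) / m))"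
      using \<kappa>_pos by (intro mult_left_mono) auto
    also have "\<dots> = (\<kappa> * ?m - \<kappa>) + \<kappa> * (m * real s + Cs\<^sup>2 * (T2 + G2) / m)" by (simp add: algebra_simps)
    finally have fin: "\<kappa> * ?D \<le> (\<kappa> * ?m - \<kappa>) + \<kappa> * (m * real s + Cs\<^sup>2 * (T2 + G2) / m)" .
    have "\<kappa> * ?m - \<kappa> \<le> (G2 - T2) / 2" using better by (simp add: diff_divide_distrib)
    then show ?thesis using fin by (rule order_trans[OF _ add_right_mono, rotated])
  qed
  have expand: "\<kappa> * ((p * \<kappa> * Cs\<^sup>2) * real s + Cs\<^sup>2 * X / (p * \<kappa> * Cs\<^sup>2)) = p / 2 * \<rho>\<^sup>2 + X / p" if "0 < p" for p X
  proof -
    have "\<kappa> * (Cs\<^sup>2 * X / (p * \<kappa> * Cs\<^sup>2)) = X / p" using \<kappa>_pos Cs that by simp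
    moreover have "\<kappa> * ((p * \<kappa> * Cs\<^sup>2) * real s) = p / 2 * \<rho>\<^sup>2"
      unfolding \<kappa>_identity[symmetric] by (simp add: power2_eq_square)
    ultimately show ?thesis by (simp only: distrib_left)
  qed
  have pos: "0 < p * \<kappa> * Cs\<^sup>2" if "0 < p" for p using \<kappa>_pos Cs that by simp
  have "\<kappa> * ?D \<le> (G2 - T2) / 2 + (2 / 2 * \<rho>\<^sup>2 + (T2 + G2) / 2)"
    using key[OF pos[of 2]] expand[of 2 "T2 + G2"] by simp
  then have "\<kappa> * ?D \<le> 2 * \<rho>\<^sup>2" using noise by (simp add: diff_divide_distrib add_divide_distrib)
  then have "?D \<le> 2 * (\<rho>\<^sup>2 / \<kappa>)" using \<kappa>_pos by (simp add: field_simps)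
  then show "?D \<le> 2 * sqrt 2 * Z" unfolding \<rho>_over_\<kappa> by simp
  have "\<kappa> * ?D \<le> (G2 - T2) / 2 + (4 / 2 * \<rho>\<^sup>2 + (T2 + G2) / 4)"
    using key[OF pos[of 4]] expand[of 4 "T2 + G2"] by simp
  then have "0 \<le> (G2 - T2) / 2 + (4 / 2 * \<rho>\<^sup>2 + (T2 + G2) / 4)"
    by (rule order_trans[rotated]) (use \<kappa>_pos D0 in simp)
  moreover have "0 \<le> (g - t) / 2 + (4 / 2 * q + (t + g) / 4) \<Longrightarrow> g \<le> q \<Longrightarrow> t \<le> 11 * q" for g t q :: real
    by (simp add: field_simps)
  ultimately show "T2 \<le> 11 * \<rho>\<^sup>2" using noise by blast
qed

text \<open>
  On the far region \<open>1 - |\<eta>| \<ge> 23/96 * 3/4 r\<^sup>2 = 23/128 r\<^sup>2\<close>, so that the divergence \<open>2 \<surd>2 Z\<close> bounds its mass by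
  \<open>256 \<surd>2 / 23 * Z / r\<^sup>2\<close>. For a near region \<open>N\<close>, the certificate \<open>\<eta>\<^sub>k\<close> is within \<open>|u|\<^sup>2\<close> of the indicator of \<open>N\<close> at
  distance \<open>|u| \<le> 1\<close> of any spike, hence within \<open>96/23 (1 - |\<eta>|)\<close>, and on the far region it differs from the
  indicator by at most 2. Adding the error \<open>7 Z\<close> in \<open>\<integral> \<eta>\<^sub>k d(\<mu> - \<mu>\<^sup>0)\<close> gives the coefficient
  \<open>512 + 192 + 161 \<le> 1536\<close> of \<open>\<surd>2 / 23 * Z / r\<^sup>2\<close>.
\<close>

theorem localisation:
  assumes r: "0 < r" "r \<le> 1"
    and F: "F \<in> sets M" "\<And>t. t \<in> space M \<Longrightarrow> t \<in> F \<longleftrightarrow> (\<forall>k\<in>{1..s}. r < scaled_dist d \<tau> t (x k))"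
    and N: "\<And>k. k \<in> {1..s} \<Longrightarrow> N k \<in> sets M"
       "\<And>k t. k \<in> {1..s} \<Longrightarrow> t \<in> space M \<Longrightarrow> t \<in> N k \<longleftrightarrow> scaled_dist d \<tau> t (x k) \<le> r"
  shows "mu.tv_integral (indicator F) \<le> 256 * sqrt 2 / 23 * (Z / r\<^sup>2)"
    and "k \<in> {1..s} \<Longrightarrow> \<bar>\<mu> (N k) - a k\<bar> \<le> 1536 * sqrt 2 / 23 * (Z / r\<^sup>2)"
proof -
  let ?u = "\<lambda>k t. nsq d (\<lambda>i. t i / (4 * \<tau>) - x k i / (4 * \<tau>))"
  have r2: "0 < r\<^sup>2" "r\<^sup>2 \<le> 1" using r by (auto simp: power_le_one)
  \<comment> \<open>the radius \<open>r \<le> 1\<close> in the metric of the regions keeps \<open>?u\<close> below 1, where the quadratic bounds hold\<close>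
  have near_u: "?u k t \<le> 3 / 4 * r\<^sup>2" if "scaled_dist d \<tau> t (x k) \<le> r" for k t
  proof -
    have "(scaled_dist d \<tau> t (x k))\<^sup>2 \<le> r\<^sup>2" using that scaled_dist_nonneg[OF \<tau>] by (intro power_mono)
    then show ?thesis unfolding scaled_dist_nsq[OF \<tau>] by simp
  qed
  have far_u: "3 / 4 * r\<^sup>2 \<le> ?u k t" if "r < scaled_dist d \<tau> t (x k)" for k t
  proof -
    have "r\<^sup>2 \<le> (scaled_dist d \<tau> t (x k))\<^sup>2" using that r by (intro power_mono) auto
    then show ?thesis unfolding scaled_dist_nsq[OF \<tau>] by simp
  qed
  have one: "\<bar>1 :: real\<bar> \<le> 1" by simp
  obtain c where cc: "(\<forall>k\<in>{1..s}. interp c d (\<lambda>i. x k i / (4 * \<tau>)) = 1) \<and>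
      (\<forall>k\<in>{1..s}. \<forall>j<d. interp c j (\<lambda>i. x k i / (4 * \<tau>)) = 0) \<and>
      (\<Sum>k\<in>{1..s}. c k d * 1) \<le> 2 * real s \<and>
      (\<forall>y. \<bar>interp c d y\<bar> \<le> 2) \<and>
      (\<forall>k\<in>{1..s}. \<forall>y. nsq d (\<lambda>i. y i - x k i / (4 * \<tau>)) \<le> 1 \<longrightarrow> \<bar>interp c d y - 1\<bar> \<le> nsq d (\<lambda>i. y i - x k i / (4 * \<tau>))) \<and>
      (\<forall>k\<in>{1..s}. \<forall>y. nsq d (\<lambda>i. y i - x k i / (4 * \<tau>)) \<le> 1 \<longrightarrow> (1::real) = 1 \<longrightarrow>
         \<bar>interp c d y\<bar> \<le> 1 - 23 / 96 * nsq d (\<lambda>i. y i - x k i / (4 * \<tau>))) \<and>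
      (\<forall>y. (\<forall>k\<in>{1..s}. 1 \<le> nsq d (\<lambda>i. y i - x k i / (4 * \<tau>))) \<longrightarrow> \<bar>interp c d y\<bar> \<le> 1 - 23 / 96)"
    using certificate_exists[where b = "\<lambda>_. 1", OF one] by (rule exE)
  have c: "\<And>k. k \<in> {1..s} \<Longrightarrow> interp c d (\<lambda>i. x k i / (4 * \<tau>)) = 1"
      "\<And>k j. k \<in> {1..s} \<Longrightarrow> j < d \<Longrightarrow> interp c j (\<lambda>i. x k i / (4 * \<tau>)) = 0"
      "(\<Sum>k\<in>{1..s}. c k d * 1) \<le> 2 * real s"
    and c_near: "\<And>k y. k \<in> {1..s} \<Longrightarrow> nsq d (\<lambda>i. y i - x k i / (4 * \<tau>)) \<le> 1 \<Longrightarrow>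
           \<bar>interp c d y\<bar> \<le> 1 - 23 / 96 * nsq d (\<lambda>i. y i - x k i / (4 * \<tau>))"
    and c_far: "\<And>y. \<forall>k\<in>{1..s}. 1 \<le> nsq d (\<lambda>i. y i - x k i / (4 * \<tau>)) \<Longrightarrow> \<bar>interp c d y\<bar> \<le> 1 - 23 / 96"
    using cc by (blast, blast, blast, blast, blast)
  have near: "23 / 96 * ?u k t \<le> 1 - \<bar>cert c t\<bar>" if "k \<in> {1..s}" "?u k t \<le> 1" for k t
    using c_near[of k "\<lambda>i. t i / (4 * \<tau>)"] that unfolding cert_def by simp
  have cert_gap: "\<exists>k\<in>{1..s}. 23 / 96 * min (?u k t) 1 \<le> 1 - \<bar>cert c t\<bar>" for t
  proof (cases "\<exists>k\<in>{1..s}. ?u k t \<le> 1")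
    case True
    then obtain k where k: "k \<in> {1..s}" "?u k t \<le> 1" by blast
    then show ?thesis using near[OF k] by (intro bexI[of _ k]) auto
  next
    case False
    then have "\<bar>interp c d (\<lambda>i. t i / (4 * \<tau>))\<bar> \<le> 1 - 23 / 96" by (intro c_far) force
    moreover have "1 \<in> {1..s}" using s by simp
    moreover from this False have "min (?u 1 t) 1 = 1" by force
    ultimately show ?thesis unfolding cert_def by (intro bexI[of _ 1]) auto
  qed
  have le1: "\<bar>cert c t\<bar> \<le> 1" for t
  proof -
    obtain k where k: "23 / 96 * min (?u k t) 1 \<le> 1 - \<bar>cert c t\<bar>" using cert_gap[of t] by blast
    have "0 \<le> min (?u k t) 1" using nsq_nonneg by simp
    then show ?thesis using k by linarith
  qed
  have cF: "cert c (x k) = 1" if "k \<in> {1..s}" for k using c(1)[OF that] by (simp add: cert_def)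
  note B = bregman[OF cF c(2,3) le1]
  let ?D = "mu.tv_integral (\<lambda>t. 1 - \<bar>cert c t\<bar>)"
  have abm: "(\<lambda>t. \<bar>cert c t\<bar>) \<in> borel_measurable M" using cert_measurable_M[of c] by measurable
  have far_gap: "23 / 128 * r\<^sup>2 * indicator F t \<le> 1 - \<bar>cert c t\<bar>" if t: "t \<in> space M" for t
  proof (cases "t \<in> F")
    case True
    obtain k where k: "k \<in> {1..s}" "23 / 96 * min (?u k t) 1 \<le> 1 - \<bar>cert c t\<bar>" using cert_gap by blast
    have "r < scaled_dist d \<tau> t (x k)" using F(2)[OF t] True k(1) by blast
    then have "3 / 4 * r\<^sup>2 \<le> ?u k t" by (rule far_u)
    then have "3 / 4 * r\<^sup>2 \<le> min (?u k t) 1" using r2 by simp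
    then have "23 / 128 * r\<^sup>2 \<le> 1 - \<bar>cert c t\<bar>" using k(2) by linarith
    then show ?thesis using True by simp
  next
    case False
    then show ?thesis using le1 by simp
  qed
  have "mu.tv_integral (\<lambda>t. 23 / 128 * r\<^sup>2 * indicator F t + 0 * 0) \<le> ?D"
    using F(1) abm far_gap le1 r2
    by (intro mu.tv_integral_mono[where B = 1 and B' = 1]) (auto simp: indicator_def)
  moreover have "mu.tv_integral (\<lambda>t. 23 / 128 * r\<^sup>2 * indicator F t + 0 * 0) = 23 / 128 * r\<^sup>2 * mu.tv_integral (indicator F) + 0 * mu.tv_integral (\<lambda>_. 0)"
    using F(1) by (intro mu.tv_integral_linear[where B = 1 and B' = 0]) (auto simp: indicator_def)
  ultimately have "23 / 128 * r\<^sup>2 * mu.tv_integral (indicator F) \<le> 2 * sqrt 2 * Z" using B(1) by simp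
  then have "mu.tv_integral (indicator F) \<le> 2 * sqrt 2 * Z / (23 / 128 * r\<^sup>2)"
    using r2 by (simp add: le_divide_eq mult_ac)
  then show V: "mu.tv_integral (indicator F) \<le> 256 * sqrt 2 / 23 * (Z / r\<^sup>2)" by simp
  assume k: "k \<in> {1..s}"
  have one: "\<bar>if l = k then 1 else 0 :: real\<bar> \<le> 1" for l by simp
  obtain e where ee: "(\<forall>l\<in>{1..s}. interp e d (\<lambda>i. x l i / (4 * \<tau>)) = (if l = k then 1 else 0)) \<and>
      (\<forall>l\<in>{1..s}. \<forall>j<d. interp e j (\<lambda>i. x l i / (4 * \<tau>)) = 0) \<and>
      (\<Sum>l\<in>{1..s}. e l d * (if l = k then 1 else 0)) \<le> 2 * real s \<and>
      (\<forall>y. \<bar>interp e d y\<bar> \<le> 2) \<and>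
      (\<forall>l\<in>{1..s}. \<forall>y. nsq d (\<lambda>i. y i - x l i / (4 * \<tau>)) \<le> 1 \<longrightarrow>
         \<bar>interp e d y - (if l = k then 1 else 0)\<bar> \<le> nsq d (\<lambda>i. y i - x l i / (4 * \<tau>)))"
    using certificate_exists[where b = "\<lambda>l. if l = k then 1 else 0", OF one] by (elim exE conjE) blast
  have e: "\<And>l. l \<in> {1..s} \<Longrightarrow> interp e d (\<lambda>i. x l i / (4 * \<tau>)) = (if l = k then 1 else 0)"
      "\<And>l j. l \<in> {1..s} \<Longrightarrow> j < d \<Longrightarrow> interp e j (\<lambda>i. x l i / (4 * \<tau>)) = 0"
      "(\<Sum>l\<in>{1..s}. e l d * (if l = k then 1 else 0)) \<le> 2 * real s"
    and e2: "\<And>y. \<bar>interp e d y\<bar> \<le> 2"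
    and e_near: "\<And>l y. l \<in> {1..s} \<Longrightarrow> nsq d (\<lambda>i. y i - x l i / (4 * \<tau>)) \<le> 1 \<Longrightarrow>
           \<bar>interp e d y - (if l = k then 1 else 0)\<bar> \<le> nsq d (\<lambda>i. y i - x l i / (4 * \<tau>))"
    using ee by (blast, blast, blast, blast, blast)
  have eF: "cert e (x l) = (if l = k then 1 else 0)" if "l \<in> {1..s}" for l using e(1)[OF that] by (simp add: cert_def)
  have em: "cert e \<in> borel_measurable M" by (rule cert_measurable_M)
  have Nm: "indicator (N k) \<in> borel_measurable M" using N(1)[OF k] by simp
  have e2': "\<bar>cert e t\<bar> \<le> 2" for t unfolding cert_def by (rule e2)
  define q where "q t = \<bar>indicator (N k) t - cert e t\<bar>" for t
  have qm: "q \<in> borel_measurable M" unfolding q_def[abs_def] using em Nm by measurable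
  have qb: "\<bar>q t\<bar> \<le> 3" for t using e2'[of t] by (auto simp: q_def indicator_def)
  have q_le: "q t \<le> 2 * indicator F t + 96 / 23 * (1 - \<bar>cert c t\<bar>)" if t: "t \<in> space M" for t
  proof (cases "t \<in> F")
    case True
    then have "t \<notin> N k" using F(2)[OF t] N(2)[OF k t] k by force
    then have "q t \<le> 2" using e2'[of t] by (simp add: q_def)
    moreover have "0 \<le> 96 / 23 * (1 - \<bar>cert c t\<bar>)" using le1[of t] by simp
    moreover have "indicator F t = (1 :: real)" using True by simp
    ultimately show ?thesis by linarith
  next
    case False
    then obtain l0 where "l0 \<in> {1..s}" "scaled_dist d \<tau> t (x l0) \<le> r" using F(2)[OF t] by force
    then obtain l where l: "l \<in> {1..s}" "scaled_dist d \<tau> t (x l) \<le> r" and lk: "t \<in> N k \<Longrightarrow> l = k"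
      using N(2)[OF k t] k by (cases "t \<in> N k") auto
    have ul: "?u l t \<le> 1" using near_u[OF l(2)] r2 by linarith
    have "indicator (N k) t = (if l = k then 1 else 0 :: real)"
      using lk N(2)[OF k t] l(2) by (auto simp: indicator_def)
    then have "q t \<le> ?u l t"
      using e_near[OF l(1), of "\<lambda>i. t i / (4 * \<tau>)"] ul unfolding q_def cert_def by (simp add: abs_minus_commute)
    also have "\<dots> \<le> 96 / 23 * (1 - \<bar>cert c t\<bar>)" using near[OF l(1) ul] by simp
    finally show ?thesis using False by simp
  qed
  have "mu.tv_integral q \<le> mu.tv_integral (\<lambda>t. 2 * indicator F t + 96 / 23 * (1 - \<bar>cert c t\<bar>))"
    using qm F(1) abm qb q_le le1
    by (intro mu.tv_integral_mono[where B = 3 and B' = 10]) (auto simp: indicator_def)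
  also have "\<dots> = 2 * mu.tv_integral (indicator F) + 96 / 23 * ?D"
    using F(1) abm le1 by (intro mu.tv_integral_linear[where B = 1 and B' = 1]) (auto simp: indicator_def)
  finally have qI: "mu.tv_integral q \<le> 2 * mu.tv_integral (indicator F) + 96 / 23 * ?D" .
  have "signed_integral M \<mu> (\<lambda>t. indicator (N k) t - cert e t) = \<mu> (N k) - signed_integral M \<mu> (cert e)"
    unfolding mu.measure_eq_signed_integral[OF N(1)[OF k]]
    by (intro mu.signed_integral_diff[where B = 1 and B' = 2] Nm em e2') (auto simp: indicator_def)
  moreover have "\<bar>signed_integral M \<mu> (\<lambda>t. indicator (N k) t - cert e t)\<bar> \<le> mu.tv_integral q"
    using qb unfolding q_def
    by (intro mu.abs_signed_integral_le[where B = 3] borel_measurable_diff Nm em) auto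
  ultimately have s1: "\<bar>\<mu> (N k) - signed_integral M \<mu> (cert e)\<bar> \<le> mu.tv_integral q" by simp
  have sp: "0 < real s" using s by simp
  \<comment> \<open>balances the two terms, given \<open>T2 + G2 \<le> 12 \<rho>\<^sup>2\<close>, up to a constant\<close>
  let ?m = "4 * Cs * \<rho> / sqrt (real s)"
  have mp: "0 < ?m" using Cs \<rho> sp by simp
  have "\<bar>signed_integral M \<mu> (cert e) - (\<Sum>l\<in>{1..s}. a l * (if l = k then 1 else 0))\<bar> \<le> ?m * real s + Cs\<^sup>2 * (T2 + G2) / ?m"
    by (rule cert_difference[where b = "\<lambda>l. if l = k then 1 else 0", OF eF e(2,3) mp])
  also have "(\<Sum>l\<in>{1..s}. a l * (if l = k then 1 else 0)) = a k" using k by (simp add: if_distrib cong: if_cong)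
  also have "Cs\<^sup>2 * (T2 + G2) / ?m \<le> Cs\<^sup>2 * (12 * \<rho>\<^sup>2) / ?m"
    using B(2) noise mp by (intro divide_right_mono mult_left_mono) auto
  also have "?m * real s + Cs\<^sup>2 * (12 * \<rho>\<^sup>2) / ?m = 7 * Z"
  proof -
    have a: "?m * real s = 4 * Z" unfolding Z_def using sp by (simp add: real_div_sqrt field_simps)
    have b: "Cs\<^sup>2 * (12 * \<rho>\<^sup>2) / ?m = 3 * Z" unfolding Z_def using Cs \<rho> sp by (simp add: power2_eq_square field_simps)
    show ?thesis unfolding a b by simp
  qed
  finally have s2: "\<bar>signed_integral M \<mu> (cert e) - a k\<bar> \<le> 7 * Z" by simp
  have "\<bar>\<mu> (N k) - a k\<bar> \<le> 2 * (256 * sqrt 2 / 23 * (Z / r\<^sup>2)) + 96 / 23 * (2 * sqrt 2 * Z) + 7 * Z"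
    using s1 s2 qI V B(1) by linarith
  also have "\<dots> \<le> 2 * (256 * sqrt 2 / 23 * (Z / r\<^sup>2)) + 192 / 23 * (sqrt 2 * (Z / r\<^sup>2)) + 7 * (sqrt 2 * (Z / r\<^sup>2))"
  proof -
    have "Z \<le> Z / r\<^sup>2" using r2 Z_pos by (simp add: le_divide_eq mult_left_le)
    then have 1: "sqrt 2 * Z \<le> sqrt 2 * (Z / r\<^sup>2)" by (rule mult_left_mono) simp
    have "1 * Z \<le> sqrt 2 * Z" using Z_pos by (intro mult_right_mono) auto
    then show ?thesis using 1 by linarith
  qed
  also have "\<dots> = (704 + 161) * sqrt 2 / 23 * (Z / r\<^sup>2)" by (simp add: field_simps)
  also have "\<dots> \<le> 1536 * sqrt 2 / 23 * (Z / r\<^sup>2)"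
    using Z_pos r2 by (intro mult_right_mono divide_right_mono) auto
  finally show "\<bar>\<mu> (N k) - a k\<bar> \<le> 1536 * sqrt 2 / 23 * (Z / r\<^sup>2)" .
qed

end

section \<open>The sampling model\<close>

lemma integral_translate:
  fixes f :: "vec \<Rightarrow> 'b :: {banach, second_countable_topology}"
  assumes f: "f \<in> borel_measurable (Rd d)"
  shows "(\<integral>z. f (vdiff d z t) \<partial>Rd d) = (\<integral>z. f z \<partial>Rd d)"
proof -
  have "vdiff d z t = vaffine d (\<lambda>i. - t i) 1 z" for z by (simp add: vdiff_def vaffine_def)
  then show ?thesis using Rd_affine[OF _ f, of 1 "\<lambda>i. - t i"] by simp
qed

lemma vdiff_measurable_left [measurable]: "(\<lambda>z. vdiff d z t) \<in> Rd d \<rightarrow>\<^sub>M Rd d"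
  unfolding vdiff_def by (intro Rd_measurableI borel_measurable_diff component_measurable) auto

lemma vdiff_measurable_right: "vdiff d z \<in> Rd d \<rightarrow>\<^sub>M Rd d"
  unfolding vdiff_def by (intro Rd_measurableI borel_measurable_diff component_measurable) auto

text \<open>
  A sample point is a spike plus an independent error with density \<open>\<phi>\<close>: translations of the template
  integrate to 1 and multiply its transform by a phase.
\<close>

lemma mixture_measure:
  fixes a :: "nat \<Rightarrow> real"
  assumes \<phi>: "probability_density d \<phi>" and id: "(\<lambda>t. t) \<in> M \<rightarrow>\<^sub>M Rd d"
    and I: "finite I" "\<And>k. k \<in> I \<Longrightarrow> 0 \<le> a k" "(\<Sum>k\<in>I. a k) = 1" "\<And>k. k \<in> I \<Longrightarrow> x k \<in> space M"
  defines "Q \<equiv> density (Rd d) (\<lambda>z. ennreal (conv_measure d M \<phi> (discrete_measure I a x) z))"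
  shows "prob_space Q"
    and "w \<in> space (Rd d) \<Longrightarrow> measure_ft d Q w = fourier d \<phi> w * signed_ft d M (discrete_measure I a x) w"
proof -
  have \<phi>m [measurable]: "\<phi> \<in> borel_measurable (Rd d)" and \<phi>0: "\<And>x. x \<in> space (Rd d) \<Longrightarrow> 0 \<le> \<phi> x"
    and \<phi>1: "(\<integral>\<^sup>+x. ennreal (\<phi> x) \<partial>Rd d) = 1"
    using \<phi> by (auto simp: probability_density_def)
  have \<phi>I: "(\<integral>z. \<phi> z \<partial>Rd d) = 1"
    by (subst integral_eq_nn_integral) (use \<phi>0 \<phi>1 in auto)
  define g where "g z = (\<Sum>k\<in>I. a k * \<phi> (vdiff d z (x k)))" for z
  have conv: "conv_measure d M \<phi> (discrete_measure I a x) z = g z" for z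
  proof -
    have m: "(\<lambda>t. \<phi> (vdiff d z t)) \<in> borel_measurable M"
      by (rule measurable_compose[OF measurable_compose[OF id vdiff_measurable_right] \<phi>m])
    have "integral\<^sup>L (jordan_pos M (discrete_measure I a x)) (\<lambda>t. \<phi> (vdiff d z t)) = (\<Sum>k\<in>I. a k *\<^sub>R \<phi> (vdiff d z (x k)))"
      using I(1,2,4) m by (rule integral_jordan_pos_discrete)
    moreover have "integral\<^sup>L (jordan_neg M (discrete_measure I a x)) (\<lambda>t. \<phi> (vdiff d z t)) = 0"
      using I(1,2,4) m by (rule integral_jordan_neg_discrete)
    ultimately show ?thesis by (simp add: conv_measure_def signed_integral_def g_def)
  qed
  have shift1: "(\<integral>z. \<phi> (vdiff d z t) \<partial>Rd d) = 1" for t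
    unfolding integral_translate[OF \<phi>m] by (rule \<phi>I)
  have shift_int: "integrable (Rd d) (\<lambda>z. \<phi> (vdiff d z t))" for t
    using shift1[of t] not_integrable_integral_eq by force
  have gm [measurable]: "g \<in> borel_measurable (Rd d)" unfolding g_def[abs_def] by measurable
  have g0: "0 \<le> g z" for z unfolding g_def using I(2) \<phi>0 by (intro sum_nonneg mult_nonneg_nonneg) auto
  have gint: "integrable (Rd d) g" unfolding g_def[abs_def]
    by (intro Bochner_Integration.integrable_sum integrable_mult_right shift_int)
  have "(\<integral>z. g z \<partial>Rd d) = 1"
    unfolding g_def using I(3) shift_int shift1 by (subst Bochner_Integration.integral_sum) auto
  then have g1: "(\<integral>\<^sup>+z. ennreal (g z) \<partial>Rd d) = 1" using nn_integral_eq_integral[OF gint] g0 by simp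
  show "prob_space Q" unfolding Q_def conv by (rule prob_spaceI) (simp add: emeasure_density g1 cong: nn_integral_cong)
  assume w: "w \<in> space (Rd d)"
  have cm [measurable]: "(\<lambda>z. cis (- dotv d w z)) \<in> borel_measurable (Rd d)" using w by measurable
  have four: "fourier d \<phi> w = (\<integral>z. \<phi> z *\<^sub>R cis (- dotv d w z) \<partial>Rd d)"
    unfolding fourier_eq_ft ft_def by (simp add: scaleR_conv_of_real)
  have sh: "(\<integral>z. \<phi> (vdiff d z t) *\<^sub>R cis (- dotv d w z) \<partial>Rd d) = fourier d \<phi> w * cis (- dotv d w t)" for t
  proof -
    have "(\<integral>z. \<phi> (vdiff d z t) *\<^sub>R cis (- dotv d w z) \<partial>Rd d)
       = (\<integral>z. (\<phi> (vdiff d z t) *\<^sub>R cis (- dotv d w (vdiff d z t))) * cis (- dotv d w t) \<partial>Rd d)"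
      by (intro Bochner_Integration.integral_cong refl) (simp add: dotv_vdiff cis_mult)
    also have "\<dots> = (\<integral>z. \<phi> (vdiff d z t) *\<^sub>R cis (- dotv d w (vdiff d z t)) \<partial>Rd d) * cis (- dotv d w t)"
      by (rule integral_mult_left_zero)
    also have "(\<integral>z. \<phi> (vdiff d z t) *\<^sub>R cis (- dotv d w (vdiff d z t)) \<partial>Rd d) = fourier d \<phi> w"
      unfolding four by (rule integral_translate) measurable
    finally show ?thesis .
  qed
  have ci: "integrable (Rd d) (\<lambda>z. \<phi> (vdiff d z t) *\<^sub>R cis (- dotv d w z))" for t
    by (rule Bochner_Integration.integrable_bound[OF shift_int[of t]]) auto
  have "measure_ft d Q w = (\<integral>z. g z *\<^sub>R cis (- dotv d w z) \<partial>Rd d)"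
    unfolding measure_ft_def Q_def conv using g0 by (intro integral_density) auto
  also have "\<dots> = (\<integral>z. (\<Sum>k\<in>I. a k *\<^sub>R (\<phi> (vdiff d z (x k)) *\<^sub>R cis (- dotv d w z))) \<partial>Rd d)"
    unfolding g_def by (simp add: scaleR_sum_left)
  also have "\<dots> = (\<Sum>k\<in>I. a k *\<^sub>R (fourier d \<phi> w * cis (- dotv d w (x k))))"
    using ci by (subst Bochner_Integration.integral_sum) (auto simp: sh simp del: scaleR_scaleR)
  also have "\<dots> = fourier d \<phi> w * (\<Sum>k\<in>I. a k *\<^sub>R cis (- dotv d w (x k)))"
    by (simp add: sum_distrib_left mult_scaleR_right)
  also have "(\<Sum>k\<in>I. a k *\<^sub>R cis (- dotv d w (x k))) = signed_ft d M (discrete_measure I a x) w"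
    using I(1,2,4) id w by (rule signed_ft_discrete[symmetric])
  finally show "measure_ft d Q w = fourier d \<phi> w * signed_ft d M (discrete_measure I a x) w" .
qed

lemma observation_has_band:
  assumes \<tau>: "0 < \<tau>"
  shows "has_band d \<tau> (signed_ft d (Rd d) (empirical_measure n z)) (observation d \<tau> n z)"
proof -
  have "variation (Rd d) (empirical_measure n z) (space (Rd d)) < \<infinity>"
    unfolding empirical_measure_def by (subst variation_discrete) auto
  moreover have "signed_measure (Rd d) (empirical_measure n z)"
    unfolding empirical_measure_def by (rule signed_measure_discrete) simp
  ultimately have "has_band d \<tau> (\<lambda>w. 1 * signed_ft d (Rd d) (empirical_measure n z) w) (conv_measure d (Rd d) (lam d \<tau>) (empirical_measure n z))"
    by (intro has_band_signed has_band_lam \<tau>) auto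
  then show ?thesis by (simp add: observation_def[abs_def])
qed

lemma signed_ft_empirical:
  assumes z: "\<And>j. j \<in> {1..n} \<Longrightarrow> z j \<in> space (Rd d)" and w: "w \<in> space (Rd d)"
  shows "signed_ft d (Rd d) (empirical_measure n z) w = empirical_ft d n z w"
  unfolding empirical_measure_def empirical_ft_def by (rule signed_ft_discrete) (use z w in auto)

lemma band_energy_cong:
  assumes "\<And>w. w \<in> space (Rd d) \<Longrightarrow> H w = H' w"
  shows "band_energy d \<tau> H = band_energy d \<tau> H'"
  unfolding band_energy_def using assms by (simp cong: Bochner_Integration.integral_cong)

lemma has_band_bounded_symbol:
  assumes "has_band d \<tau> H g"
  shows "\<exists>B. bounded_symbol d H B"
  using has_bandD(1,2)[OF assms] by (auto simp: bounded_symbol_def)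

text \<open>
  The data and \<open>F \<mu>\<close> are both inverse transforms on the cube, with symbols \<open>Y\<close> and \<open>\<phi>^ \<mu>^\<close>, and hence so is
  their difference.
\<close>

lemma objective_eq:
  assumes \<tau>: "0 < \<tau>" and \<phi>: "probability_density d \<phi>" and \<mu>: "finite_signed (borel_on d X) \<mu> d"
    and y: "has_band d \<tau> Y y"
  shows "objective d X \<tau> \<phi> y \<kappa> \<mu> =
    ennreal (band_energy d \<tau> (\<lambda>w. Y w - fourier d \<phi> w * signed_ft d (borel_on d X) \<mu> w) / 2) +
    ennreal \<kappa> * variation (borel_on d X) \<mu> X"
proof -
  interpret finite_signed "borel_on d X" \<mu> d by fact
  have "has_band d \<tau> (\<lambda>w. fourier d \<phi> w * signed_ft d (borel_on d X) \<mu> w) (forward d X \<tau> \<phi> \<mu>)"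
    unfolding forward_def[abs_def] by (rule has_band_signed[OF sm fin id has_band_template[OF \<tau> \<phi>]])
  note has_bandD(5)[OF has_band_diff[OF y this]]
  moreover have "ennreal b / 2 = ennreal (b / 2)" if "0 \<le> b" for b
    using that divide_ennreal[of b 2] by simp
  ultimately show ?thesis unfolding objective_def by (simp add: band_energy_nonneg)
qed

text \<open>
  In the scaled coordinates the squared distance is \<open>(v / (4 \<tau>))\<^sup>2\<close>, and the bound on \<open>\<tau>\<close> gives
  \<open>(v / (4 \<tau>))\<^sup>4 \<ge> (147.77 / 4)\<^sup>4 s d\<^sup>7\<close>, where \<open>(147.77 / 4)\<^sup>4\<close> is slightly above 1862000.
\<close>

lemma spike_configurationI:
  assumes d: "1 \<le> d" and s: "1 \<le> s" and \<tau>: "0 < \<tau>" "ereal \<tau> \<le> tau_max d s x"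
    and x: "\<And>k. k \<in> {1..s} \<Longrightarrow> x k \<in> space (Rd d)"
  shows "spike_configuration d s \<tau> x"
proof
  fix k l assume kl: "k \<in> {1..s}" "l \<in> {1..s}" "k \<noteq> l"
  define K where "K = 147.77 * real s powr (1/4) * real d powr (7/4)"
  define v where "v = vdist d (x k) (x l)"
  let ?u = "nsq d (\<lambda>i. x k i / (4 * \<tau>) - x l i / (4 * \<tau>))"
  have K: "0 < K" unfolding K_def using d s by simp
  have "(INF (k, l) \<in> {(k, l). k \<in> {1..s} \<and> l \<in> {1..s} \<and> k \<noteq> l}. ereal (vdist d (x k) (x l))) \<le> ereal v"
    unfolding v_def using kl by (intro INF_lower2[of "(k, l)"]) auto
  then have "tau_max d s x \<le> ereal v / ereal K"
    unfolding tau_max_def K_def[symmetric] using K by (intro ereal_divide_right_mono) auto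
  moreover have "ereal v / ereal K = ereal (v / K)" using K by simp
  ultimately have "ereal \<tau> \<le> ereal (v / K)" using \<tau>(2) by (simp only: order_trans)
  then have Kv: "K * \<tau> \<le> v" using K by (simp add: le_divide_eq mult.commute)
  have "4 / 3 * ?u = (v / (2 * sqrt 3 * \<tau>))\<^sup>2"
    unfolding scaled_dist_nsq[OF \<tau>(1), symmetric] by (simp add: scaled_dist_def v_def)
  then have u: "?u = (v / (4 * \<tau>))\<^sup>2" by (simp add: power_divide power_mult_distrib)
  have "K / 4 \<le> v / (4 * \<tau>)" using Kv \<tau>(1) by (simp add: field_simps)
  then have "(K / 4) ^ 4 \<le> (v / (4 * \<tau>)) ^ 4" using K by (intro power_mono) auto
  also have "\<dots> = ?u\<^sup>2" unfolding u by (simp flip: power_mult)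
  finally have le: "(K / 4) ^ 4 \<le> ?u\<^sup>2" .
  have "(real s powr (1/4)) ^ 4 = real s" "(real d powr (7/4)) ^ 4 = real d ^ 7"
    using d s by (simp_all add: powr_power)
  then have "(K / 4) ^ 4 = (147.77 / 4) ^ 4 * (real s * real d ^ 7)"
    unfolding K_def power_divide power_mult_distrib by simp
  moreover have "1862000 * (real s * real d ^ 7) \<le> (147.77 / 4) ^ 4 * (real s * real d ^ 7)"
    by (intro mult_right_mono) (auto simp: power_divide)
  ultimately show "1862000 * real s * real d ^ 7 \<le> ?u\<^sup>2" using le by (simp only: mult.assoc)
qed (use assms in auto)

lemma localisation_radius:
  assumes n: "1 \<le> (n::nat)" and \<delta>: "0 < \<delta>" "\<delta> ^ 4 \<le> real n"
  shows "0 < \<delta> * real n powr (-1/4)" and "\<delta> * real n powr (-1/4) \<le> 1"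
    and "(\<delta> * real n powr (-1/4))\<^sup>2 = \<delta>\<^sup>2 / sqrt (real n)"
proof -
  let ?r = "\<delta> * real n powr (-1/4)"
  have n0: "0 < real n" using n by simp
  show r0: "0 < ?r" using \<delta> n0 by simp
  have "(real n powr (-1/4)) ^ 2 = real n powr (-1/4 + -1/4)" unfolding power2_eq_square by (rule powr_add[symmetric])
  also have "\<dots> = 1 / sqrt (real n)" using n0 by (simp add: powr_minus_divide powr_half_sqrt)
  finally show r2: "?r\<^sup>2 = \<delta>\<^sup>2 / sqrt (real n)" by (simp add: power_mult_distrib)
  have "?r ^ 4 = (?r\<^sup>2)\<^sup>2" by (simp only: power_mult[symmetric]) simp
  also have "\<dots> = \<delta> ^ 4 / real n" unfolding r2 using n0 by (simp add: power_divide flip: power_mult)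
  also have "\<dots> \<le> 1 ^ 4" using \<delta>(2) n0 by simp
  finally show "?r \<le> 1" using r0 by (subst (asm) power_mono_iff) auto
qed

lemma scaled_dist_measurable:
  "(\<lambda>t. scaled_dist d \<tau> t y) \<in> borel_measurable (Rd d)"
  unfolding scaled_dist_def vdist_def L2_set_def
  by (intro borel_measurable_times borel_measurable_const measurable_compose[OF _ borel_measurable_sqrt] borel_measurable_sum
      borel_measurable_power borel_measurable_diff component_measurable) auto

section \<open>Recovery of the spikes\<close>

lemma space_borel_on:
  assumes "compactin (Rd_topology d) X"
  shows "X \<subseteq> space (Rd d)" "space (borel_on d X) = X"
proof -
  show XS: "X \<subseteq> space (Rd d)"
    using compactin_subset_topspace[OF assms] by (simp add: Rd_topology_def space_Rd PiE_UNIV_domain PiE_def)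
  then show "space (borel_on d X) = X" by (auto simp: borel_on_def space_restrict_space)
qed

lemma near_region_sets:
  assumes X: "compactin (Rd_topology d) X"
  shows "near_region d X \<tau> y r \<in> sets (borel_on d X)"
proof -
  have "(\<lambda>t. scaled_dist d \<tau> t y) \<in> borel_measurable (borel_on d X)"
    by (rule measurable_compose[OF position_borel_on scaled_dist_measurable])
  then show ?thesis
    using borel_measurable_le[of "\<lambda>t. scaled_dist d \<tau> t y" "borel_on d X" "\<lambda>_. r"]
    by (simp add: near_region_def space_borel_on[OF X])
qed

lemma far_region_sets:
  assumes X: "compactin (Rd_topology d) X"
  shows "far_region d X \<tau> s x r \<in> sets (borel_on d X)"
  unfolding far_region_def using sets.top[of "borel_on d X"] near_region_sets[OF X]
  by (auto simp: space_borel_on[OF X])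

text \<open>
  The event is the one on which the noise is at most \<open>\<rho>\<^sup>2\<close>. The variation of \<open>\<mu>\<close> is finite, because otherwise
  its objective would be infinite, whereas that of the spikes is finite. So \<open>localisation\<close> applies, and \<open>Z / r\<^sup>2\<close> is the common factor \<open>W\<close> of the bounds.
\<close>

lemma recovery:
  fixes d s n :: nat and X :: "vec set" and a :: "nat \<Rightarrow> real" and x :: "nat \<Rightarrow> vec"
    and \<tau> \<alpha> \<delta> Cs C\<alpha> \<kappa> r :: real
  assumes d: "1 \<le> d" and X: "compactin (Rd_topology d) X" and xX: "\<And>k. k \<in> {1..s} \<Longrightarrow> x k \<in> X"
    and a: "\<And>k. k \<in> {1..s} \<Longrightarrow> 0 < a k" "(\<Sum>k\<in>{1..s}. a k) = 1"
    and \<tau>: "0 < \<tau>" "ereal \<tau> \<le> tau_max d s x"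
    and \<phi>: "probability_density d \<phi>" and Cfin: "C_switch d \<tau> \<phi> < \<infinity>" and Cs: "Cs = enn2real (C_switch d \<tau> \<phi>)"
    and \<delta>: "0 < \<delta>" "\<delta> ^ 4 \<le> real n" and r: "r = \<delta> * real n powr (-1/4)"
    and \<alpha>: "0 < \<alpha>" "\<alpha> < 1" and C\<alpha>: "C\<alpha> = 2 * sqrt (1 + ln (1 / \<alpha>))"
    and \<kappa>: "\<kappa> = 1 / (sqrt 2 * Cs) * (C\<alpha> * \<tau> powr (- real d / 2) / sqrt (real n)) * (1 / sqrt (real s))"
    and n: "1 \<le> n"
  defines "\<mu>0 \<equiv> discrete_measure {1..s} a x" and "W \<equiv> C\<alpha> * Cs * \<tau> powr (- real d / 2) / \<delta>\<^sup>2 * sqrt (real s)"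
  shows "\<exists>E \<in> sets (sample_law d X \<phi> \<mu>0 n). 1 - \<alpha> \<le> measure (sample_law d X \<phi> \<mu>0 n) E \<and>
    (\<forall>z\<in>E. \<forall>\<mu> \<in> radon_measures d X.
      objective d X \<tau> \<phi> (observation d \<tau> n z) \<kappa> \<mu> \<le> objective d X \<tau> \<phi> (observation d \<tau> n z) \<kappa> \<mu>0 \<longrightarrow>
      variation (borel_on d X) \<mu> (far_region d X \<tau> s x r) \<le> ennreal (256 * sqrt 2 / 23 * W) \<and>
      (\<forall>k\<in>{1..s}. \<bar>\<mu> (near_region d X \<tau> (x k) r) - a k\<bar> \<le> 1536 * sqrt 2 / 23 * W))"
proof -
  let ?M = "borel_on d X"
  note XS = space_borel_on(1)[OF X] and spM = space_borel_on(2)[OF X]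
  have XM: "X \<in> sets ?M" using sets.top[of ?M] spM by simp
  have s: "1 \<le> s" using a(2) by (cases s) auto
  have a0: "0 \<le> a k" if "k \<in> {1..s}" for k using a(1)[OF that] by simp
  have xM: "x k \<in> space ?M" if "k \<in> {1..s}" for k using xX[OF that] spM by simp
  have xS: "x k \<in> space (Rd d)" if "k \<in> {1..s}" for k using xX[OF that] XS by blast
  note conf = spike_configurationI[OF d s \<tau> xS]
  define Q where "Q = density (Rd d) (\<lambda>z. ennreal (conv_measure d ?M \<phi> \<mu>0 z))"
  have Qp: "prob_space Q" unfolding Q_def \<mu>0_def
    using \<phi> position_borel_on finite_atLeastAtMost a0 a(2) xM by (rule mixture_measure(1))
  have Qf: "measure_ft d Q w = fourier d \<phi> w * signed_ft d ?M \<mu>0 w" if "w \<in> space (Rd d)" for w unfolding Q_def \<mu>0_def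
    using \<phi> position_borel_on finite_atLeastAtMost a0 a(2) xM that by (rule mixture_measure(2))
  interpret sampling Q d n \<tau>
    using Qp n \<tau>(1) by (simp add: sampling_def sampling_axioms_def Q_def)
  have law: "sample_law d X \<phi> \<mu>0 n = P" by (simp add: sample_law_def Q_def)
  define \<rho> where "\<rho> = C\<alpha> * \<tau> powr (- real d / 2) / sqrt (real n)"
  have L: "0 < ln (1 / \<alpha>)" using \<alpha> by simp
  have n0: "0 < real n" using n by simp
  have \<rho>0: "0 < \<rho>" unfolding \<rho>_def C\<alpha> using \<tau>(1) n0 L by (intro divide_pos_pos mult_pos_pos) auto
  have \<rho>2: "\<rho>\<^sup>2 = 4 * (1 + ln (1 / \<alpha>)) * ((1 / \<tau>) ^ d / real n)"
  proof -
    have "(\<tau> powr (- real d / 2))\<^sup>2 = \<tau> powr (- real d / 2 + - real d / 2)" unfolding power2_eq_square by (rule powr_add[symmetric])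
    also have "\<dots> = (1 / \<tau>) ^ d" using \<tau>(1) by (simp add: powr_minus_divide powr_realpow power_one_over)
    finally show ?thesis unfolding \<rho>_def C\<alpha> using L n0 by (simp add: power_divide power_mult_distrib)
  qed
  have Cs0: "0 < Cs" by (rule switch_pos[OF \<tau>(1) Cfin Cs])
  have \<kappa>\<rho>: "\<kappa> = \<rho> / (sqrt 2 * Cs * sqrt (real s))" unfolding \<kappa> \<rho>_def by simp
  have \<kappa>0: "0 < \<kappa>" unfolding \<kappa>\<rho> using \<rho>0 Cs0 s by simp
  note rad = localisation_radius[OF n \<delta>, folded r]
  have Zr: "Cs * sqrt (real s) * \<rho> / r\<^sup>2 = W"
    unfolding rad(3) \<rho>_def W_def using n0 by (simp add: mult_ac)
  interpret tm: positioned_measure "density (Rd d) (\<lambda>x. ennreal (\<phi> x))" d by (rule template_measure(2)[OF \<phi>])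
  have \<Phi>1: "cmod (fourier d \<phi> w) \<le> 1" for w
    using tm.measure_ft_bound[of w] prob_space.prob_space[OF template_measure(1)[OF \<phi>]] by (simp add: template_measure(3)[OF \<phi>])
  have sm0: "signed_measure ?M \<mu>0" unfolding \<mu>0_def by (rule signed_measure_discrete) simp
  have var0: "variation ?M \<mu>0 X = 1"
  proof -
    have "variation ?M \<mu>0 X = ennreal (\<mu>0 X)" unfolding \<mu>0_def using finite_atLeastAtMost a0 XM by (rule variation_discrete)
    also have "\<mu>0 X = (\<Sum>k\<in>{1..s}. a k)" unfolding \<mu>0_def discrete_measure_def using xX by (intro sum.cong) auto
    finally show ?thesis using a(2) by simp
  qed
  have fs0: "finite_signed ?M \<mu>0 d" by (rule finite_signed.intro[OF sm0 _ position_borel_on]) (simp add: spM var0)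
  obtain E where E: "E \<in> sets P" "1 - \<alpha> \<le> measure P E"
    and noise: "\<And>z. z \<in> E \<Longrightarrow> band_energy d \<tau> (\<lambda>w. empirical_ft d n z w - measure_ft d Q w) \<le> \<rho>\<^sup>2"
    using noise_bound[OF \<alpha>] unfolding \<rho>2 by blast
  show ?thesis unfolding law
  proof (intro bexI[OF _ E(1)] conjI[OF E(2)] ballI impI)
    fix z \<mu> assume z: "z \<in> E" and \<mu>: "\<mu> \<in> radon_measures d X"
      and le: "objective d X \<tau> \<phi> (observation d \<tau> n z) \<kappa> \<mu> \<le> objective d X \<tau> \<phi> (observation d \<tau> n z) \<kappa> \<mu>0"
    have "z \<in> space P" using z sets.sets_into_space[OF E(1)] by blast
    then have zS: "z j \<in> space (Rd d)" if "j \<in> {1..n}" for j using that by (auto simp: space_PiM Q_space)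
    define Y where "Y = signed_ft d (Rd d) (empirical_measure n z)"
    have Yband: "has_band d \<tau> Y (observation d \<tau> n z)" unfolding Y_def by (rule observation_has_band[OF \<tau>(1)])
    obtain BY where BY: "bounded_symbol d Y BY" using has_band_bounded_symbol[OF Yband] by blast
    have sm: "signed_measure ?M \<mu>" using \<mu> by (simp add: radon_measures_def)
    let ?G = "band_energy d \<tau> (\<lambda>w. Y w - fourier d \<phi> w * signed_ft d ?M \<mu>0 w)"
    let ?T = "band_energy d \<tau> (\<lambda>w. Y w - fourier d \<phi> w * signed_ft d ?M \<mu> w)"
    have obj0: "objective d X \<tau> \<phi> (observation d \<tau> n z) \<kappa> \<mu>0 = ennreal (?G / 2 + \<kappa>)"
      unfolding objective_eq[OF \<tau>(1) \<phi> fs0 Yband] var0 using band_energy_nonneg \<kappa>0 by (simp add: ennreal_plus)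
    have fin: "variation ?M \<mu> (space ?M) < \<infinity>"
    proof (rule ccontr)
      assume "\<not> variation ?M \<mu> (space ?M) < \<infinity>"
      then have "objective d X \<tau> \<phi> (observation d \<tau> n z) \<kappa> \<mu> = \<infinity>"
        unfolding objective_def spM using \<kappa>0 by (simp add: less_top[symmetric] ennreal_mult_top)
      then show False using le unfolding obj0 by (simp add: top_unique)
    qed
    interpret mu: finite_signed ?M \<mu> d by (rule finite_signed.intro[OF sm fin position_borel_on])
    let ?m = "mu.tv_integral (\<lambda>_. 1)"
    have "?m = mu.tv_integral (indicator X)"
      unfolding mu.tv_integral_def by (intro arg_cong2[where f = "(+)"] Bochner_Integration.integral_cong refl) (auto simp: spM)
    then have var: "variation ?M \<mu> X = ennreal ?m" using mu.tv_integral_indicator[OF XM] by simp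
    have m0: "0 \<le> ?m" unfolding mu.tv_integral_def by (intro add_nonneg_nonneg integral_nonneg_AE) auto
    have "objective d X \<tau> \<phi> (observation d \<tau> n z) \<kappa> \<mu> = ennreal (?T / 2 + \<kappa> * ?m)"
      unfolding objective_eq[OF \<tau>(1) \<phi> mu.finite_signed_axioms Yband] var
      using band_energy_nonneg \<kappa>0 m0 by (simp add: ennreal_plus ennreal_mult)
    then have "ennreal (?T / 2 + \<kappa> * ?m) \<le> ennreal (?G / 2 + \<kappa>)" using le unfolding obj0 by simp
    moreover have "0 \<le> ?G / 2 + \<kappa>" using \<kappa>0 band_energy_nonneg by (intro add_nonneg_nonneg) auto
    ultimately have better: "?T / 2 + \<kappa> * ?m \<le> ?G / 2 + \<kappa>" by (simp only: ennreal_le_iff)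
    have "?G = band_energy d \<tau> (\<lambda>w. empirical_ft d n z w - measure_ft d Q w)"
      
    proof (rule band_energy_cong)
      fix w assume w: "w \<in> space (Rd d)"
      have "Y w = empirical_ft d n z w" unfolding Y_def using zS w by (rule signed_ft_empirical)
      then show "Y w - fourier d \<phi> w * signed_ft d ?M \<mu>0 w = empirical_ft d n z w - measure_ft d Q w" using Qf[OF w] by simp
    qed
    then have G: "?G \<le> \<rho>\<^sup>2" using noise[OF z] by simp
    interpret cmp: comparison d s \<tau> x ?M \<mu> a "fourier d \<phi>" Y Cs \<rho> \<kappa> BY
      unfolding comparison_def comparison_axioms_def \<mu>0_def[symmetric]
      by (intro conjI allI impI conf mu.finite_signed_axioms a xM \<Phi>1 BY Cs0 \<rho>0 \<kappa>\<rho> G better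
          has_bandD(1)[OF has_band_template[OF \<tau>(1) \<phi>]] switch_bound[OF \<tau>(1) Cfin Cs])
    note Nm = near_region_sets[OF X, of \<tau> _ r] and Fm = far_region_sets[OF X, of \<tau> s x r]
    have Fc: "t \<in> far_region d X \<tau> s x r \<longleftrightarrow> (\<forall>k\<in>{1..s}. r < scaled_dist d \<tau> t (x k))" if "t \<in> space ?M" for t
      using that unfolding spM far_region_def near_region_def by (auto simp: not_le)
    have Nc: "t \<in> near_region d X \<tau> (x k) r \<longleftrightarrow> scaled_dist d \<tau> t (x k) \<le> r" if "t \<in> space ?M" for t k
      using that unfolding spM near_region_def by simp
    have Zr': "cmp.Z / r\<^sup>2 = W" unfolding cmp.Z_def by (rule Zr)
    have loc1: "mu.tv_integral (indicator (far_region d X \<tau> s x r)) \<le> 256 * sqrt 2 / 23 * W"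
      unfolding Zr'[symmetric] using rad(1,2) Fm Fc Nm Nc by (rule cmp.localisation(1))
    have loc2: "\<bar>\<mu> (near_region d X \<tau> (x k) r) - a k\<bar> \<le> 1536 * sqrt 2 / 23 * W" if "k \<in> {1..s}" for k
      unfolding Zr'[symmetric] using rad(1,2) Fm Fc Nm Nc that by (rule cmp.localisation(2))
    have "variation ?M \<mu> (far_region d X \<tau> s x r) = ennreal (mu.tv_integral (indicator (far_region d X \<tau> s x r)))"
      by (rule mu.tv_integral_indicator[OF Fm, symmetric])
    also have "\<dots> \<le> ennreal (256 * sqrt 2 / 23 * W)" by (intro ennreal_leI loc1)
    finally show "variation ?M \<mu> (far_region d X \<tau> s x r) \<le> ennreal (256 * sqrt 2 / 23 * W) \<and>
        (\<forall>k\<in>{1..s}. \<bar>\<mu> (near_region d X \<tau> (x k) r) - a k\<bar> \<le> 1536 * sqrt 2 / 23 * W)"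
      using loc2 by blast
  qed
qed

text \<open>
  The bound on the mass of the far region gives the last claim: a set that is disjoint from all near regions
  lies in the far region, so it cannot have more mass.
\<close>

theorem proposition3p1:
  shows "\<exists>C1 > (0::real). \<exists>C2 > (0::real). \<exists>c :: nat \<Rightarrow> real.
    (\<exists>p :: real poly. \<forall>d. c d = poly p (real d)) \<and>
    (\<forall>(d::nat) (X :: vec set) (s0::nat) (a :: nat \<Rightarrow> real) (x :: nat \<Rightarrow> vec) (\<mu>0 :: vec set \<Rightarrow> real)
       (\<tau>::real) (\<phi> :: vec \<Rightarrow> real) (\<delta> :: nat \<Rightarrow> real) (\<alpha>::real) (n::nat)
       (Cs::real) (C\<alpha>::real) (\<kappa>::real) (r::real).
      1 \<le> d \<longrightarrow>
      compactin (Rd_topology d) X \<longrightarrow>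
      (\<forall>k\<in>{1..s0}. x k \<in> X) \<longrightarrow> inj_on x {1..s0} \<longrightarrow>
      (\<forall>k\<in>{1..s0}. 0 < a k) \<longrightarrow> (\<Sum>k=1..s0. a k) = 1 \<longrightarrow>
      \<mu>0 = discrete_measure {1..s0} a x \<longrightarrow>
      0 < \<tau> \<longrightarrow> ereal \<tau> \<le> tau_max d s0 x \<longrightarrow>
      probability_density d \<phi> \<longrightarrow>
      C_switch d \<tau> \<phi> < \<infinity> \<longrightarrow> Cs = enn2real (C_switch d \<tau> \<phi>) \<longrightarrow>
      (\<forall>m. 0 < \<delta> m) \<longrightarrow> filterlim \<delta> at_top sequentially \<longrightarrow>
      r = \<delta> n * real n powr (-1/4) \<longrightarrow>
      0 < \<alpha> \<longrightarrow> \<alpha> < 1 \<longrightarrow>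
      C\<alpha> = 2 * sqrt (1 + C1 * ln (C2 / \<alpha>)) \<longrightarrow>
      \<kappa> = 1 / (sqrt 2 * Cs) * (C\<alpha> * \<tau> powr (- real d / 2) / sqrt (real n)) * (1 / sqrt (real s0)) \<longrightarrow>
      1 \<le> n \<longrightarrow> c d * \<delta> n ^ 4 \<le> real n \<longrightarrow>
      (\<exists>E \<in> sets (sample_law d X \<phi> \<mu>0 n).
         1 - \<alpha> \<le> measure (sample_law d X \<phi> \<mu>0 n) E \<and>
         (\<forall>z\<in>E. \<forall>\<mu> \<in> radon_measures d X.
            objective d X \<tau> \<phi> (observation d \<tau> n z) \<kappa> \<mu>
              \<le> objective d X \<tau> \<phi> (observation d \<tau> n z) \<kappa> \<mu>0 \<longrightarrow>
            variation (borel_on d X) \<mu> (far_region d X \<tau> s0 x r)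
              \<le> ennreal (256 * sqrt 2 * C\<alpha> * Cs * \<tau> powr (- real d / 2) / (23 * (\<delta> n)\<^sup>2) * sqrt (real s0)) \<and>
            (\<forall>k\<in>{1..s0}. \<bar>\<mu> (near_region d X \<tau> (x k) r) - a k\<bar>
              \<le> 1536 * sqrt 2 * C\<alpha> * Cs * \<tau> powr (- real d / 2) / (23 * (\<delta> n)\<^sup>2) * sqrt (real s0)) \<and>
            (\<forall>A \<in> sets (borel_on d X).
              variation (borel_on d X) \<mu> A
                > ennreal (256 * sqrt 2 * C\<alpha> * Cs * \<tau> powr (- real d / 2) / (23 * (\<delta> n)\<^sup>2) * sqrt (real s0)) \<longrightarrow>
              (\<exists>k\<in>{1..s0}. \<exists>t\<in>A. 1 / (2 * sqrt 3 * \<tau>) * vdist d t (x k) \<le> r)))))"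
proof (rule exI[of _ 1], rule conjI, simp, rule exI[of _ 1], rule conjI, simp, rule exI[of _ "\<lambda>_. 1"], rule conjI, rule exI[of _ "[:1:]"], simp, intro allI impI, goal_cases)
  case (1 d X s0 a x \<mu>0 \<tau> \<phi> \<delta> \<alpha> n Cs C\<alpha> \<kappa> r)
  define W where "W = C\<alpha> * Cs * \<tau> powr (- real d / 2) / (\<delta> n)\<^sup>2 * sqrt (real s0)"
  have W: "256 * sqrt 2 * C\<alpha> * Cs * \<tau> powr (- real d / 2) / (23 * (\<delta> n)\<^sup>2) * sqrt (real s0) = 256 * sqrt 2 / 23 * W"
      "1536 * sqrt 2 * C\<alpha> * Cs * \<tau> powr (- real d / 2) / (23 * (\<delta> n)\<^sup>2) * sqrt (real s0) = 1536 * sqrt 2 / 23 * W"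
    by (simp_all add: W_def)
  have \<delta>n: "0 < \<delta> n" "\<delta> n ^ 4 \<le> real n" using 1 by auto
  have C: "C\<alpha> = 2 * sqrt (1 + ln (1 / \<alpha>))" using 1 by simp
  have xX: "\<And>k. k \<in> {1..s0} \<Longrightarrow> x k \<in> X" and a: "\<And>k. k \<in> {1..s0} \<Longrightarrow> 0 < a k" using 1 by blast+
  obtain E where E: "E \<in> sets (sample_law d X \<phi> \<mu>0 n)" "1 - \<alpha> \<le> measure (sample_law d X \<phi> \<mu>0 n) E"
    and rec: "\<And>z \<mu>. z \<in> E \<Longrightarrow> \<mu> \<in> radon_measures d X \<Longrightarrow>
      objective d X \<tau> \<phi> (observation d \<tau> n z) \<kappa> \<mu> \<le> objective d X \<tau> \<phi> (observation d \<tau> n z) \<kappa> \<mu>0 \<Longrightarrow>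
      variation (borel_on d X) \<mu> (far_region d X \<tau> s0 x r) \<le> ennreal (256 * sqrt 2 / 23 * W) \<and>
      (\<forall>k\<in>{1..s0}. \<bar>\<mu> (near_region d X \<tau> (x k) r) - a k\<bar> \<le> 1536 * sqrt 2 / 23 * W)"
    using recovery[OF 1(1,2) xX a 1(6,8,9,10,11,12) \<delta>n 1(15,16,17) C 1(19,20), folded 1(7) W_def] by blast
  show ?case unfolding W
  proof (intro bexI[OF _ E(1)] conjI[OF E(2)] ballI impI)
    fix z \<mu> assume z: "z \<in> E" and \<mu>: "\<mu> \<in> radon_measures d X"
      and le: "objective d X \<tau> \<phi> (observation d \<tau> n z) \<kappa> \<mu> \<le> objective d X \<tau> \<phi> (observation d \<tau> n z) \<kappa> \<mu>0"
    note main = rec[OF z \<mu> le]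
    have "\<exists>k\<in>{1..s0}. \<exists>t\<in>A. 1 / (2 * sqrt 3 * \<tau>) * vdist d t (x k) \<le> r"
      if A: "A \<in> sets (borel_on d X)" and big: "ennreal (256 * sqrt 2 / 23 * W) < variation (borel_on d X) \<mu> A" for A
    proof (rule ccontr)
      assume none: "\<not> ?thesis"
      have "signed_measure (borel_on d X) \<mu>" using \<mu> by (simp add: radon_measures_def)
      moreover have "far_region d X \<tau> s0 x r \<in> sets (borel_on d X)" by (rule far_region_sets[OF 1(2)])
      moreover have "A \<subseteq> X" using sets.sets_into_space[OF A] by (auto simp: borel_on_def space_restrict_space)
      then have "A \<subseteq> far_region d X \<tau> s0 x r"
        using none unfolding far_region_def near_region_def scaled_dist_def by blast
      ultimately have "variation (borel_on d X) \<mu> A \<le> variation (borel_on d X) \<mu> (far_region d X \<tau> s0 x r)"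
        using A by (intro variation_mono)
      then show False using main big by (meson leD order_trans)
    qed
    then show "variation (borel_on d X) \<mu> (far_region d X \<tau> s0 x r) \<le> ennreal (256 * sqrt 2 / 23 * W) \<and>
        (\<forall>k\<in>{1..s0}. \<bar>\<mu> (near_region d X \<tau> (x k) r) - a k\<bar> \<le> 1536 * sqrt 2 / 23 * W) \<and>
        (\<forall>A \<in> sets (borel_on d X). ennreal (256 * sqrt 2 / 23 * W) < variation (borel_on d X) \<mu> A \<longrightarrow>
          (\<exists>k\<in>{1..s0}. \<exists>t\<in>A. 1 / (2 * sqrt 3 * \<tau>) * vdist d t (x k) \<le> r))"
      using main by blast
  qed
qed

end
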